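(* Let $f:S^1\to S^2$ be a CaTherine wheel and let $h:S^1\to S^1$, $H:S^2\to S^2$ be orientation-preserving homeomorphisms with $f\circ h=H\circ f$. Then: (1) some finite power $h^n$ ($n\ge1$) of $h$ is either the identity, or has a finite, even, positive number of fixed points on $S^1$, with dynamics alternating between sources and sinks; (2) up to replacing $h^n$ by $h^{-n}$ if necessary, the attracting fixed points are joined by leaves of $\mathcal{L}^+(f)$ and the repelling fixed points are joined by leaves of $\mathcal{L}^-(f)$; (3) if $h^n$ has at least 4 fixed points, then the images in $S^2$ of the attracting (resp. repelling) fixed points of $h^n$ are the unique fixed points of $H$, and are attracting (resp. repelling) for $H$; (4) if $h^n$ has exactly 2 fixed points, then the images in $S^2$ of these fixed points are the unique fixed points of $H$, and either (a) they are distinct and are attracting/repelling for $H$, or (b) they are equal in $S^2$ and the restriction of $H$ to the complement of this unique fixed point is conjugate to a translation of the plane.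
   Context: $S^1,S^2$ are oriented. A closed interval $I\subset S^1$ is a closed subset homeomorphic to $[0,1]$, oriented from $S^1$; $[p,q]$ is the oriented interval from $p$ to $q$. A CaTherine wheel is a continuous surjection $f:S^1\to S^2$ such that for every closed interval $I$, $f(I)$ is a closed disk and $f(\partial I)\subset\partial f(I)$. For each $I$, each component $Y$ of $\partial f(I)\setminus f(\partial I)$ has a unique (canonical) orientation making $f:I\cap f^{-1}(Y)\to Y$ monotone increasing; $Z^+(I)$ is the component (or $\emptyset$) whose canonical orientation agrees with its boundary orientation as part of $\partial f(I)$, $f(I)\subset S^2$. $I$ is degenerate if $f(\partial I)$ is a single point, positively degenerate if also $Z^+(I)=\emptyset$, and negatively degenerate otherwise. $\mathcal{L}^+(f)$ (resp. $\mathcal{L}^-(f)$) is the set of unordered pairs $\{p,q\}$ of distinct points ("leaves") with $[p,q]$ positively (resp. negatively) degenerate. *)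

theory Defs
  imports "HOL-Analysis.Analysis" "HOL-Complex_Analysis.Complex_Analysis" "HOL-Homology.Homology"
begin

text \<open>S^1 is the unit circle in the complex plane, oriented counterclockwise;
  S^2 is the unit sphere in R^3, oriented by the outward normal.\<close>

definition S1 :: "complex set" where
  "S1 = sphere 0 1"

definition S2 :: "(real^3) set" where
  "S2 = sphere 0 1"

text \<open>Counterclockwise angle from p to q, in [0, 2 pi), and the oriented closed
  interval [p,q] of S^1 (for p \<noteq> q this is the closed arc going counterclockwise
  from p to q; every closed interval of S^1 is of this form).\<close>

definition ccw_angle :: "complex \<Rightarrow> complex \<Rightarrow> real" where
  "ccw_angle p q = Arg2pi (q / p)"

definition arc :: "complex \<Rightarrow> complex \<Rightarrow> complex set" where
  "arc p q = {p * cis t | t. 0 \<le> t \<and> t \<le> ccw_angle p q}"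

definition closed_disk :: "(real^3) set \<Rightarrow> bool" where
  "closed_disk D \<longleftrightarrow> D \<subseteq> S2 \<and> D homeomorphic (cball (0::complex) 1)"

text \<open>Boundary of a subset of S^2 (its frontier relative to S^2); for a closed
  disk this is the boundary circle.\<close>

definition bdry :: "(real^3) set \<Rightarrow> (real^3) set" where
  "bdry D = D \<inter> closure (S2 - D)"

text \<open>Orientation-preserving stereographic projection from the north pole (0,0,1)
  onto the complex plane (S^2 oriented by its outward normal).\<close>

definition stereo :: "real^3 \<Rightarrow> complex" where
  "stereo v = Complex (v$1) (- (v$2)) / complex_of_real (1 - v$3)"

definition north :: "real^3" where
  "north = vector [0, 0, 1]"

text \<open>A parametrization \<open>\<delta>\<close> of the boundary circle of a closed disk D, defined on S^1,
  is positively oriented (i.e. induces the boundary orientation of \<open>\<partial>D\<close> as the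
  boundary of \<open>D \<subseteq> S^2\<close>) if, after rotating a point of \<open>S^2 - D\<close> to the north pole
  and projecting stereographically, it winds once positively around the image of
  an interior point of D.\<close>

definition pos_oriented :: "(real^3) set \<Rightarrow> (complex \<Rightarrow> real^3) \<Rightarrow> bool" where
  "pos_oriented D \<delta> \<longleftrightarrow>
     (\<exists>N \<in> S2 - D. \<exists>R. orthogonal_transformation R \<and> det (matrix R) = 1 \<and> R N = north \<and>
        (\<exists>w \<in> D - bdry D.
           winding_number (\<lambda>t. stereo (R (\<delta> (cis (2 * pi * t))))) (stereo (R w)) = 1))"

definition catherine_wheel :: "(complex \<Rightarrow> real^3) \<Rightarrow> bool" where
  "catherine_wheel f \<longleftrightarrow>
     continuous_on S1 f \<and> f ` S1 = S2 \<and>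
     (\<forall>p \<in> S1. \<forall>q \<in> S1. p \<noteq> q \<longrightarrow>
        closed_disk (f ` arc p q) \<and> {f p, f q} \<subseteq> bdry (f ` arc p q))"

text \<open>For the interval I = [p,q] and a component Y of \<open>\<partial>f(I) - f(\<partial>I)\<close>:
  the canonical orientation of Y agrees with its boundary orientation iff
  f restricted to \<open>I \<inter> f^{-1}(Y)\<close> is monotone (non-decreasing) from the order of I
  (from p to q) to the order of Y induced by the boundary orientation of \<open>\<partial>f(I)\<close>.
  The latter order is read off a positively oriented parametrization \<open>\<delta>\<close> with
  inverse \<open>\<delta>'\<close>, starting from any base point z of the boundary circle outside Y.\<close>

definition canon_agrees ::
    "(complex \<Rightarrow> real^3) \<Rightarrow> complex \<Rightarrow> complex \<Rightarrow> (real^3) set \<Rightarrow> bool" where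
  "canon_agrees f p q Y \<longleftrightarrow>
     (let D = f ` arc p q in
      \<forall>\<delta> \<delta>'. homeomorphism S1 (bdry D) \<delta> \<delta>' \<and> pos_oriented D \<delta> \<longrightarrow>
        (\<forall>z \<in> bdry D - Y. \<forall>s1 s2.
           s1 \<in> arc p q \<and> s2 \<in> arc p q \<and> f s1 \<in> Y \<and> f s2 \<in> Y \<and> s1 \<in> arc p s2
           \<longrightarrow> \<delta>' (f s1) \<in> arc (\<delta>' z) (\<delta>' (f s2))))"

definition Zplus_empty :: "(complex \<Rightarrow> real^3) \<Rightarrow> complex \<Rightarrow> complex \<Rightarrow> bool" where
  "Zplus_empty f p q \<longleftrightarrow>
     \<not> (\<exists>Y \<in> components (bdry (f ` arc p q) - {f p, f q}). canon_agrees f p q Y)"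

definition degenerate :: "(complex \<Rightarrow> real^3) \<Rightarrow> complex \<Rightarrow> complex \<Rightarrow> bool" where
  "degenerate f p q \<longleftrightarrow> p \<in> S1 \<and> q \<in> S1 \<and> p \<noteq> q \<and> f p = f q"

definition pos_degenerate :: "(complex \<Rightarrow> real^3) \<Rightarrow> complex \<Rightarrow> complex \<Rightarrow> bool" where
  "pos_degenerate f p q \<longleftrightarrow> degenerate f p q \<and> Zplus_empty f p q"

definition neg_degenerate :: "(complex \<Rightarrow> real^3) \<Rightarrow> complex \<Rightarrow> complex \<Rightarrow> bool" where
  "neg_degenerate f p q \<longleftrightarrow> degenerate f p q \<and> \<not> Zplus_empty f p q"

definition Lplus :: "(complex \<Rightarrow> real^3) \<Rightarrow> complex set set" where
  "Lplus f = {{p, q} | p q. pos_degenerate f p q}"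

definition Lminus :: "(complex \<Rightarrow> real^3) \<Rightarrow> complex set set" where
  "Lminus f = {{p, q} | p q. neg_degenerate f p q}"

definition emb2 :: "complex \<Rightarrow> nat \<Rightarrow> real" where
  "emb2 z = (\<lambda>i. if i = 0 then Re z else if i = 1 then Im z else 0)"

definition unemb2 :: "(nat \<Rightarrow> real) \<Rightarrow> complex" where
  "unemb2 x = Complex (x 0) (x 1)"

definition emb3 :: "real^3 \<Rightarrow> nat \<Rightarrow> real" where
  "emb3 v = (\<lambda>i. if i = 0 then v$1 else if i = 1 then v$2 else if i = 2 then v$3 else 0)"

definition unemb3 :: "(nat \<Rightarrow> real) \<Rightarrow> real^3" where
  "unemb3 x = vector [x 0, x 1, x 2]"

definition op_homeo_S1 :: "(complex \<Rightarrow> complex) \<Rightarrow> bool" where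
  "op_homeo_S1 h \<longleftrightarrow> (\<exists>h'. homeomorphism S1 S1 h h') \<and>
     Brouwer_degree2 1 (emb2 \<circ> h \<circ> unemb2) = 1"

definition op_homeo_S2 :: "(real^3 \<Rightarrow> real^3) \<Rightarrow> bool" where
  "op_homeo_S2 H \<longleftrightarrow> (\<exists>H'. homeomorphism S2 S2 H H') \<and>
     Brouwer_degree2 2 (emb3 \<circ> H \<circ> unemb3) = 1"

definition attracting :: "'a::metric_space set \<Rightarrow> ('a \<Rightarrow> 'a) \<Rightarrow> 'a \<Rightarrow> bool" where
  "attracting X g x \<longleftrightarrow> x \<in> X \<and> g x = x \<and>
     (\<forall>e>0. \<exists>d>0. \<forall>y\<in>X. dist y x < d \<longrightarrow> (\<forall>k. dist ((g ^^ k) y) x < e)) \<and>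
     (\<exists>d>0. \<forall>y\<in>X. dist y x < d \<longrightarrow> (\<lambda>k. (g ^^ k) y) \<longlonglongrightarrow> x)"

definition repelling :: "'a::metric_space set \<Rightarrow> ('a \<Rightarrow> 'a) \<Rightarrow> 'a \<Rightarrow> bool" where
  "repelling X g x \<longleftrightarrow> attracting X (inv_into X g) x"

definition consecutive :: "complex set \<Rightarrow> complex \<Rightarrow> complex \<Rightarrow> bool" where
  "consecutive F x y \<longleftrightarrow> x \<in> F \<and> y \<in> F \<and> x \<noteq> y \<and>
     (\<forall>w \<in> F. w \<in> arc x y \<longrightarrow> w = x \<or> w = y)"

end

theory Submission imports Defs "HOL-Library.Real_Mod" begin

text \<open>
Lift the wheel to the line, \<open>F t = f (cis t)\<close>, and \<open>h\<close> to an increasing map. Two complementary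
images \<open>F ` {s..t}\<close> and \<open>F ` {t..s + 2 * pi}\<close> are disks with a common boundary, and three consecutive
images covering the sphere share at most two points (a planarity argument with theta curves).
By Brouwer degree \<open>H\<close> fixes a point \<open>c\<close>; if \<open>h\<close> had no periodic points, a minimal set in the
invariant fibre over \<open>c\<close> would contradict this planarity, so a power of \<open>h\<close> lifts to \<open>l\<close> with fixed points.
All forward orbits of \<open>l\<close> converge to one point \<open>a\<close> of the sphere and all backward orbits to
one point \<open>r\<close>. If \<open>a \<noteq> r\<close>, the fixed points of \<open>l\<close> alternate between the fibres of \<open>a\<close> and \<open>r\<close>, and the
boundary circles of interleaved disks carry opposite canonical orientations, because their two
arcs recombine into loops that are null-homotopic off a common interior point. If \<open>a = r\<close>,
there is one source and one sink, and tiling the two half planes by the disks between a point of the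
fibre and its image conjugates \<open>H\<close> to a translation.
\<close>

subsection \<open>The circle\<close>

lemma homeomorphism_imp_inj_on: "homeomorphism S T f g ==> inj_on f S"
 by (metis homeomorphism_def inj_on_inverseI)

lemma cis_eq_iff_int: "cis s = cis t \<longleftrightarrow> (EX k::int. s = t+2*pi * of_int k)"
 by (subst cis_eq_iff, subst rcong_sym_iff) (simp add: rcong_altdef mult_ac)

lemma cis_eq_imp_eq: "cis s = cis t ==> \<bar>s - t\<bar> < 2*pi ==> s = t"
 using rcong_imp_eq[of s t "2*pi"] by (simp add: cis_eq_iff)

lemma cis_shift_int: "cis (x+2*pi * of_int k) = cis x" using cis_eq_iff_int by blast

lemma cis_periodic: "cis (t+2*pi) = cis t" using cis_shift_int[of t 1] by simp

lemma real_period_representative: "EX k. s <= x+2*pi * of_int k & x+2*pi * of_int k < s+2*pi"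
proof -
 define k where "k = - \<lfloor>(x - s) / (2*pi)\<rfloor>"
 have "- of_int k * (2*pi) <= x - s" "x - s < (- of_int k+1) * (2*pi)"
  using floor_divide_lower[of "2*pi" "x - s"] floor_divide_upper[of "2*pi" "x - s"] by (simp_all add: k_def)
 then show ?thesis by (intro exI[of _ k]) (simp add: algebra_simps)
qed

lemma periodic_shift_int:
 fixes f :: "real => 'a"
 assumes "!!t. f (t+2*pi) = f t" shows "f (t+2*pi * of_int k) = f t"
proof -
 interpret periodic_fun_simple f "2*pi" by unfold_locales (rule assms)
 show ?thesis using plus_of_int[of t k] by (simp add: mult.commute)
qed

lemma degree_shift_int:
 fixes l :: "real => real"
 assumes "!!t. l (t+2*pi) = l t + d" shows "l (t+2*pi * of_int k) = l t + d * of_int k"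
proof -
 have "l (t+2*pi * of_int k) - d / (2*pi) * (t+2*pi * of_int k) = l t - d / (2*pi) * t"
  by (rule periodic_shift_int) (simp add: assms distrib_left)
 then show ?thesis by (simp add: distrib_left)
qed

lemma S1_iff_cis: "z : S1 \<longleftrightarrow> (EX t. z = cis t)"
proof
 assume "z : S1"
 then have "z = cis (Arg z)" by (metis S1_def cis_Arg mem_sphere_0 norm_zero sgn_eq zero_neq_one div_by_1 of_real_1)
 then show "EX t. z = cis t" by blast
qed (auto simp: S1_def)

lemma cis_in_S1 [simp]: "cis t : S1" by (simp add: S1_def)

lemma cis_image_period: "cis ` {s..s+2*pi} = S1"
proof
 show "S1 <= cis ` {s..s+2*pi}"
 proof
  fix z assume "z : S1"
  then obtain x where "z = cis x" using S1_iff_cis by blast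
  moreover obtain k where "s <= x+2*pi * of_int k" "x+2*pi * of_int k < s+2*pi" using real_period_representative by blast
  ultimately show "z : cis ` {s..s+2*pi}" using cis_shift_int[of x k] by (intro image_eqI[of _ _ "x+2*pi * of_int k"]) auto
 qed
qed auto

lemma arc_cis:
 assumes "s <= t" "t < s+2*pi" shows "arc (cis s) (cis t) = cis ` {s..t}"
proof -
 have "Arg2pi (cis (t - s)) = t - s"
  by (rule Arg2pi_unique[of 1]) (use assms in \<open>auto simp: cis_conv_exp\<close>)
 then have "ccw_angle (cis s) (cis t) = t - s" by (simp add: ccw_angle_def cis_divide)
 then have "arc (cis s) (cis t) = (%u. cis (s + u)) ` {0..t - s}" by (auto simp: arc_def cis_mult)
 also have "\<dots> = cis ` ((%u. s + u) ` {0..t - s})" by (simp only: image_image)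
 finally show ?thesis by simp
qed

definition circle_loop :: "real => (complex => real^3) => real => real^3" where
 "circle_loop \<alpha> \<delta> t = \<delta> (cis (2*pi * (\<alpha> + t)))"

lemma circle_loop:
 assumes h: "homeomorphism S1 B \<delta> \<delta>'"
 shows "simple_path (circle_loop \<alpha> \<delta>)" "path_image (circle_loop \<alpha> \<delta>) = B"
  "pathstart (circle_loop \<alpha> \<delta>) = \<delta> (cis (2*pi * \<alpha>))" "pathfinish (circle_loop \<alpha> \<delta>) = \<delta> (cis (2*pi * \<alpha>))"
proof -
 let ?circ = "part_circlepath 0 1 (2*pi * \<alpha>) (2*pi * \<alpha>+2*pi)"
 have "path_image ?circ = cis ` {2*pi * \<alpha>..2*pi * \<alpha>+2*pi}"
  by (simp add: path_image_part_circlepath' closed_segment_eq_real_ivl)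
 then have circ: "path_image ?circ = S1" by (simp only: cis_image_period)
 have loop: "circle_loop \<alpha> \<delta> = \<delta> \<circ> ?circ"
  by (simp add: fun_eq_iff circle_loop_def part_circlepath_def linepath_def cis_conv_exp algebra_simps)
 show "simple_path (circle_loop \<alpha> \<delta>)" unfolding loop
  by (rule simple_path_continuous_image)
   (use circ homeomorphism_cont1[OF h] homeomorphism_imp_inj_on[OF h] in \<open>auto simp: simple_path_part_circlepath\<close>)
 show "path_image (circle_loop \<alpha> \<delta>) = B"
  unfolding loop path_image_compose circ by (rule homeomorphism_image1[OF h])
 show "pathstart (circle_loop \<alpha> \<delta>) = \<delta> (cis (2*pi * \<alpha>))" by (simp add: circle_loop_def pathstart_def)
 show "pathfinish (circle_loop \<alpha> \<delta>) = \<delta> (cis (2*pi * \<alpha>))"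
  using cis_periodic[of "2*pi * \<alpha>"] by (simp add: circle_loop_def pathfinish_def algebra_simps)
qed

lemma S1_eq_cis_unit_angle:
 assumes "z : S1" obtains \<alpha> where "0 <= \<alpha>" "\<alpha> < 1" "z = cis (2*pi * \<alpha>)"
proof -
 obtain x where x: "z = cis x" using assms S1_iff_cis by blast
 obtain k where k: "0 <= x+2*pi * of_int k" "x+2*pi * of_int k < 0+2*pi" using real_period_representative by blast
 show thesis by (rule that[of "(x+2*pi * of_int k) / (2*pi)"]) (use k x in \<open>simp_all add: cis_shift_int\<close>)
qed

subsection \<open>Stereographic projection\<close>

definition unstereo :: "complex => real^3" where
 "unstereo z = vector [2 * Re z / (1+(norm z)\<^sup>2), - 2 * Im z / (1+(norm z)\<^sup>2),
            ((norm z)\<^sup>2 - 1) / (1+(norm z)\<^sup>2)]"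

lemma norm_real3: "norm (v::real^3) = sqrt ((v$1)\<^sup>2+(v$2)\<^sup>2+(v$3)\<^sup>2)"
 by (simp add: norm_vec_def L2_set_def sum_3)

lemma S2_iff: "(v::real^3) : S2 \<longleftrightarrow> (v$1)\<^sup>2+(v$2)\<^sup>2+(v$3)\<^sup>2 = 1"
 by (simp add: S2_def norm_real3)

lemma vec3_eq_iff: "(v::real^3) = w \<longleftrightarrow> v$1 = w$1 & v$2 = w$2 & v$3 = w$3"
 by (simp add: vec_eq_iff forall_3)

lemma S2_third_lt_1:
 fixes v :: "real^3"
 assumes "v : S2" "v ~= north" shows "v$3 < 1"
proof -
 have sphere: "(v$1)\<^sup>2+(v$2)\<^sup>2+(v$3)\<^sup>2 = 1" using assms by (simp add: S2_iff)
 then have "(v$3)\<^sup>2 <= 1" by (smt (verit) zero_le_power2)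
 then have "v$3 <= 1" using abs_le_square_iff[of "v$3" 1] by auto
 moreover have "v$3 ~= 1"
 proof
  assume "v$3 = 1"
  with sphere have "(v$1)\<^sup>2+(v$2)\<^sup>2 = 0" by simp
  then have "v$1 = 0" "v$2 = 0" by (simp_all add: sum_power2_eq_zero_iff)
  with \<open>v$3 = 1\<close> assms(2) show False by (simp add: vec3_eq_iff north_def)
 qed
 ultimately show ?thesis by simp
qed


lemma unstereo_denom_pos: "0 < 1+(norm (z::complex))\<^sup>2"
 by (simp add: add_pos_nonneg)

lemma unstereo_in_S2: "unstereo z : S2 - {north}"
proof -
 define N where "N = (norm z)\<^sup>2"
 have N: "1 + N ~= 0" "N = (Re z)\<^sup>2+(Im z)\<^sup>2" using unstereo_denom_pos[of z] by (auto simp: N_def cmod_power2)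
 have "(2 * Re z / (1 + N))\<^sup>2+(- 2 * Im z / (1 + N))\<^sup>2+((N - 1) / (1 + N))\<^sup>2
   = (4 * N+(N - 1)\<^sup>2) / (1 + N)\<^sup>2"
  by (simp add: power_divide add_divide_distrib[symmetric] N(2) power_mult_distrib)
 also have "4 * N+(N - 1)\<^sup>2 = (1 + N)\<^sup>2" by (simp add: power2_eq_square algebra_simps)
 also have "(1 + N)\<^sup>2 / (1 + N)\<^sup>2 = 1" using N by simp
 finally have "unstereo z : S2" by (simp add: S2_iff unstereo_def N_def)
 moreover have "unstereo z ~= north"
  using N(1) by (auto simp: unstereo_def north_def vec3_eq_iff N_def field_simps)
 ultimately show ?thesis by simp
qed

lemma unstereo_stereo:
 assumes "v : S2 - {north}" shows "unstereo (stereo v) = v"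
proof -
 have lt: "v$3 < 1" using S2_third_lt_1 assms by auto
 have horizontal: "(v$1)\<^sup>2+(v$2)\<^sup>2 = (1 + v$3) * (1 - v$3)"
  using assms by (simp add: S2_iff power2_eq_square algebra_simps)
 have coords: "Re (stereo v) = v$1 / (1 - v$3)" "Im (stereo v) = - (v$2) / (1 - v$3)"
  by (simp_all add: stereo_def Re_divide_of_real Im_divide_of_real)
 have "(norm (stereo v))\<^sup>2 = ((v$1)\<^sup>2+(v$2)\<^sup>2) / (1 - v$3)\<^sup>2"
  by (simp add: cmod_power2 coords power_divide add_divide_distrib)
 also have "\<dots> = (1 + v$3) / (1 - v$3)" unfolding horizontal using lt by (simp add: power2_eq_square)
 finally have norm: "(norm (stereo v))\<^sup>2 = (1 + v$3) / (1 - v$3)" .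
 have denom: "1+(norm (stereo v))\<^sup>2 = 2 / (1 - v$3)" unfolding norm using lt by (simp add: field_simps)
 have numer: "(norm (stereo v))\<^sup>2 - 1 = 2 * v$3 / (1 - v$3)" unfolding norm using lt by (simp add: field_simps)
 show ?thesis using lt unfolding vec3_eq_iff unstereo_def denom numer coords by (simp add: field_simps)
qed

lemma stereo_unstereo: "stereo (unstereo z) = z"
proof -
 define N where "N = (norm z)\<^sup>2"
 have N: "1 + N ~= 0" using unstereo_denom_pos[of z] by (simp add: N_def)
 then have "1 - (N - 1) / (1 + N) = 2 / (1 + N)" by (simp add: field_simps)
 then show ?thesis
  using N by (simp add: stereo_def unstereo_def N_def[symmetric] complex_eq_iff Re_divide_of_real Im_divide_of_real)
qed

lemma stereo_homeomorphism: "homeomorphism (S2 - {north}) UNIV stereo unstereo"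
proof (rule homeomorphismI)
 have stereo: "stereo = (%v::real^3. (of_real (v$1) - \<i> * of_real (v$2)) / complex_of_real (1 - v$3))"
  by (rule ext) (simp add: stereo_def complex_eq_iff)
 show "continuous_on (S2 - {north}) stereo"
  unfolding stereo by (intro continuous_intros) (use S2_third_lt_1 in fastforce)
 have unstereo: "unstereo = (%z. (2 * Re z / (1+(norm z)\<^sup>2)) *\<^sub>R axis 1 1+(- 2 * Im z / (1+(norm z)\<^sup>2)) *\<^sub>R axis 2 1 +
            (((norm z)\<^sup>2 - 1) / (1+(norm z)\<^sup>2)) *\<^sub>R axis 3 1)"
  by (rule ext) (simp add: vec3_eq_iff unstereo_def axis_def)
 show "continuous_on UNIV unstereo"
  unfolding unstereo by (intro continuous_intros) (metis unstereo_denom_pos less_irrefl)+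
qed (use unstereo_in_S2 unstereo_stereo stereo_unstereo in auto)

lemma orthogonal_transformation_homeomorphism_S2:
 fixes R :: "real^3 => real^3"
 assumes "orthogonal_transformation R" shows "homeomorphism S2 S2 R (inv_into UNIV R)"
proof (rule homeomorphismI)
 have lin: "linear R" using assms orthogonal_transformation_linear by blast
 have inv: "orthogonal_transformation (inv_into UNIV R)" using assms by (rule orthogonal_transformation_inv)
 then have lin_inv: "linear (inv_into UNIV R)" using orthogonal_transformation_linear by blast
 show "continuous_on S2 R" "continuous_on S2 (inv_into UNIV R)" using lin lin_inv by (simp_all add: linear_continuous_on linear_linear)
 show "R ` S2 <= S2" "inv_into UNIV R ` S2 <= S2"
  using assms inv by (auto simp: S2_def orthogonal_transformation_norm)
 show "inv_into UNIV R (R x) = x" "R (inv_into UNIV R x) = x" for x using orthogonal_transformation_bij[OF assms] by (simp_all add: bij_is_inj bij_is_surj surj_f_inv_f)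
qed

lemma rotated_stereo_homeomorphism:
 fixes R :: "real^3 => real^3"
 assumes "orthogonal_transformation R" "N : S2" "R N = north"
 shows "homeomorphism (S2 - {N}) UNIV (%v. stereo (R v)) (%z. inv_into UNIV R (unstereo z))"
proof -
 have b: "bij R" using assms orthogonal_transformation_bij by blast
 have "homeomorphism (S2 - {N}) (S2 - {north}) R (inv_into UNIV R)"
 proof (rule homeomorphism_of_subsets[OF orthogonal_transformation_homeomorphism_S2[OF assms(1)]])
  have "R ` (S2 - {N}) = R ` S2 - R ` {N}" using b by (simp add: image_set_diff bij_is_inj)
  also have "\<dots> = S2 - {north}"
   using assms orthogonal_transformation_homeomorphism_S2[OF assms(1)] by (simp add: homeomorphism_def)
  finally show "R ` (S2 - {N}) = S2 - {north}" .
 qed auto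
 from homeomorphism_compose[OF this stereo_homeomorphism] show ?thesis by (simp add: o_def)
qed

lemma stereographic_chart:
 assumes "N : S2"
 obtains R where "orthogonal_transformation R" "det (matrix R) = 1" "R N = north"
  "homeomorphism (S2 - {N}) (UNIV::complex set) (%v. stereo (R v)) (%z. inv_into UNIV R (unstereo z))"
proof -
 have "norm N = norm north" using assms by (simp add: S2_def norm_real3 north_def)
 then obtain R where "orthogonal_transformation R" "det (matrix R) = 1" "R N = north"
  using rotation_exists[of N north] by auto
 with rotated_stereo_homeomorphism assms that show thesis by blast
qed

lemma punctured_S2_homeomorphism:
 assumes "N : S2"
 obtains sg tu where "homeomorphism (S2 - {N}) (UNIV::complex set) sg tu"
 using stereographic_chart[OF assms] by metis


lemma connected_S2_minus_two:
 assumes "a : S2" shows "connected (S2 - {a, b})"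
proof -
 obtain sg tu where h: "homeomorphism (S2 - {a}) (UNIV::complex set) sg tu"
  using punctured_S2_homeomorphism assms by blast
 have "connected (tu ` (- {sg b}))"
  by (intro connected_continuous_image connected_punctured_universe continuous_on_subset[OF homeomorphism_cont2[OF h]]) auto
 moreover have "S2 - {a, b} = tu ` (- {sg b})" if "b : S2 - {a}"
 proof -
  have "tu ` (UNIV - {sg b}) = tu ` UNIV - tu ` {sg b}"
   by (rule inj_on_image_set_diff[OF homeomorphism_imp_inj_on[OF homeomorphism_symD[OF h]]]) auto
  then show ?thesis using homeomorphism_image2[OF h] homeomorphism_apply1[OF h that] by (auto simp: Compl_eq_Diff_UNIV)
 qed
 moreover have "S2 - {a, b} = S2 - {a}" if "b ~: S2 - {a}" using that by auto
 moreover have "connected (S2 - {a})"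
  using connected_continuous_image[OF homeomorphism_cont2[OF h] connected_UNIV] homeomorphism_image2[OF h] by simp
 ultimately show ?thesis by (cases "b : S2 - {a}") simp_all
qed

lemma north_in_S2: "north : S2" "- north : S2" "north ~= - north"
 by (auto simp: S2_iff north_def vec3_eq_iff)


lemma openin_S2_punctured_chart:
 assumes "homeomorphism (S2 - {N}) (UNIV::complex set) sg tu" "U <= S2 - {N}"
 shows "openin (top_of_set S2) U \<longleftrightarrow> open (sg ` U)"
proof -
 have tu: "tu ` (sg ` U) = U"
 proof -
  have "tu (sg x) = x" if "x : U" for x using homeomorphism_apply1[OF assms(1)] assms(2) that by blast
  then show ?thesis by (simp add: image_image)
 qed
 show ?thesis
 proof
  assume "openin (top_of_set S2) U"
  then have "openin (top_of_set (S2 - {N})) U"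
   using assms(2) openin_subset_trans by blast
  then show "open (sg ` U)"
   using homeomorphism_imp_open_map[OF assms(1)] by simp
 next
  assume "open (sg ` U)"
  then have "openin (top_of_set UNIV) (sg ` U)" by simp
  then have "openin (top_of_set (S2 - {N})) (tu ` sg ` U)"
   using homeomorphism_imp_open_map[of UNIV "S2 - {N}" tu sg] assms(1) homeomorphism_symD by blast
  then show "openin (top_of_set S2) U" using openin_trans[OF _ openin_delete[OF openin_subtopology_self]] tu by metis
 qed
qed

subsection \<open>Closed disks in the sphere\<close>

lemma invariance_of_domain_into_S2:
 fixes \<phi> :: "complex => real^3"
 assumes "continuous_on W \<phi>" "inj_on \<phi> W" "open W" "\<phi> ` W <= S2"
 shows "openin (top_of_set S2) (\<phi> ` W)"
proof -
 have punctured: "openin (top_of_set S2) (\<phi> ` W - {N})" if N: "N : S2" for N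
 proof -
  obtain sg tu where s: "homeomorphism (S2 - {N}) (UNIV::complex set) sg tu"
   using punctured_S2_homeomorphism N by blast
  define V where "V = {b : W. \<phi> b ~= N}"
  have "open V" unfolding V_def
   using continuous_open_preimage[OF assms(1,3), of "- {N}"] by (simp add: vimage_def Int_def open_Compl)
  have V: "\<phi> ` V = \<phi> ` W - {N}" "V <= W" by (auto simp: V_def)
  have sub: "\<phi> ` V <= S2 - {N}" using assms(4) by (auto simp: V_def)
  have "open ((sg \<circ> \<phi>) ` V)"
  proof (rule invariance_of_domain[OF _ \<open>open V\<close>])
   show "continuous_on V (sg \<circ> \<phi>)"
    by (intro continuous_on_compose continuous_on_subset[OF assms(1) V(2)] continuous_on_subset[OF homeomorphism_cont1[OF s] sub])
   show "inj_on (sg \<circ> \<phi>) V"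
    by (intro comp_inj_on inj_on_subset[OF assms(2) V(2)] inj_on_subset[OF homeomorphism_imp_inj_on[OF s] sub])
  qed
  then have "open (sg ` (\<phi> ` V))" by (simp add: image_comp)
  then show ?thesis using openin_S2_punctured_chart[OF s sub] V(1) by simp
 qed
 have "\<phi> ` W = (\<phi> ` W - {north}) Un (\<phi> ` W - {- north})" using north_in_S2 by auto
 then show ?thesis using punctured north_in_S2 openin_Un by metis
qed

lemma invariance_of_domain_from_S2:
 fixes \<psi> :: "real^3 => complex"
 assumes "continuous_on U \<psi>" "inj_on \<psi> U" "openin (top_of_set S2) U"
 shows "open (\<psi> ` U)"
 using invariance_of_domain_sphere_affine_set[OF assms(1,2), of UNIV 1 0] assms(3) by (simp add: S2_def)

lemma sphere_Un_ball: "ball x r Un sphere x r = cball x r"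
 by auto

lemma closed_disk_param:
 assumes "closed_disk D"
 obtains \<phi> \<psi> where "homeomorphism (cball (0::complex) 1) D \<phi> \<psi>"
  "\<phi> ` sphere 0 1 = bdry D" "\<phi> ` ball 0 1 = D - bdry D" "openin (top_of_set S2) (D - bdry D)"
proof -
 obtain \<psi> \<phi> where h: "homeomorphism D (cball (0::complex) 1) \<psi> \<phi>"
  using assms by (auto simp: closed_disk_def homeomorphic_def)
 note h' = homeomorphism_symD[OF h]
 have DS: "D <= S2" using assms by (simp add: closed_disk_def)
 have interior_open: "openin (top_of_set S2) (\<phi> ` ball 0 1)"
  by (rule invariance_of_domain_into_S2[OF continuous_on_subset[OF homeomorphism_cont1[OF h'] ball_subset_cball]
    inj_on_subset[OF homeomorphism_imp_inj_on[OF h'] ball_subset_cball] open_ball])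
   (use homeomorphism_image2[OF h] DS in auto)
 have interior: "\<phi> ` ball 0 1 Int bdry D = {}"
 proof -
  obtain V where V: "open V" "\<phi> ` ball 0 1 = S2 Int V" using interior_open by (auto simp: openin_open)
  have "\<phi> ` ball 0 1 <= D" using homeomorphism_image2[OF h] ball_subset_cball by blast
  then have "V Int (S2 - D) = {}" using V(2) by auto
  then have "V Int closure (S2 - D) = {}" using open_Int_closure_eq_empty[OF V(1)] by simp
  then show ?thesis using V by (auto simp: bdry_def)
 qed
 have boundary: "\<phi> s : bdry D" if s: "s : sphere 0 1" for s
 proof (rule ccontr)
  assume "\<phi> s ~: bdry D"
  define U where "U = S2 Int - closure (S2 - D)"
  have UD: "U <= D" using closure_subset[of "S2 - D"] by (auto simp: U_def)
  have "open (\<psi> ` U)"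
  proof (rule invariance_of_domain_from_S2)
   show "openin (top_of_set S2) U" unfolding U_def by (intro openin_open_Int open_Compl closed_closure)
   show "continuous_on U \<psi>" by (rule continuous_on_subset[OF homeomorphism_cont1[OF h] UD])
   show "inj_on \<psi> U" by (rule inj_on_subset[OF homeomorphism_imp_inj_on[OF h] UD])
  qed
  moreover have "\<psi> ` U <= cball 0 1" using UD homeomorphism_image1[OF h] by blast
  ultimately have ball: "\<psi> ` U <= ball 0 1" by (metis interior_cball interior_maximal)
  have sc: "s : cball 0 1" using s by auto
  then have "\<phi> s : D" using homeomorphism_image2[OF h] by blast
  then have "\<phi> s : U" using \<open>\<phi> s ~: bdry D\<close> DS by (auto simp: U_def bdry_def)
  then have "\<psi> (\<phi> s) : ball 0 1" using ball by blast
  then show False using homeomorphism_apply2[OF h sc] s by simp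
 qed
 have D: "D = \<phi> ` ball 0 1 Un \<phi> ` sphere 0 1"
  using homeomorphism_image2[OF h] unfolding image_Un[symmetric] by (simp add: sphere_Un_ball)
 have sphere: "\<phi> ` sphere 0 1 = bdry D"
 proof
  show "\<phi> ` sphere 0 1 <= bdry D" using boundary by (rule image_subsetI)
  have "bdry D <= D" by (auto simp: bdry_def)
  then show "bdry D <= \<phi> ` sphere 0 1" using interior equalityD1[OF D] by blast
 qed
 moreover have "\<phi> ` ball 0 1 = D - bdry D" using interior D unfolding sphere by blast
 ultimately show thesis using that[OF h'] interior_open by simp
qed

subsection \<open>Arcs and subcontinua of a simple closed curve\<close>

lemma simple_loop_gap:
 fixes gm :: "real => 'a::real_normed_vector"
 assumes sp: "simple_path gm" and st: "pathstart gm = c" and P: "closed P" "connected P" "P <= path_image gm" "c : P"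
  and lm: "0 < l" "l < m" "m < 1" "gm l ~: P" "gm m ~: P"
 shows "P Int gm ` {l..m} = {}"
proof -
 have cont_gm: "continuous_on {0..1} gm" and loop: "loop_free gm" using sp by (auto simp: simple_path_def path_def)
 have closed_mid: "closed (gm ` {l..m})"
  by (intro compact_imp_closed compact_continuous_image continuous_on_subset[OF cont_gm]) (use lm in auto)
 have closed_ends: "closed (gm ` ({0..l} Un {m..1}))"
  by (intro compact_imp_closed compact_continuous_image continuous_on_subset[OF cont_gm] compact_Un) (use lm in auto)
 have cover: "P <= gm ` {l..m} Un gm ` ({0..l} Un {m..1})"
 proof
  fix x assume "x : P"
  then obtain t where t: "t : {0..1}" "x = gm t" using P by (auto simp: path_image_def)
  then have "t : {l..m} | t : {0..l} Un {m..1}" using lm by auto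
  then show "x : gm ` {l..m} Un gm ` ({0..l} Un {m..1})" using t by blast
 qed
 have disjoint: "gm ` {l..m} Int gm ` ({0..l} Un {m..1}) Int P = {}"
 proof -
  have "gm t ~: P" if t: "t : {l..m}" "t' : {0..l} Un {m..1}" "gm t = gm t'" for t t'
  proof -
   have "t : {0..1}" "t' : {0..1}" using t lm by auto
   then have "t = t' | t = 0 & t' = 1 | t = 1 & t' = 0" using loop t by (simp add: loop_free_def)
   then have "t = l | t = m" using t lm by auto
   then show ?thesis using lm by auto
  qed
  then show ?thesis by fastforce
 qed
 have ends_meet: "gm ` ({0..l} Un {m..1}) Int P ~= {}"
 proof -
  have "gm 0 = c" using st by (simp add: pathstart_def)
  then have "c : gm ` ({0..l} Un {m..1})" using lm by (metis UnCI atLeastAtMost_iff imageI less_eq_real_def)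
  then show ?thesis using P by auto
 qed
 show ?thesis
  using connected_closedD[OF P(2) disjoint cover closed_mid closed_ends] ends_meet by auto
qed


lemma simple_loop_inj:
 assumes "simple_path gm" "gm s = gm t" "s : {0..1}" "t : {0..1}" "t ~= 0" "t ~= 1"
 shows "s = t"
 using assms unfolding simple_path_def loop_free_def by blast

lemma simple_loop_image_infinite:
 assumes "simple_path gm" "0 <= a" "a < b" "b <= 1" shows "infinite (gm ` {a..b})"
proof
 assume "finite (gm ` {a..b})"
 then have "finite (gm ` {a<..<b})" by (rule finite_subset[rotated]) auto
 moreover have "inj_on gm {a<..<b}" by (rule inj_onI, rule simple_loop_inj[OF assms(1)]) (use assms in auto)
 ultimately show False using finite_imageD infinite_Ioo[OF assms(3)] by blast
qed

lemma simple_loop_subcontinuum: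
 fixes gm :: "real => 'a::real_normed_vector"
 assumes sp: "simple_path gm" and st: "pathstart gm = c" "pathfinish gm = c"
  and P: "closed P" "connected P" "P <= path_image gm" "c : P"
 obtains a b where "0 <= a" "a <= b" "b <= 1" "P = gm ` ({0..a} Un {b..1})"
proof (cases "P = path_image gm")
 case True
 have "{0..1/2} Un {1/2..1} = {0..1::real}" by auto
 then show thesis using True that[of "1/2" "1/2"] by (simp add: path_image_def)
next
 case False
 have c01: "gm 0 : P" "gm 1 : P" using st P by (auto simp: pathstart_def pathfinish_def)
 define C where "C = {t : {0..1}. gm t ~: P}"
 have C01: "0 < t & t < 1" if "t : C" for t using that c01 by (auto simp: C_def less_le)
 have "C = {0<..<1} Int gm -` (- P)" using C01 by (auto simp: C_def)
 moreover have "continuous_on {0<..<1} gm"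
  using sp by (auto simp: simple_path_def path_def intro: continuous_on_subset)
 ultimately have "open C" using P(1) continuous_open_preimage by (metis open_Compl open_greaterThanLessThan)
 define a b where "a = Inf C" and "b = Sup C"
 have ne: "C ~= {}" using False P by (auto simp: C_def path_image_def)
 have bdd: "bdd_below C" "bdd_above C" by (auto simp: C_def intro: bdd_belowI bdd_aboveI)
 have ab: "a <= t & t <= b" if "t : C" for t using that bdd by (simp add: a_def b_def cInf_lower cSup_upper)
 have "a ~: C" "b ~: C" unfolding a_def b_def
  using Inf_notin_open[OF \<open>open C\<close>, of 0] Sup_notin_open[OF \<open>open C\<close>, of 1] C01 by blast+
 then have "a < t & t < b" if "t : C" for t using ab[OF that] that by (auto simp: less_le)
 moreover have "t : C" if t: "a < t" "t < b" for t
 proof -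
  obtain u v where uv: "u : C" "u < t" "v : C" "t < v"
   using cInf_lessD[OF ne, of t] less_cSupD[OF ne, of t] t unfolding a_def b_def by blast
  then have "P Int gm ` {u..v} = {}"
   by (intro simple_loop_gap[OF sp st(1) P]) (use C01 in \<open>auto simp: C_def\<close>)
  then show "t : C" using uv C01[OF uv(1)] C01[OF uv(3)] by (auto simp: C_def)
 qed
 ultimately have C: "C = {a<..<b}" by auto
 have "0 <= a" unfolding a_def by (rule cInf_greatest[OF ne]) (simp add: C_def)
 moreover have "b <= 1" unfolding b_def by (rule cSup_least[OF ne]) (simp add: C_def)
 moreover have "a <= b" using ne ab by force
 ultimately have rng: "0 <= a" "b <= 1" "a <= b" by auto
 have "P = gm ` ({0..1} - C)" using P(3) by (auto simp: C_def path_image_def)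
 also have "{0..1} - C = {0..a} Un {b..1}" using rng by (auto simp: C)
 finally show thesis using that rng by blast
qed

lemma simple_loop_cover_by_two_arcs:
 assumes sp: "simple_path gm" and st: "pathstart gm = c"
  and t: "0 < b" "b <= 1" "0 <= a" "a < 1"
  and cover: "path_image gm = gm ` {b..1} Un gm ` {0..a}" and meet: "gm ` {b..1} Int gm ` {0..a} <= {c, d}"
 shows "b = a & gm b = d"
proof -
 have "b <= a"
 proof (rule ccontr)
  assume gap: "~ b <= a"
  then have "gm ((a + b) / 2) : path_image gm" using t by (auto simp: path_image_def)
  then obtain s where s: "s : {b..1} Un {0..a}" "gm ((a + b) / 2) = gm s" unfolding cover by blast
  have "s = (a + b) / 2" by (rule simple_loop_inj[OF sp s(2)[symmetric]]) (use gap t s(1) in auto)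
  then show False using s(1) gap by auto
 qed
 moreover have "~ b < a"
 proof
  assume "b < a"
  then have "infinite (gm ` {b..a})" using simple_loop_image_infinite[OF sp] t by simp
  moreover have "gm ` {b..a} <= {c, d}" using t by (intro subset_trans[OF _ meet] Int_greatest image_mono) auto
  ultimately show False using finite_subset by blast
 qed
 ultimately have "b = a" by simp
 moreover have "gm b ~= c"
  using simple_loop_inj[OF sp, of 0 b] st t \<open>b = a\<close> by (auto simp: pathstart_def)
 moreover have "gm b : gm ` {b..1} Int gm ` {0..a}" using t \<open>b = a\<close> by auto
 ultimately show ?thesis using meet by auto
qed

lemma simple_loop_two_arcs:
 fixes gm :: "real => 'a::real_normed_vector"
 assumes sp: "simple_path gm" and st: "pathstart gm = c" "pathfinish gm = c"
  and P: "closed P" "connected P" "c : P" "P ~= {c}"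
  and Q: "closed Q" "connected Q" "c : Q" "Q ~= {c}"
  and PQ: "P Un Q = path_image gm" "P Int Q <= {c, d}"
 obtains tu where "0 < tu" "tu < 1" "gm tu = d" "P = gm ` {0..tu} & Q = gm ` {tu..1} | P = gm ` {tu..1} & Q = gm ` {0..tu}"
proof -
 have proper: "X ~= path_image gm" if "connected Y" "c : Y" "Y ~= {c}" "X Un Y = path_image gm" "X Int Y <= {c, d}" for X Y
 proof
  assume "X = path_image gm"
  then have "finite Y" using that by (intro finite_subset[of Y "{c, d}"]) auto
  then show False using that connected_finite_iff_sing[of Y] by auto
 qed
 have ne: "P ~= path_image gm" "Q ~= path_image gm"
  using proper[OF Q(2-4) PQ] proper[OF P(2-4), of Q] PQ by (auto simp: Un_commute Int_commute)
 have g01: "gm 0 = c" "gm 1 = c" using st by (auto simp: pathstart_def pathfinish_def)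
 obtain a b where ab: "0 <= a" "a <= b" "b <= 1" "P = gm ` ({0..a} Un {b..1})"
  using simple_loop_subcontinuum[OF sp st P(1,2) _ P(3)] PQ by blast
 obtain a' b' where ab': "0 <= a'" "a' <= b'" "b' <= 1" "Q = gm ` ({0..a'} Un {b'..1})"
  using simple_loop_subcontinuum[OF sp st Q(1,2) _ Q(3)] PQ by blast
 have lt: "a < 1" "a' < 1" "0 < b" "0 < b'" using ab ab' ne by (auto simp: path_image_def less_le)
 have thin: "~ s < t" if "0 <= s" "t <= 1" "gm ` {s..t} <= P Int Q" for s t
  using simple_loop_image_infinite[OF sp, of s t] that PQ(2) finite_subset[of "gm ` {s..t}" "{c, d}"] by auto
 have "gm ` {0..min a a'} <= P Int Q" "gm ` {max b b'..1} <= P Int Q" unfolding ab(4) ab'(4) by auto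
 then have "~ 0 < min a a'" "~ max b b' < 1" using thin[of 0 "min a a'"] thin[of "max b b'" 1] lt by auto
 then have "a = 0 | a' = 0" "b = 1 | b' = 1" using ab(1,3) ab'(1,3) by auto
 moreover have "~ (a = 0 & b = 1)" "~ (a' = 0 & b' = 1)" using P(4) Q(4) ab(4) ab'(4) g01 by auto
 moreover have c_in: "c : gm ` {s..1}" "c : gm ` {0..t}" if "s <= 1" "0 <= t" for s t
  using g01 that by (auto intro: rev_image_eqI)
 ultimately consider (Q_initial) "a = 0" "b' = 1" | (P_initial) "a' = 0" "b = 1" by blast
 then show thesis
 proof cases
  case Q_initial
  then have arcs: "P = gm ` {b..1}" "Q = gm ` {0..a'}"
   using ab(3,4) ab'(1,4) c_in[of b a'] g01 by (simp_all add: image_Un insert_absorb)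
  have "b = a' & gm b = d" using PQ lt ab(3) ab'(1) unfolding arcs
   by (intro simple_loop_cover_by_two_arcs[OF sp st(1)]) simp_all
  then show thesis using that[of b] arcs lt by auto
 next
  case P_initial
  then have arcs: "Q = gm ` {b'..1}" "P = gm ` {0..a}"
   using ab(1,4) ab'(3,4) c_in[of b' a] g01 by (simp_all add: image_Un insert_absorb)
  have "b' = a & gm b' = d" using PQ lt ab(1) ab'(3) unfolding arcs
   by (intro simple_loop_cover_by_two_arcs[OF sp st(1)]) (simp_all add: Un_commute Int_commute)
  then show thesis using that[of b'] arcs lt by auto
 qed
qed

lemma simple_loop_cover_meets_twice:
 fixes gm :: "real => 'a::real_normed_vector"
 assumes sp: "simple_path gm" and st: "pathstart gm = c" "pathfinish gm = c"
  and P: "closed P" "connected P" "c : P" "P ~= {c}"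
  and Q: "closed Q" "connected Q" "c : Q" "Q ~= {c}"
  and PQ: "P Un Q = path_image gm"
 shows "EX d. d ~= c & d : P Int Q"
proof (rule ccontr)
 assume "\<nexists>d. d ~= c & d : P Int Q"
 then have sub: "P Int Q <= {c, c}" by auto
 obtain tu where tu: "0 < tu" "tu < 1" "gm tu = c"
  using simple_loop_two_arcs[OF sp st P Q PQ sub] by metis
 have "gm 0 = gm tu" using st tu by (simp add: pathstart_def)
 then show False using simple_loop_inj[OF sp, of 0 tu] tu by auto
qed


lemma simple_loop_arc_mem:
 assumes "simple_path gm" "gm x : gm ` {a..b}" "0 < x" "x < 1" "0 <= a" "b <= 1"
 shows "x : {a..b}"
proof -
 obtain y where y: "y : {a..b}" "gm y = gm x" using assms(2) by auto
 have "y = x" by (rule simple_loop_inj[OF assms(1) y(2)]) (use y assms in auto)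
 then show ?thesis using y by simp
qed

lemma simple_loop_overlap_disconnected:
 fixes gm :: "real => 'a::real_normed_vector"
 assumes sp: "simple_path gm" "pathstart gm = c" and ab: "0 < a" "a <= b" "b < 1"
  and S: "closed S" "connected S" "c : S" "S = gm ` {a..1} Int gm ` {0..b}"
 shows False
proof -
 have outside: "gm x ~: S" if x: "0 < x" "x < 1" "x < a | b < x" for x
 proof
  assume "gm x : S"
  then have "gm x : gm ` {a..1}" "gm x : gm ` {0..b}" unfolding S(4) by blast+
  then show False using simple_loop_arc_mem[OF sp(1), of x] x ab by fastforce
 qed
 have "S Int gm ` {a / 2..(b+1) / 2} = {}"
 proof (rule simple_loop_gap[OF sp S(1,2) _ S(3)])
  show "S <= path_image gm" unfolding S(4) path_image_def using ab by auto
  show "gm (a / 2) ~: S" "gm ((b+1) / 2) ~: S" by (rule outside; use ab in simp)+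
 qed (use ab in auto)
 moreover have "gm a : S" unfolding S(4) using ab by auto
 moreover have "gm a : gm ` {a / 2..(b+1) / 2}" using ab by auto
 ultimately show False by blast
qed

lemma simple_loop_opposite_arcs_disconnected:
 fixes gm :: "real => 'a::real_normed_vector"
 assumes g: "simple_path gm" "pathstart gm = c" "pathfinish gm = c" and s: "0 < s" "s < 1" and t: "0 < t" "t < 1"
  and arcs: "A = gm ` {0..s} & B = gm ` {s..1}" "C = gm ` {0..t} & D = gm ` {t..1}"
  and con: "connected (B Int C)" "connected (A Int D)" and c: "c : A Int B Int C Int D"
  and closed: "closed A" "closed B" "closed C" "closed D"
 shows False
proof (cases "s <= t")
 case True
 show False by (rule simple_loop_overlap_disconnected[OF g(1,2) s(1) True t(2), of "B Int C"]) (use g arcs con c closed in auto)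
next
 case False
 then have "t <= s" by simp
 show False by (rule simple_loop_overlap_disconnected[OF g(1,2) t(1) \<open>t <= s\<close> s(2), of "A Int D"]) (use g arcs con c closed in auto)
qed

text \<open>Two decompositions of the loop into two arcs at \<open>c\<close>: if opposite arcs meet only near \<open>c\<close>,
  the decompositions run in opposite directions and share their second division point.\<close>

lemma simple_loop_two_divisions:
 fixes gm :: "real => 'a::real_normed_vector"
 assumes g: "simple_path gm" "pathstart gm = c" "pathfinish gm = c"
  and P: "closed P" "connected P" "c : P" and Q: "closed Q" "connected Q" "c : Q"
  and X: "closed X" "connected X" "c : X" and Y: "closed Y" "connected Y" "c : Y"
  and PQ: "P Un Q = path_image gm" "P Int Q <= {c, d}" and XY: "X Un Y = path_image gm" "X Int Y <= {c, d'}"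
  and con: "connected (Q Int X)" "connected (P Int Y)"
  and z: "z : P" "z : X" "z ~= c" and w: "w : Q" "w : Y" "w ~= c"
 shows "z = w"
proof -
 have interior: "EX x. 0 < x & x < 1 & v = gm x" if v: "v : path_image gm" "v ~= c" for v
 proof -
  obtain x where x: "0 <= x" "x <= 1" "v = gm x" using v(1) by (auto simp: path_image_def)
  moreover have "x ~= 0" "x ~= 1" using x(3) v(2) g(2,3) by (auto simp: pathstart_def pathfinish_def)
  ultimately show ?thesis by (intro exI[of _ x]) auto
 qed
 obtain \<zeta> where \<zeta>: "0 < \<zeta>" "\<zeta> < 1" "z = gm \<zeta>" using interior[of z] z PQ by blast
 obtain \<omega> where \<omega>: "0 < \<omega>" "\<omega> < 1" "w = gm \<omega>" using interior[of w] w PQ by blast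
 have ne: "P ~= {c}" "Q ~= {c}" "X ~= {c}" "Y ~= {c}" using z w by auto
 obtain s where s: "0 < s" "s < 1" "P = gm ` {0..s} & Q = gm ` {s..1} | P = gm ` {s..1} & Q = gm ` {0..s}"
  by (rule simple_loop_two_arcs[OF g P ne(1) Q ne(2) PQ])
 obtain t where t: "0 < t" "t < 1" "X = gm ` {0..t} & Y = gm ` {t..1} | X = gm ` {t..1} & Y = gm ` {0..t}"
  by (rule simple_loop_two_arcs[OF g X ne(3) Y ne(4) XY])
 note mem = simple_loop_arc_mem[OF g(1)]
 note same = simple_loop_opposite_arcs_disconnected[OF g s(1,2) t(1,2)]
 have "\<zeta> = \<omega>"
  using s(3) t(3)
 proof (elim disjE)
  assume "P = gm ` {0..s} & Q = gm ` {s..1}" "X = gm ` {t..1} & Y = gm ` {0..t}"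
  then have "gm \<zeta> : gm ` {0..s}" "gm \<zeta> : gm ` {t..1}" "gm \<omega> : gm ` {s..1}" "gm \<omega> : gm ` {0..t}"
   using z(1,2) w(1,2) \<zeta>(3) \<omega>(3) by simp_all
  from mem[OF this(1) \<zeta>(1,2)] mem[OF this(2) \<zeta>(1,2)] mem[OF this(3) \<omega>(1,2)] mem[OF this(4) \<omega>(1,2)]
  show ?thesis using s(1,2) t(1,2) by simp
 next
  assume "P = gm ` {s..1} & Q = gm ` {0..s}" "X = gm ` {0..t} & Y = gm ` {t..1}"
  then have "gm \<zeta> : gm ` {s..1}" "gm \<zeta> : gm ` {0..t}" "gm \<omega> : gm ` {0..s}" "gm \<omega> : gm ` {t..1}"
   using z(1,2) w(1,2) \<zeta>(3) \<omega>(3) by simp_all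
  from mem[OF this(1) \<zeta>(1,2)] mem[OF this(2) \<zeta>(1,2)] mem[OF this(3) \<omega>(1,2)] mem[OF this(4) \<omega>(1,2)]
  show ?thesis using s(1,2) t(1,2) by simp
 next
  assume "P = gm ` {0..s} & Q = gm ` {s..1}" "X = gm ` {0..t} & Y = gm ` {t..1}"
  from same[OF this] con P Q X Y show ?thesis by blast
 next
  assume "P = gm ` {s..1} & Q = gm ` {0..s}" "X = gm ` {t..1} & Y = gm ` {0..t}"
  from same[OF conj_commute[THEN iffD1, OF this(1)] conj_commute[THEN iffD1, OF this(2)]] con P Q X Y show ?thesis by blast
 qed
 then show ?thesis using \<zeta> \<omega> by simp
qed

subsection \<open>Three disks with disjoint interiors share at most two points\<close>

lemma connected_unbounded_subset_outside:
 assumes "connected X" "~ bounded X" "X Int S = {}"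
 shows "X <= outside S"
proof
 fix x assume x: "x : X"
 then have "X <= connected_component_set (- S) x"
  using assms by (intro connected_component_maximal) auto
 then have "~ bounded (connected_component_set (- S) x)" using assms bounded_subset by blast
 then show "x : outside S" using x assms by (auto simp: outside_def)
qed


lemma closed_disk_interior_connected_punctured:
 assumes D: "closed_disk D" shows "connected (D - bdry D - {N})"
proof -
 obtain \<phi> \<psi> where h: "homeomorphism (cball (0::complex) 1) D \<phi> \<psi>" "\<phi> ` ball 0 1 = D - bdry D"
  using closed_disk_param[OF D] by metis
 have cont: "continuous_on (ball 0 1) \<phi>"
  by (rule continuous_on_subset[OF homeomorphism_cont1[OF h(1)]]) auto
 show ?thesis
 proof (cases "N : D - bdry D")
  case True
  then obtain x where x: "x : ball 0 1" "N = \<phi> x" unfolding h(2)[symmetric] by auto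
  have "\<phi> ` (ball 0 1 - {x}) = \<phi> ` ball 0 1 - \<phi> ` {x}"
   by (rule inj_on_image_set_diff[OF homeomorphism_imp_inj_on[OF h(1)]]) (use x in auto)
  moreover have "connected (\<phi> ` (ball 0 1 - {x}))"
   by (intro connected_continuous_image continuous_on_subset[OF cont] connected_punctured_convex) (auto simp: aff_dim_open)
  ultimately show ?thesis using x h(2) by simp
 next
  case False
  have "connected (\<phi> ` ball 0 1)" by (intro connected_continuous_image cont) auto
  then show ?thesis using False h(2) by simp
 qed
qed

lemma closed_disk_interior_nonempty: "closed_disk D ==> D - bdry D ~= {}"
 by (metis closed_disk_param ball_eq_empty image_is_empty not_one_le_zero)

lemma closed_disk_interior_connected:
 assumes D: "closed_disk D" shows "connected (D - bdry D)"
proof -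
 have "0 ~: D" using D by (auto simp: closed_disk_def S2_def)
 then show ?thesis using closed_disk_interior_connected_punctured[OF D, of 0] by simp
qed

lemma closed_disk_boundary_subset_closure:
 assumes D: "closed_disk D" shows "bdry D <= closure (D - bdry D)"
proof -
 obtain \<phi> \<psi> where h: "homeomorphism (cball (0::complex) 1) D \<phi> \<psi>" "\<phi> ` sphere 0 1 = bdry D" "\<phi> ` ball 0 1 = D - bdry D"
  using closed_disk_param[OF D] by metis
 have "\<phi> ` closure (ball 0 1) <= closure (\<phi> ` ball 0 1)"
  by (rule image_closure_subset) (use homeomorphism_cont1[OF h(1)] closure_subset[of "\<phi> ` ball 0 1"] in auto)
 moreover have "bdry D <= \<phi> ` closure (ball 0 1)" unfolding h(2)[symmetric] by (intro image_mono) auto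
 ultimately show ?thesis using h(3) by auto
qed

lemma closed_disk_boundary_circle:
 assumes D: "closed_disk D" obtains \<delta> \<delta>' where "homeomorphism S1 (bdry D) \<delta> \<delta>'"
proof -
 obtain \<phi> \<psi> where h: "homeomorphism (cball (0::complex) 1) D \<phi> \<psi>" "\<phi> ` sphere 0 1 = bdry D"
  using closed_disk_param[OF D] by metis
 then have "homeomorphism S1 (bdry D) \<phi> \<psi>"
  by (intro homeomorphism_of_subsets[OF h(1)]) (auto simp: S1_def bdry_def)
 then show thesis by (rule that)
qed

lemma closed_disk_boundary_loop:
 assumes D: "closed_disk D" and c: "c : bdry D"
 obtains gm where "simple_path gm" "pathstart gm = c" "pathfinish gm = c" "path_image gm = bdry D"
proof -
 obtain \<delta> \<delta>' where h: "homeomorphism S1 (bdry D) \<delta> \<delta>'" by (rule closed_disk_boundary_circle[OF D])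
 then have "\<delta>' c : S1" "\<delta> (\<delta>' c) = c" using c homeomorphism_image2 homeomorphism_apply2 by blast+
 then obtain \<alpha> where "\<delta> (cis (2*pi * \<alpha>)) = c" by (metis S1_eq_cis_unit_angle)
 then show thesis using that circle_loop[OF h, of \<alpha>] by simp
qed

lemma closed_disk_boundary_infinite:
 assumes D: "closed_disk D" shows "infinite (bdry D)"
proof -
 obtain \<delta> \<delta>' where "homeomorphism S1 (bdry D) \<delta> \<delta>'" by (rule closed_disk_boundary_circle[OF D])
 from circle_loop(1,2)[OF this, of 0] show ?thesis
  using simple_loop_image_infinite[of "circle_loop 0 \<delta>" 0 1] by (simp add: path_image_def)
qed

lemma closed_disk_boundary_connected:
 assumes D: "closed_disk D" shows "connected (bdry D)"
proof -
 obtain \<delta> \<delta>' where "homeomorphism S1 (bdry D) \<delta> \<delta>'" by (rule closed_disk_boundary_circle[OF D])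
 from circle_loop(1,2)[OF this, of 0] show ?thesis
  by (metis connected_path_image simple_path_imp_path)
qed

lemma closed_disk_minus_boundary_point_connected:
 assumes D: "closed_disk D" and c: "c : bdry D"
 shows "connected (D - {c})"
proof -
 obtain \<phi> \<psi> where h: "homeomorphism (cball (0::complex) 1) D \<phi> \<psi>"
  using closed_disk_param[OF D] by metis
 have cD: "c : D" using c by (simp add: bdry_def)
 have "connected (cball (0::complex) 1 - {\<psi> c})"
  by (rule connected_punctured_convex) (simp_all add: aff_dim_cball)
 then have "connected (\<phi> ` (cball 0 1 - {\<psi> c}))"
  by (intro connected_continuous_image continuous_on_subset[OF homeomorphism_cont1[OF h]]) auto
 moreover have "\<phi> ` (cball 0 1 - {\<psi> c}) = D - {c}"
 proof -
  have inj: "inj_on \<phi> (cball 0 1)" by (rule homeomorphism_imp_inj_on[OF h])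
  have "\<psi> c : cball 0 1" using homeomorphism_image2[OF h] cD by blast
  then have "\<phi> ` (cball 0 1 - {\<psi> c}) = \<phi> ` cball 0 1 - \<phi> ` {\<psi> c}"
   using inj by (simp add: inj_on_image_set_diff)
  then show ?thesis using homeomorphism_image1[OF h] homeomorphism_apply2[OF h cD] by simp
 qed
 ultimately show ?thesis by simp
qed

lemma theta_inside_step:
 fixes a b c :: "real => complex"
 defines "ab \<equiv> path_image a Un path_image b" and "ac \<equiv> path_image a Un path_image c"
 assumes loop: "simple_path (a +++ reversepath b)" "pathfinish a = pathfinish b" "pathstart a = pathstart b"
  and c_outside: "path_image c - {pathstart a, pathfinish a} <= outside ab"
  and ends: "pathstart c = pathstart a" "pathfinish c = pathfinish a" "path a" "path c" "path b"
  and b0: "b0 : path_image b" "b0 : outside ac" and ou: "ou : inside ab"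
 shows "winding_number (a +++ reversepath c) ou = 0"
proof (rule ccontr)
 assume nonzero: "winding_number (a +++ reversepath c) ou ~= 0"
 have imgs: "path_image (a +++ reversepath b) = ab" "path_image (a +++ reversepath c) = ac"
  using loop ends by (simp_all add: path_image_join ab_def ac_def)
 have inside_ab: "connected (inside ab)" "frontier (inside ab) = ab"
  using Jordan_inside_outside[OF loop(1)] loop by (auto simp: imgs)
 have disjoint: "inside ab Int ac = {}"
 proof -
  have "inside ab Int ab = {}" "inside ab Int outside ab = {}" by simp_all
  moreover have "pathstart a : path_image a" "pathfinish a : path_image a" by auto
  ultimately show ?thesis using c_outside unfolding ab_def ac_def by blast
 qed
 have "ou ~: outside ac"
  using nonzero winding_number_zero_in_outside[of "a +++ reversepath c" ou] imgs ends by auto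
 then have ou_inside: "ou : inside ac" using ou disjoint by (auto simp: inside_outside)
 have "inside ab <= connected_component_set (- ac) ou"
  using inside_ab ou disjoint by (intro connected_component_maximal) auto
 then have "inside ab <= inside ac" using ou_inside inside_same_component by blast
 moreover have "b0 : closure (inside ab)" using inside_ab(2) b0 by (auto simp: frontier_def ab_def)
 ultimately have "b0 : closure (inside ac)" using closure_mono by blast
 moreover have "closure (inside ac) <= inside ac Un ac"
  using closure_inside_subset[of ac] ends by (simp add: ac_def closed_Un closed_path_image Un_commute)
 ultimately show False using b0(2) inside_Int_outside[of ac] outside_no_overlap[of ac] by blast
qed

lemma arc_continuous_image:
 assumes "Path_Connected.arc p" "continuous_on (path_image p) f" "inj_on f (path_image p)"
 shows "Path_Connected.arc (f \<circ> p)"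
 using assms by (auto simp: Path_Connected.arc_def path_image_def intro: path_continuous_image comp_inj_on)

lemma arc_has_interior_point:
 fixes d :: "real => 'a::topological_space"
 assumes "Path_Connected.arc d" shows "EX x:path_image d. x ~: {p, q}"
proof -
 have "inj_on d {0..1}" using assms by (simp add: Path_Connected.arc_def)
 then have "infinite (path_image d)" unfolding path_image_def
  using finite_imageD[of d "{0..1}"] infinite_Icc[of 0 "1::real"] by auto
 then show ?thesis by (metis finite.emptyI finite.insertI finite_subset subsetI)
qed

text \<open>In a theta graph in the plane one of the three arcs lies inside the circle of the other two,
  because the winding numbers of the three circles add up to zero.\<close>

lemma no_theta_all_outside:
 fixes a b c :: "real => complex"
 assumes arcs: "Path_Connected.arc a" "Path_Connected.arc b" "Path_Connected.arc c"
  and ends: "pathstart a = p" "pathfinish a = q" "pathstart b = p" "pathfinish b = q" "pathstart c = p" "pathfinish c = q"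
  and meet: "path_image a Int path_image b <= {p, q}" "path_image a Int path_image c <= {p, q}" "path_image b Int path_image c <= {p, q}"
  and aout: "path_image a - {p, q} <= outside (path_image b Un path_image c)"
  and bout: "path_image b - {p, q} <= outside (path_image a Un path_image c)"
  and cout: "path_image c - {p, q} <= outside (path_image a Un path_image b)"
 shows False
proof -
 have pa: "path a" "path b" "path c" using arcs arc_imp_path by auto
 have loop_ab: "simple_path (a +++ reversepath b)"
  by (rule simple_path_join_loop) (use arcs ends meet in \<open>auto intro: arc_reversepath\<close>)
 have loop_ba: "simple_path (b +++ reversepath a)"
  by (rule simple_path_join_loop) (use arcs ends meet in \<open>auto intro: arc_reversepath\<close>)
 obtain a0 where a0: "a0 : path_image a" "a0 ~: {p, q}" using arc_has_interior_point arcs by blast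
 obtain b0 where b0: "b0 : path_image b" "b0 ~: {p, q}" using arc_has_interior_point arcs by blast
 have pim: "path_image (a +++ reversepath b) = path_image a Un path_image b"
  using ends by (simp add: path_image_join)
 have "inside (path_image a Un path_image b) ~= {}"
  using Jordan_inside_outside[OF loop_ab] ends by (auto simp: pim)
 then obtain ou where ou: "ou : inside (path_image a Un path_image b)" by blast
 have oab: "ou ~: path_image a" "ou ~: path_image b"
  using ou inside_no_overlap[of "path_image a Un path_image b"] by blast+
 have oc: "ou ~: path_image c"
 proof
  assume "ou : path_image c"
  moreover have "ou ~: {p, q}" using oab ends by (metis insert_iff pathfinish_in_path_image pathstart_in_path_image singletonD)
  ultimately have "ou : outside (path_image a Un path_image b)" using cout by blast
  then show False using ou inside_Int_outside by blast
 qed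
 have wa: "winding_number (a +++ reversepath c) ou = 0"
  by (rule theta_inside_step[of a b c b0]) (use loop_ab pa ends cout b0 bout ou in auto)
 have wb: "winding_number (b +++ reversepath c) ou = 0"
  by (rule theta_inside_step[of b a c a0]) (use loop_ba pa ends cout a0 aout ou in \<open>auto simp: Un_commute\<close>)
 have "winding_number a ou - winding_number c ou = 0" "winding_number b ou - winding_number c ou = 0"
  using wa wb pa oab oc ends by (simp_all add: winding_number_join winding_number_reversepath)
 then have "winding_number (a +++ reversepath b) ou = 0"
  using pa oab ends by (simp add: winding_number_join winding_number_reversepath)
 moreover have "norm (winding_number (a +++ reversepath b) ou) = 1"
  using simple_closed_path_norm_winding_number_inside[OF loop_ab] ou pim by simp
 ultimately show False by simp
qed

lemma closed_disk_chord:
 assumes D: "closed_disk D" and t: "t1 : bdry D" "t2 : bdry D" "t1 ~= t2"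
 obtains af where "Path_Connected.arc af" "pathstart af = t1" "pathfinish af = t2"
  "path_image af <= (D - bdry D) Un {t1, t2}"
proof -
 obtain \<phi> \<psi> where h: "homeomorphism (cball (0::complex) 1) D \<phi> \<psi>"
  "\<phi> ` sphere 0 1 = bdry D" "\<phi> ` ball 0 1 = D - bdry D"
  using closed_disk_param[OF D] by metis
 obtain x y where xy: "x : sphere 0 1" "y : sphere 0 1" "t1 = \<phi> x" "t2 = \<phi> y"
  using t unfolding h(2)[symmetric] by blast
 have "x ~= y" using xy t by auto
 have seg: "closed_segment x y <= cball 0 1"
  using xy by (intro closed_segment_subset) auto
 have "Path_Connected.arc (\<phi> \<circ> linepath x y)"
  by (intro arc_continuous_image arc_linepath \<open>x ~= y\<close> continuous_on_subset[OF homeomorphism_cont1[OF h(1)]]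
    inj_on_subset[OF homeomorphism_imp_inj_on[OF h(1)]]) (use seg in auto)
 moreover have "path_image (\<phi> \<circ> linepath x y) <= (D - bdry D) Un {t1, t2}"
 proof -
  have "open_segment x y <= ball 0 1"
  proof
   fix z assume "z : open_segment x y"
   then have "dist 0 z < dist 0 x | dist 0 z < dist 0 y" by (rule dist_decreases_open_segment)
   then show "z : ball 0 1" using xy by auto
  qed
  then have "closed_segment x y <= ball 0 1 Un {x, y}" by (auto simp: open_segment_def)
  then have "\<phi> ` closed_segment x y <= \<phi> ` ball 0 1 Un {t1, t2}" using xy by blast
  then show ?thesis by (simp add: path_image_compose h)
 qed
 ultimately show thesis using that xy by (simp add: pathstart_compose pathfinish_compose)
qed

lemma closed_disk_interior_unbounded_from_boundary_point:
 assumes s: "homeomorphism (S2 - {N}) (UNIV::complex set) sg tu" and X: "closed_disk X" "N : bdry X"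
 shows "~ bounded (sg ` (X - bdry X))"
proof
 assume "bounded (sg ` (X - bdry X))"
 then have "compact (tu ` closure (sg ` (X - bdry X)))"
  by (intro compact_continuous_image continuous_on_subset[OF homeomorphism_cont2[OF s]]) auto
 then have "closed (tu ` closure (sg ` (X - bdry X)))" by (rule compact_imp_closed)
 moreover have "X - bdry X <= tu ` closure (sg ` (X - bdry X))"
 proof
  fix x assume x: "x : X - bdry X"
  then have "x : S2 - {N}" using X by (auto simp: closed_disk_def)
  then have "x = tu (sg x)" by (rule homeomorphism_apply1[OF s, symmetric])
  then show "x : tu ` closure (sg ` (X - bdry X))" using x closure_subset by (metis imageI subsetD)
 qed
 ultimately have "closure (X - bdry X) <= tu ` closure (sg ` (X - bdry X))" by (rule closure_minimal[rotated])
 moreover have "N ~: range tu" using homeomorphism_image2[OF s] by auto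
 ultimately show False using closed_disk_boundary_subset_closure[OF X(1)] X(2) by blast
qed

lemma closed_disk_chord_image:
 assumes s: "homeomorphism (S2 - {t3}) (UNIV::complex set) sg tu"
  and X: "closed_disk X" "{t1, t2, t3} <= bdry X" and t: "t1 ~= t2" "t1 ~= t3" "t2 ~= t3"
 obtains af where "Path_Connected.arc af" "pathstart af = sg t1" "pathfinish af = sg t2"
  "path_image af <= sg ` (X - bdry X) Un {sg t1, sg t2}"
proof -
 obtain af where af: "Path_Connected.arc af" "pathstart af = t1" "pathfinish af = t2"
  "path_image af <= (X - bdry X) Un {t1, t2}"
  using closed_disk_chord[OF X(1), of t1 t2] X t by auto
 moreover have "X <= S2" "bdry X <= X" using X(1) by (auto simp: closed_disk_def bdry_def)
 ultimately have "path_image af <= S2 - {t3}" using X(2) t by blast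
 then have "Path_Connected.arc (sg \<circ> af)"
  by (intro arc_continuous_image af continuous_on_subset[OF homeomorphism_cont1[OF s]] inj_on_subset[OF homeomorphism_imp_inj_on[OF s]])
 then show thesis using af by (intro that[of "sg \<circ> af"]) (auto simp: path_image_compose pathstart_compose pathfinish_compose)
qed

lemma three_disks_at_most_two_points:
 assumes D: "closed_disk A" "closed_disk B" "closed_disk C"
  and dis: "(A - bdry A) Int (B Un C) = {}" "(B - bdry B) Int (A Un C) = {}" "(C - bdry C) Int (A Un B) = {}"
  and t: "{t1, t2, t3} <= A Int B Int C" "t1 ~= t2" "t1 ~= t3" "t2 ~= t3"
 shows False
proof -
 have tb: "{t1, t2, t3} <= bdry A" "{t1, t2, t3} <= bdry B" "{t1, t2, t3} <= bdry C"
  using t dis by blast+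
 have "t3 : S2" using t D by (auto simp: closed_disk_def)
 then obtain sg tu where s: "homeomorphism (S2 - {t3}) (UNIV::complex set) sg tu"
  using punctured_S2_homeomorphism by blast
 have inj: "inj_on sg (S2 - {t3})" by (rule homeomorphism_imp_inj_on[OF s])
 define face where "face X = sg ` (X - bdry X)" for X
 have XS: "X - bdry X <= S2 - {t3}" if "closed_disk X" "{t1, t2, t3} <= bdry X" for X
  using that by (auto simp: closed_disk_def)
 have tS: "{t1, t2} <= S2 - {t3}" using D tb t by (auto simp: closed_disk_def bdry_def)
 have face_outside: "face X <= outside S"
  if X: "closed_disk X" "{t1, t2, t3} <= bdry X" and "face X Int S = {}" for X S
 proof (rule connected_unbounded_subset_outside)
  show "connected (face X)" unfolding face_def
   by (intro connected_continuous_image closed_disk_interior_connected X continuous_on_subset[OF homeomorphism_cont1[OF s]] XS)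
  show "~ bounded (face X)" unfolding face_def
   by (rule closed_disk_interior_unbounded_from_boundary_point[OF s]) (use X in auto)
 qed fact
 obtain a where a: "Path_Connected.arc a" "pathstart a = sg t1" "pathfinish a = sg t2"
   "path_image a <= face A Un {sg t1, sg t2}"
  by (rule closed_disk_chord_image[OF s D(1) tb(1) t(2-4), folded face_def], rule that)
 obtain b where b: "Path_Connected.arc b" "pathstart b = sg t1" "pathfinish b = sg t2"
   "path_image b <= face B Un {sg t1, sg t2}"
  by (rule closed_disk_chord_image[OF s D(2) tb(2) t(2-4), folded face_def], rule that)
 obtain c where c: "Path_Connected.arc c" "pathstart c = sg t1" "pathfinish c = sg t2"
   "path_image c <= face C Un {sg t1, sg t2}"
  by (rule closed_disk_chord_image[OF s D(3) tb(3) t(2-4), folded face_def], rule that)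
 have disjoint: "sg ` X Int sg ` Y = {}" if "X Int Y = {}" "X <= S2 - {t3}" "Y <= S2 - {t3}" for X Y
  using inj_on_image_Int[OF inj that(2,3)] that(1) by simp
 have faces: "face A Int face B = {}" "face A Int face C = {}" "face B Int face C = {}"
   "face A Int sg ` {t1, t2} = {}" "face B Int sg ` {t1, t2} = {}" "face C Int sg ` {t1, t2} = {}"
  unfolding face_def using dis tb by (intro disjoint XS[OF D(1)] XS[OF D(2)] XS[OF D(3)] tS; blast)+
 note images = a(4) b(4) c(4)
 show False
 proof (rule no_theta_all_outside[OF a(1) b(1) c(1) a(2,3) b(2,3) c(2,3)])
  show "path_image a Int path_image b <= {sg t1, sg t2}" "path_image a Int path_image c <= {sg t1, sg t2}"
   "path_image b Int path_image c <= {sg t1, sg t2}"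
   using images faces by blast+
  have "face A <= outside (path_image b Un path_image c)" "face B <= outside (path_image a Un path_image c)"
   "face C <= outside (path_image a Un path_image b)"
   using images faces by (intro face_outside D tb; auto)+
  then show "path_image a - {sg t1, sg t2} <= outside (path_image b Un path_image c)"
   "path_image b - {sg t1, sg t2} <= outside (path_image a Un path_image c)"
   "path_image c - {sg t1, sg t2} <= outside (path_image a Un path_image b)"
   using images by blast+
 qed
qed

lemma sphere_Janiszewski_dual:
 assumes A: "compact A" "connected A" "A <= S2" and B: "compact B" "connected B" "B <= S2"
  and N: "N : S2" "N ~: A Un B" and con: "connected (S2 - (A Un B) - {N})"
 shows "connected (A Int B)"
proof -
 obtain sg tu where s: "homeomorphism (S2 - {N}) (UNIV::complex set) sg tu"
  using punctured_S2_homeomorphism N by blast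
 have inj: "inj_on sg (S2 - {N})" by (rule homeomorphism_imp_inj_on[OF s])
 have sub: "A <= S2 - {N}" "B <= S2 - {N}" using A B N by auto
 have cs: "continuous_on X sg" if "X <= S2 - {N}" for X
  using that continuous_on_subset[OF homeomorphism_cont1[OF s]] by blast
 have "- (sg ` A Un sg ` B) = sg ` (S2 - (A Un B) - {N})"
 proof -
  have "sg ` (S2 - {N} - (A Un B)) = sg ` (S2 - {N}) - sg ` (A Un B)"
   by (rule inj_on_image_set_diff[OF inj]) (use sub in auto)
  moreover have "S2 - {N} - (A Un B) = S2 - (A Un B) - {N}" by auto
  ultimately show ?thesis using homeomorphism_image1[OF s] by (auto simp: image_Un)
 qed
 moreover have "connected (sg ` (S2 - (A Un B) - {N}))"
  by (intro connected_continuous_image con cs) auto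
 ultimately have "connected (- (sg ` A Un sg ` B))" by simp
 then have "connected (sg ` A Int sg ` B)"
  by (intro Janiszewski_dual compact_continuous_image connected_continuous_image A B cs sub)
 moreover have "sg ` A Int sg ` B = sg ` (A Int B)" using inj_on_image_Int[OF inj sub] by simp
 ultimately have "connected (sg ` (A Int B))" by simp
 then have "connected (tu ` (sg ` (A Int B)))"
  by (rule connected_continuous_image[rotated]) (rule continuous_on_subset[OF homeomorphism_cont2[OF s]], simp)
 moreover have "tu ` sg ` (A Int B) = A Int B"
 proof -
  have "tu (sg x) = x" if "x : A Int B" for x using homeomorphism_apply1[OF s, of x] sub that by blast
  then show ?thesis by (simp add: image_image)
 qed
 ultimately show ?thesis by simp
qed

subsection \<open>Wheels on the line\<close>

text \<open>A CaTherine wheel precomposed with the universal covering of the circle; intervals of the circle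
  are images of intervals \<open>{s..t}\<close> with \<open>s < t < s + 2 * pi\<close>.\<close>

locale wheel =
 fixes F :: "real => real^3"
 assumes cont: "continuous_on UNIV F"
  and per: "F (t+2*pi) = F t"
  and surj: "range F = S2"
  and disk: "s < t ==> t < s+2*pi ==> closed_disk (F ` {s..t})"
  and ends: "s < t ==> t < s+2*pi ==> F s : bdry (F ` {s..t}) & F t : bdry (F ` {s..t})"
begin

lemma per_int: "F (t+2*pi * of_int k) = F t" using per by (rule periodic_shift_int)

lemma per_minus: "F (t - 2*pi) = F t" using per[of "t - 2*pi"] by simp

lemma cont_on: "continuous_on A F" using cont continuous_on_subset by blast

lemma F_in: "F t : S2" using surj by auto

lemma shift_image: "F ` {s+2*pi..t+2*pi} = F ` {s..t}"
proof -
 have "{s+2*pi..t+2*pi} = (%x. x+2*pi) ` {s..t}" by simp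
 then show ?thesis by (simp only: image_image per)
qed

lemma compact_im: "compact (F ` {s..t})" by (intro compact_continuous_image cont_on) simp

lemma closed_im: "closed (F ` {s..t})" using compact_im by (rule compact_imp_closed)

lemma connected_im: "connected (F ` {s..t})" by (intro connected_continuous_image cont_on) simp

lemma full_image: "F ` {s..s+2*pi} = S2"
proof
 show "S2 <= F ` {s..s+2*pi}"
 proof
  fix y assume "y : S2"
  then obtain x where x: "y = F x" using surj by auto
  obtain k where k: "s <= x+2*pi * of_int k" "x+2*pi * of_int k < s+2*pi" using real_period_representative by blast
  have "y = F (x+2*pi * of_int k)" using per_int x by simp
  then show "y : F ` {s..s+2*pi}" using k by auto
 qed
qed (use F_in in auto)

lemma image_split: "s <= t ==> t <= u ==> F ` {s..u} = F ` {s..t} Un F ` {t..u}"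
 by (metis image_Un ivl_disj_un_two_touch(4))

lemma bdry_eq:
 assumes "s < t" "t < s+2*pi"
 shows "bdry (F ` {s..t}) = F ` {s..t} Int F ` {t..s+2*pi}"
proof
 have cov: "F ` {s..t} Un F ` {t..s+2*pi} = S2" using image_split[of s t "s+2*pi"] full_image assms by simp
 have "closure (S2 - F ` {s..t}) <= F ` {t..s+2*pi}"
  by (rule closure_minimal) (use cov compact_imp_closed[OF compact_im] in auto)
 then show "bdry (F ` {s..t}) <= F ` {s..t} Int F ` {t..s+2*pi}" by (auto simp: bdry_def)
 show "F ` {s..t} Int F ` {t..s+2*pi} <= bdry (F ` {s..t})"
 proof
  fix y assume y: "y : F ` {s..t} Int F ` {t..s+2*pi}"
  then obtain x where x: "t <= x" "x <= s+2*pi" "y = F x" by auto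
  consider (left) "x = t" | (right) "x = s+2*pi" | (inside) "t < x" "x < s+2*pi" using x by linarith
  then show "y : bdry (F ` {s..t})"
  proof cases
   case left then show ?thesis using ends assms x by blast
  next
   case right then show ?thesis using ends assms x per by metis
  next
   case inside
   then have "F x : bdry (F ` {s..x})" using ends[of s x] assms by simp
   then have "F x : closure (S2 - F ` {s..x})" by (simp add: bdry_def)
   moreover have "closure (S2 - F ` {s..x}) <= closure (S2 - F ` {s..t})"
    by (intro closure_mono Diff_mono image_mono) (use inside in auto)
   ultimately show ?thesis using y x by (auto simp: bdry_def)
  qed
 qed
qed

lemma interior_eq:
 assumes "s < t" "t < s+2*pi"
 shows "F ` {s..t} - bdry (F ` {s..t}) = S2 - F ` {t..s+2*pi}"
proof -
 have "F ` {s..t} Un F ` {t..s+2*pi} = S2" using image_split[of s t "s+2*pi"] full_image assms by simp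
 then show ?thesis unfolding bdry_eq[OF assms] by auto
qed

lemma complement_eq:
 assumes "s < t" "t < s+2*pi"
 shows "F ` {t..s+2*pi} - bdry (F ` {t..s+2*pi}) = S2 - F ` {s..t}"
 using interior_eq[of t "s+2*pi"] shift_image[of s t] assms by simp

lemma connected_Int_consecutive:
 assumes "s < t" "t < u" "u < s+2*pi"
 shows "connected (F ` {s..t} Int F ` {t..u})"
proof -
 have un: "F ` {s..t} Un F ` {t..u} = F ` {s..u}" using image_split[of s t u] assms by simp
 have eq: "F ` {u..s+2*pi} - bdry (F ` {u..s+2*pi}) = S2 - F ` {s..u}" using complement_eq assms by simp
 have d: "closed_disk (F ` {u..s+2*pi})" using disk assms by simp
 obtain N where N: "N : S2 - F ` {s..u}" using closed_disk_interior_nonempty[OF d] unfolding eq by blast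
 have con: "connected (S2 - F ` {s..u} - {N})" using closed_disk_interior_connected_punctured[OF d] unfolding eq by blast
 show ?thesis
  by (rule sphere_Janiszewski_dual[of _ _ N])
    (use N con F_in compact_im connected_im in \<open>auto simp: un simp del: image_Un\<close>)
qed

lemma triple_at_most_two:
 assumes "s < t" "t < u" "u < s+2*pi"
  and "{t1, t2, t3} <= F ` {s..t} Int F ` {t..u} Int F ` {u..s+2*pi}" "t1 ~= t2" "t1 ~= t3"
 shows "t2 = t3"
proof (rule ccontr)
 assume "t2 ~= t3"
 have i1: "F ` {s..t} - bdry (F ` {s..t}) = S2 - (F ` {t..u} Un F ` {u..s+2*pi})"
  using interior_eq[of s t] image_split[of t u "s+2*pi"] assms by simp
 have i2: "F ` {t..u} - bdry (F ` {t..u}) = S2 - (F ` {u..s+2*pi} Un F ` {s..t})"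
  using interior_eq[of t u] image_split[of u "s+2*pi" "t+2*pi"] shift_image[of s t] assms by simp
 have i3: "F ` {u..s+2*pi} - bdry (F ` {u..s+2*pi}) = S2 - (F ` {s..t} Un F ` {t..u})"
  using complement_eq[of s u] image_split[of s t u] assms by simp
 show False
  by (rule three_disks_at_most_two_points[of "F ` {s..t}" "F ` {t..u}" "F ` {u..s+2*pi}" t1 t2 t3])
    (use assms \<open>t2 ~= t3\<close> disk i1 i2 i3 in auto)
qed


lemma interval_image_infinite: assumes "s < t" shows "infinite (F ` {s..t})"
proof -
 define t' where "t' = min t (s + pi)"
 have t': "s < t'" "t' < s+2*pi" "t' <= t" using assms pi_gt_zero unfolding t'_def by linarith+
 have "infinite (bdry (F ` {s..t'}))" using closed_disk_boundary_infinite disk t' by blast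
 moreover have "bdry (F ` {s..t'}) <= F ` {s..t}" using t' by (auto simp: bdry_def)
 ultimately show ?thesis using finite_subset by blast
qed


lemma interval_image_not_subset_finite:
 assumes "s < t" "finite A" shows "EX x. s < x & x < t & F x ~: A"
proof (rule ccontr)
 assume "~ ?thesis"
 then have "F ` {(2 * s + t) / 3..(s+2 * t) / 3} <= A" using assms(1) by force
 then show False using interval_image_infinite[of "(2 * s + t) / 3" "(s+2 * t) / 3"] assms finite_subset by auto
qed

lemma endpoint_mem: "s <= t ==> F s : F ` {s..t}" "s <= t ==> F t : F ` {s..t}"
 by auto

lemma disk_boundary_point:
 assumes "s < t" "t < s+2*pi" obtains z where "z : bdry (F ` {s..t})" "z ~= c"
 using closed_disk_boundary_infinite[OF disk[OF assms]] by (metis finite.emptyI finite_insert finite_subset insertCI subsetI)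

lemma consecutive_Int_nontrivial:
 assumes "s < t" "t < u" "u < s+2*pi" and c: "F t : bdry (F ` {s..u})"
 shows "EX z:F ` {s..t} Int F ` {t..u}. z ~= F t"
proof (rule ccontr)
 assume "~ ?thesis"
 then have dis: "F ` {s..t} Int F ` {t..u} Int (F ` {s..u} - {F t}) = {}" by blast
 have un: "F ` {s..u} = F ` {s..t} Un F ` {t..u}" using image_split[of s t u] assms by simp
 have "connected (F ` {s..u} - {F t})"
  using closed_disk_minus_boundary_point_connected[OF disk c] assms by simp
 then have "F ` {s..t} Int (F ` {s..u} - {F t}) = {} | F ` {t..u} Int (F ` {s..u} - {F t}) = {}"
  by (rule connected_closedD[OF _ dis]) (use un closed_im in auto)
 then have "F ` {s..t} <= {F t} | F ` {t..u} <= {F t}" using un by blast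
 then show False using interval_image_infinite[of s t] interval_image_infinite[of t u] assms finite_subset by blast
qed

lemma boundary_cover:
 assumes "s < t" "t < u" "u < s+2*pi"
 shows "bdry (F ` {s..t}) = (F ` {s..t} Int F ` {t..u}) Un (F ` {s..t} Int F ` {u..s+2*pi})"
 using bdry_eq[of s t] image_split[of t u "s+2*pi"] assms by auto

lemma connected_Int_consecutive':
 assumes "s < t" "t < u" "u < s+2*pi"
 shows "connected (F ` {s..t} Int F ` {u..s+2*pi})"
 using connected_Int_consecutive[of u "s+2*pi" "t+2*pi"] shift_image[of s t] assms by (simp add: Int_commute)

lemma third_point:
 assumes q: "q1 < q2" "q2 < q3" "q3 < q1+2*pi" and c: "F q1 = c" "F q2 = c" "F q3 = c"
 shows "EX d. d ~= c & d : F ` {q1..q2} & d : F ` {q2..q3} & d : F ` {q3..q1+2*pi}"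
proof -
 have d: "closed_disk (F ` {q1..q2})" using disk q by simp
 have cb: "c : bdry (F ` {q1..q2})" using ends[of q1 q2] q c by simp
 obtain gm where g: "simple_path gm" "pathstart gm = c" "pathfinish gm = c" "path_image gm = bdry (F ` {q1..q2})"
  using closed_disk_boundary_loop[OF d cb] by blast
 have in_tiles: "c : F ` {q1..q2}" "c : F ` {q2..q3}" "c : F ` {q3..q1+2*pi}"
  using endpoint_mem(1)[of q1 q2] endpoint_mem(1)[of q2 q3] endpoint_mem(1)[of q3 "q1+2*pi"] q c by auto
 have meets_next: "EX z:F ` {q1..q2} Int F ` {q2..q3}. z ~= c"
  using consecutive_Int_nontrivial[of q1 q2 q3] ends[of q1 q3] q c by simp
 have "EX z:F ` {q3..q1+2*pi} Int F ` {q1+2*pi..q2+2*pi}. z ~= F (q1+2*pi)"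
  by (rule consecutive_Int_nontrivial) (use ends[of q3 "q2+2*pi"] q c per in auto)
 then have meets_last: "EX z:F ` {q1..q2} Int F ` {q3..q1+2*pi}. z ~= c" using shift_image per c by auto
 have "EX d. d ~= c & d : (F ` {q1..q2} Int F ` {q2..q3}) Int (F ` {q1..q2} Int F ` {q3..q1+2*pi})"
 proof (rule simple_loop_cover_meets_twice[OF g(1-3)])
  show "closed (F ` {q1..q2} Int F ` {q2..q3})" "closed (F ` {q1..q2} Int F ` {q3..q1+2*pi})"
   by (auto intro: closed_Int closed_im)
  show "connected (F ` {q1..q2} Int F ` {q2..q3})" using connected_Int_consecutive q by simp
  show "connected (F ` {q1..q2} Int F ` {q3..q1+2*pi})" using connected_Int_consecutive' q by simp
  show "F ` {q1..q2} Int F ` {q2..q3} Un F ` {q1..q2} Int F ` {q3..q1+2*pi} = path_image gm"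
   using boundary_cover[of q1 q2 q3] g q by simp
 qed (use meets_next meets_last in_tiles in auto)
 then show ?thesis by blast
qed

lemma triple_subset_pair:
 assumes "s < t" "t < u" "u < s+2*pi" and c: "c : F ` {s..t} Int F ` {t..u} Int F ` {u..s+2*pi}"
 obtains d where "F ` {s..t} Int F ` {t..u} Int F ` {u..s+2*pi} <= {c, d}"
proof (cases "EX d. d ~= c & d : F ` {s..t} Int F ` {t..u} Int F ` {u..s+2*pi}")
 case True
 then obtain d where d: "d ~= c" "d : F ` {s..t} Int F ` {t..u} Int F ` {u..s+2*pi}" by blast
 have "x = d" if "x : F ` {s..t} Int F ` {t..u} Int F ` {u..s+2*pi}" "x ~= c" for x
  using triple_at_most_two[OF assms(1-3), of c x d] that d c by blast
 then show thesis using that[of d] by blast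
next
 case False
 then show thesis using that[of c] by blast
qed

text \<open>The configuration excluded here is a planar \<open>K\<^sub>5\<close> on \<open>c\<close> and the four disks.\<close>

lemma unlinked:
 assumes q: "q1 < q2" "q2 < q3" "q3 < q4" "q4 < q1+2*pi"
  and c: "F q1 = c" "F q2 = c" "F q3 = c" "F q4 = c"
  and z: "z : F ` {q1..q2}" "z : F ` {q3..q4}" "z ~= c"
  and w: "w : F ` {q2..q3}" "w : F ` {q4..q1+2*pi}" "w ~= c"
 shows "z = w"
proof -
 define E1 E2 E3 E4 E12 E34 where "E1 = F ` {q1..q2}" and "E2 = F ` {q2..q3}" and "E3 = F ` {q3..q4}"
  and "E4 = F ` {q4..q1+2*pi}" and "E12 = F ` {q1..q3}" and "E34 = F ` {q3..q1+2*pi}"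
 note E = E1_def E2_def E3_def E4_def E12_def E34_def
 have unions: "E12 = E1 Un E2" "E34 = E3 Un E4"
  unfolding E using image_split[of q1 q2 q3] image_split[of q3 q4 "q1+2*pi"] q by auto
 have cl: "closed E1" "closed E2" "closed E3" "closed E4" "closed E12" "closed E34"
  unfolding E by (rule closed_im)+
 have c_in: "c : E1" "c : E2" "c : E3" "c : E4"
  using endpoint_mem(1)[of q1 q2] endpoint_mem(1)[of q2 q3] endpoint_mem(1)[of q3 q4] endpoint_mem(1)[of q4 "q1+2*pi"] q c
  unfolding E by auto
 have "closed_disk E12" "c : bdry E12" unfolding E using disk[of q1 q3] ends[of q1 q3] q c by simp_all
 then obtain gm where g: "simple_path gm" "pathstart gm = c" "pathfinish gm = c" "path_image gm = bdry E12"
  using closed_disk_boundary_loop by blast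
 have image: "path_image gm = E12 Int E34" unfolding g(4) unfolding E using bdry_eq q by simp
 have lt: "q3 < q1+2*pi" "q1+2*pi < q3+2*pi" using q by auto
 have "c : F ` {q1..q2} Int F ` {q2..q3} Int F ` {q3..q1+2*pi}" using c_in unions unfolding E by blast
 then obtain d where d: "E1 Int E2 Int E34 <= {c, d}"
  using triple_subset_pair[OF q(1,2) lt(1)] unfolding E by blast
 have "c : F ` {q3..q4} Int F ` {q4..q1+2*pi} Int F ` {q1+2*pi..q3+2*pi}"
  using c_in unions shift_image[of q1 q3] unfolding E by blast
 then obtain d' where d': "E3 Int E4 Int E12 <= {c, d'}"
  using triple_subset_pair[OF q(3,4) lt(2)] shift_image[of q1 q3] unfolding E by metis
 have con: "connected (E1 Int E34)" "connected (E2 Int E34)" "connected (E2 Int E3)"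
  unfolding E using connected_Int_consecutive' connected_Int_consecutive q by simp_all
 have con_shifted: "connected (E3 Int E12)" "connected (E4 Int E12)" "connected (E1 Int E4)"
  using connected_Int_consecutive'[of q3 q4 "q1+2*pi"] connected_Int_consecutive[of q4 "q1+2*pi" "q3+2*pi"]
   connected_Int_consecutive[of q4 "q1+2*pi" "q2+2*pi"] shift_image[of q1 q3] shift_image[of q1 q2] q
  unfolding E by (simp_all add: Int_commute)
 have meets: "(E2 Int E34) Int (E3 Int E12) = E2 Int E3" "(E1 Int E34) Int (E4 Int E12) = E1 Int E4"
  using unions by auto
 have zw: "z : E1" "z : E3" "w : E2" "w : E4" using z w unfolding E by auto
 show ?thesis
 proof (rule simple_loop_two_divisions[OF g(1-3), of "E1 Int E34" "E2 Int E34" "E3 Int E12" "E4 Int E12" d d'])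
  show "E1 Int E34 Un E2 Int E34 = path_image gm" "E3 Int E12 Un E4 Int E12 = path_image gm"
   using image unions by blast+
  show "E1 Int E34 Int (E2 Int E34) <= {c, d}" "E3 Int E12 Int (E4 Int E12) <= {c, d'}" using d d' by blast+
  show "connected (E2 Int E34 Int (E3 Int E12))" "connected (E1 Int E34 Int (E4 Int E12))" unfolding meets by fact+
 qed (use cl con con_shifted c_in unions zw z(3) w(3) in \<open>auto intro: closed_Int\<close>)
qed

end

subsection \<open>Degrees of maps without fixed points\<close>

definition unit_nsphere :: "nat => (nat => real) set" where
 "unit_nsphere n = {x. (\<Sum>i\<le>n. x i ^ 2) = 1 & (ALL i>n. x i = 0)}"

lemma nsphere_eq: "nsphere n = top_of_set (unit_nsphere n)"
 by (simp add: nsphere unit_nsphere_def euclidean_product_topology)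

lemma continuous_map_nsphere_iff: "continuous_map (nsphere n) (nsphere n) f \<longleftrightarrow> continuous_on (unit_nsphere n) f & f ` unit_nsphere n <= unit_nsphere n"
 unfolding nsphere_eq using continuous_map_subtopology_eu[of "unit_nsphere n" "unit_nsphere n" f] by auto

lemma no_fixpoint_homotopic_uminus:
 fixes f :: "'a::real_normed_vector => 'a"
 assumes f: "continuous_on (sphere 0 1) f" "f ` sphere 0 1 <= sphere 0 1" and nofix: "!!x. x : sphere 0 1 ==> f x ~= x"
 shows "homotopic_with_canon (%_. True) (sphere 0 1) (sphere 0 1) f uminus"
proof -
 define k where "k = (%(t::real, x). (1 - t) *\<^sub>R f x - t *\<^sub>R x)"
 have k_nonzero: "k (t, x) ~= 0" if "t : {0..1}" "x : sphere 0 1" for t x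
 proof
  assume "k (t, x) = 0"
  then have balance: "(1 - t) *\<^sub>R f x = t *\<^sub>R x" by (simp add: k_def)
  have "f x : sphere 0 1" using that f(2) by blast
  then have "norm (f x) = 1" "norm x = 1" using that by auto
  then have "\<bar>1 - t\<bar> = \<bar>t\<bar>" using arg_cong[OF balance, of norm] by simp
  then have half: "t = 1/2" using that by auto
  have "(1/2) *\<^sub>R f x = (1/2::real) *\<^sub>R x" using balance unfolding half by simp
  then have "f x = x" by simp
  then show False using nofix that by blast
 qed
 have cont_f: "continuous_on ({0..1} \<times> sphere 0 1) (%p. f (snd p))"
  by (rule continuous_on_compose2[OF f(1)]) (auto intro: continuous_intros)
 have cont_k: "continuous_on ({0..1} \<times> sphere 0 1) k"
  unfolding k_def case_prod_unfold by (intro continuous_intros cont_f)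
 show ?thesis
 proof (subst homotopic_with, simp, intro exI[of _ "%p. k p /\<^sub>R norm (k p)"] conjI ballI allI)
  have "continuous_on ({0..1} \<times> sphere 0 1) (%p. k p /\<^sub>R norm (k p))"
   by (intro continuous_intros cont_k) (use k_nonzero in auto)
  moreover have "k p /\<^sub>R norm (k p) : sphere 0 1" if "p : {0..1} \<times> sphere 0 1" for p
   using k_nonzero[of "fst p" "snd p"] that by auto
  ultimately show "continuous_map (prod_topology (top_of_set {0..1}) (top_of_set (sphere 0 1))) (top_of_set (sphere 0 1)) (%p. k p /\<^sub>R norm (k p))"
   by (simp add: prod_topology_subtopology_eu continuous_map_subtopology_eu Pi_iff)
  show "k (0, x) /\<^sub>R norm (k (0, x)) = f x" if "x : topspace (top_of_set (sphere 0 1))" for x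
  proof -
   have "x : sphere 0 1" using that by simp
   then have "f x : sphere 0 1" using f(2) by blast
   then have "norm (f x) = 1" by simp
   then show ?thesis by (simp add: k_def)
  qed
  show "k (1, x) /\<^sub>R norm (k (1, x)) = - x" if "x : topspace (top_of_set (sphere 0 1))" for x
   using that by (simp add: k_def)
 qed auto
qed

lemma degree_no_fixpoint:
 fixes e :: "'a::real_normed_vector => nat => real"
 assumes e: "continuous_on (sphere 0 1) e" "e ` sphere 0 1 <= unit_nsphere n" and u: "continuous_on (unit_nsphere n) u" "u ` unit_nsphere n <= sphere 0 1"
  and f: "continuous_on (sphere 0 1) f" "f ` sphere 0 1 <= sphere 0 1" "!!x. x : sphere 0 1 ==> f x ~= x"
 shows "Brouwer_degree2 n (e \<circ> f \<circ> u) = Brouwer_degree2 n (e \<circ> uminus \<circ> u)"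
proof -
 have "homotopic_with (%_. True) (top_of_set (sphere 0 1)) (nsphere n) (e \<circ> f) (e \<circ> uminus)"
  by (rule homotopic_with_compose_continuous_map_left[OF no_fixpoint_homotopic_uminus[OF f]])
   (use e in \<open>auto simp: nsphere_eq continuous_map_subtopology_eu\<close>)
 then have "homotopic_with (%_. True) (nsphere n) (nsphere n) (e \<circ> f \<circ> u) (e \<circ> uminus \<circ> u)"
  by (rule homotopic_with_compose_continuous_map_right)
   (use u in \<open>auto simp: nsphere_eq continuous_map_subtopology_eu\<close>)
 then show ?thesis by (rule Brouwer_degree2_homotopic)
qed

definition coord_reflection :: "nat => (nat => real) => nat => real" where
 "coord_reflection k x i = (if i = k then - x i else x i)"

lemma continuous_map_coord_reflection: "continuous_map (nsphere n) (nsphere n) (coord_reflection k)"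
 unfolding coord_reflection_def by (rule continuous_map_nsphere_reflection)

lemma degree_coord_reflection:
 assumes "k <= n" shows "Brouwer_degree2 n (coord_reflection k) = -1"
proof -
 define s where "s = (%(x::nat=>real) i. x (Transposition.transpose 0 k i))"
 have sN: "s x : unit_nsphere n" if "x : unit_nsphere n" for x
 proof -
  have b: "bij_betw (Transposition.transpose 0 k) {..n} {..n}"
   using assms by (intro bij_betw_byWitness[where f' = "Transposition.transpose 0 k"]) (auto simp: Transposition.transpose_def)
  have "(\<Sum>i\<le>n. (s x i)\<^sup>2) = (\<Sum>i\<le>n. (x i)\<^sup>2)"
   unfolding s_def using sum.reindex_bij_betw[OF b, of "%i. (x i)\<^sup>2"] by simp
  moreover have "s x i = 0" if "i > n" for i
   using \<open>x : unit_nsphere n\<close> that assms by (auto simp: s_def unit_nsphere_def Transposition.transpose_def)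
  ultimately show ?thesis using that by (simp add: unit_nsphere_def)
 qed
 have "continuous_on (unit_nsphere n) s" unfolding s_def
  by (intro continuous_on_coordinatewise_then_product continuous_on_product_coordinates[THEN continuous_on_subset]) auto
 then have cs: "continuous_map (nsphere n) (nsphere n) s"
  using sN by (auto simp: continuous_map_nsphere_iff)
 have ss: "s \<circ> s = id" by (auto simp: s_def fun_eq_iff)
 note reflection = continuous_map_coord_reflection[of n 0]
 have "coord_reflection k = s \<circ> (coord_reflection 0 \<circ> s)"
  by (auto simp: fun_eq_iff s_def coord_reflection_def Transposition.transpose_def)
 then have "Brouwer_degree2 n (coord_reflection k) = Brouwer_degree2 n s * (Brouwer_degree2 n (coord_reflection 0) * Brouwer_degree2 n s)"
  using Brouwer_degree2_compose[OF cs reflection] Brouwer_degree2_compose[OF continuous_map_compose[OF cs reflection] cs] by simp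
 moreover have "Brouwer_degree2 n s * Brouwer_degree2 n s = 1"
  using Brouwer_degree2_compose[OF cs cs] ss by simp
 moreover have "Brouwer_degree2 n (coord_reflection 0) = -1"
  unfolding coord_reflection_def by (rule Brouwer_degree2_reflection)
 ultimately show ?thesis by (simp add: mult.commute mult.left_commute)
qed

lemma emb3_continuous: "continuous_on A emb3" "emb3 ` S2 <= unit_nsphere 2"
proof -
 have "continuous_on A (%v. emb3 v i)" for i
  by (cases "i = 0"; cases "i = 1"; cases "i = 2") (auto simp: emb3_def intro!: continuous_intros)
 then show "continuous_on A emb3" by (intro continuous_on_coordinatewise_then_product)
 show "emb3 ` S2 <= unit_nsphere 2" by (auto simp: unit_nsphere_def emb3_def S2_iff numeral_2_eq_2)
qed

lemma unemb3_continuous: "continuous_on A unemb3" "unemb3 ` unit_nsphere 2 <= S2"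
proof -
 have coords: "unemb3 = (%x. x 0 *\<^sub>R axis 1 1 + x 1 *\<^sub>R axis 2 1 + x 2 *\<^sub>R axis 3 1)"
  by (rule ext) (simp add: unemb3_def vec3_eq_iff axis_def)
 show "continuous_on A unemb3" unfolding coords
  by (intro continuous_intros continuous_on_product_coordinates[THEN continuous_on_subset]) auto
 show "unemb3 ` unit_nsphere 2 <= S2" by (auto simp: unit_nsphere_def unemb3_def S2_iff numeral_2_eq_2)
qed


lemma degree_antipode_S2: "Brouwer_degree2 2 (emb3 \<circ> uminus \<circ> unemb3) = -1"
proof -
 note cr = continuous_map_coord_reflection[of 2]
 have "Brouwer_degree2 2 (emb3 \<circ> uminus \<circ> unemb3)
  = Brouwer_degree2 2 (coord_reflection 0 \<circ> (coord_reflection 1 \<circ> coord_reflection 2))"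
 proof (rule Brouwer_degree2_eq)
  fix x assume "x : topspace (nsphere 2)"
  then have "x i = 0" if "i > 2" for i using that by (simp add: nsphere_eq unit_nsphere_def)
  then show "(emb3 \<circ> uminus \<circ> unemb3) x = (coord_reflection 0 \<circ> (coord_reflection 1 \<circ> coord_reflection 2)) x"
   by (auto simp: fun_eq_iff emb3_def unemb3_def coord_reflection_def)
 qed
 also have "\<dots> = -1"
  using Brouwer_degree2_compose[OF cr[of 2] cr[of 1]] Brouwer_degree2_compose[OF continuous_map_compose[OF cr[of 2] cr[of 1]] cr[of 0]]
  by (simp add: degree_coord_reflection)
 finally show ?thesis .
qed

lemma op_homeo_S2_fixed_point:
 assumes "op_homeo_S2 H" obtains c where "c : S2" "H c = c"
proof (rule ccontr)
 assume no_thesis: "~ thesis"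
 obtain H' where H: "homeomorphism S2 S2 H H'" and "Brouwer_degree2 2 (emb3 \<circ> H \<circ> unemb3) = 1"
  using assms by (auto simp: op_homeo_S2_def)
 moreover have "Brouwer_degree2 2 (emb3 \<circ> H \<circ> unemb3) = Brouwer_degree2 2 (emb3 \<circ> uminus \<circ> unemb3)"
 proof (rule degree_no_fixpoint)
  show "H x ~= x" if "x : sphere 0 1" for x using no_thesis that[folded S2_def] \<open>\<And>c. c : S2 ==> H c = c ==> thesis\<close> by blast
 qed (use H emb3_continuous unemb3_continuous in \<open>auto simp: S2_def[symmetric] homeomorphism_def\<close>)
 ultimately show False by (simp add: degree_antipode_S2)
qed

definition deg1 :: "(complex => complex) => int" where
 "deg1 q = Brouwer_degree2 1 (emb2 \<circ> q \<circ> unemb2)"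

lemma emb2_continuous: "continuous_on A emb2" "emb2 ` S1 <= unit_nsphere 1" "unemb2 (emb2 z) = z"
proof -
 have "continuous_on A (%v. emb2 v i)" for i
  by (cases "i = 0"; cases "i = 1") (auto simp: emb2_def intro!: continuous_intros)
 then show "continuous_on A emb2" by (intro continuous_on_coordinatewise_then_product)
 have "(Re z)\<^sup>2+(Im z)\<^sup>2 = 1" if "norm z = 1" for z
  using that cmod_power2[of z] by simp
 then show "emb2 ` S1 <= unit_nsphere 1" by (auto simp: unit_nsphere_def emb2_def S1_def)
 show "unemb2 (emb2 z) = z" by (simp add: emb2_def unemb2_def)
qed

lemma unemb2_continuous: "continuous_on A unemb2" "unemb2 ` unit_nsphere 1 <= S1"
proof -
 have coords: "unemb2 = (%x. of_real (x 0) + \<i> * of_real (x 1))"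
  by (rule ext) (simp add: unemb2_def complex_eq_iff)
 show "continuous_on A unemb2" unfolding coords
  by (intro continuous_intros continuous_on_product_coordinates[THEN continuous_on_subset]) auto
 show "unemb2 ` unit_nsphere 1 <= S1" by (auto simp: unit_nsphere_def unemb2_def S1_def cmod_def)
qed


lemma deg1_continuous_map:
 assumes "continuous_on S1 q" "q ` S1 <= S1"
 shows "continuous_map (nsphere 1) (nsphere 1) (emb2 \<circ> q \<circ> unemb2)"
 unfolding continuous_map_nsphere_iff
proof
 have "continuous_on (unit_nsphere 1) (q \<circ> unemb2)"
  using unemb2_continuous assms by (intro continuous_on_compose) (auto intro: continuous_on_subset)
 then show "continuous_on (unit_nsphere 1) (emb2 \<circ> q \<circ> unemb2)"
  using emb2_continuous by (metis continuous_on_compose comp_assoc)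
 show "(emb2 \<circ> q \<circ> unemb2) ` unit_nsphere 1 <= unit_nsphere 1"
  using unemb2_continuous(2) emb2_continuous(2) assms(2) by (fastforce simp: image_subset_iff)
qed

lemma deg1_compose:
 assumes "continuous_on S1 q" "q ` S1 <= S1" "continuous_on S1 p" "p ` S1 <= S1"
 shows "deg1 (q \<circ> p) = deg1 q * deg1 p"
proof -
 have "emb2 \<circ> (q \<circ> p) \<circ> unemb2 = (emb2 \<circ> q \<circ> unemb2) \<circ> (emb2 \<circ> p \<circ> unemb2)"
  by (auto simp: fun_eq_iff emb2_continuous)
 then show ?thesis unfolding deg1_def
  using Brouwer_degree2_compose[OF deg1_continuous_map[OF assms(3,4)] deg1_continuous_map[OF assms(1,2)]] by simp
qed

lemma deg1_cong:
 assumes "!!z. z : S1 ==> p z = q z" shows "deg1 p = deg1 q"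
 unfolding deg1_def
proof (rule Brouwer_degree2_eq)
 fix x assume "x : topspace (nsphere 1)"
 then have "unemb2 x : S1" using unemb2_continuous by (auto simp: nsphere_eq)
 then show "(emb2 \<circ> p \<circ> unemb2) x = (emb2 \<circ> q \<circ> unemb2) x" using assms by simp
qed


lemma deg1_reflection: "deg1 cnj = -1" "deg1 uminus = 1" "deg1 id = 1"
proof -
 note cr = continuous_map_coord_reflection[of 1]
 have vanish: "x i = 0" if "x : topspace (nsphere 1)" "i > 1" for x :: "nat => real" and i
  using that by (simp add: nsphere_eq unit_nsphere_def)
 have "deg1 cnj = Brouwer_degree2 1 (coord_reflection 1)" unfolding deg1_def
  by (rule Brouwer_degree2_eq) (use vanish in \<open>auto simp: fun_eq_iff emb2_def unemb2_def coord_reflection_def\<close>)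
 then show "deg1 cnj = -1" by (simp add: degree_coord_reflection)
 have "deg1 uminus = Brouwer_degree2 1 (coord_reflection 0 \<circ> coord_reflection 1)" unfolding deg1_def
  by (rule Brouwer_degree2_eq) (use vanish in \<open>auto simp: fun_eq_iff emb2_def unemb2_def coord_reflection_def\<close>)
 then show "deg1 uminus = 1" using Brouwer_degree2_compose[OF cr[of 1] cr[of 0]] by (simp add: degree_coord_reflection)
 have "deg1 id = Brouwer_degree2 1 id" unfolding deg1_def
  by (rule Brouwer_degree2_eq) (use vanish in \<open>auto simp: fun_eq_iff emb2_def unemb2_def\<close>)
 then show "deg1 id = 1" by simp
qed

lemma deg1_no_fixpoint:
 assumes "continuous_on S1 q" "q ` S1 <= S1" "!!z. z : S1 ==> q z ~= z"
 shows "deg1 q = 1"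
proof -
 have "deg1 q = deg1 uminus" unfolding deg1_def
  by (rule degree_no_fixpoint)
   (use assms emb2_continuous unemb2_continuous in \<open>auto simp: S1_def[symmetric]\<close>)
 then show ?thesis by (simp add: deg1_reflection)
qed

lemma deg1_rotation:
 assumes "w : S1" shows "deg1 (%z. w * z) = 1"
proof (cases "w = 1")
 case True
 then have "deg1 (%z. w * z) = deg1 id" by (intro deg1_cong) simp
 then show ?thesis by (simp add: deg1_reflection)
next
 case False
 show ?thesis by (rule deg1_no_fixpoint) (use assms False in \<open>auto intro!: continuous_intros simp: S1_def norm_mult\<close>)
qed

subsection \<open>Lifting circle homeomorphisms to the line\<close>

lemma increasing_lift_oscillation:
 fixes l :: "real => real"
 assumes l: "strict_mono l" "!!t. l (t+2*pi) = l t+2*pi" shows "l t - t < l s - s+2*pi"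
proof -
 obtain k where k: "s <= t+2*pi * of_int k" "t+2*pi * of_int k < s+2*pi" using real_period_representative by blast
 have "l (t+2*pi * of_int k) < l s+2*pi" using strict_monoD[OF l(1) k(2)] l(2) by simp
 then show ?thesis using k(1) degree_shift_int[of l "2*pi" t k, OF l(2)] by simp
qed

lemma increasing_lift_surj:
 fixes l :: "real => real"
 assumes l: "continuous_on UNIV l" "!!t. l (t+2*pi) = l t+2*pi" shows "surj l"
proof -
 have "EX t. y = l t" for y
 proof -
  obtain k where "l 0 <= y+2*pi * of_int k" "y+2*pi * of_int k < l 0+2*pi" using real_period_representative by blast
  then obtain t where "l t = y+2*pi * of_int k"
   using IVT'[of l 0 "y+2*pi * of_int k" "2*pi"] l(2)[of 0] continuous_on_subset[OF l(1)] by auto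
  then have "y = l (t+2*pi * of_int (- k))" using degree_shift_int[of l "2*pi" t "- k", OF l(2)] by simp
  then show ?thesis ..
 qed
 then show ?thesis by (auto simp: surj_def)
qed

text \<open>A suitable rotation makes the map fixed point free.\<close>

lemma deg1_increasing_lift:
 assumes q: "continuous_on S1 q" "q ` S1 <= S1"
  and l: "continuous_on UNIV l" "strict_mono l" "!!t. l (t+2*pi) = l t+2*pi" "!!t. q (cis t) = cis (l t)"
 shows "deg1 q = 1"
proof -
 define u where "u = (%t. l t - t)"
 have cu: "continuous_on {0..2*pi} u" unfolding u_def
  by (intro continuous_intros continuous_on_subset[OF l(1)]) auto
 obtain a where a: "a : {0..2*pi}" "!!t. t : {0..2*pi} ==> u a <= u t"
  using continuous_attains_inf[OF _ _ cu] by auto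
 obtain b where b: "b : {0..2*pi}" "!!t. t : {0..2*pi} ==> u t <= u b"
  using continuous_attains_sup[OF _ _ cu] by auto
 have "u b < u a+2*pi" using increasing_lift_oscillation[OF l(2,3)] by (simp add: u_def)
 moreover define \<alpha> where "\<alpha> = - u a+(2*pi - (u b - u a)) / 2"
 ultimately have range: "0 < u t + \<alpha>" "u t + \<alpha> < 2*pi" if "t : {0..2*pi}" for t
  using a(2)[OF that] b(2)[OF that] by (auto simp: \<alpha>_def field_simps)
 define rot where "rot = (%z. cis \<alpha> * z)"
 have cr: "continuous_on S1 rot" "rot ` S1 <= S1" unfolding rot_def
  by (intro continuous_intros) (auto simp: S1_def norm_mult)
 have "deg1 (rot \<circ> q) = 1"
 proof (rule deg1_no_fixpoint)
  show "continuous_on S1 (rot \<circ> q)" using q cr by (intro continuous_on_compose) (auto intro: continuous_on_subset)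
  show "(rot \<circ> q) ` S1 <= S1" using q cr by auto
  fix z assume "z : S1"
  then have "z : cis ` {0..0+2*pi}" by (simp only: cis_image_period)
  then obtain t where t: "t : {0..2*pi}" "z = cis t" by auto
  have "(rot \<circ> q) z = cis (\<alpha> + l t)" using l(4) t by (simp add: rot_def cis_mult)
  moreover have "cis (\<alpha> + l t) ~= cis t"
   using cis_eq_imp_eq[of "\<alpha> + l t" t] range[OF t(1)] by (auto simp: u_def)
  ultimately show "(rot \<circ> q) z ~= z" using t by simp
 qed
 moreover have "deg1 rot = 1" unfolding rot_def by (rule deg1_rotation) simp
 ultimately show ?thesis using deg1_compose[OF cr q] by simp
qed

lemma circle_map_lift:
 assumes h: "continuous_on S1 h" "h ` S1 <= S1"
 obtains l k where "continuous_on UNIV l" "!!t. h (cis t) = cis (l t)" "!!t. l (t+2*pi) = l t+2*pi * of_int (k::int)"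
proof -
 have hS: "h (cis t) : S1" for t using h(2) cis_in_S1 by blast
 have "continuous_on UNIV (%t. h (cis t))"
  by (rule continuous_on_compose2[OF h(1)]) (auto intro: continuous_intros)
 moreover have "h (cis t) ~= 0" for t using hS[of t] by (auto simp: S1_def)
 ultimately obtain g where g: "continuous_on UNIV g" "!!t. h (cis t) = exp (g t)"
  using continuous_logarithm_on_contractible[of UNIV "%t::real. h (cis t)"] by (metis UNIV_I contractible_UNIV)
 define l where "l = (%t. Im (g t))"
 have cont_l: "continuous_on UNIV l" unfolding l_def by (intro continuous_intros g)
 have hl: "h (cis t) = cis (l t)" for t
 proof -
  have "norm (exp (g t)) = 1" using hS[of t] g by (simp add: S1_def)
  then have "Re (g t) = 0" by simp
  then have "exp (g t) = cis (l t)" by (simp add: exp_eq_polar l_def)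
  then show ?thesis using g by simp
 qed
 define m where "m = (%t. l (t+2*pi) - l t)"
 have cont_m: "continuous_on UNIV m" unfolding m_def
  by (intro continuous_intros continuous_on_compose2[OF cont_l]) auto
 have multiple: "EX k::int. m t = 2*pi * of_int k" for t
 proof -
  have "cis (l (t+2*pi)) = cis (l t)" using hl cis_periodic by metis
  then show ?thesis using cis_eq_iff_int[of "l (t+2*pi)" "l t"] by (auto simp: m_def)
 qed
 have "m constant_on UNIV"
 proof (rule continuous_discrete_range_constant[OF _ cont_m])
  show "EX e>0. ALL y. y : UNIV & m y ~= m x --> e <= norm (m y - m x)" for x
  proof (intro exI[of _ "2*pi"] conjI allI impI)
   fix y assume neq: "y : UNIV & m y ~= m x"
   obtain k k' :: int where k: "m x = 2*pi * of_int k" "m y = 2*pi * of_int k'" using multiple by meson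
   then have "k ~= k'" using neq by auto
   then have "1 <= \<bar>of_int (k' - k) :: real\<bar>" by linarith
   moreover have "m y - m x = 2*pi * of_int (k' - k)" using k by (simp add: algebra_simps)
   ultimately show "2*pi <= norm (m y - m x)" by (simp add: abs_mult)
  qed simp
 qed auto
 then obtain mm where "!!t. m t = mm" by (auto simp: constant_on_def)
 then obtain d where "!!t. m t = d" by (auto simp: constant_on_def)
 then obtain k :: int where "!!t. l (t+2*pi) = l t+2*pi * of_int k"
  using multiple[of 0] by (auto simp: m_def algebra_simps)
 then show thesis using that cont_l hl by blast
qed

lemma injective_lift_inj:
 fixes l :: "real => real" and k :: int
 assumes l: "continuous_on UNIV l" "!!t. l (t+2*pi) = l t+2*pi * of_int k" and inj: "!!s t. cis (l s) = cis (l t) ==> cis s = cis t"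
 shows "inj l"
proof -
 have "k ~= 0"
 proof
  assume "k = 0"
  define d where "d t = l (t + pi) - l t" for t
  have "d pi = - d 0" using l(2)[of 0] \<open>k = 0\<close> by (simp add: d_def)
  moreover have "continuous_on {0..pi} d" unfolding d_def
   by (intro continuous_intros continuous_on_compose2[OF l(1)]) auto
  ultimately obtain t where "d t = 0"
   using IVT'[of d 0 0 pi] IVT2'[of d pi 0 0] by (cases "0 <= d 0") auto
  then have "cis (t + pi) = cis t" using inj[of "t + pi" t] by (simp add: d_def)
  then show False using cis_eq_imp_eq[of "t + pi" t] by simp
 qed
 show ?thesis
 proof (rule injI)
  fix s t assume e: "l s = l t"
  then obtain j :: int where j: "s = t+2*pi * of_int j" using inj[of s t] cis_eq_iff_int by auto
  then have "2*pi * of_int k * of_int j = 0" using degree_shift_int[of l "2*pi * of_int k" t j, OF l(2)] e by simp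
  then show "s = t" using j \<open>k ~= 0\<close> by simp
 qed
qed

lemma increasing_injective_lift_degree:
 fixes l :: "real => real" and k :: int
 assumes l: "continuous_on UNIV l" "!!t. l (t+2*pi) = l t+2*pi * of_int k" and inj: "!!s t. cis (l s) = cis (l t) ==> cis s = cis t"
  and mono: "strict_mono l"
 shows "k = 1"
proof -
 have "0 < 2*pi * of_int k" using l(2)[of 0] strict_monoD[OF mono, of 0 "2*pi"] by simp
 then have "0 < k" by (simp add: zero_less_mult_iff)
 moreover have "~ 2 <= k"
 proof
  assume "2 <= k"
  then have "2*pi * 2 <= 2*pi * of_int k" by (intro mult_left_mono) auto
  then obtain x where x: "0 <= x" "x <= 2*pi" "l x = l 0+2*pi"
   using IVT'[of l 0 "l 0+2*pi" "2*pi"] continuous_on_subset[OF l(1)] l(2)[of 0] by auto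
  then have "cis x = cis 0" using inj[of x 0] cis_periodic[of "l 0"] by simp
  moreover have "x ~= 0" "x ~= 2*pi" using x l(2)[of 0] \<open>2*pi * 2 <= 2*pi * of_int k\<close> by auto
  ultimately show False using cis_eq_imp_eq[of x 0] x by auto
 qed
 ultimately show ?thesis by simp
qed

lemma homeomorphism_S1_lift:
 assumes h: "homeomorphism S1 S1 h h'" and deg: "deg1 h = 1"
 obtains l where "continuous_on UNIV l" "strict_mono l" "!!t. l (t+2*pi) = l t+2*pi" "!!t. h (cis t) = cis (l t)"
proof -
 have ch: "continuous_on S1 h" "h ` S1 <= S1" using h by (auto simp: homeomorphism_def)
 obtain l and k :: int where l: "continuous_on UNIV l" "!!t. h (cis t) = cis (l t)" "!!t. l (t+2*pi) = l t+2*pi * of_int k"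
  using circle_map_lift[OF ch] by metis
 have inj: "cis s = cis t" if "cis (l s) = cis (l t)" for s t
  using homeomorphism_apply1[OF h] cis_in_S1 that unfolding l(2)[symmetric] by metis
 have "strict_mono l | strict_antimono_on UNIV l"
  using injective_eq_monotone_map[of UNIV l] l(1) injective_lift_inj[OF l(1,3) inj] by auto
 then show thesis
 proof
  assume "strict_mono l"
  moreover from this have "k = 1" using increasing_injective_lift_degree[OF l(1,3) inj] by blast
  ultimately show thesis using that[of l] l by simp
 next
  assume "strict_antimono_on UNIV l"
  then have mono: "strict_mono (%t. - l t)" by (auto simp: monotone_on_def)
  have cont: "continuous_on UNIV (%t. - l t)" using l(1) by (intro continuous_intros)
  have shift: "- l (t+2*pi) = - l t+2*pi * of_int (- k)" for t by (simp add: l(3))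
  have "cis s = cis t" if "cis (- l s) = cis (- l t)" for s t
   using inj that by (metis cis_cnj complex_cnj_cnj)
  then have "- k = 1" by (rule increasing_injective_lift_degree[OF cont shift _ mono])
  have cc: "continuous_on S1 (cnj \<circ> h)" "(cnj \<circ> h) ` S1 <= S1"
   using ch by (auto intro!: continuous_intros simp: S1_def o_def)
  have "deg1 (cnj \<circ> h) = 1"
   by (rule deg1_increasing_lift[OF cc cont mono]) (use shift \<open>- k = 1\<close> l(2) in \<open>auto simp: cis_cnj\<close>)
  moreover have "deg1 (cnj \<circ> h) = deg1 cnj * deg1 h"
   by (rule deg1_compose) (use ch in \<open>auto intro!: continuous_intros simp: S1_def\<close>)
  ultimately show thesis using deg deg1_reflection by simp
 qed
qed

lemma catherine_wheel_lift:
 assumes "catherine_wheel f" shows "wheel (%t. f (cis t))"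
proof
 have cf: "continuous_on S1 f" "f ` S1 = S2" using assms by (auto simp: catherine_wheel_def)
 show "continuous_on UNIV (%t. f (cis t))"
  by (rule continuous_on_compose2[OF cf(1)]) (auto intro: continuous_intros)
 show "f (cis (t+2*pi)) = f (cis t)" for t by (simp only: cis_periodic)
 have "range (%t. f (cis t)) = f ` range cis" by (simp add: image_image)
 moreover have "range cis = S1" using S1_iff_cis by auto
 ultimately show "range (%t. f (cis t)) = S2" using cf by simp
 fix s t :: real assume st: "s < t" "t < s+2*pi"
 have im: "f ` arc (cis s) (cis t) = (%t. f (cis t)) ` {s..t}"
  using arc_cis[of s t] st by (simp add: image_image)
 have "cis s ~= cis t" using cis_eq_imp_eq[of s t] st by auto
 then have "closed_disk (f ` arc (cis s) (cis t)) & {f (cis s), f (cis t)} <= bdry (f ` arc (cis s) (cis t))"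
  using assms cis_in_S1 unfolding catherine_wheel_def by blast
 then show "closed_disk ((%t. f (cis t)) ` {s..t})"
  "f (cis s) : bdry ((%t. f (cis t)) ` {s..t}) & f (cis t) : bdry ((%t. f (cis t)) ` {s..t})"
  unfolding im by auto
qed

lemma (in wheel) wheel_reflect: "wheel (%t. F (- t))"
proof
 show "continuous_on UNIV (%t. F (- t))"
  by (rule continuous_on_compose2[OF cont]) (auto intro: continuous_intros)
 show "F (- (t+2*pi)) = F (- t)" for t using per_minus[of "- t"] by simp
 show "range (%t. F (- t)) = S2"
 proof -
  have "F t : range (%t. F (- t))" for t by (rule image_eqI[of _ _ "- t"]) auto
  then have "range F <= range (%t. F (- t))" by blast
  then show ?thesis using surj F_in by blast
 qed
 fix s t :: real assume st: "s < t" "t < s+2*pi"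
 have im: "(%t. F (- t)) ` {s..t} = F ` {- t..- s}"
 proof -
  have "uminus ` {s..t} = {- t..- s}" by simp
  then show ?thesis by (metis image_image)
 qed
 show "closed_disk ((%t. F (- t)) ` {s..t})" unfolding im using disk st by simp
 show "F (- s) : bdry ((%t. F (- t)) ` {s..t}) & F (- t) : bdry ((%t. F (- t)) ` {s..t})"
  unfolding im using ends[of "- t" "- s"] st by simp
qed

subsection \<open>Equivariant wheels\<close>

lemma closed_periodic_gap:
 fixes S :: "real set"
 assumes cl: "closed S" and ne: "S ~= {}" and per: "!!x (k::int). x : S ==> x+2*pi * of_int k : S" and t: "t ~: S"
 obtains u v where "u : S" "v : S" "u < t" "t < v" "v <= u+2*pi" "!!x. u < x ==> x < v ==> x ~: S"
proof -
 define u where "u = Sup (S Int {..t})"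
 define v where "v = Inf (S Int {t..})"
 obtain x0 where "x0 : S" using ne by blast
 then obtain k where "t - 2*pi <= x0+2*pi * of_int k" "x0+2*pi * of_int k < t" "x0+2*pi * of_int k : S"
  using real_period_representative[of "t - 2*pi" x0] per by auto
 moreover from this have "x0+2*pi * of_int (k+1) : S Int {t..}" using per[OF \<open>x0 : S\<close>, of "k+1"] by (auto simp: algebra_simps)
 ultimately have ne: "S Int {..t} ~= {}" "S Int {t..} ~= {}" by auto
 have bd: "bdd_above (S Int {..t})" "bdd_below (S Int {t..})" by (auto intro: bdd_aboveI bdd_belowI)
 have u: "u : S Int {..t}" unfolding u_def by (rule closed_contains_Sup) (use ne bd cl in auto)
 have v: "v : S Int {t..}" unfolding v_def by (rule closed_contains_Inf) (use ne bd cl in auto)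
 have gap: "x ~: S" if "u < x" "x < v" for x
 proof
  assume x: "x : S"
  show False
  proof (cases "x <= t")
   case True
   then have "x <= u" unfolding u_def using x bd by (intro cSup_upper) auto
   then show False using that by simp
  next
   case False
   then have "v <= x" unfolding v_def using x bd by (intro cInf_lower) auto
   then show False using that by simp
  qed
 qed
 have ut: "u < t" "t < v" using u v t by (auto simp: less_le)
 have "u+2*pi : S" using per[of u 1] u by simp
 then have "v <= u+2*pi" using gap[of "u+2*pi"] pi_gt_zero by fastforce
 then show thesis using that[of u v] u v ut gap by auto
qed

locale wheel_map = wheel F for F +
 fixes l l' :: "real => real" and H H' :: "real^3 => real^3"
 assumes l_mono: "strict_mono l" and l_cont: "continuous_on UNIV l" and l_per: "l (t+2*pi) = l t+2*pi"
  and l'l: "l' (l t) = t" and ll': "l (l' t) = t"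
  and FH: "F (l t) = H (F t)" and hom: "homeomorphism S2 S2 H H'"
begin

lemma l_less [simp]: "l s < l t \<longleftrightarrow> s < t" using l_mono by (simp add: strict_mono_less)
lemma l_le [simp]: "l s <= l t \<longleftrightarrow> s <= t" using l_mono by (simp add: strict_mono_less_eq)
lemma l_eq [simp]: "l s = l t \<longleftrightarrow> s = t" using l_mono by (simp add: strict_mono_eq)

lemma H'H: "y : S2 ==> H' (H y) = y" and HH': "y : S2 ==> H (H' y) = y"
 using homeomorphism_apply1[OF hom] homeomorphism_apply2[OF hom] by auto

lemma H_in: "y : S2 ==> H y : S2" and H'_in: "y : S2 ==> H' y : S2"
 using homeomorphism_image1[OF hom] homeomorphism_image2[OF hom] by auto

lemma H_inj: "x : S2 ==> y : S2 ==> H x = H y \<longleftrightarrow> x = y" using H'H by metis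

lemma FH': "F (l' t) = H' (F t)" using FH[of "l' t"] H'H F_in ll' by metis

lemma wheel_map_inverse: "wheel_map F l' l H' H"
proof
 have "l' s < l' t \<longleftrightarrow> s < t" for s t using l_less[of "l' s" "l' t"] by (simp add: ll')
 then show "strict_mono l'" by (simp add: strict_mono_def)
 show "continuous_on UNIV l'"
 proof -
  have "l ` UNIV = UNIV" using ll' by (metis surjI)
  moreover have "inj l" using l_eq by (simp add: inj_def)
  ultimately obtain g where g: "homeomorphism UNIV UNIV l g"
   using invariance_of_domain_homeomorphism[of UNIV l] l_cont by auto
  have "g t = l' t" for t using homeomorphism_apply1[OF g, of "l' t"] by (simp add: ll')
  then show ?thesis using homeomorphism_cont2[OF g] by (metis ext)
 qed
 show "l' (t+2*pi) = l' t+2*pi" for t using l_per[of "l' t"] l'l ll' by metis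
 show "l (l' t) = t" "l' (l t) = t" for t by (rule ll', rule l'l)
 show "F (l' t) = H' (F t)" for t by (rule FH')
 show "homeomorphism S2 S2 H' H" using hom by (rule homeomorphism_symD)
qed

lemma pow_mono: "strict_mono (l ^^ n)" by (induction n) (auto simp: strict_mono_def)

lemma pow_per: "(l ^^ n) (t+2*pi) = (l ^^ n) t+2*pi" by (induction n) (auto simp: l_per)

lemma pow_cont: "continuous_on UNIV (l ^^ n)"
proof (induction n)
 case 0 then show ?case by (simp add: id_def)
next
 case (Suc n)
 then show ?case using continuous_on_compose2[OF l_cont Suc] by (simp add: o_def)
qed

lemma pow_FH: "F ((l ^^ n) t) = (H ^^ n) (F t)" by (induction n) (auto simp: FH)

lemma pow_in: "y : S2 ==> (H ^^ n) y : S2" by (induction n) (auto simp: H_in)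

lemma pow_commute: "(l ^^ n) (l t) = l ((l ^^ n) t)" by (simp add: funpow_swap1)

lemma l_per_int: "l (t+2*pi * of_int k) = l t+2*pi * of_int k"
 using l_per by (rule degree_shift_int)

lemma pow_per_int: "(l ^^ n) (t+2*pi * of_int k) = (l ^^ n) t+2*pi * of_int k"
 by (induction n) (auto simp: l_per_int)

lemma wheel_map_pow: "wheel_map F (l ^^ n) (l' ^^ n) (H ^^ n) (H' ^^ n)"
proof
 have inv: "(f ^^ n) ((g ^^ n) t) = t" if "!!t. f (g t) = t" for f g :: "real => real" and t
  by (induction n arbitrary: t) (auto simp: funpow_swap1 that)
 show "(l' ^^ n) ((l ^^ n) t) = t" "(l ^^ n) ((l' ^^ n) t) = t" for t
  by (rule inv, rule l'l) (rule inv, rule ll')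
 show "homeomorphism S2 S2 (H ^^ n) (H' ^^ n)"
 proof (induction n)
  case 0 then show ?case by (simp add: homeomorphism_def id_def)
 next
  case (Suc n)
  have "homeomorphism S2 S2 (H \<circ> H ^^ n) (H' ^^ n \<circ> H')" using homeomorphism_compose[OF Suc hom] .
  moreover have "H' ^^ n \<circ> H' = H' \<circ> H' ^^ n" by (simp add: fun_eq_iff funpow_swap1)
  ultimately show ?case by (simp only: funpow.simps)
 qed
qed (auto simp: pow_mono pow_cont pow_per pow_FH)

lemma wheel_map_shift: "wheel_map F (%t. l t+2*pi * of_int k) (%t. l' (t - 2*pi * of_int k)) H H'"
proof
 show "strict_mono (%t. l t+2*pi * of_int k)" by (simp add: strict_mono_def)
 show "continuous_on UNIV (%t. l t+2*pi * of_int k)" by (intro continuous_intros l_cont)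
qed (auto simp: l_per l'l ll' per_int FH hom)

lemma wheel_map_reflect: "wheel_map (%t. F (- t)) (%t. - l (- t)) (%t. - l' (- t)) H H'"
proof -
 interpret R: wheel "%t. F (- t)" by (rule wheel_reflect)
 show ?thesis
 proof
  show "strict_mono (%t. - l (- t))" by (simp add: strict_mono_def)
  show "continuous_on UNIV (%t. - l (- t))"
   by (intro continuous_intros continuous_on_compose2[OF l_cont]) auto
  show "- l (- (t+2*pi)) = - l (- t)+2*pi" for t using l_per[of "- t - 2*pi"] by simp
 qed (auto simp: l'l ll' FH hom)
qed

definition lift_iterate :: "nat => int => real => real" where
 "lift_iterate n k x = (l ^^ n) x+2*pi * of_int k"

lemma lift_iterate_strict_mono: "strict_mono (lift_iterate n k)"
 using pow_mono[of n] by (simp add: lift_iterate_def strict_mono_def)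

lemma lift_iterate_cont: "continuous_on A (lift_iterate n k)"
 unfolding lift_iterate_def[abs_def] by (intro continuous_intros continuous_on_subset[OF pow_cont]) auto

lemma F_lift_iterate: "F (lift_iterate n k x) = (H ^^ n) (F x)"
 by (simp add: lift_iterate_def per_int pow_FH)

lemma lift_iterate_add: "lift_iterate m j (lift_iterate n k x) = lift_iterate (m + n) (j + k) x"
 unfolding lift_iterate_def pow_per_int funpow_add by (simp add: algebra_simps)

lemma lift_iterate_crossing:
 assumes "lift_iterate m j x <= lift_iterate n k x" "lift_iterate n k y <= lift_iterate m j y"
 shows "EX z. lift_iterate m j z = lift_iterate n k z"
proof -
 define d where "d x = lift_iterate n k x - lift_iterate m j x" for x
 have "continuous_on S d" for S unfolding d_def by (intro continuous_intros lift_iterate_cont)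
 moreover have "0 <= d x" "d y <= 0" using assms by (auto simp: d_def)
 ultimately obtain z where "d z = 0" using IVT'[of d y 0 x] IVT2'[of d y 0 x] by (metis linear)
 then have "lift_iterate m j z = lift_iterate n k z" by (simp add: d_def)
 then show ?thesis by blast
qed

definition invariant_set :: "real set => bool" where
 "invariant_set S \<longleftrightarrow> closed S & S ~= {} & (ALL x:S. ALL n k. lift_iterate n k x : S)"

lemma invariant_setI:
 assumes "closed S" "x0 : S" "!!x. x : S ==> l x : S" "!!x (k::int). x : S ==> x+2*pi * of_int k : S"
 shows "invariant_set S"
proof -
 have "(l ^^ n) x : S" if "x : S" for n x using that by (induction n) (auto intro: assms)
 then show ?thesis using assms by (auto simp: invariant_set_def lift_iterate_def)
qed

lemma invariant_setD:
 assumes "invariant_set S"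
 shows "closed S" "S ~= {}" "x : S ==> lift_iterate n k x : S" "x : S ==> x+2*pi * of_int k : S" "x : S ==> l x : S"
proof -
 have iterate: "lift_iterate n k y : S" if "y : S" for n k y using assms that by (simp add: invariant_set_def)
 show "closed S" "S ~= {}" using assms by (simp_all add: invariant_set_def)
 show "x : S ==> lift_iterate n k x : S" by (rule iterate)
 show "x : S ==> x+2*pi * of_int k : S" "x : S ==> l x : S"
  using iterate[of x 0 k] iterate[of x 1 0] by (simp_all add: lift_iterate_def)
qed

lemma invariant_fibre:
 assumes "c : S2" "H c = c" shows "invariant_set {t. F t = c}"
proof -
 obtain x where "F x = c" using assms surj by (metis imageE)
 moreover have "closed {t. F t = c}" using continuous_closed_preimage_constant[of UNIV F c] cont by simp
 ultimately show ?thesis by (intro invariant_setI[of _ x]) (auto simp: per_int FH assms)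
qed

lemma invariant_chain_Inter:
 assumes ne: "\<C> ~= {}" and inv: "!!X. X : \<C> ==> invariant_set X" and chain: "!!X Y. X : \<C> ==> Y : \<C> ==> X <= Y | Y <= X"
 shows "invariant_set (\<Inter>\<C>)"
proof -
 have "(\<Inter>X\<in>\<C>. X Int {0..2*pi}) ~= {}"
 proof (rule compact_chain)
  show "compact T" if "T : (%X. X Int {0..2*pi}) ` \<C>" for T
   using that invariant_setD(1)[OF inv] by (auto intro: closed_Int_compact)
  show "{} ~: (%X. X Int {0..2*pi}) ` \<C>"
  proof
   assume "{} : (%X. X Int {0..2*pi}) ` \<C>"
   then obtain X where X: "X : \<C>" "X Int {0..2*pi} = {}" by blast
   obtain x where x: "x : X" using invariant_setD(2)[OF inv[OF X(1)]] by blast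
   obtain k where "0 <= x+2*pi * of_int k" "x+2*pi * of_int k < 0+2*pi" using real_period_representative by blast
   then have "x+2*pi * of_int k : X Int {0..2*pi}" using invariant_setD(4)[OF inv[OF X(1)] x] by simp
   then show False using X by blast
  qed
  show "T <= T' | T' <= T" if "T : (%X. X Int {0..2*pi}) ` \<C> & T' : (%X. X Int {0..2*pi}) ` \<C>" for T T'
   using that chain by blast
 qed
 then obtain x0 where "x0 : \<Inter>\<C>" using ne by auto
 moreover have "closed (\<Inter>\<C>)" using invariant_setD(1)[OF inv] by (intro closed_Inter) auto
 ultimately show ?thesis using invariant_setD(4,5)[OF inv] by (intro invariant_setI[of _ x0]) auto
qed

lemma minimal_invariant_subset:
 assumes K: "invariant_set K"
 obtains M where "invariant_set M" "M <= K" "!!S. invariant_set S ==> S <= M ==> S = M"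
proof -
 let ?A = "{- S |S. invariant_set S & S <= K}"
 have "EX N:?A. ALL X:?A. N <= X --> X = N"
 proof (rule subset_Zorn_nonempty)
  show "?A ~= {}" using K by blast
  fix \<C> assume ne: "\<C> ~= {}" and chain: "subset.chain ?A \<C>"
  have mem: "invariant_set (- X)" "- X <= K" if "X : \<C>" for X
   using chain that by (auto simp: subset_chain_def)
  have "X <= Y | Y <= X" if "X : \<C>" "Y : \<C>" for X Y using chain that by (simp add: subset_chain_def)
  then have "X <= Y | Y <= X" if "X : uminus ` \<C>" "Y : uminus ` \<C>" for X Y
   using that by (metis imageE Compl_subset_Compl_iff)
  then have "invariant_set (\<Inter>(uminus ` \<C>))" by (intro invariant_chain_Inter) (use ne mem in auto)
  moreover have "\<Inter>(uminus ` \<C>) <= K" using ne mem by auto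
  moreover have "\<Union>\<C> = - \<Inter>(uminus ` \<C>)" by auto
  ultimately show "\<Union>\<C> : ?A" by blast
 qed
 then obtain M where M: "invariant_set M" "M <= K" "ALL X:?A. - M <= X --> X = - M" by blast
 show thesis
 proof (rule that[OF M(1,2)])
  fix S assume "invariant_set S" "S <= M"
  then have "- S = - M" using M(2) by (intro M(3)[rule_format]) auto
  then show "S = M" by simp
 qed
qed

lemma minimal_orbit_dense:
 assumes M: "invariant_set M" "!!S. invariant_set S ==> S <= M ==> S = M" and v: "v : M" and w: "w : M" and e: "e > 0"
 shows "EX n>=m. EX k. \<bar>lift_iterate n k v - w\<bar> < e"
proof -
 define Or where "Or = {lift_iterate n k v |n k. n >= m}"
 have Or: "lift_iterate n k y : Or" if "y : Or" for n k y
 proof -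
  have "EX n' k'. n' >= m & y = lift_iterate n' k' v" using that by (auto simp: Or_def)
  then obtain n' k' where "n' >= m" "y = lift_iterate n' k' v" by blast
  then show ?thesis unfolding Or_def mem_Collect_eq
   by (intro exI[of _ "n + n'"] exI[of _ "k + k'"]) (simp add: lift_iterate_add)
 qed
 have "lift_iterate n k ` closure Or <= closure Or" for n k
  by (rule image_closure_subset[OF lift_iterate_cont]) (use Or closure_subset[of Or] in auto)
 moreover have "lift_iterate m 0 v : Or" unfolding Or_def by blast
 ultimately have "invariant_set (closure Or)" unfolding invariant_set_def by auto
 moreover have "closure Or <= M"
  by (rule closure_minimal) (use invariant_setD(1,3)[OF M(1)] v in \<open>auto simp: Or_def\<close>)
 ultimately have "w : closure Or" using M(2) w by blast
 then obtain y where "y : Or" "dist y w < e" using e closure_approachable by blast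
 then show ?thesis by (auto simp: Or_def dist_real_def)
qed

end

locale wheel_minimal_fibre = wheel_map +
 fixes c :: "real^3" and M :: "real set"
 assumes c: "c : S2" "H c = c"
  and aperiodic: "!!n k x. n >= 1 ==> lift_iterate n k x ~= x"
  and invariant_M: "invariant_set M" and minimal_M: "!!S. invariant_set S ==> S <= M ==> S = M"
  and M_fibre: "x : M ==> F x = c"
begin

lemmas M_closed = invariant_setD(1)[OF invariant_M] and M_nonempty = invariant_setD(2)[OF invariant_M]
 and M_iterate = invariant_setD(3)[OF invariant_M] and M_shift = invariant_setD(4)[OF invariant_M]

lemma M_dense: "v : M ==> w : M ==> e > 0 ==> EX n>=m. EX k. \<bar>lift_iterate n k v - w\<bar> < e"
 by (rule minimal_orbit_dense[OF invariant_M]) (use minimal_M in auto)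

lemma M_shift_period: "x : M ==> x+2*pi : M" "x : M ==> x - 2*pi : M"
 using M_shift[of x 1] M_shift[of x "-1"] by simp_all

lemma lift_iterates_agree:
 assumes "lift_iterate m j x = lift_iterate n k x" shows "m = n"
proof -
 have False if "m < n" "lift_iterate m j x = lift_iterate n k x" for m n j k
 proof -
  have "lift_iterate (n - m) (k - j) (lift_iterate m j x) = lift_iterate n k x"
   using that(1) by (simp add: lift_iterate_add)
  moreover have "1 <= n - m" using that(1) by linarith
  ultimately show False using aperiodic that(2) by metis
 qed
 then show ?thesis using assms by (metis linorder_neqE_nat)
qed

lemma forward_everywhere:
 assumes "m >= 1" "y < lift_iterate m k y" shows "x < lift_iterate m k x"
proof (rule ccontr)
 assume "~ ?thesis"
 moreover have "lift_iterate 0 0 = (%x. x)" by (simp add: lift_iterate_def fun_eq_iff)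
 ultimately show False
  using lift_iterate_crossing[of m k x 0 0 y] aperiodic[OF assms(1)] assms(2) by (auto simp: not_less)
qed

lemma M_perfect:
 assumes w: "w : M" "e > 0" shows "EX y:M. y ~= w & \<bar>y - w\<bar> < e"
proof -
 obtain n k where "n >= 1" "\<bar>lift_iterate n k w - w\<bar> < e" using M_dense[OF w(1) w(1) w(2), of 1] by blast
 then show ?thesis using aperiodic[of n k w] M_iterate[OF w(1), of n k] by blast
qed

definition gap :: "real => real => bool" where
 "gap u v \<longleftrightarrow> u : M & v : M & u < v & (ALL x. u < x --> x < v --> x ~: M)"

lemma gapD:
 assumes "gap u v" shows "u : M" "v : M" "u < v" "u < x ==> x < v ==> x ~: M"
 using assms by (auto simp: gap_def)

lemma gap_right_accumulation:
 assumes g: "gap u v" and e: "e > 0" shows "EX y:M. v < y & y < v + e"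
proof -
 obtain y where y: "y : M" "y ~= v" "\<bar>y - v\<bar> < min e (v - u)" using M_perfect[of v "min e (v - u)"] e gapD[OF g] by auto
 then have "~ y < v" using gapD(4)[OF g, of y] by auto
 then show ?thesis using y by (intro bexI[of _ y]) auto
qed

lemma gap_left_accumulation:
 assumes g: "gap u v" and e: "e > 0" shows "EX y:M. u - e < y & y < u"
proof -
 obtain y where y: "y : M" "y ~= u" "\<bar>y - u\<bar> < min e (v - u)" using M_perfect[of u "min e (v - u)"] e gapD[OF g] by auto
 then have "~ u < y" using gapD(4)[OF g, of y] by auto
 then show ?thesis using y by (intro bexI[of _ y]) auto
qed

lemma gap_exists:
 assumes "t ~: M" obtains u v where "gap u v" "u < t" "t < v"
 by (rule closed_periodic_gap[OF M_closed M_nonempty _ assms], erule M_shift, rule that) (auto simp: gap_def)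

lemma gap_width: assumes g: "gap u v" shows "v < u+2*pi"
proof -
 have "v ~= u+2*pi"
 proof
  assume period: "v = u+2*pi"
  obtain y where y: "y : M" "v < y" "y < v+(v - u)" using gap_right_accumulation[OF g, of "v - u"] gapD[OF g] by auto
  then show False using gapD(4)[OF g, of "y - 2*pi"] M_shift_period(2)[OF y(1)] period by auto
 qed
 moreover have "~ u+2*pi < v" using gapD(4)[OF g, of "u+2*pi"] M_shift_period(1)[OF gapD(1)[OF g]] by auto
 ultimately show ?thesis by simp
qed

lemma forward_return:
 assumes g: "gap u v" and w: "w : M" "a < w" "w < b"
 shows "EX m>=1. EX k. (ALL x. x < lift_iterate m k x) & lift_iterate m k a < b"
proof -
 obtain n1 k1 where close: "\<bar>lift_iterate n1 k1 v - w\<bar> < min (w - a) (b - w)"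
  using M_dense[OF gapD(2)[OF g] w(1), of "min (w - a) (b - w)" 0] w by auto
 define y1 where "y1 = lift_iterate n1 k1 v"
 have y1: "a < y1" "y1 < b" using close by (auto simp: y1_def)
 have "isCont (lift_iterate n1 k1) v" using lift_iterate_cont[of UNIV] by (simp add: continuous_on_eq_continuous_at)
 then obtain d where d: "d > 0" "!!x. \<bar>x - v\<bar> < d ==> \<bar>lift_iterate n1 k1 x - y1\<bar> < b - y1"
  using y1 unfolding continuous_at_real_range y1_def by (metis diff_gt_0_iff_gt real_norm_def)
 obtain y where y: "y : M" "v < y" "y < v + d" using gap_right_accumulation[OF g d(1)] by blast
 define y' where "y' = lift_iterate n1 k1 y"
 have y': "y1 < y'" "y' < b" "y' : M"
  using d(2)[of y] y strict_monoD[OF lift_iterate_strict_mono y(2)] M_iterate by (auto simp: y'_def y1_def)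
 obtain n2 k2 where n2: "n2 >= n1+1" "\<bar>lift_iterate n2 k2 v - y'\<bar> < min (y' - y1) (b - y')"
  using M_dense[OF gapD(2)[OF g] y'(3), of "min (y' - y1) (b - y')" "n1+1"] y' by auto
 have step: "lift_iterate (n2 - n1) (k2 - k1) y1 = lift_iterate n2 k2 v"
  using n2(1) by (simp add: y1_def lift_iterate_add)
 have "x < lift_iterate (n2 - n1) (k2 - k1) x" for x
  by (rule forward_everywhere[of _ y1]) (use n2 step in auto)
 moreover have "lift_iterate (n2 - n1) (k2 - k1) a < b"
  using strict_monoD[OF lift_iterate_strict_mono y1(1), of "n2 - n1" "k2 - k1"] step n2(2) by auto
 ultimately show ?thesis using n2(1) by (intro exI[of _ "n2 - n1"]) auto
qed

text \<open>Two lifted iterates that are ordered differently at \<open>a\<close> and \<open>b\<close> would agree somewhere.\<close>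

lemma common_return:
 assumes one: "m1 >= 1" "ALL x. x < lift_iterate m1 k1 x" "lift_iterate m1 k1 a < a'"
  and two: "m2 >= 1" "ALL x. x < lift_iterate m2 k2 x" "lift_iterate m2 k2 b < b'"
 shows "EX m>=1. EX k. (ALL x. x < lift_iterate m k x) & lift_iterate m k a < a' & lift_iterate m k b < b'"
proof (rule ccontr)
 assume "~ ?thesis"
 then have "~ lift_iterate m1 k1 b < b'" "~ lift_iterate m2 k2 a < a'" using one two by blast+
 then have order: "lift_iterate m1 k1 a < lift_iterate m2 k2 a" "lift_iterate m2 k2 b < lift_iterate m1 k1 b"
  using one two by auto
 then obtain z where "lift_iterate m1 k1 z = lift_iterate m2 k2 z"
  using lift_iterate_crossing less_imp_le by metis
 then have "m1 = m2" by (rule lift_iterates_agree)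
 then show False using order by (simp add: lift_iterate_def)
qed

lemma linked_gaps:
 obtains u v u' v' s s' where "gap u v" "gap u' v'" "v < u'" "v' < u+2*pi"
  "u < s" "s < v" "u' < s'" "s' < v'" "F s = F s'" "F s ~= c"
proof -
 obtain x where "x ~: M" using interval_image_not_subset_finite[of 0 1 "{c}"] M_fibre by auto
 then obtain u v where uv: "gap u v" by (rule gap_exists)
 note uvD = gapD[OF uv] gap_width[OF uv]
 obtain z where z: "z : bdry (F ` {u..v})" "z ~= c" using disk_boundary_point[of u v c] uvD by auto
 then have "z : F ` {u..v}" "z : F ` {v..u+2*pi}" using bdry_eq[of u v] uvD by auto
 then obtain s s' where s: "u <= s" "s <= v" "z = F s" and s': "v <= s'" "s' <= u+2*pi" "z = F s'" by auto
 have Fc: "F u = c" "F v = c" "F (u+2*pi) = c" using M_fibre uvD per by auto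
 have s1: "u < s" "s < v" "v < s'" "s' < u+2*pi" using s s' z Fc by (auto simp: less_le)
 have "s' ~: M" using M_fibre s' z by auto
 then obtain u' v' where uv': "gap u' v'" "u' < s'" "s' < v'" by (rule gap_exists)
 obtain y where y: "y : M" "v < y" "y < v+(s' - v)" using gap_right_accumulation[OF uv, of "s' - v"] s1 by auto
 have "v < u'"
 proof (rule ccontr)
  assume "~ v < u'"
  then show False using gapD(4)[OF uv'(1), of y] y uv'(3) by auto
 qed
 obtain y where y: "y : M" "u - (u+2*pi - s') < y" "y < u" using gap_left_accumulation[OF uv, of "u+2*pi - s'"] s1 by auto
 have "v' < u+2*pi"
 proof (rule ccontr)
  assume "~ v' < u+2*pi"
  then show False using gapD(4)[OF uv'(1), of "y+2*pi"]
    M_shift_period(1)[OF y(1)] y uv'(2) by auto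
 qed
 then show thesis using that[OF uv uv'(1) \<open>v < u'\<close> _ s1(1,2) uv'(2,3)] s s' z by simp
qed

lemma periodic_image_point:
 obtains m s where "m >= 1" "(H ^^ m) (F s) = F s" "F s ~= c"
proof -
 obtain u v u' v' s s' where g: "gap u v" "gap u' v'" and vu': "v < u'" "v' < u+2*pi"
  and s: "u < s" "s < v" "u' < s'" "s' < v'" "F s = F s'" "F s ~= c" by (rule linked_gaps)
 note uv = gapD[OF g(1)] gap_width[OF g(1)] and uv' = gapD[OF g(2)]
 obtain y where y: "y : M" "v < y" "y < v+(u' - v)" using gap_right_accumulation[OF g(1), of "u' - v"] vu' by auto
 obtain m1 k1 where return1: "m1 >= 1" "ALL x. x < lift_iterate m1 k1 x" "lift_iterate m1 k1 v < u'"
  using forward_return[OF g(1) y(1), of v u'] y by auto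
 obtain y where y: "y : M" "u - (u+2*pi - v') < y" "y < u" using gap_left_accumulation[OF g(1), of "u+2*pi - v'"] vu' by auto
 obtain m2 k2 where return2: "m2 >= 1" "ALL x. x < lift_iterate m2 k2 x" "lift_iterate m2 k2 v' < u+2*pi"
  using forward_return[OF g(1) M_shift_period(1)[OF y(1)], of v' "u+2*pi"] y by auto
 obtain m k where m: "m >= 1" and forward: "!!x. x < lift_iterate m k x"
  and returns: "lift_iterate m k v < u'" "lift_iterate m k v' < u+2*pi"
  using common_return[OF return1 return2] by blast
 define T where "T = lift_iterate m k"
 have Tmono: "T x < T y" if "x < y" for x y unfolding T_def using lift_iterate_strict_mono that by (rule strict_monoD)
 have TM: "T x : M" if "x : M" for x unfolding T_def by (rule M_iterate[OF that])
 have Tu: "v <= T u" "v' <= T u'" using uv uv' TM[of u] TM[of u'] forward[of u] forward[of u'] by (force simp: T_def not_less)+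
 have FT: "F (T x) = (H ^^ m) (F x)" for x by (simp add: T_def F_lift_iterate)
 have wpow: "(H ^^ i) (F s) ~= c" for i
 proof (induction i)
  case (Suc i)
  then show ?case using H_inj[OF pow_in[OF F_in] c(1), of i s] c(2) by auto
 qed (use s in simp)
 have "F s = (H ^^ m) (F s)"
 proof (rule unlinked[of u v u' v' c])
  show "F s : F ` {u..v}" by (rule imageI) (use s in simp)
  show "F s : F ` {u'..v'}" unfolding s(5) by (rule imageI) (use s in simp)
  have "T s : {v..u'}" using Tmono[OF s(1)] Tmono[OF s(2)] Tu returns by (simp add: T_def)
  then show "(H ^^ m) (F s) : F ` {v..u'}" unfolding FT[symmetric] by blast
  have "T s' : {v'..u+2*pi}" using Tmono[OF s(3)] Tmono[OF s(4)] Tu returns by (simp add: T_def)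
  then show "(H ^^ m) (F s) : F ` {v'..u+2*pi}" unfolding s(5) FT[symmetric] by blast
  show "(H ^^ m) (F s) ~= c" by (rule wpow)
 qed (use uv uv' vu' M_fibre s in auto)
 then show thesis using that[of m s] m s by simp
qed

text \<open>\<open>Y\<close> cuts the line into intervals that \<open>l\<close> permutes; a return
  of \<open>u \<in> M\<close> to its interval fixes the endpoints.\<close>

lemma no_closed_invariant_set_off_M:
 assumes Y: "closed Y" "Y ~= {}" "Y Int M = {}" and Y_shift: "!!x (j::int). x+2*pi * of_int j : Y \<longleftrightarrow> x : Y"
  and l_Y: "!!x. l x : Y \<longleftrightarrow> x : Y"
 shows False
proof -
 obtain u where u: "u : M" using M_nonempty by blast
 then have "u ~: Y" using Y(3) by blast
 obtain \<alpha> \<beta> where gap: "\<alpha> : Y" "\<beta> : Y" "\<alpha> < u" "u < \<beta>" "!!x. \<alpha> < x ==> x < \<beta> ==> x ~: Y"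
  by (rule closed_periodic_gap[OF Y(1,2) _ \<open>u ~: Y\<close>]) (simp add: Y_shift, blast)
 obtain n j where n: "n >= 1" "\<bar>lift_iterate n j u - u\<bar> < min (u - \<alpha>) (\<beta> - u)"
  using M_dense[OF u u, of "min (u - \<alpha>) (\<beta> - u)" 1] gap by auto
 define \<phi> where "\<phi> = lift_iterate n j"
 have \<phi>u: "\<alpha> < \<phi> u" "\<phi> u < \<beta>" using n by (auto simp: \<phi>_def)
 have \<phi>Y: "\<phi> x : Y \<longleftrightarrow> x : Y" for x
 proof -
  have "(l ^^ i) x : Y \<longleftrightarrow> x : Y" for i by (induction i) (simp_all add: l_Y)
  then show ?thesis by (simp add: \<phi>_def lift_iterate_def Y_shift)
 qed
 have "\<phi> \<alpha> < \<phi> u" unfolding \<phi>_def by (rule strict_monoD[OF lift_iterate_strict_mono gap(3)])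
 then have "\<phi> \<alpha> <= \<alpha>" using gap(5)[of "\<phi> \<alpha>"] \<phi>Y[of \<alpha>] gap(1) \<phi>u by fastforce
 then obtain y where y: "\<alpha> <= y" "y <= u" "\<phi> y = \<alpha>"
  using IVT'[of \<phi> \<alpha> \<alpha> u] \<phi>u gap lift_iterate_cont unfolding \<phi>_def by force
 then have "y : Y" using \<phi>Y[of y] gap by simp
 then have "y = \<alpha>" using gap(5)[of y] y gap by force
 then show False using aperiodic[OF n(1), of j \<alpha>] y by (simp add: \<phi>_def)
qed

lemma no_periodic_image_point:
 assumes m: "m >= 1" "(H ^^ m) (F s) = F s" "F s ~= c"
 shows False
proof -
 define Or where "Or = range (%i. (H ^^ i) (F s))"
 define Y where "Y = {t. F t : Or}"
 have OrS: "(H ^^ i) (F s) : S2" for i using pow_in F_in by blast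
 have "Or = (%i. (H ^^ i) (F s)) ` {..<m}"
 proof -
  have "(H ^^ i) (F s) = (H ^^ (i mod m)) (F s)" for i by (rule funpow_mod_eq[OF m(2), symmetric])
  then show ?thesis using m(1) unfolding Or_def by (auto intro!: rev_image_eqI[of "_ mod m"])
 qed
 then have Y_closed: "closed Y" unfolding Y_def using continuous_closed_preimage[OF cont, of Or]
  by (simp add: vimage_def finite_imp_closed)
 have "F s : Or" unfolding Or_def by (rule range_eqI[of _ _ 0]) simp
 then have Y_nonempty: "Y ~= {}" by (auto simp: Y_def)
 have Y_shift: "x+2*pi * of_int j : Y \<longleftrightarrow> x : Y" for x and j :: int by (simp add: Y_def per_int)
 have "c ~: Or"
 proof
  assume "c : Or"
  then obtain i where "(H ^^ i) (F s) = c" by (auto simp: Or_def)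
  moreover have "(H ^^ i) (F x) = c ==> F x = c" for x i
   using H_inj[OF pow_in[OF F_in] c(1)] c(2) by (induction i) auto
  ultimately show False using m(3) by blast
 qed
 moreover have "F u = c" if "u : M" for u by (rule M_fibre[OF that])
 ultimately have "Y Int M = {}" by (auto simp: Y_def)
 have l_Y: "l x : Y \<longleftrightarrow> x : Y" for x
 proof
  assume "l x : Y"
  then obtain i where "H (F x) = (H ^^ i) (F s)" by (auto simp: Y_def Or_def FH)
  also have "\<dots> = (H ^^ (i + m)) (F s)" by (simp add: funpow_add m(2))
  also have "\<dots> = H ((H ^^ (i + m - 1)) (F s))" using m(1) by (cases "i + m") auto
  finally have "F x = (H ^^ (i + m - 1)) (F s)" using H_inj F_in OrS by blast
  then show "x : Y" by (auto simp: Y_def Or_def)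
 next
  assume "x : Y"
  then obtain i where "F x = (H ^^ i) (F s)" by (auto simp: Y_def Or_def)
  then have "F (l x) = (H ^^ Suc i) (F s)" by (simp add: FH)
  then show "l x : Y" unfolding Y_def Or_def by blast
 qed
 show False by (rule no_closed_invariant_set_off_M[OF Y_closed Y_nonempty \<open>Y Int M = {}\<close> Y_shift l_Y])
qed

end

context wheel_map
begin

lemma periodic_point_exists:
 assumes c: "c : S2" "H c = c"
 shows "EX n>=1. EX x k. (l ^^ n) x = x+2*pi * of_int k"
proof (rule ccontr)
 assume none: "~ ?thesis"
 have aperiodic: "lift_iterate n k x ~= x" if "n >= 1" for n k x
 proof
  assume "lift_iterate n k x = x"
  then have "(l ^^ n) x = x+2*pi * of_int (- k)" by (simp add: lift_iterate_def)
  then show False using none that by blast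
 qed
 obtain M where M: "invariant_set M" "M <= {t. F t = c}" "!!S. invariant_set S ==> S <= M ==> S = M"
  by (rule minimal_invariant_subset[OF invariant_fibre[OF c]], rule that)
 interpret N: wheel_minimal_fibre F l l' H H' c M by unfold_locales (use c aperiodic M in auto)
 show False using N.periodic_image_point N.no_periodic_image_point by metis
qed

end

subsection \<open>Attracting fixed points\<close>

definition iterate_limit :: "(real => real) => real => real" where
 "iterate_limit l t = lim (%n. (l ^^ n) t)"

definition forward_gap :: "(real => real) => real => real => bool" where
 "forward_gap l u v \<longleftrightarrow> u < v & l u = u & l v = v & (ALL x. u < x --> x < v --> x < l x)"

definition contracts_at :: "(real => real) => real => real => bool" where
 "contracts_at l x \<epsilon> \<longleftrightarrow> l x = x & (ALL y. 0 < \<bar>y - x\<bar> --> \<bar>y - x\<bar> < \<epsilon> --> \<bar>l y - x\<bar> < \<bar>y - x\<bar>)"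

lemma iterate_tendsto_up:
 fixes l :: "real => real"
 assumes cont: "continuous_on UNIV l" and mono: "strict_mono l" and v: "l v = v" and t: "t < v" and up: "!!x. t <= x ==> x < v ==> x < l x"
 shows "(%n. (l ^^ n) t) \<longlonglongrightarrow> v"
proof -
 have r: "t <= (l ^^ n) t & (l ^^ n) t < v" for n
 proof (induction n)
  case (Suc n)
  have "l ((l ^^ n) t) < l v" using Suc mono by (simp add: strict_mono_less)
  moreover have "(l ^^ n) t < l ((l ^^ n) t)" using up Suc by simp
  ultimately show ?case using Suc v by auto
 qed (use t in simp)
 have inc: "incseq (%n. (l ^^ n) t)" by (rule incseq_SucI) (use up r in \<open>auto intro: less_imp_le\<close>)
 obtain L where L: "(%n. (l ^^ n) t) \<longlonglongrightarrow> L" "ALL n. (l ^^ n) t <= L"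
  using incseq_convergent[OF inc, of v] r by (auto intro: less_imp_le)
 have Lv: "L <= v" using L(1) r by (intro LIMSEQ_le_const2[OF L(1)]) (auto intro: less_imp_le)
 have tL: "t <= L" using L(2) by (metis funpow_0)
 have "isCont l L" using cont by (simp add: continuous_on_eq_continuous_at)
 then have "(%n. l ((l ^^ n) t)) \<longlonglongrightarrow> l L" using L(1) by (rule isCont_tendsto_compose)
 moreover have "(%n. l ((l ^^ n) t)) \<longlonglongrightarrow> L" using LIMSEQ_Suc[OF L(1)] by simp
 ultimately have "l L = L" using LIMSEQ_unique by blast
 then have "L = v" using up[of L] tL Lv by fastforce
 then show ?thesis using L by simp
qed

lemma iterate_tendsto_down:
 fixes l :: "real => real"
 assumes cont: "continuous_on UNIV l" and mono: "strict_mono l" and v: "l v = v" and t: "v < t" and down: "!!x. v < x ==> x <= t ==> l x < x"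
 shows "(%n. (l ^^ n) t) \<longlonglongrightarrow> v"
proof -
 define k where "k = (%x. - l (- x))"
 have "(%n. (k ^^ n) (- t)) \<longlonglongrightarrow> - v"
 proof (rule iterate_tendsto_up)
  show "continuous_on UNIV k" unfolding k_def by (intro continuous_intros continuous_on_compose2[OF cont]) auto
  show "strict_mono k" using mono by (auto simp: k_def strict_mono_def)
  show "x < k x" if "- t <= x" "x < - v" for x using down[of "- x"] that by (simp add: k_def)
 qed (use v t in \<open>auto simp: k_def\<close>)
 moreover have "(k ^^ n) (- t) = - (l ^^ n) t" for n by (induction n) (auto simp: k_def)
 ultimately have "(%n. - (l ^^ n) t) \<longlonglongrightarrow> - v" by simp
 from tendsto_minus[OF this] show ?thesis by simp
qed

lemma contracts_at_iterates:
 assumes cont: "continuous_on UNIV l" and mono: "strict_mono l" and contr: "contracts_at l x \<epsilon>" and y: "\<bar>y - x\<bar> < \<epsilon>"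
 shows "\<bar>(l ^^ k) y - x\<bar> <= \<bar>y - x\<bar>" "(%n. (l ^^ n) y) \<longlonglongrightarrow> x"
proof -
 have closer: "\<bar>l z - x\<bar> < \<bar>z - x\<bar>" if "z ~= x" "\<bar>z - x\<bar> < \<epsilon>" for z
  using contr that by (auto simp: contracts_at_def)
 have x: "l x = x" using contr by (simp add: contracts_at_def)
 show "\<bar>(l ^^ k) y - x\<bar> <= \<bar>y - x\<bar>"
 proof (induction k)
  case (Suc k)
  then show ?case using closer[of "(l ^^ k) y"] y x by (cases "(l ^^ k) y = x") auto
 qed simp
 consider (left) "y < x" | (same) "y = x" | (right) "x < y" by linarith
 then show "(%n. (l ^^ n) y) \<longlonglongrightarrow> x"
 proof cases
  case left
  show ?thesis
  proof (rule iterate_tendsto_up[OF cont mono x left])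
   fix z assume z: "y <= z" "z < x"
   have "l z < x" using strict_monoD[OF mono z(2)] x by simp
   then show "z < l z" using closer[of z] z y by auto
  qed
 next
  case same
  have "(l ^^ n) x = x" for n by (induction n) (auto simp: x)
  then show ?thesis using same by simp
 next
  case right
  show ?thesis
  proof (rule iterate_tendsto_down[OF cont mono x right])
   fix z assume z: "x < z" "z <= y"
   have "x < l z" using strict_monoD[OF mono z(1)] x by simp
   then show "l z < z" using closer[of z] z y by auto
  qed
 qed
qed

lemma dist_cis_le: "dist (cis s) (cis t) <= \<bar>s - t\<bar>"
proof -
 have "dist (cis s) (cis t) = norm (cis t * (cis (s - t) - 1))" by (simp add: dist_norm cis_mult algebra_simps)
 also have "\<dots> = norm (exp (\<i> * of_real (s - t)) - 1)" by (simp add: norm_mult cis_conv_exp)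
 also have "\<dots> = 2 * \<bar>sin ((s - t) / 2)\<bar>" by (rule dist_exp_i_1)
 also have "\<dots> <= 2 * \<bar>(s - t) / 2\<bar>" using abs_sin_x_le_abs_x[of "(s - t) / 2"] by simp
 finally show ?thesis by simp
qed

lemma compact_periodic_image:
 fixes p :: "real => 'a::metric_space"
 assumes cont: "continuous_on UNIV p" and per: "!!t. p (t+2*pi) = p t"
  and X: "closed X" "!!x (k::int). x : X ==> x+2*pi * of_int k : X"
 shows "compact (p ` X)"
proof -
 have "p ` X <= p ` (X Int {0..2*pi})"
 proof
  fix y assume "y : p ` X"
  then obtain x where x: "x : X" "y = p x" by blast
  obtain k where k: "0 <= x+2*pi * of_int k" "x+2*pi * of_int k < 0+2*pi" using real_period_representative by blast
  have "y = p (x+2*pi * of_int k)" using x periodic_shift_int[of p, OF per] by simp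
  moreover have "x+2*pi * of_int k : X Int {0..2*pi}" using X(2) x k by simp
  ultimately show "y : p ` (X Int {0..2*pi})" by (rule image_eqI)
 qed
 then have "p ` X = p ` (X Int {0..2*pi})" by blast
 moreover have "compact (X Int {0..2*pi})" using X(1) by (simp add: closed_Int_compact)
 ultimately show ?thesis using compact_continuous_image continuous_on_subset[OF cont] by (metis subset_UNIV)
qed

lemma periodic_fibre_neighbourhood:
 fixes p :: "real => 'a::metric_space"
 assumes cont: "continuous_on UNIV p" and per: "!!t. p (t+2*pi) = p t" and "\<delta> > 0"
 shows "EX d>0. ALL t. dist (p t) a < d --> (EX x. p x = a & \<bar>t - x\<bar> < \<delta>)"
proof -
 define Y where "Y = {t. ALL x. p x = a --> \<delta> <= \<bar>t - x\<bar>}"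
 have "Y = - (\<Union>x\<in>{x. p x = a}. ball x \<delta>)" by (auto simp: Y_def dist_real_def abs_minus_commute not_less)
 then have "closed Y" by (simp only:) (intro closed_Compl open_UN ballI open_ball)
 moreover have "t+2*pi * of_int k : Y" if "t : Y" for t and k :: int
 proof -
  have "p (x - 2*pi * of_int k) = p x" for x using periodic_shift_int[of p, OF per, of x "- k"] by simp
  then have "\<delta> <= \<bar>t - (x - 2*pi * of_int k)\<bar>" if "p x = a" for x using \<open>t : Y\<close> that by (simp add: Y_def)
  then show ?thesis by (simp add: Y_def algebra_simps)
 qed
 ultimately have "open (- (p ` Y))" using compact_periodic_image[OF cont per] compact_imp_closed by blast
 moreover have "a : - (p ` Y)" using \<open>\<delta> > 0\<close> by (auto simp: Y_def)
 ultimately obtain d where d: "d > 0" "ball a d <= - (p ` Y)" using openE by metis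
 have "EX x. p x = a & \<bar>t - x\<bar> < \<delta>" if "dist (p t) a < d" for t
 proof -
  have "p t : ball a d" using that by (simp add: dist_commute)
  then have "t ~: Y" using d(2) by blast
  then show ?thesis by (auto simp: Y_def not_le)
 qed
 then show ?thesis using d(1) by blast
qed

lemma periodic_uniformly_continuous:
 fixes p :: "real => 'a::metric_space"
 assumes cont: "continuous_on UNIV p" and per: "!!t. p (t+2*pi) = p t" and "e > 0"
 obtains d where "d > 0" "!!s t. \<bar>s - t\<bar> < d ==> dist (p s) (p t) < e"
proof -
 have "uniformly_continuous_on {-1..2*pi+1} p"
  by (intro compact_uniformly_continuous continuous_on_subset[OF cont]) auto
 then obtain d where d: "d > 0" "!!s t. s : {-1..2*pi+1} ==> t : {-1..2*pi+1} ==> dist s t < d ==> dist (p s) (p t) < e"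
  using assms(3) unfolding uniformly_continuous_on_def by metis
 have "dist (p s) (p t) < e" if "\<bar>s - t\<bar> < min d 1" for s t
 proof -
  obtain k where k: "0 <= s+2*pi * of_int k" "s+2*pi * of_int k < 0+2*pi" using real_period_representative by blast
  have "dist (p (s+2*pi * of_int k)) (p (t+2*pi * of_int k)) < e"
   by (rule d(2)) (use k that in \<open>auto simp: dist_real_def\<close>)
  then show ?thesis by (simp add: periodic_shift_int[of p, OF per])
 qed
 then show thesis using that[of "min d 1"] d(1) by auto
qed

lemma attracting_semiconjugate:
 fixes p :: "real => 'a::metric_space"
 assumes p: "continuous_on UNIV p" "!!t. p (t+2*pi) = p t" "p ` UNIV = X" and q: "!!t. q (p t) = p (l t)"
  and l: "continuous_on UNIV l" "strict_mono l" and a: "a : X" and e: "\<epsilon> > 0"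
  and contr: "!!x. p x = a ==> contracts_at l x \<epsilon>"
 shows "attracting X q a"
proof -
 have qk: "(q ^^ k) (p t) = p ((l ^^ k) t)" for k t by (induction k) (auto simp: q)
 have near: "EX d>0. ALL y:X. dist y a < d --> (EX t x. y = p t & p x = a & \<bar>t - x\<bar> < \<delta>)" if "\<delta> > 0" for \<delta>
  using periodic_fibre_neighbourhood[OF p(1,2) that, of a] p(3) by (metis imageE)
 show ?thesis unfolding attracting_def
 proof (intro conjI allI impI a)
  obtain x where "p x = a" using a p(3) by blast
  then show "q a = a" using q[of x] contr[of x] by (simp add: contracts_at_def)
  fix e' :: real assume "e' > 0"
  then obtain \<delta> where \<delta>: "\<delta> > 0" "!!s t. \<bar>s - t\<bar> < \<delta> ==> dist (p s) (p t) < e'"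
   using periodic_uniformly_continuous[OF p(1,2)] by metis
  obtain d where d: "d > 0" "ALL y:X. dist y a < d --> (EX t x. y = p t & p x = a & \<bar>t - x\<bar> < min \<delta> \<epsilon>)"
   using near[of "min \<delta> \<epsilon>"] \<delta>(1) e by auto
  have "dist ((q ^^ k) y) a < e'" if y: "y : X" "dist y a < d" for y k
  proof -
   obtain t x where t: "y = p t" "p x = a" "\<bar>t - x\<bar> < min \<delta> \<epsilon>" using d y by blast
   have "\<bar>(l ^^ k) t - x\<bar> <= \<bar>t - x\<bar>" by (rule contracts_at_iterates(1)[OF l contr]) (use t in auto)
   then show ?thesis using \<delta>(2)[of "(l ^^ k) t" x] t by (simp add: qk)
  qed
  then show "EX d>0. ALL y:X. dist y a < d --> (ALL k. dist ((q ^^ k) y) a < e')" using d(1) by blast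
 next
  obtain d where d: "d > 0" "ALL y:X. dist y a < d --> (EX t x. y = p t & p x = a & \<bar>t - x\<bar> < \<epsilon>)"
   using near[OF e] by blast
  have "(%k. (q ^^ k) y) \<longlonglongrightarrow> a" if y: "y : X" "dist y a < d" for y
  proof -
   obtain t x where t: "y = p t" "p x = a" "\<bar>t - x\<bar> < \<epsilon>" using d y by blast
   have "(%n. (l ^^ n) t) \<longlonglongrightarrow> x" by (rule contracts_at_iterates(2)[OF l contr]) (use t in auto)
   moreover have "isCont p x" using p(1) by (simp add: continuous_on_eq_continuous_at)
   ultimately have "(%n. p ((l ^^ n) t)) \<longlonglongrightarrow> p x" by (rule isCont_tendsto_compose[rotated])
   then show ?thesis using t by (simp add: qk)
  qed
  then show "EX d>0. ALL y:X. dist y a < d --> (%k. (q ^^ k) y) \<longlonglongrightarrow> a" using d(1) by blast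
 qed
qed

lemma fixed_point_iterates_close:
 fixes H :: "'a::metric_space => 'a"
 assumes cont: "continuous_on X H" and im: "H ` X <= X" and x: "x : X" "H x = x" and "e > 0"
 shows "EX d>0. ALL i<n. ALL y:X. dist y x < d --> dist ((H ^^ i) y) x < e"
proof (induction n)
 case (Suc n)
 have into: "(H ^^ i) y : X" if "y : X" for i y using that im by (induction i) auto
 have "continuous_on X (H ^^ n)"
 proof (induction n)
  case (Suc n)
  have "continuous_on X (%y. H ((H ^^ n) y))" by (rule continuous_on_compose2[OF cont Suc]) (use into in auto)
  then show ?case by (simp add: o_def)
 qed (simp add: id_def)
 moreover have "(H ^^ n) x = x" by (induction n) (auto simp: x)
 ultimately obtain d where d: "d > 0" "ALL y:X. dist y x < d --> dist ((H ^^ n) y) x < e"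
  using x(1) \<open>e > 0\<close> unfolding continuous_on_iff by metis
 obtain d' where "d' > 0" "ALL i<n. ALL y:X. dist y x < d' --> dist ((H ^^ i) y) x < e" using Suc by blast
 then show ?case using d by (intro exI[of _ "min d d'"]) (auto simp: less_Suc_eq)
qed (auto intro: exI[of _ 1])

lemma attracting_power:
 fixes H :: "'a::metric_space => 'a"
 assumes A: "attracting X (H ^^ n) x" and n: "n >= 1" and cont: "continuous_on X H" and im: "H ` X <= X" and fx: "H x = x"
 shows "attracting X H x"
proof -
 have xX: "x : X" using A by (simp add: attracting_def)
 have split: "(H ^^ k) y = (H ^^ (k mod n)) (((H ^^ n) ^^ (k div n)) y)" for k y
 proof -
  have "H ^^ k = H ^^ (k mod n + n * (k div n))" by simp
  also have "\<dots> = H ^^ (k mod n) \<circ> (H ^^ n) ^^ (k div n)" by (simp only: funpow_add funpow_mult)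
  finally show ?thesis by (metis o_apply)
 qed
 have into: "((H ^^ n) ^^ k) y : X" if "y : X" for k y
 proof -
  have "(H ^^ i) y : X" if "y : X" for i y using that im by (induction i) auto
  then show ?thesis using that by (induction k) auto
 qed
 have close: "EX d>0. ALL k y. y : X --> dist (((H ^^ n) ^^ (k div n)) y) x < d --> dist ((H ^^ k) y) x < e" if "e > 0" for e
 proof -
  obtain d where d: "d > 0" "ALL i<n. ALL y:X. dist y x < d --> dist ((H ^^ i) y) x < e"
   using fixed_point_iterates_close[OF cont im xX fx \<open>e > 0\<close>] by blast
  have "dist ((H ^^ k) y) x < e" if "y : X" "dist (((H ^^ n) ^^ (k div n)) y) x < d" for k y
   unfolding split[of k y] using d(2) into[OF that(1)] that(2) n by simp
  then show ?thesis using d(1) by blast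
 qed
 show ?thesis unfolding attracting_def
 proof (intro conjI allI impI xX fx)
  fix e :: real assume "e > 0"
  then obtain d1 where d1: "d1 > 0" "ALL k y. y : X --> dist (((H ^^ n) ^^ (k div n)) y) x < d1 --> dist ((H ^^ k) y) x < e"
   using close by blast
  obtain d where "d > 0" "ALL y:X. dist y x < d --> (ALL k. dist (((H ^^ n) ^^ k) y) x < d1)"
   using A d1(1) unfolding attracting_def by blast
  then show "EX d>0. ALL y:X. dist y x < d --> (ALL k. dist ((H ^^ k) y) x < e)" using d1(2) by blast
 next
  obtain d where d: "d > 0" "ALL y:X. dist y x < d --> (%k. ((H ^^ n) ^^ k) y) \<longlonglongrightarrow> x"
   using A unfolding attracting_def by blast
  have "(%k. (H ^^ k) y) \<longlonglongrightarrow> x" if y: "y : X" "dist y x < d" for y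
  proof (rule metric_LIMSEQ_I)
   fix e :: real assume "e > 0"
   then obtain d1 where d1: "d1 > 0" "ALL k y. y : X --> dist (((H ^^ n) ^^ (k div n)) y) x < d1 --> dist ((H ^^ k) y) x < e"
    using close by blast
   obtain N where N: "!!k. k >= N ==> dist (((H ^^ n) ^^ k) y) x < d1" using d(2) y d1(1) metric_LIMSEQ_D by blast
   have "dist ((H ^^ k) y) x < e" if "k >= N * n" for k
    using d1(2) y(1) N[of "k div n"] that n by (simp add: less_eq_div_iff_mult_less_eq)
   then show "EX no. ALL k>=no. dist ((H ^^ k) y) x < e" by blast
  qed
  then show "EX d>0. ALL y:X. dist y x < d --> (%k. (H ^^ k) y) \<longlonglongrightarrow> x" using d(1) by blast
 qed
qed

lemma attracting_not_repelling:
 fixes g :: "'a::metric_space => 'a"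
 assumes A: "attracting X g x" and R: "repelling X g x" and inj: "inj_on g X" and im: "g ` X <= X"
  and limit: "!!d. d > 0 ==> EX y:X. y ~= x & dist y x < d"
 shows False
proof -
 obtain d where d: "d > 0" "ALL y:X. dist y x < d --> (%k. (g ^^ k) y) \<longlonglongrightarrow> x"
  using A unfolding attracting_def by blast
 obtain y where y: "y : X" "y ~= x" "dist y x < d" using limit[OF d(1)] by blast
 have "dist y x > 0" using y by simp
 then obtain d' where d': "d' > 0" "ALL z:X. dist z x < d' --> (ALL k. dist ((inv_into X g ^^ k) z) x < dist y x)"
  using R unfolding repelling_def attracting_def by blast
 have "(%k. (g ^^ k) y) \<longlonglongrightarrow> x" using d y by blast
 then obtain k where k: "dist ((g ^^ k) y) x < d'" using d'(1) by (meson metric_LIMSEQ_D order_refl)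
 have pin: "(g ^^ i) y : X" for i using y im by (induction i) auto
 have "(inv_into X g ^^ i) ((g ^^ i) y) = y" for i
 proof (induction i)
  case (Suc i)
  have "(inv_into X g ^^ Suc i) ((g ^^ Suc i) y) = (inv_into X g ^^ i) (inv_into X g (g ((g ^^ i) y)))"
   by (simp add: funpow_swap1)
  then show ?case using Suc inv_into_f_f[OF inj pin] by simp
 qed simp
 then have "dist y x < dist y x" using d'(2) pin k by metis
 then show False by simp
qed


lemma attracting_cong:
 assumes into: "!!y. y : X ==> g y : X" and eq: "!!y. y : X ==> g' y = g y" and A: "attracting X g x"
 shows "attracting X g' x"
proof -
 have "(g' ^^ k) y = (g ^^ k) y & (g ^^ k) y : X" if "y : X" for k y using that by (induction k) (auto simp: into eq)
 then show ?thesis using A eq unfolding attracting_def by simp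
qed

lemma iterate_limit_commute:
 assumes commute: "!!s. m (L s) = L (m s)" and L: "continuous_on UNIV L" and lim: "(%n. (m ^^ n) t) \<longlonglongrightarrow> iterate_limit m t"
 shows "iterate_limit m (L t) = L (iterate_limit m t)"
proof -
 have "isCont L x" for x using L by (simp add: continuous_on_eq_continuous_at)
 then have "(%n. L ((m ^^ n) t)) \<longlonglongrightarrow> L (iterate_limit m t)" using lim by (rule isCont_tendsto_compose)
 moreover have "(m ^^ n) (L t) = L ((m ^^ n) t)" for n by (induction n) (simp_all add: commute)
 ultimately show ?thesis unfolding iterate_limit_def[of m "L t"] by (intro limI) simp
qed

subsection \<open>Source-sink dynamics\<close>

context wheel_map
begin

lemma l'_mono: "strict_mono l'" and l'_cont: "continuous_on UNIV l'" and l'_per: "l' (t+2*pi) = l' t+2*pi"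
 using wheel_map_inverse by (auto simp: wheel_map_def wheel_map_axioms_def)

lemma l'_fix: "l' x = x \<longleftrightarrow> l x = x" using l'l ll' by metis

lemma fix_per: "l t = t ==> l (t+2*pi * of_int k) = t+2*pi * of_int k"
 by (simp add: l_per_int)

lemma closed_fix: "closed {t. l t = t}"
proof -
 have "closed {t. l t - t = 0}"
  using continuous_closed_preimage_constant[of UNIV "%t. l t - t" 0] by (simp add: continuous_intros l_cont)
 then show ?thesis by simp
qed

lemma fixed_interval_invariant:
 assumes "l u = u" "l v = v" "u < t" "t < v"
 shows "u < (l ^^ n) t" "(l ^^ n) t < v" "u < (l' ^^ n) t" "(l' ^^ n) t < v"
proof -
 have fixed': "l' u = u" "l' v = v" using assms by (simp_all add: l'_fix)
 show "u < (l ^^ n) t" "(l ^^ n) t < v"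
  by (induction n) (use assms l_less[of u] l_less[of _ v] in auto)
 show "u < (l' ^^ n) t" "(l' ^^ n) t < v"
  by (induction n) (use assms fixed' strict_mono_less[OF l'_mono, of u] strict_mono_less[OF l'_mono, of _ v] in auto)
qed

lemma forward_gap_inverse:
 assumes gap: "forward_gap l u v" and t: "u < t" "t < v" shows "l' t < t"
proof -
 have "u < l' t" "l' t < v" using fixed_interval_invariant[of u v t 1] gap t by (auto simp: forward_gap_def)
 then show ?thesis using gap by (auto simp: forward_gap_def ll' dest: spec[of _ "l' t"])
qed

lemma forward_gaps_contract:
 assumes gaps: "forward_gap l u x" "forward_gap l' x v" and wide: "\<epsilon> <= x - u" "\<epsilon> <= v - x"
 shows "contracts_at l x \<epsilon>"
proof -
 have ends: "l u = u" "l v = v" "l x = x" using gaps by (auto simp: forward_gap_def l'_fix)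
 show ?thesis unfolding contracts_at_def
 proof (intro conjI allI impI ends(3))
  fix y assume y: "0 < \<bar>y - x\<bar>" "\<bar>y - x\<bar> < \<epsilon>"
  consider (left) "u < y" "y < x" | (right) "x < y" "y < v" using y wide by fastforce
  then show "\<bar>l y - x\<bar> < \<bar>y - x\<bar>"
  proof cases
   case left
   then have "y < l y" "l y < x" using gaps(1) fixed_interval_invariant(2)[OF ends(1,3), of y 1] by (auto simp: forward_gap_def)
   then show ?thesis by simp
  next
   case right
   then have "l y < y" "x < l y"
    using wheel_map.forward_gap_inverse[OF wheel_map_inverse gaps(2)] fixed_interval_invariant(1)[OF ends(3,2), of y 1] by auto
   then show ?thesis by simp
  qed
 qed
qed

lemma forward_gap_limits:
 assumes gap: "forward_gap l u v" and t: "u < t" "t < v"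
 shows "(%n. (l ^^ n) t) \<longlonglongrightarrow> v" "(%n. (l' ^^ n) t) \<longlonglongrightarrow> u" "iterate_limit l t = v" "iterate_limit l' t = u"
proof -
 have fixed': "l' u = u" "l' v = v" using gap by (simp_all add: forward_gap_def l'_fix)
 show up: "(%n. (l ^^ n) t) \<longlonglongrightarrow> v"
  by (rule iterate_tendsto_up[OF l_cont l_mono _ t(2)]) (use gap t in \<open>auto simp: forward_gap_def\<close>)
 show down: "(%n. (l' ^^ n) t) \<longlonglongrightarrow> u"
  by (rule iterate_tendsto_down[OF l'_cont l'_mono fixed'(1) t(1)]) (use forward_gap_inverse[OF gap] t in auto)
 show "iterate_limit l t = v" "iterate_limit l' t = u" using limI[OF up] limI[OF down] by (simp_all add: iterate_limit_def)
qed

lemma forward_gapI: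
 assumes ends: "l u = u" "l v = v" and t: "u < t" "t < v" "t < l t" and free: "!!x. u < x ==> x < v ==> l x ~= x"
 shows "forward_gap l u v"
proof -
 have "x < l x" if x: "u < x" "x < v" for x
 proof (rule ccontr)
  assume "~ x < l x"
  define d where "d x = l x - x" for x
  have "continuous_on A d" for A unfolding d_def by (intro continuous_intros continuous_on_subset[OF l_cont]) auto
  moreover have "d x <= 0" "0 <= d t" using \<open>~ x < l x\<close> t by (auto simp: d_def)
  ultimately have "EX y. (x <= y & y <= t | t <= y & y <= x) & d y = 0"
   using IVT'[of d x 0 t] IVT2'[of d x 0 t] by (metis linear)
  then show False using free t x by (force simp: d_def)
 qed
 then show ?thesis using ends t by (auto simp: forward_gap_def)
qed

end

locale wheel_fix = wheel_map +
 assumes fixp: "EX x. l x = x" and nontriv: "EX x. l x ~= x"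
begin

lemma wheel_fix_inverse: "wheel_fix F l' l H' H"
 unfolding wheel_fix_def wheel_fix_axioms_def using wheel_map_inverse fixp nontriv by (simp add: l'_fix)

lemma fixed_gap:
 assumes "l t ~= t"
 obtains u v where "u < t" "t < v" "v <= u+2*pi" "l u = u" "l v = v" "!!x. u < x ==> x < v ==> l x ~= x"
  "forward_gap l u v | forward_gap l' u v"
proof -
 have nonempty: "{t. l t = t} ~= {}" and t: "t ~: {t. l t = t}" using fixp assms by auto
 obtain u v where uv: "u : {t. l t = t}" "v : {t. l t = t}" "u < t" "t < v" "v <= u+2*pi"
   "!!x. u < x ==> x < v ==> x ~: {t. l t = t}"
  by (rule closed_periodic_gap[OF closed_fix nonempty _ t]) (simp add: fix_per, blast)
 have "forward_gap l u v | forward_gap l' u v"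
 proof (cases "t < l t")
  case True
  then show ?thesis using uv by (intro disjI1 forward_gapI[of u v t]) auto
 next
  case False
  then have "l t < t" using assms by simp
  then have "t < l' t" using strict_monoD[OF l'_mono, of "l t" t] by (simp add: l'l)
  then show ?thesis using uv by (intro disjI2 wheel_map.forward_gapI[OF wheel_map_inverse, of u v t]) (auto simp: l'_fix)
 qed
 then show thesis using that uv by auto
qed

lemma iterate_limit:
 assumes "l t ~= t"
 shows "(%n. (l ^^ n) t) \<longlonglongrightarrow> iterate_limit l t" "l (iterate_limit l t) = iterate_limit l t"
proof -
 obtain u v where uv: "u < t" "t < v" "l u = u" "l v = v" "forward_gap l u v | forward_gap l' u v"
  by (rule fixed_gap[OF assms], rule that)
 have "(%n. (l ^^ n) t) \<longlonglongrightarrow> v & iterate_limit l t = v | (%n. (l ^^ n) t) \<longlonglongrightarrow> u & iterate_limit l t = u"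
  using uv(5) forward_gap_limits[of u v t] wheel_map.forward_gap_limits[OF wheel_map_inverse, of u v t] uv(1,2) by blast
 then show "(%n. (l ^^ n) t) \<longlonglongrightarrow> iterate_limit l t" "l (iterate_limit l t) = iterate_limit l t" using uv by auto
qed

lemma F_limit:
 assumes "l t ~= t" shows "(%n. (H ^^ n) (F t)) \<longlonglongrightarrow> F (iterate_limit l t)"
proof -
 have "isCont F x" for x using cont by (simp add: continuous_on_eq_continuous_at)
 then have "(%n. F ((l ^^ n) t)) \<longlonglongrightarrow> F (iterate_limit l t)"
  using iterate_limit(1)[OF assms] by (rule isCont_tendsto_compose)
 then show ?thesis by (simp add: pow_FH)
qed

lemma same_image_same_limit:
 assumes "l t ~= t" "l t' ~= t'" "F t = F t'"
 shows "F (iterate_limit l t) = F (iterate_limit l t')"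
 using F_limit[OF assms(1)] F_limit[OF assms(2)] assms(3) LIMSEQ_unique by metis

lemma H_fixed_limit:
 assumes "l t ~= t" "H (F t) = F t"
 shows "F (iterate_limit l t) = F t"
proof -
 have "(H ^^ n) (F t) = F t" for n by (induction n) (auto simp: assms)
 then have "(%n::nat. F t) \<longlonglongrightarrow> F (iterate_limit l t)" using F_limit[OF assms(1)] by simp
 then show ?thesis by (simp add: LIMSEQ_const_iff)
qed

definition basin :: "real^3 => real^3 => real set" where
 "basin a r = {t. l t ~= t & F (iterate_limit l t) = a & F (iterate_limit l' t) = r}"

lemma basin_gap:
 assumes "l t ~= t"
 obtains u v where "u < t" "t < v" "{u, v} = {iterate_limit l t, iterate_limit l' t}"
  "!!x. u < x ==> x < v ==> l x ~= x" "{u<..<v} <= basin a r | {u<..<v} Int basin a r = {}"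
proof -
 obtain u v where uv: "u < t" "t < v" "!!x. u < x ==> x < v ==> l x ~= x" "forward_gap l u v | forward_gap l' u v"
  by (rule fixed_gap[OF assms], rule that)
 have "(ALL x. u < x --> x < v --> iterate_limit l x = v & iterate_limit l' x = u) |
   (ALL x. u < x --> x < v --> iterate_limit l x = u & iterate_limit l' x = v)"
  using uv(4) forward_gap_limits(3,4)[of u v] wheel_map.forward_gap_limits(3,4)[OF wheel_map_inverse, of u v] by blast
 then have ends: "{u, v} = {iterate_limit l t, iterate_limit l' t}"
  and same: "!!x. u < x ==> x < v ==> iterate_limit l x = iterate_limit l t & iterate_limit l' x = iterate_limit l' t"
  using uv(1,2) by auto
 have "x : basin a r \<longleftrightarrow> t : basin a r" if "u < x" "x < v" for x
  using same[OF that] uv(3)[OF that] assms by (simp add: basin_def)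
 then have "{u<..<v} <= basin a r | {u<..<v} Int basin a r = {}" by (cases "t : basin a r") auto
 then show thesis using that[OF uv(1,2) ends uv(3)] by blast
qed

lemma open_basin: "open (basin a r)"
proof (rule openI)
 fix t assume t: "t : basin a r"
 then have nonfixed: "l t ~= t" by (simp add: basin_def)
 obtain u v where "u < t" "t < v" "{u<..<v} <= basin a r | {u<..<v} Int basin a r = {}"
  by (rule basin_gap[OF nonfixed, of a r], rule that)
 moreover from this have "t : {u<..<v}" by simp
 ultimately have "t : {u<..<v}" "{u<..<v} <= basin a r" using t by blast+
 then show "EX e>0. ball t e <= basin a r" by (meson open_greaterThanLessThan openE subset_trans)
qed

lemma open_other_basins: "open {t. l t ~= t & t ~: basin a r}"
proof (rule openI)
 fix t assume t: "t : {t. l t ~= t & t ~: basin a r}"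
 then have nonfixed: "l t ~= t" by simp
 obtain u v where "u < t" "t < v" "!!x. u < x ==> x < v ==> l x ~= x"
  "{u<..<v} <= basin a r | {u<..<v} Int basin a r = {}"
  by (rule basin_gap[OF nonfixed, of a r], rule that)
 moreover from this have "t : {u<..<v}" by simp
 ultimately have "t : {u<..<v}" "{u<..<v} <= {t. l t ~= t & t ~: basin a r}" using t by auto
 then show "EX e>0. ball t e <= {t. l t ~= t & t ~: basin a r}" by (meson open_greaterThanLessThan openE subset_trans)
qed

lemma same_image_basin:
 assumes "t : basin a r" "l t' ~= t'" "F t' = F t" shows "t' : basin a r"
 using same_image_same_limit[of t' t] wheel_fix.same_image_same_limit[OF wheel_fix_inverse, of t' t] assms
 by (auto simp: basin_def l'_fix)

lemma basin_shift: "t+2*pi * of_int k : basin a r \<longleftrightarrow> t : basin a r"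
proof -
 have "t+2*pi * of_int k : basin a r" if "t : basin a r" for t and k :: int
  by (rule same_image_basin[OF that]) (use that in \<open>auto simp: basin_def l_per_int per_int\<close>)
 from this[of t k] this[of "t+2*pi * of_int k" "- k"] show ?thesis by auto
qed

lemma closure_basin_fixed:
 assumes t: "t : closure (basin a r)" "l t = t" shows "F t : {a, r}"
proof -
 have "EX y:{s. F s : {a, r}}. dist y t < e" if "e > 0" for e
 proof -
  obtain b where b: "b : basin a r" "dist b t < e" using t \<open>e > 0\<close> closure_approachable by blast
  then have lb: "l b ~= b" "F (iterate_limit l b) = a" "F (iterate_limit l' b) = r" by (auto simp: basin_def)
  obtain u v where uv: "u < b" "b < v" "{u, v} = {iterate_limit l b, iterate_limit l' b}" "!!x. u < x ==> x < v ==> l x ~= x"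
   by (rule basin_gap[OF lb(1), of a r], rule that)
  have "F u : {a, r}" "F v : {a, r}" using uv(3) lb by (auto simp: doubleton_eq_iff)
  moreover have "t <= u | v <= t" using uv(4) t(2) by force
  then have "dist u t < e | dist v t < e" using b uv by (auto simp: dist_real_def)
  ultimately show ?thesis by auto
 qed
 then have "t : closure {s. F s : {a, r}}" by (simp add: closure_approachable)
 moreover have "closed {s. F s : {a, r}}"
  using continuous_closed_preimage[OF cont, of "{a, r}"] by (simp add: vimage_def)
 ultimately show ?thesis by simp
qed

lemma basin_images_meet:
 assumes t: "t : closure (basin a r)" "t' ~: basin a r" "F t = F t'" shows "F t : {a, r}"
proof (rule ccontr)
 assume off: "F t ~: {a, r}"
 then have nonfixed: "l t ~= t" using closure_basin_fixed t by blast
 have "closure (basin a r) Int {t. l t ~= t & t ~: basin a r} = {}"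
  using open_Int_closure_eq_empty[OF open_other_basins, of a r "basin a r"] by blast
 then have basin: "t : basin a r" using t nonfixed by blast
 show False
 proof (cases "l t' = t'")
  case True
  then have "H (F t) = F t" using t(3) FH[of t'] by simp
  then show False using H_fixed_limit[OF nonfixed] basin off by (simp add: basin_def)
 next
  case False
  then show False using same_image_basin[OF basin] t by simp
 qed
qed

lemma basin_image_complement:
 assumes b: "b : basin a r" and t: "t ~: basin a r" shows "F t : {a, r}"
proof -
 let ?C1 = "F ` closure (basin a r)" and ?C2 = "F ` (- basin a r)" and ?S = "S2 - {a, r}"
 have a: "a : S2" using b F_in by (auto simp: basin_def)
 have "(%x. x+2*pi * of_int k) ` closure (basin a r) <= closure (basin a r)" for k :: int
  by (rule image_closure_subset) (use closure_subset[of "basin a r"] in \<open>auto intro!: continuous_intros simp: basin_shift\<close>)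
 then have C1: "compact ?C1" by (intro compact_periodic_image[OF cont per]) auto
 have C2: "compact ?C2" using open_basin by (intro compact_periodic_image[OF cont per]) (auto simp: basin_shift)
 have disjoint: "?C1 Int ?C2 Int ?S = {}" using basin_images_meet by blast
 have cover: "?S <= ?C1 Un ?C2" using surj closure_subset[of "basin a r"] by blast
 have "?C1 Int ?S = {} | ?C2 Int ?S = {}"
  by (rule connected_closedD[OF connected_S2_minus_two[OF a] disjoint cover]) (use C1 C2 compact_imp_closed in auto)
 moreover have "?C1 Int ?S ~= {}"
 proof -
  have nonfixed: "l b ~= b" using b by (simp add: basin_def)
  obtain u v where uv: "u < b" "b < v" "{u<..<v} <= basin a r | {u<..<v} Int basin a r = {}"
   by (rule basin_gap[OF nonfixed, of a r], rule that)
  then obtain x where "u < x" "x < v" "F x ~: {a, r}"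
   using interval_image_not_subset_finite[of u v "{a, r}"] less_trans[OF uv(1,2)] by auto
  moreover have "b : {u<..<v}" "x : {u<..<v}" using uv calculation by simp_all
  then have "x : basin a r" using uv(3) b by blast
  ultimately have "F x : ?C1 Int ?S" using closure_subset[of "basin a r"] F_in by blast
  then show ?thesis by blast
 qed
 ultimately show ?thesis using t F_in by blast
qed

end

locale wheel_source_sink = wheel_fix +
 fixes a r :: "real^3"
 assumes limits: "l t ~= t ==> F (iterate_limit l t) = a & F (iterate_limit l' t) = r" and fixed: "l t = t ==> F t : {a, r}"

lemma (in wheel_fix) source_sink: obtains a r where "wheel_source_sink F l l' H H' a r"
proof -
 obtain t1 where "l t1 ~= t1" using nontriv by blast
 then obtain a r where t1: "t1 : basin a r" by (auto simp: basin_def)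
 note outside = basin_image_complement[OF t1]
 have all: "t : basin a r" if "l t ~= t" for t
 proof (rule ccontr)
  assume t: "t ~: basin a r"
  obtain u v where uv: "u < t" "t < v" "{u<..<v} <= basin a r | {u<..<v} Int basin a r = {}"
   by (rule basin_gap[OF \<open>l t ~= t\<close>, of a r], rule that)
  then obtain x where "u < x" "x < v" "F x ~: {a, r}"
   using interval_image_not_subset_finite[of u v "{a, r}"] less_trans[OF uv(1,2)] by auto
  moreover have "t : {u<..<v}" "x : {u<..<v}" using uv calculation by simp_all
  then have "x ~: basin a r" using uv(3) t by blast
  ultimately show False using outside by blast
 qed
 have "wheel_source_sink F l l' H H' a r"
  by unfold_locales (use all outside in \<open>auto simp: basin_def\<close>)
 then show thesis by (rule that)
qed

context wheel_source_sink
begin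

lemma poles: "a : S2" "r : S2" "H a = a" "H r = r"
proof -
 obtain t where t: "l t ~= t" using nontriv by blast
 have "l (iterate_limit l t) = iterate_limit l t" "l (iterate_limit l' t) = iterate_limit l' t"
  using iterate_limit(2)[OF t] wheel_fix.iterate_limit(2)[OF wheel_fix_inverse, of t] t by (simp_all add: l'_fix)
 then show "a : S2" "r : S2" "H a = a" "H r = r" using limits[OF t] F_in FH by metis+
qed

lemma wheel_source_sink_inverse: "wheel_source_sink F l' l H' H r a"
proof -
 interpret I: wheel_fix F l' l H' H by (rule wheel_fix_inverse)
 show ?thesis by unfold_locales (use limits fixed in \<open>auto simp: l'_fix\<close>)
qed

lemma H_fixed_pole:
 assumes "y : S2" shows "H y = y \<longleftrightarrow> y : {a, r}"
proof
 assume y: "H y = y"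
 obtain t where t: "y = F t" using assms surj by (metis imageE)
 show "y : {a, r}"
 proof (cases "l t = t")
  case True then show ?thesis using fixed t by blast
 next
  case False
  then have "F (iterate_limit l t) = F t" using y t by (intro H_fixed_limit) auto
  then show ?thesis using limits[OF False] t by simp
 qed
qed (use poles in auto)

end

locale wheel_hyperbolic = wheel_source_sink +
 assumes distinct: "a ~= r"
begin

lemma wheel_hyperbolic_inverse: "wheel_hyperbolic F l' l H' H r a"
 using wheel_source_sink_inverse distinct by (simp add: wheel_hyperbolic_def wheel_hyperbolic_axioms_def)

lemma pole_fixed: "l t = t \<longleftrightarrow> F t : {a, r}"
proof
 assume pole: "F t : {a, r}"
 show "l t = t"
 proof (rule ccontr)
  assume t: "l t ~= t"
  then have "l' t ~= t" by (simp add: l'_fix)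
  moreover have "H (F t) = F t" using pole poles by auto
  moreover then have "H' (F t) = F t" using H'H F_in by metis
  ultimately have "F (iterate_limit l t) = F (iterate_limit l' t)"
   using H_fixed_limit[OF t] wheel_fix.H_fixed_limit[OF wheel_fix_inverse, of t] by simp
  then show False using limits[OF t] distinct by simp
 qed
qed (rule fixed)

lemma forward_gap_poles:
 assumes gap: "forward_gap l u v" shows "F u = r" "F v = a"
proof -
 define t where "t = (u + v) / 2"
 have t: "u < t" "t < v" using gap by (auto simp: t_def forward_gap_def)
 have "l t ~= t" using gap t by (auto simp: forward_gap_def)
 then show "F u = r" "F v = a" using limits[of t] forward_gap_limits[OF gap t] by auto
qed

lemma backward_gap_poles: "forward_gap l' u v ==> F u = a" "forward_gap l' u v ==> F v = r"
 using wheel_hyperbolic.forward_gap_poles[OF wheel_hyperbolic_inverse] by auto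

text \<open>Between two fixed points \<open>F\<close> takes both values \<open>a\<close> and \<open>r\<close>, so uniform continuity keeps them apart.\<close>

lemma fixed_points_separated:
 obtains \<epsilon> where "\<epsilon> > 0" "!!x y. l x = x ==> l y = y ==> \<bar>x - y\<bar> < \<epsilon> ==> x = y"
proof -
 obtain \<epsilon> where \<epsilon>: "\<epsilon> > 0" "!!s t. \<bar>s - t\<bar> < \<epsilon> ==> dist (F s) (F t) < dist a r"
  using periodic_uniformly_continuous[OF cont per, of "dist a r"] distinct by auto
 have separated: "x + \<epsilon> <= y" if xy: "l x = x" "l y = y" "x < y" for x y
 proof -
  obtain t where t: "x < t" "t < y" "l t ~= t"
   using interval_image_not_subset_finite[OF xy(3), of "{a, r}"] fixed by blast
  obtain u v where uv: "u < t" "t < v" "!!x. u < x ==> x < v ==> l x ~= x" "forward_gap l u v | forward_gap l' u v"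
   by (rule fixed_gap[OF t(3)], rule that)
  have "x <= u" "v <= y" using uv(3)[of x] uv(3)[of y] uv t xy by force+
  moreover have "dist (F u) (F v) = dist a r"
   using uv(4) forward_gap_poles[of u v] backward_gap_poles[of u v] by (auto simp: dist_commute)
  then have "~ \<bar>u - v\<bar> < \<epsilon>" using \<epsilon>(2)[of u v] by auto
  ultimately show ?thesis using uv by linarith
 qed
 show thesis
 proof (rule that[OF \<epsilon>(1)])
  fix x y assume "l x = x" "l y = y" "\<bar>x - y\<bar> < \<epsilon>"
  then show "x = y" using separated[of x y] separated[of y x] by (cases x y rule: linorder_cases) auto
 qed
qed

lemma sink_gaps:
 assumes x: "F x = a"
 obtains u v where "forward_gap l u x" "forward_gap l' x v" "x - 2*pi <= u" "v <= x+2*pi"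
proof -
 have lx: "l x = x" using x pole_fixed by simp
 obtain \<epsilon> where \<epsilon>: "\<epsilon> > 0" "!!x y. l x = x ==> l y = y ==> \<bar>x - y\<bar> < \<epsilon> ==> x = y" by (rule fixed_points_separated, rule that)
 have nonfixed: "l y ~= y" if "y ~= x" "\<bar>x - y\<bar> < \<epsilon>" for y using \<epsilon>(2)[OF lx, of y] that by auto
 have "l (x - \<epsilon> / 2) ~= x - \<epsilon> / 2" "l (x + \<epsilon> / 2) ~= x + \<epsilon> / 2" using \<epsilon>(1) nonfixed[of "x - \<epsilon> / 2"] nonfixed[of "x + \<epsilon> / 2"] by auto
 obtain u1 v1 where gap1: "u1 < x - \<epsilon> / 2" "x - \<epsilon> / 2 < v1" "v1 <= u1+2*pi" "l v1 = v1" "!!y. u1 < y ==> y < v1 ==> l y ~= y"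
   "forward_gap l u1 v1 | forward_gap l' u1 v1"
  by (rule fixed_gap[OF \<open>l (x - \<epsilon> / 2) ~= x - \<epsilon> / 2\<close>], rule that)
 have "v1 <= x" using gap1(5)[of x] gap1(1) lx \<epsilon>(1) by force
 then have v1: "v1 = x" using nonfixed[of v1] gap1(2,4) \<epsilon>(1) by (cases "v1 = x") auto
 obtain u2 v2 where gap2: "u2 < x + \<epsilon> / 2" "x + \<epsilon> / 2 < v2" "v2 <= u2+2*pi" "l u2 = u2" "!!y. u2 < y ==> y < v2 ==> l y ~= y"
   "forward_gap l u2 v2 | forward_gap l' u2 v2"
  by (rule fixed_gap[OF \<open>l (x + \<epsilon> / 2) ~= x + \<epsilon> / 2\<close>], rule that)
 have "x <= u2" using gap2(5)[of x] gap2(2) lx \<epsilon>(1) by force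
 then have u2: "u2 = x" using nonfixed[of u2] gap2(1,4) \<epsilon>(1) by (cases "u2 = x") auto
 have "forward_gap l u1 x" using gap1(6) backward_gap_poles(2)[of u1 v1] x distinct unfolding v1 by auto
 moreover have "forward_gap l' x v2" using gap2(6) forward_gap_poles(1)[of u2 v2] x distinct unfolding u2 by auto
 ultimately show thesis using that gap1(3) gap2(3) v1 u2 by simp
qed

lemma sink_contracts: obtains \<epsilon> where "\<epsilon> > 0" "!!x. F x = a ==> contracts_at l x \<epsilon>"
proof -
 obtain \<epsilon> where \<epsilon>: "\<epsilon> > 0" "!!x y. l x = x ==> l y = y ==> \<bar>x - y\<bar> < \<epsilon> ==> x = y" by (rule fixed_points_separated, rule that)
 have "contracts_at l x \<epsilon>" if x: "F x = a" for x
 proof -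
  obtain u v where gaps: "forward_gap l u x" "forward_gap l' x v" by (rule sink_gaps[OF x], rule that)
  then have "u < x" "x < v" "l u = u" "l v = v" "l x = x" by (auto simp: forward_gap_def l'_fix)
  then have "\<epsilon> <= x - u" "\<epsilon> <= v - x" using \<epsilon>(2)[of u x] \<epsilon>(2)[of x v] by force+
  then show ?thesis by (rule forward_gaps_contract[OF gaps])
 qed
 then show thesis using that \<epsilon>(1) by blast
qed

end

subsection \<open>Source and sink with the same image\<close>

context wheel
begin

lemma dist_interval_image:
 assumes "c ~: F ` {s..t}" shows "EX \<eta>>0. ALL x:{s..t}. \<eta> <= dist (F x) c"
 using separate_point_closed[OF closed_im assms] by (auto simp: dist_commute)

lemma halves_accumulate_at_endpoint:
 assumes s: "u < s" "s < v" "v <= u+2*pi" and c: "F u = c" "F v = c" "F s ~= c"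
 shows "c islimpt (F ` {u..s} Int F ` {s..v})"
proof (rule connected_imp_perfect)
 show "connected (F ` {u..s} Int F ` {s..v})"
 proof (cases "v < u+2*pi")
  case True then show ?thesis using connected_Int_consecutive s by simp
 next
  case False
  then have v: "v = u+2*pi" using s by simp
  have "closed_disk (F ` {u..s})" using disk s v by simp
  then have "connected (bdry (F ` {u..s}))" by (rule closed_disk_boundary_connected)
  then show ?thesis using bdry_eq[of u s] s v by simp
 qed
 show c_in: "c : F ` {u..s} Int F ` {s..v}" using endpoint_mem(1)[of u s] endpoint_mem(2)[of s v] c s by simp
 show "F ` {u..s} Int F ` {s..v} ~= {x}" for x
  using c_in c(3) endpoint_mem(2)[of u s] endpoint_mem(1)[of s v] s by (metis IntI less_imp_le singletonD)
qed

end

lemma (in wheel_map) forward_gap_shift_int: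
 assumes "forward_gap l u v" shows "forward_gap l (u+2*pi * of_int k) (v+2*pi * of_int k)"
proof -
 have "x < l x" if "u+2*pi * of_int k < x" "x < v+2*pi * of_int k" for x
 proof -
  have "x - 2*pi * of_int k < l (x - 2*pi * of_int k)" using assms that by (simp add: forward_gap_def)
  then show ?thesis using l_per_int[of "x - 2*pi * of_int k" k] by simp
 qed
 then show ?thesis using assms by (simp add: forward_gap_def l_per_int)
qed

lemma (in wheel_map) forward_gap_shift: "forward_gap l u v ==> forward_gap l (u+2*pi) (v+2*pi)"
 using forward_gap_shift_int[of u v 1] by simp

locale wheel_parabolic = wheel_fix +
 fixes c :: "real^3"
 assumes fix_c: "l t = t ==> F t = c" and Hfix_c: "H (F t) = F t ==> F t = c"
begin

lemma H_pole: "H c = c" using fixp fix_c FH by metis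

lemma pole_in_S2: "c : S2" using fixp fix_c F_in by metis

lemma wheel_parabolic_inverse: "wheel_parabolic F l' l H' H c"
proof -
 interpret I: wheel_fix F l' l H' H by (rule wheel_fix_inverse)
 show ?thesis
 proof
  fix t show "F t = c" if "l' t = t" using that fix_c l'_fix by blast
  show "F t = c" if "H' (F t) = F t"
  proof (rule Hfix_c)
   show "H (F t) = F t" using that HH' F_in by metis
  qed
 qed
qed

lemma Fl_c: "F (l t) = c \<longleftrightarrow> F t = c"
 using FH H_inj[OF F_in pole_in_S2] H_pole by metis

lemma Fl'_c: "F (l' t) = c \<longleftrightarrow> F t = c"
 using Fl_c[of "l' t"] by (simp add: ll')

lemma Fpow_c: "F ((l ^^ n) t) = c \<longleftrightarrow> F t = c" "F ((l' ^^ n) t) = c \<longleftrightarrow> F t = c"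
 by (induction n) (simp_all add: Fl_c Fl'_c)


lemma no_linked_orbits:
 assumes q: "q1 <= s" "s <= q2" "q2 <= l s" "l s <= q3" "q3 <= s'" "s' <= q4" "q4 <= l s'" "l s' <= q1+2*pi"
  and c: "F q1 = c" "F q2 = c" "F q3 = c" "F q4 = c" and s: "F s = F s'" "F s ~= c"
 shows False
proof -
 have nonpole: "F (l s) ~= c" "F (l s') ~= c" "F s' ~= c" using s Fl_c by auto
 have order: "q1 < s" "s < q2" "q2 < l s" "l s < q3" "q3 < s'" "s' < q4" "q4 < l s'" "l s' < q1+2*pi"
  using q nonpole c s per[of q1] by (auto simp: less_le)
 have image: "F (l s) = F (l s')" using s FH by simp
 have "F s = F (l s)"
 proof (rule unlinked[of q1 q2 q3 q4 c])
  show "F s : F ` {q1..q2}" using order by auto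
  show "F s : F ` {q3..q4}" unfolding s(1) using order by auto
  show "F (l s) : F ` {q2..q3}" using order by auto
  show "F (l s) : F ` {q4..q1+2*pi}" unfolding image using order by auto
 qed (use order c nonpole s in auto)
 then show False using Hfix_c[of s] FH s by metis
qed


lemma at_most_two_fixed:
 assumes q: "q1 < q2" "q2 < q3" "q3 < q1+2*pi" and f: "l q1 = q1" "l q2 = q2" "l q3 = q3"
 shows False
proof -
 have period: "l (q1+2*pi) = q1+2*pi" using l_per f by simp
 obtain d where d: "d ~= c" "d : F ` {q1..q2}" "d : F ` {q2..q3}" "d : F ` {q3..q1+2*pi}"
  using third_point[OF q, of c] fix_c f by auto
 have inv: "H d : F ` {x..y}" if xy: "l x = x" "l y = y" "d : F ` {x..y}" for x y
 proof -
  obtain t where t: "x <= t" "t <= y" "d = F t" using xy(3) by auto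
  have "l t : {x..y}" using l_le[of x t] l_le[of t y] t xy by simp
  moreover have "H d = F (l t)" using t FH by simp
  ultimately show ?thesis by blast
 qed
 obtain t where t: "d = F t" using d by auto
 have "H d ~= c" using Fl_c[of t] FH d t by simp
 moreover have "c : F ` {q1..q2}" "c : F ` {q2..q3}" "c : F ` {q3..q1+2*pi}"
  using endpoint_mem(1)[of q1 q2] endpoint_mem(1)[of q2 q3] endpoint_mem(1)[of q3 "q1+2*pi"] q fix_c[OF f(1)] fix_c[OF f(2)] fix_c[OF f(3)]
  by (simp_all add: less_imp_le)
 ultimately have "d = H d"
  by (intro triple_at_most_two[OF q, of c d "H d"]) (use d inv f period in auto)
 then show False using Hfix_c[of t] t d by simp
qed

lemma forward_gap_iterates_mono:
 assumes gap: "forward_gap l u v" and x: "u < x" "x < v" and "i <= j" shows "(l ^^ i) x <= (l ^^ j) x"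
proof -
 have "(l ^^ n) x <= (l ^^ Suc n) x" for n
  using gap fixed_interval_invariant[of u v x n] x by (simp add: forward_gap_def less_imp_le)
 then show ?thesis using lift_Suc_mono_le[of "%n. (l ^^ n) x", OF _ \<open>i <= j\<close>] by blast
qed

lemma fundamental_iterate:
 assumes gap: "forward_gap l u v" and x: "u < x" "x < s" "s < v"
 obtains k where "(l ^^ k) x < s" "s <= (l ^^ Suc k) x"
proof -
 have "(%n. (l ^^ n) x) \<longlonglongrightarrow> v" by (rule forward_gap_limits(1)[OF gap]) (use x in auto)
 then have "eventually (%n. (l ^^ n) x > s) sequentially" using x(3) by (rule order_tendstoD(1))
 then obtain n where n: "s <= (l ^^ n) x" by (metis eventually_sequentially less_imp_le order_refl)
 define N where "N = (LEAST n. s <= (l ^^ n) x)"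
 have N: "s <= (l ^^ N) x" unfolding N_def using n by (rule LeastI)
 have "N ~= 0" using N x by (metis funpow_0 not_less)
 then obtain k where k: "N = Suc k" using not0_implies_Suc by blast
 have "~ s <= (l ^^ k) x" using not_less_Least[of k "%n. s <= (l ^^ n) x"] k by (simp add: N_def)
 then show thesis using that[of k] N k by auto
qed

lemma fibre_in_fundamental_domain:
 assumes gap: "forward_gap l u v" and p: "u < p" "p < v" "F p = c" and t: "u < t" "t < v"
 obtains \<kappa> where "t <= \<kappa>" "\<kappa> <= l t" "F \<kappa> = c"
proof (cases "p < l t")
 case True
 have "l t < v" using fixed_interval_invariant(2)[of u v t 1] gap t by (simp add: forward_gap_def)
 then obtain k where "(l ^^ k) p < l t" "l t <= (l ^^ Suc k) p" using fundamental_iterate[OF gap p(1) True] by blast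
 then show thesis using that[of "(l ^^ k) p"] Fpow_c p by auto
next
 case False
 then have "t < p" using gap t by (force simp: forward_gap_def)
 then obtain k where k: "(l ^^ k) t < p" "p <= (l ^^ Suc k) t" using fundamental_iterate[OF gap t(1) _ p(2)] by blast
 have "(l ^^ k) ((l' ^^ k) p) = p" using wheel_map.ll'[OF wheel_map_pow] by blast
 then have "(l ^^ k) t < (l ^^ k) ((l' ^^ k) p)" "(l ^^ k) ((l' ^^ k) p) <= (l ^^ k) (l t)"
  using k by (simp_all add: pow_commute)
 then have "t < (l' ^^ k) p" "(l' ^^ k) p <= l t" using pow_mono[of k] by (simp_all add: strict_mono_less strict_mono_less_eq)
 then show thesis using that[of "(l' ^^ k) p"] Fpow_c p by auto
qed

lemma iterates_uniformly_near_pole: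
 assumes gap: "forward_gap l u v" and s: "u < s" "s < v" and "\<eta> > 0"
 obtains N where "!!k x. k >= N ==> s <= x ==> x < v ==> dist (F ((l ^^ k) x)) c < \<eta>"
proof -
 have v: "l u = u" "l v = v" using gap by (auto simp: forward_gap_def)
 have "isCont F v" using cont by (simp add: continuous_on_eq_continuous_at)
 then obtain \<delta> where \<delta>: "\<delta> > 0" "!!y. dist y v < \<delta> ==> dist (F y) c < \<eta>"
  using \<open>\<eta> > 0\<close> fix_c[OF v(2)] unfolding continuous_at_eps_delta by metis
 obtain N where N: "!!k. k >= N ==> dist ((l ^^ k) s) v < \<delta>"
  using forward_gap_limits(1)[OF gap s] \<delta>(1) metric_LIMSEQ_D by blast
 have "dist (F ((l ^^ k) x)) c < \<eta>" if k: "k >= N" and x: "s <= x" "x < v" for k x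
 proof (rule \<delta>(2))
  have "(l ^^ k) s <= (l ^^ k) x" using pow_mono[of k] x by (simp add: strict_mono_less_eq)
  moreover have "(l ^^ k) x < v" using fixed_interval_invariant[OF v, of x k] x s by auto
  ultimately show "dist ((l ^^ k) x) v < \<delta>" using N[OF k] by (auto simp: dist_real_def)
 qed
 then show thesis by (rule that)
qed

text \<open>If the fibre of \<open>c\<close> missed a gap, points of \<open>F ` {u..s} \<inter> F ` {s..v}\<close> close to \<open>c\<close> would be
  carried by an iterate to points that are close to \<open>c\<close> and at the same time in a fundamental domain.\<close>

lemma fibre_meets_forward_gap:
 assumes gap: "forward_gap l u v" and "v <= u+2*pi"
 shows "EX p. u < p & p < v & F p = c"
proof (rule ccontr)
 assume "~ ?thesis"
 then have free: "F x ~= c" if "u < x" "x < v" for x using that by blast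
 have uv: "u < v" "l u = u" "l v = v" using gap by (auto simp: forward_gap_def)
 have Fuv: "F u = c" "F v = c" using uv fix_c by auto
 define s where "s = (u + v) / 2"
 have s: "u < s" "s < v" using uv by (auto simp: s_def)
 have away: "EX \<eta>>0. ALL t:{p..q}. \<eta> <= dist (F t) c" if "u < p" "q < v" for p q
 proof (rule dist_interval_image)
  have "F t ~= c" if "t : {p..q}" for t by (rule free) (use that \<open>u < p\<close> \<open>q < v\<close> in auto)
  then show "c ~: F ` {p..q}" by blast
 qed
 have "l s < v" using fixed_interval_invariant(2)[OF uv(2,3) s, of 1] by simp
 then obtain \<eta> where \<eta>: "\<eta> > 0" "ALL x:{s..l s}. \<eta> <= dist (F x) c"
  using away[of s "l s"] s by blast
 obtain N where N: "!!k x. k >= N ==> s <= x ==> x < v ==> dist (F ((l ^^ k) x)) c < \<eta>"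
  by (rule iterates_uniformly_near_pole[OF gap s \<eta>(1)], rule that)
 define w where "w = (l' ^^ N) s"
 have w: "u < w" "(l ^^ N) w = s"
  using fixed_interval_invariant(3)[OF uv(2,3) s] wheel_map.ll'[OF wheel_map_pow] by (auto simp: w_def)
 then obtain \<xi> where \<xi>: "\<xi> > 0" "ALL x:{w..s}. \<xi> <= dist (F x) c"
  using away[of w s] s by blast
 obtain z where z: "z : F ` {u..s} Int F ` {s..v}" "z ~= c" "dist z c < \<xi>"
  using halves_accumulate_at_endpoint[OF s assms(2) Fuv free[OF s]] \<xi>(1) unfolding islimpt_approachable by blast
 then obtain x y where xy: "u <= x" "x <= s" "z = F x" "s <= y" "y <= v" "z = F y" by auto
 have x: "u < x" and y: "y < v" using xy z Fuv by (auto simp: less_le)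
 have "x < w" using bspec[OF \<xi>(2), of x] z(3) xy by (cases "x < w") auto
 then have xN: "(l ^^ N) x < s" using strict_monoD[OF pow_mono] w(2) by metis
 have xs: "x < s" using forward_gap_iterates_mono[OF gap x, of 0 N] xN xy s by auto
 obtain k where k: "(l ^^ k) x < s" "s <= (l ^^ Suc k) x" using fundamental_iterate[OF gap x xs s(2)] by blast
 have "N <= Suc k" using forward_gap_iterates_mono[OF gap x, of "Suc k" N] k xN xs s by (cases "N <= Suc k") auto
 moreover have "(l ^^ Suc k) x : {s..l s}" using k l_less[of "(l ^^ k) x" s] by (simp add: less_imp_le)
 then have "\<eta> <= dist (F ((l ^^ Suc k) x)) c" using \<eta> by blast
 moreover have "F ((l ^^ Suc k) x) = F ((l ^^ Suc k) y)" using xy pow_FH by metis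
 ultimately show False using N[of "Suc k" y] xy y by simp
qed

lemma no_full_forward_gap: "~ forward_gap l x (x+2*pi)"
proof
 assume gap: "forward_gap l x (x+2*pi)"
 define y where "y = x+2*pi"
 have ends: "l x = x" "l y = y" and up: "!!t. x < t ==> t < y ==> t < l t" using gap by (auto simp: forward_gap_def y_def)
 have pole: "F x = c" "F y = c" using ends fix_c by auto
 obtain p where p: "x < p" "p < y" "F p = c" using fibre_meets_forward_gap[OF gap] by (auto simp: y_def)
 have order: "x < l' p" "l' p < p" "p < l p" "l p < y"
  using fixed_interval_invariant[OF ends p(1,2), of 1] up[of p] up[of "l' p"] p by (auto simp: ll')
 have orbit: "F (l' p) = c" "F (l p) = c" using p by (simp_all add: Fl_c Fl'_c)
 obtain d where d: "d ~= c" "d : F ` {l' p..p}" "d : F ` {p..l p}" "d : F ` {l p..l' p+2*pi}"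
  using third_point[of "l' p" p "l p" c] order p orbit by (auto simp: y_def)
 then obtain s1 s2 s3 where s: "l' p <= s1" "s1 <= p" "p <= s2" "s2 <= l p" "l p <= s3" "s3 <= l' p+2*pi"
  "d = F s1" "d = F s2" "d = F s3" by auto
 have between: "EX \<kappa>. t <= \<kappa> & \<kappa> <= l t & F \<kappa> = c" if t: "x < t" "t < y" for t
  by (rule fibre_in_fundamental_domain[OF gap p(1) _ p(3) t(1)]) (use p t in \<open>auto simp: y_def\<close>)
 have "s3 ~= y" using s d pole by auto
 then consider (low) "s3 < y" | (high) "y < s3" by linarith
 then show False
 proof cases
  case low
  obtain \<kappa> where \<kappa>: "s3 <= \<kappa>" "\<kappa> <= l s3" "F \<kappa> = c" using between[of s3] low s order by auto
  have "l s3 < y" "p <= l s1" "l s1 <= l p" using l_less[of s3 y] low ends l_le[of "l' p" s1] s by (auto simp: ll')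
  then show False
   by (intro no_linked_orbits[of "l' p" s1 p "l p" s3 \<kappa>]) (use s \<kappa> p orbit order d in \<open>auto simp: y_def\<close>)
 next
  case high
  define s0 where "s0 = s3 - 2*pi"
  have s0: "x < s0" "s0 <= l' p" "F s0 = d" using high s per_minus[of s3] by (auto simp: s0_def y_def)
  obtain \<kappa> where \<kappa>: "s0 <= \<kappa>" "\<kappa> <= l s0" "F \<kappa> = c" using between[of s0] s0 order p by auto
  have "l s0 <= p" using l_le[of s0 "l' p"] s0 by (simp add: ll')
  moreover have "l p <= l s2" "l s2 < y" using s l_less[of s2 y] ends order by auto
  ultimately show False
   by (intro no_linked_orbits[of x s0 \<kappa> p s2 "l p"]) (use s s0 \<kappa> p orbit pole d in \<open>auto simp: y_def\<close>)
 qed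
qed

lemma no_two_forward_gaps:
 assumes gaps: "forward_gap l x y" "forward_gap l y (x+2*pi)" shows False
proof -
 have ends: "x < y" "y < x+2*pi" "l x = x" "l y = y" "l (x+2*pi) = x+2*pi" using gaps by (auto simp: forward_gap_def)
 have pole: "F x = c" "F y = c" "F (x+2*pi) = c" using ends fix_c by auto
 obtain z where z: "z : bdry (F ` {x..y})" "z ~= c" using disk_boundary_point[OF ends(1,2)] by blast
 then have "z : F ` {x..y}" "z : F ` {y..x+2*pi}" using bdry_eq[of x y] ends by auto
 then obtain s s' where s: "x <= s" "s <= y" "z = F s" "y <= s'" "s' <= x+2*pi" "z = F s'" by auto
 have order: "x < s" "s < y" "y < s'" "s' < x+2*pi" using s z pole by (auto simp: less_le)
 obtain p where p: "x < p" "p < y" "F p = c" using fibre_meets_forward_gap[OF gaps(1)] ends by auto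
 obtain p' where p': "y < p'" "p' < x+2*pi" "F p' = c" using fibre_meets_forward_gap[OF gaps(2)] ends by auto
 obtain \<kappa> where \<kappa>: "s <= \<kappa>" "\<kappa> <= l s" "F \<kappa> = c" by (rule fibre_in_fundamental_domain[OF gaps(1) p order(1,2)])
 obtain \<kappa>' where \<kappa>': "s' <= \<kappa>'" "\<kappa>' <= l s'" "F \<kappa>' = c" by (rule fibre_in_fundamental_domain[OF gaps(2) p' order(3,4)])
 have "l s < y" "l s' < x+2*pi" using l_less[of s y] l_less[of s' "x+2*pi"] order ends by auto
 then show False
  by (intro no_linked_orbits[of x s \<kappa> y s' \<kappa>']) (use s order \<kappa> \<kappa>' pole z in auto)
qed

lemma two_fixed_points:
 obtains x y where "forward_gap l x y" "forward_gap l' y (x+2*pi)"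
proof -
 interpret I: wheel_parabolic F l' l H' H c by (rule wheel_parabolic_inverse)
 obtain t0 where t0: "l t0 ~= t0" using nontriv by blast
 obtain u v where uv: "u < t0" "t0 < v" "v <= u+2*pi" "l u = u" "l v = v" and first: "forward_gap l u v | forward_gap l' u v"
  by (rule fixed_gap[OF t0], rule that)
 have width: "v < u+2*pi" using first no_full_forward_gap[of u] I.no_full_forward_gap[of u] uv by (cases "v = u+2*pi") auto
 have free: "l w ~= w" if w: "v < w" "w < u+2*pi" for w
  using at_most_two_fixed[of u v w] uv w by auto
 define t1 where "t1 = (v+(u+2*pi)) / 2"
 have t1: "v < t1" "t1 < u+2*pi" using width by (auto simp: t1_def)
 obtain u1 v1 where gap1: "u1 < t1" "t1 < v1" "l u1 = u1" "l v1 = v1" "!!x. u1 < x ==> x < v1 ==> l x ~= x"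
  and second: "forward_gap l u1 v1 | forward_gap l' u1 v1"
  by (rule fixed_gap[OF free[OF t1]], rule that)
 have "~ u1 < v" "~ v < u1" using gap1(5)[of v] free[of u1] gap1 uv t1 by auto
 moreover have "~ u+2*pi < v1" "~ v1 < u+2*pi" using gap1(5)[of "u+2*pi"] free[of v1] gap1 uv t1 l_per[of u] by auto
 ultimately have ends: "u1 = v" "v1 = u+2*pi" by auto
 consider "forward_gap l u v" "forward_gap l' v (u+2*pi)" | "forward_gap l v (u+2*pi)" "forward_gap l' u v"
  using first second no_two_forward_gaps[of u v] I.no_two_forward_gaps[of u v] unfolding ends by blast
 then show thesis
 proof cases
  assume "forward_gap l v (u+2*pi)" "forward_gap l' u v"
  then show thesis using I.forward_gap_shift[of u v] by (intro that[of v "u+2*pi"]) auto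
 qed (rule that)
qed

end

subsection \<open>Extending boundary maps over disks\<close>

definition triangle :: "complex set" where "triangle = {z. 0 <= Re z & 0 <= Im z & Re z + Im z <= 1}"
definition triangle_boundary :: "complex set" where "triangle_boundary = {z : triangle. Re z = 0 | Im z = 0 | Re z + Im z = 1}"

lemma triangle_facts: "compact triangle" "convex triangle" "interior triangle = triangle - triangle_boundary" "interior triangle ~= {}"
proof -
 have halfplanes: "triangle = {z. (1::complex) \<bullet> z >= 0} Int {z. \<i> \<bullet> z >= 0} Int {z. (1 + \<i>) \<bullet> z <= 1}"
  by (auto simp: triangle_def inner_complex_def)
 have nonzero: "(1::complex) + \<i> ~= 0" by (simp add: complex_eq_iff)
 have "interior triangle = {z. (1::complex) \<bullet> z > 0} Int {z. \<i> \<bullet> z > 0} Int {z. (1 + \<i>) \<bullet> z < 1}"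
  unfolding halfplanes interior_Int interior_halfspace_ge[OF one_neq_zero] interior_halfspace_ge[OF complex_i_not_zero]
   interior_halfspace_le[OF nonzero] ..
 then have int: "interior triangle = {z. 0 < Re z & 0 < Im z & Re z + Im z < 1}"
  by (auto simp: inner_complex_def)
 show "interior triangle = triangle - triangle_boundary" unfolding int
 proof (rule Set.set_eqI)
  fix z :: complex
  show "z : {z. 0 < Re z & 0 < Im z & Re z + Im z < 1} \<longleftrightarrow> z : triangle - triangle_boundary"
   unfolding triangle_boundary_def triangle_def mem_Collect_eq Diff_iff by linarith
 qed
 have "Complex (1/4) (1/4) : interior triangle" unfolding int by simp
 then show "interior triangle ~= {}" by blast
 show "convex triangle" unfolding halfplanes by (intro convex_Int convex_halfspace_ge convex_halfspace_le)
 have "closed triangle" unfolding halfplanes by (intro closed_Int closed_halfspace_ge closed_halfspace_le)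
 moreover have "triangle <= cball 0 2"
 proof
  fix z assume "z : triangle"
  then have "\<bar>Re z\<bar> <= 1" "\<bar>Im z\<bar> <= 1" by (auto simp: triangle_def)
  then show "z : cball 0 2" using cmod_le[of z] by simp
 qed
 ultimately show "compact triangle" using bounded_cball bounded_subset compact_eq_bounded_closed by blast
qed


lemma homeomorphism_image_interior:
 fixes S T :: "'a::euclidean_space set"
 assumes h: "homeomorphism S T f g" shows "f ` interior S = interior T"
proof
 have into: "f ` interior S <= interior T" if h: "homeomorphism S T f g" for S T :: "'a set" and f g
 proof (rule interior_maximal)
  show "f ` interior S <= T" using homeomorphism_image1[OF h] interior_subset by blast
  show "open (f ` interior S)"
   by (rule invariance_of_domain[OF continuous_on_subset[OF homeomorphism_cont1[OF h] interior_subset] open_interior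
     inj_on_subset[OF homeomorphism_imp_inj_on[OF h] interior_subset]])
 qed
 show "f ` interior S <= interior T" by (rule into[OF h])
 show "interior T <= f ` interior S"
 proof
  fix y assume y: "y : interior T"
  then have "g y : interior S" using into[OF homeomorphism_symD[OF h]] by blast
  moreover have "f (g y) = y" using homeomorphism_apply2[OF h] y interior_subset by blast
  ultimately show "y : f ` interior S" by (metis imageI)
 qed
qed

lemma triangle_homeomorphism:
 obtains j k where "homeomorphism triangle (cball (0::complex) 1) j k" "j ` triangle_boundary = sphere 0 1"
proof -
 have "aff_dim triangle = 2" using aff_dim_nonempty_interior[OF triangle_facts(4)] by simp
 then have "triangle homeomorphic cball (0::complex) 1"
  by (intro homeomorphic_convex_compact_sets) (auto simp: triangle_facts aff_dim_cball)
 then obtain j k where jk: "homeomorphism triangle (cball (0::complex) 1) j k" by (auto simp: homeomorphic_def)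
 have "j ` (triangle - interior triangle) = j ` triangle - j ` interior triangle"
  by (rule inj_on_image_set_diff[OF homeomorphism_imp_inj_on[OF jk]]) (use interior_subset in auto)
 also have "\<dots> = sphere 0 1"
  unfolding homeomorphism_image1[OF jk] homeomorphism_image_interior[OF jk] by (auto simp: not_less)
 finally have "j ` (triangle - interior triangle) = sphere 0 1" .
 moreover have "triangle - interior triangle = triangle_boundary" unfolding triangle_facts(3) by (auto simp: triangle_boundary_def)
 ultimately show thesis using that[OF jk] by simp
qed

definition cone_map :: "('a => 'a) => 'a => 'a::euclidean_space" where
 "cone_map g z = norm z *\<^sub>R g (sgn z)"

lemma cone_map_sphere: "norm z = 1 ==> cone_map g z = g z"
 by (simp add: cone_map_def sgn_div_norm)

lemma norm_cone_map:
 assumes "g ` sphere 0 1 <= sphere 0 1" shows "norm (cone_map g z) = norm z"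
proof (cases "z = 0")
 case False
 then have "g (sgn z) : g ` sphere 0 1" by (intro imageI) (simp add: norm_sgn)
 then have "g (sgn z) : sphere 0 1" using assms by blast
 then show ?thesis by (simp add: cone_map_def)
qed (simp add: cone_map_def)

lemma continuous_on_cone_map:
 fixes g :: "'a::euclidean_space => 'a"
 assumes cont: "continuous_on (sphere 0 1) g" and im: "g ` sphere 0 1 <= sphere 0 1"
 shows "continuous_on A (cone_map g)"
proof -
 have "isCont (cone_map g) z" for z
 proof (cases "z = 0")
  case True
  have "((%x. norm (cone_map g x)) \<longlongrightarrow> 0) (at 0)"
   unfolding norm_cone_map[OF im] by (rule tendsto_norm_zero[OF tendsto_ident_at])
  then have "(cone_map g \<longlongrightarrow> 0) (at 0)" by (rule tendsto_norm_zero_cancel)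
  then show ?thesis using True by (simp add: continuous_at cone_map_def)
 next
  case False
  have "continuous_on (- {0}) (%x. g (sgn x))"
  proof (rule continuous_on_compose2[OF cont])
   show "continuous_on (- {0}) (sgn :: 'a => 'a)" unfolding sgn_div_norm[abs_def] by (intro continuous_intros) auto
  qed (auto simp: norm_sgn split: if_splits)
  then have "continuous_on (- {0}) (cone_map g)" unfolding cone_map_def[abs_def] by (intro continuous_intros)
  then show ?thesis using False by (simp add: continuous_on_eq_continuous_at open_Compl)
 qed
 then show ?thesis by (simp add: continuous_at_imp_continuous_on)
qed

lemma inj_cone_map:
 assumes inj: "inj_on g (sphere 0 1)" and im: "g ` sphere 0 1 <= sphere 0 1"
 shows "inj (cone_map g)"
proof (rule injI)
 fix v w assume eq: "cone_map g v = cone_map g w"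
 have norms: "norm v = norm w" using eq norm_cone_map[OF im] by metis
 show "v = w"
 proof (cases "v = 0")
  case True then show ?thesis using norms by simp
 next
  case False
  then have "w ~= 0" using norms by auto
  then have "sgn v = sgn w" using inj False eq norms by (simp add: cone_map_def inj_on_eq_iff norm_sgn)
  then show ?thesis using norms sgn_div_norm False by (metis norm_eq_zero inverse_nonzero_iff_nonzero real_vector.scale_cancel_left)
 qed
qed

lemma cone_map_cball:
 assumes im: "g ` sphere 0 1 = sphere 0 1"
 shows "cone_map g ` cball 0 1 = cball 0 1"
proof
 show "cone_map g ` cball 0 1 <= cball 0 1" using norm_cone_map[of g] im by auto
 show "cball 0 1 <= cone_map g ` cball 0 1"
 proof
  fix w :: 'a assume w: "w : cball 0 1"
  show "w : cone_map g ` cball 0 1"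
  proof (cases "w = 0")
   case True
   then show ?thesis by (intro image_eqI[of _ _ 0]) (auto simp: cone_map_def)
  next
   case False
   then have "sgn w : g ` sphere 0 1" using im by (simp add: norm_sgn)
   then obtain v where v: "norm v = 1" "g v = sgn w" by auto
   have "cone_map g (norm w *\<^sub>R v) = norm w *\<^sub>R g v" using v False by (simp add: cone_map_def sgn_scaleR sgn_div_norm)
   also have "\<dots> = w" using v False by (simp add: sgn_div_norm)
   finally show ?thesis using v w by (intro image_eqI[of _ _ "norm w *\<^sub>R v"]) auto
  qed
 qed
qed

lemma extend_boundary_map:
 assumes D: "closed_disk D" and b: "continuous_on triangle_boundary b" "inj_on b triangle_boundary" "b ` triangle_boundary = bdry D"
 obtains B where "continuous_on triangle B" "inj_on B triangle" "B ` triangle = D" "!!z. z : triangle_boundary ==> B z = b z"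
proof -
 obtain \<phi> \<psi> where h: "homeomorphism (cball (0::complex) 1) D \<phi> \<psi>" "\<phi> ` sphere 0 1 = bdry D"
  using closed_disk_param[OF D] by metis
 obtain j k where jk: "homeomorphism triangle (cball (0::complex) 1) j k" "j ` triangle_boundary = sphere 0 1"
  by (rule triangle_homeomorphism)
 have edge: "triangle_boundary <= triangle" and bD: "bdry D <= D" by (auto simp: triangle_boundary_def bdry_def)
 have kj: "k (j z) = z" if "z : triangle_boundary" for z using homeomorphism_apply1[OF jk(1)] edge that by blast
 then have k_sphere: "k ` sphere 0 1 = triangle_boundary" unfolding jk(2)[symmetric] by (simp add: image_image)
 have "\<psi> (\<phi> z) = z" if "z : sphere 0 1" for z using homeomorphism_apply1[OF h(1)] that by auto
 then have \<psi>_bdry: "\<psi> ` bdry D = sphere 0 1" unfolding h(2)[symmetric] by (simp add: image_image)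
 define g where "g = \<psi> \<circ> (b \<circ> k)"
 have g_sphere: "g ` sphere 0 1 = sphere 0 1" by (simp only: g_def image_comp[symmetric] k_sphere b(3) \<psi>_bdry)
 have k: "continuous_on (sphere 0 1) k" "inj_on k (sphere 0 1)"
  using homeomorphism_cont2[OF jk(1)] homeomorphism_imp_inj_on[OF homeomorphism_symD[OF jk(1)]]
  by (auto intro: continuous_on_subset inj_on_subset)
 have bk: "continuous_on (sphere 0 1) (b \<circ> k)" "inj_on (b \<circ> k) (sphere 0 1)"
  using continuous_on_compose[OF k(1), of b] comp_inj_on[OF k(2), of b] b(1,2) unfolding k_sphere by blast+
 have \<psi>: "continuous_on (bdry D) \<psi>" "inj_on \<psi> (bdry D)"
  using homeomorphism_cont2[OF h(1)] homeomorphism_imp_inj_on[OF homeomorphism_symD[OF h(1)]] bD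
  by (auto intro: continuous_on_subset inj_on_subset)
 have "(b \<circ> k) ` sphere 0 1 = bdry D" by (simp only: image_comp[symmetric] k_sphere b(3))
 then have g: "continuous_on (sphere 0 1) g" "inj_on g (sphere 0 1)"
  using continuous_on_compose[OF bk(1), of \<psi>] comp_inj_on[OF bk(2), of \<psi>] \<psi> by (simp_all only: g_def)
 define B where "B = \<phi> \<circ> (cone_map g \<circ> j)"
 have "j ` triangle = cball 0 1" by (rule homeomorphism_image1[OF jk(1)])
 then have cone_triangle: "(cone_map g \<circ> j) ` triangle = cball 0 1" by (simp only: image_comp[symmetric] cone_map_cball[OF g_sphere])
 show thesis
 proof (rule that[of B])
  have "continuous_on triangle (cone_map g \<circ> j)"
   by (rule continuous_on_compose[OF homeomorphism_cont1[OF jk(1)] continuous_on_cone_map[OF g(1)]]) (simp add: g_sphere)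
  then show "continuous_on triangle B"
   unfolding B_def by (rule continuous_on_compose) (simp only: cone_triangle homeomorphism_cont1[OF h(1)])
  have "inj_on (cone_map g \<circ> j) triangle"
   by (rule comp_inj_on[OF homeomorphism_imp_inj_on[OF jk(1)] inj_on_subset[OF inj_cone_map[OF g(2)]]]) (simp_all add: g_sphere)
  then show "inj_on B triangle"
   unfolding B_def by (rule comp_inj_on) (simp only: cone_triangle homeomorphism_imp_inj_on[OF h(1)])
  have "B ` triangle = \<phi> ` ((cone_map g \<circ> j) ` triangle)" unfolding B_def by (rule image_comp[symmetric])
  then show "B ` triangle = D" by (simp only: cone_triangle homeomorphism_image1[OF h(1)])
  fix z assume z: "z : triangle_boundary"
  then have "j z : sphere 0 1" using jk(2) by blast
  then have "B z = \<phi> (\<psi> (b z))" using kj[OF z] by (simp add: B_def cone_map_sphere g_def)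
  moreover have "b z : D" using b(3) z bD by blast
  ultimately show "B z = b z" using homeomorphism_apply2[OF h(1)] by simp
 qed
qed

definition strip_to_triangle :: "complex => complex" where
 "strip_to_triangle z = Complex (Re z / (1 + Im z)) (Im z / (1 + Im z))"

lemma strip_to_triangle:
 defines "S \<equiv> {z. 0 <= Im z & 0 <= Re z & Re z <= 1}"
 shows "continuous_on S strip_to_triangle" "inj_on strip_to_triangle S" "strip_to_triangle ` S = triangle - {\<i>}"
proof -
 have formula: "strip_to_triangle = (%z. of_real (Re z / (1 + Im z)) + \<i> * of_real (Im z / (1 + Im z)))"
  by (rule ext) (simp add: strip_to_triangle_def complex_eq_iff)
 show "continuous_on S strip_to_triangle" unfolding formula S_def by (intro continuous_intros) auto
 show "inj_on strip_to_triangle S"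
 proof (rule inj_onI)
  fix z w assume zw: "z : S" "w : S" "strip_to_triangle z = strip_to_triangle w"
  have positive: "0 < 1 + Im z" "0 < 1 + Im w" using zw by (auto simp: S_def)
  have "Im z / (1 + Im z) = Im w / (1 + Im w)" "Re z / (1 + Im z) = Re w / (1 + Im w)" using zw by (auto simp: strip_to_triangle_def)
  then have "Im z = Im w" using positive by (simp add: field_simps)
  then show "z = w" using \<open>Re z / (1 + Im z) = Re w / (1 + Im w)\<close> positive by (simp add: complex_eq_iff)
 qed
 show "strip_to_triangle ` S = triangle - {\<i>}"
 proof
  show "strip_to_triangle ` S <= triangle - {\<i>}"
  proof
   fix w assume "w : strip_to_triangle ` S"
   then obtain z where z: "z : S" "w = strip_to_triangle z" by blast
   have positive: "0 < 1 + Im z" using z by (auto simp: S_def)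
   have "Re w + Im w = (Re z + Im z) / (1 + Im z)" by (simp add: z strip_to_triangle_def add_divide_distrib)
   also have "\<dots> <= 1" using z positive by (simp add: S_def field_simps)
   finally have "Re w + Im w <= 1" .
   moreover have "0 <= Re w" "0 <= Im w" "Im w < 1" using z positive by (auto simp: strip_to_triangle_def S_def field_simps)
   ultimately show "w : triangle - {\<i>}" by (auto simp: triangle_def complex_eq_iff)
  qed
  show "triangle - {\<i>} <= strip_to_triangle ` S"
  proof
   fix w assume w: "w : triangle - {\<i>}"
   have Im_less: "Im w < 1"
   proof (rule ccontr)
    assume "~ Im w < 1"
    then have "Im w = 1" "Re w = 0" using w by (auto simp: triangle_def)
    then show False using w by (simp add: complex_eq_iff)
   qed
   define z where "z = Complex (Re w / (1 - Im w)) (Im w / (1 - Im w))"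
   have "1 + Im z = 1 / (1 - Im w)" using Im_less by (simp add: z_def field_simps)
   then have "strip_to_triangle z = w" using Im_less by (simp add: strip_to_triangle_def z_def complex_eq_iff)
   moreover have "z : S" using w Im_less by (auto simp: S_def z_def triangle_def field_simps)
   ultimately show "w : strip_to_triangle ` S" by blast
  qed
 qed
qed

subsection \<open>Integer powers and equivariant gluing\<close>

context wheel_map
begin

definition lpow :: "int => real => real" where "lpow j = (if 0 <= j then l ^^ nat j else l' ^^ nat (- j))"
definition Hpow :: "int => real^3 => real^3" where "Hpow j = (if 0 <= j then H ^^ nat j else H' ^^ nat (- j))"

lemma lpow_Suc: "lpow (j+1) t = l (lpow j t)"
proof (cases "0 <= j")
 case True
 then have "nat (j+1) = Suc (nat j)" by simp
 then show ?thesis using True by (simp add: lpow_def)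
next
 case False
 define n where "n = nat (- j) - 1"
 then have n: "j = - int (Suc n)" using False by simp
 have "nat (- j) = Suc n" by (simp add: n)
 moreover have "lpow (j+1) = l' ^^ n" by (auto simp: lpow_def n)
 ultimately show ?thesis using False by (simp add: lpow_def ll')
qed

lemma lpow_0 [simp]: "lpow 0 t = t" by (simp add: lpow_def)

lemma lpow_pred: "lpow (j - 1) t = l' (lpow j t)" using lpow_Suc[of "j - 1" t] l'l by simp

lemma lpow_add: "lpow (i + j) t = lpow i (lpow j t)"
proof (induction i rule: int_induct[where k = 0])
 case base then show ?case by simp
next
 case (step1 i) then show ?case using lpow_Suc[of "i + j" t] lpow_Suc[of i "lpow j t"] by (simp add: algebra_simps)
next
 case (step2 i) then show ?case using lpow_pred[of "i + j" t] lpow_pred[of i "lpow j t"] by (simp add: algebra_simps)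
qed

lemma Hpow_F: "Hpow j (F t) = F (lpow j t)"
 unfolding Hpow_def lpow_def using pow_FH wheel_map.pow_FH[OF wheel_map_inverse] by auto

lemma S2_F: "y : S2 ==> EX t. y = F t" using surj by blast

lemma Hpow_add: "y : S2 ==> Hpow (i + j) y = Hpow i (Hpow j y)"
 using S2_F[of y] lpow_add Hpow_F by metis

lemma Hpow_in: "y : S2 ==> Hpow j y : S2" using S2_F[of y] Hpow_F F_in by metis

lemma Hpow_0 [simp]: "Hpow 0 y = y" by (simp add: Hpow_def)

lemma Hpow_1: "y : S2 ==> Hpow 1 y = H y" by (simp add: Hpow_def)

lemma Hpow_inv: "y : S2 ==> Hpow (- j) (Hpow j y) = y" using Hpow_add[of y "- j" j] by simp

lemma Hpow_inj: "x : S2 ==> y : S2 ==> Hpow j x = Hpow j y \<longleftrightarrow> x = y" using Hpow_inv by metis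

lemma Hpow_cont: "continuous_on S2 (Hpow j)"
 using homeomorphism_cont1[OF wheel_map.hom[OF wheel_map_pow]] homeomorphism_cont2[OF wheel_map.hom[OF wheel_map_pow]]
 by (auto simp: Hpow_def)

lemma lpow_mono: "strict_mono (lpow j)"
 using pow_mono wheel_map.pow_mono[OF wheel_map_inverse] by (auto simp: lpow_def)

end

locale fundamental_strip = wheel_map +
 fixes W W0 :: "complex set" and u0 :: real and \<psi> :: "complex => real^3"
 assumes W0_def: "W0 = {z : W. u0 <= Re z & Re z <= u0+1}"
  and W: "closed W" "!!z (j::int). z : W ==> z + of_int j : W"
  and \<psi>: "continuous_on W0 \<psi>" "inj_on \<psi> W0" "\<psi> ` W0 <= S2" "!!z. z : W ==> Re z = u0 ==> \<psi> (z+1) = H (\<psi> z)"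
  and far: "!!j. \<bar>j\<bar> >= 2 ==> \<psi> ` W0 Int Hpow j ` (\<psi> ` W0) = {}"
  and near: "!!z. z : W0 ==> \<psi> z : H ` (\<psi> ` W0) ==> Re z = u0+1"
begin

definition glued :: "complex => real^3" where
 "glued z = Hpow \<lfloor>Re z - u0\<rfloor> (\<psi> (z - of_int \<lfloor>Re z - u0\<rfloor>))"

lemma \<psi>_S2: "z : W0 ==> \<psi> z : S2" using \<psi>(3) by blast

lemma W_minus: "z : W ==> z - of_int j : W" using W(2)[of z "- j"] by simp

lemma floor_translate:
 assumes "z : W" shows "z - of_int \<lfloor>Re z - u0\<rfloor> : W0" "Re (z - of_int \<lfloor>Re z - u0\<rfloor>) < u0+1"
proof -
 have "u0 <= Re z - of_int \<lfloor>Re z - u0\<rfloor>" "Re z - of_int \<lfloor>Re z - u0\<rfloor> < u0+1" by linarith+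
 then show "z - of_int \<lfloor>Re z - u0\<rfloor> : W0" "Re (z - of_int \<lfloor>Re z - u0\<rfloor>) < u0+1"
  using W_minus[OF assms] by (auto simp: W0_def)
qed

lemma glued_translate:
 assumes w: "w : W0" shows "glued (w + of_int j) = Hpow j (\<psi> w)"
proof (cases "Re w = u0+1")
 case True
 then have fl: "\<lfloor>Re (w + of_int j) - u0\<rfloor> = j+1" by (simp add: floor_eq_iff)
 have w1: "w - 1 : W" "Re (w - 1) = u0" using W_minus[of w 1] w True by (auto simp: W0_def)
 then have "w - 1 : W0" by (simp add: W0_def)
 have "Hpow j (\<psi> w) = Hpow j (H (\<psi> (w - 1)))" using \<psi>(4)[OF w1] by simp
 also have "\<dots> = Hpow (j+1) (\<psi> (w - 1))" using Hpow_add[of "\<psi> (w - 1)" j 1] Hpow_1 \<psi>_S2[OF \<open>w - 1 : W0\<close>] by simp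
 finally show ?thesis unfolding glued_def fl by (simp add: algebra_simps)
next
 case False
 then have "\<lfloor>Re (w + of_int j) - u0\<rfloor> = j" using w by (simp add: floor_eq_iff W0_def)
 then show ?thesis by (simp add: glued_def)
qed

lemma glued_representative:
 assumes "z : W" shows "EX w:W0. EX j::int. z = w + of_int j & glued z = Hpow j (\<psi> w)"
 using floor_translate(1)[OF assms]
 by (intro bexI[of _ "z - of_int \<lfloor>Re z - u0\<rfloor>"] exI[of _ "\<lfloor>Re z - u0\<rfloor>"]) (auto simp: glued_def)

definition strip :: "int => complex set" where
 "strip j = W Int {z. u0 + of_int j <= Re z & Re z <= u0 + of_int j+1}"

lemma strip_translate: "z : strip j ==> z - of_int j : W0"
 using W_minus by (auto simp: strip_def W0_def)

lemma closed_strip: "closed (strip j)"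
 unfolding strip_def Collect_conj_eq by (intro closed_Int W closed_Collect_le continuous_intros)

lemma continuous_on_strip: "continuous_on (strip j) glued"
proof -
 have "continuous_on (strip j) (%z. Hpow j (\<psi> (z - of_int j)))"
 proof (rule continuous_on_compose2[OF Hpow_cont])
  show "continuous_on (strip j) (%z. \<psi> (z - of_int j))"
   by (rule continuous_on_compose2[OF \<psi>(1)]) (use strip_translate in \<open>auto intro!: continuous_intros\<close>)
 qed (use strip_translate \<psi>_S2 in auto)
 moreover have "Hpow j (\<psi> (z - of_int j)) = glued z" if "z : strip j" for z
  using glued_translate[OF strip_translate[OF that], of j] by simp
 ultimately show ?thesis by (rule continuous_on_eq)
qed

lemma continuous_on_glued: "continuous_on W glued"
proof -
 have "continuous (at z within W) glued" if z: "z : W" for z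
 proof -
  define j where "j = \<lfloor>Re z - u0\<rfloor>"
  define V where "V = {w. u0 + of_int j - 1 < Re w & Re w < u0 + of_int j+1}"
  have zV: "z : V" unfolding V_def j_def mem_Collect_eq by linarith
  have "open V" unfolding V_def Collect_conj_eq by (intro open_Int open_Collect_less continuous_intros)
  have "continuous_on (strip (j - 1) Un strip j) glued"
   by (intro continuous_on_closed_Un closed_strip continuous_on_strip)
  then have "continuous_on (W Int V) glued" by (rule continuous_on_subset) (auto simp: V_def strip_def)
  then have "continuous (at z within (W Int V)) glued" using z zV by (auto simp: continuous_on_eq_continuous_within)
  moreover have "at z within (W Int V) = at z within W" by (rule at_within_nhd[OF zV \<open>open V\<close>]) auto
  ultimately show ?thesis by simp
 qed
 then show ?thesis by (simp add: continuous_on_eq_continuous_within)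
qed

lemma translates_disjoint:
 assumes w: "w : W0" "w' : W0" "Re w < u0+1" "Re w' < u0+1" and eq: "Hpow j (\<psi> w) = Hpow j' (\<psi> w')"
 shows "j = j' & w = w'"
proof -
 have w_eq: "\<psi> w = Hpow (j' - j) (\<psi> w')"
  using Hpow_inv[OF \<psi>_S2[OF w(1)], of j] eq Hpow_add[OF \<psi>_S2[OF w(2)], of "- j" j'] by simp
 have w'_eq: "\<psi> w' = Hpow (j - j') (\<psi> w)"
  using Hpow_inv[OF \<psi>_S2[OF w(2)], of j'] eq Hpow_add[OF \<psi>_S2[OF w(1)], of "- j'" j] by simp
 consider (apart) "\<bar>j' - j\<bar> >= 2" | (next_left) "j' - j = 1" | (next_right) "j - j' = 1" | (same) "j = j'" by linarith
 then show ?thesis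
 proof cases
  case apart
  have "\<psi> w : \<psi> ` W0" "\<psi> w : Hpow (j' - j) ` (\<psi> ` W0)" using w(1,2) w_eq by blast+
  then show ?thesis using far[OF apart] by blast
 next
  case next_left
  then have "\<psi> w = H (\<psi> w')" using w_eq Hpow_1 \<psi>_S2 w by simp
  then have "\<psi> w : H ` (\<psi> ` W0)" using w(2) by (metis imageI)
  then show ?thesis using near[OF w(1)] w(3) by simp
 next
  case next_right
  then have "\<psi> w' = H (\<psi> w)" using w'_eq Hpow_1 \<psi>_S2 w by simp
  then have "\<psi> w' : H ` (\<psi> ` W0)" using w(1) by (metis imageI)
  then show ?thesis using near[OF w(2)] w(4) by simp
 next
  case same
  then show ?thesis using w_eq \<psi>(2) w by (simp add: inj_on_eq_iff)
 qed
qed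

lemma inj_on_glued: "inj_on glued W"
proof (rule inj_onI)
 fix z z' assume z: "z : W" "z' : W" "glued z = glued z'"
 have "\<lfloor>Re z - u0\<rfloor> = \<lfloor>Re z' - u0\<rfloor> & z - of_int \<lfloor>Re z - u0\<rfloor> = z' - of_int \<lfloor>Re z' - u0\<rfloor>"
  by (rule translates_disjoint) (use floor_translate[OF z(1)] floor_translate[OF z(2)] z(3) in \<open>auto simp: glued_def\<close>)
 then show "z = z'" by (metis diff_add_cancel)
qed

lemma glued_image: "glued ` W = (\<Union>j. Hpow j ` (\<psi> ` W0))"
proof
 show "glued ` W <= (\<Union>j. Hpow j ` (\<psi> ` W0))" using glued_representative by fastforce
 show "(\<Union>j. Hpow j ` (\<psi> ` W0)) <= glued ` W"
 proof
  fix y assume "y : (\<Union>j. Hpow j ` (\<psi> ` W0))"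
  then obtain j w where jw: "w : W0" "y = Hpow j (\<psi> w)" by blast
  then have "y = glued (w + of_int j)" using glued_translate by simp
  moreover have "w + of_int j : W" using W(2) jw by (simp add: W0_def)
  ultimately show "y : glued ` W" by blast
 qed
qed

lemma glued_equivariant: assumes "z : W" shows "glued (z+1) = H (glued z)"
proof -
 obtain w and j :: int where w: "w : W0" "z = w + of_int j" "glued z = Hpow j (\<psi> w)" using glued_representative[OF assms] by blast
 have "z+1 = w + of_int (j+1)" using w by simp
 then have "glued (z+1) = Hpow (j+1) (\<psi> w)" using glued_translate[OF w(1), of "j+1"] by metis
 also have "\<dots> = Hpow 1 (Hpow j (\<psi> w))" using Hpow_add[OF \<psi>_S2[OF w(1)], of 1 j] by (simp add: add.commute)
 finally show ?thesis using w Hpow_1 Hpow_in \<psi>_S2 by simp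
qed

end

subsection \<open>Tiling a gap by fundamental domains\<close>

lemma loop_initial_final_arcs:
 fixes gm :: "real => 'a::real_normed_vector"
 assumes g: "simple_path gm" "pathstart gm = c" "pathfinish gm = c"
  and A: "0 < a0" "a0 <= b0" "b0 <= 1" "A = gm ` ({0..a0} Un {b0..1})"
  and B: "0 <= a1" "a1 <= b1" "b1 <= 1" "B = gm ` ({0..a1} Un {b1..1})" "B ~= {c}"
  and meet: "A Int B <= {c}"
 shows "0 < a0 & a0 < b1 & b1 < 1 & A = gm ` {0..a0} & B = gm ` {b1..1}"
proof -
 have ends: "gm 0 = c" "gm 1 = c" using g by (auto simp: pathstart_def pathfinish_def)
 have disjoint: False if t: "0 < t" "t < 1" "t <= a0 | b0 <= t" "t <= a1 | b1 <= t" for t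
 proof -
  have "gm t : A Int B" unfolding A(4) B(4) using t by auto
  then have "gm t = gm 0" using meet ends by auto
  then show False using simple_loop_inj[OF g(1), of 0 t] t by auto
 qed
 have a1: "a1 = 0"
 proof (rule ccontr)
  assume "a1 ~= 0"
  then have "0 < min (min a0 a1) (1/2)" using A(1) B(1) by auto
  then show False by (rule disjoint) auto
 qed
 have b1: "b1 < 1" using B(3,4,5) a1 ends by (cases "b1 = 1") auto
 have b0: "b0 = 1"
 proof (rule ccontr)
  assume "b0 ~= 1"
  then have "max (max b0 b1) (1/2) < 1" using A(3) b1 by auto
  then show False by (rule disjoint[rotated]) auto
 qed
 have "a0 < b1"
 proof (rule ccontr)
  assume "~ a0 < b1"
  then show False using disjoint[of "max b1 (min a0 (1/2))"] A(1) b1 by (auto simp: less_max_iff_disj min_less_iff_disj)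
 qed
 moreover have "gm 1 : gm ` {0..a0}" "gm 0 : gm ` {b1..1}"
  using ends A(1) b1 image_eqI[of "gm 1" gm 0 "{0..a0}"] image_eqI[of "gm 0" gm 1 "{b1..1}"] by auto
 then have "gm ` ({0..a0} Un {1..1}) = gm ` {0..a0}" "gm ` ({0..0} Un {b1..1}) = gm ` {b1..1}"
  by (simp_all add: insert_absorb)
 ultimately show ?thesis using A(1,4) B(4) a1 b0 b1 by simp
qed

lemma loop_two_subcontinua:
 fixes gm :: "real => 'a::real_normed_vector"
 assumes g: "simple_path gm" "pathstart gm = c" "pathfinish gm = c"
  and A: "closed A" "connected A" "A <= path_image gm" "c : A" "A ~= {c}"
  and B: "closed B" "connected B" "B <= path_image gm" "c : B" "B ~= {c}" and meet: "A Int B <= {c}"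
 obtains \<gamma> a b where "simple_path \<gamma>" "pathstart \<gamma> = c" "pathfinish \<gamma> = c" "path_image \<gamma> = path_image gm"
  "0 < a" "a < b" "b < 1" "A = \<gamma> ` {0..a}" "B = \<gamma> ` {b..1}"
proof -
 obtain a0 b0 where a0: "0 <= a0" "a0 <= b0" "b0 <= 1" "A = gm ` ({0..a0} Un {b0..1})"
  by (rule simple_loop_subcontinuum[OF g A(1-4)])
 obtain a1 b1 where a1: "0 <= a1" "a1 <= b1" "b1 <= 1" "B = gm ` ({0..a1} Un {b1..1})"
  by (rule simple_loop_subcontinuum[OF g B(1-4)])
 show thesis
 proof (cases "a0 = 0")
  case False
  then have "0 < a0" using a0 by simp
  from loop_initial_final_arcs[OF g this a0(2-4) a1 B(5) meet] show thesis using that[OF g refl] by blast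
 next
  case True
  then have "b0 ~= 1" using a0(4) A(5) g by (auto simp: pathstart_def pathfinish_def)
  then have "0 < 1 - b0" using a0(3) by simp
  have rev: "simple_path (reversepath gm)" "pathstart (reversepath gm) = c" "pathfinish (reversepath gm) = c"
   using g by (simp_all add: simple_path_reversepath)
  have image: "gm ` ({0..s} Un {t..1}) = reversepath gm ` ({0..1 - t} Un {1 - s..1})" for s t
  proof -
   have "(%u. 1 - u) ` ({0..1 - t} Un {1 - s..1}) = {0..s} Un {t..1}" by (simp add: image_Un image_diff_atLeastAtMost Un_commute)
   then show ?thesis unfolding reversepath_def by (metis image_image)
  qed
  have "0 < 1 - b0 & 1 - b0 < 1 - a1 & 1 - a1 < 1 & A = reversepath gm ` {0..1 - b0} & B = reversepath gm ` {1 - a1..1}"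
   by (rule loop_initial_final_arcs[OF rev \<open>0 < 1 - b0\<close> _ _ a0(4)[unfolded image] _ _ _ a1(4)[unfolded image] B(5) meet])
    (use a0 a1 in auto)
  then show thesis by (intro that[OF rev, of "1 - b0" "1 - a1"]) (auto simp: path_image_reversepath)
 qed
qed

locale wheel_tile = wheel_parabolic +
 fixes x y p :: real
 assumes gap: "forward_gap l x y" and short: "y < x+2*pi" and p: "x < p" "p < y" "F p = c"
begin

lemma ends_fixed: "l x = x" "l y = y" and xy: "x < y" "y < x+2*pi" and forward: "x < t ==> t < y ==> t < l t"
 using gap short by (auto simp: forward_gap_def)

abbreviation "tile \<equiv> F ` {p..l p}"
abbreviation "pre_tile \<equiv> F ` {l' p..p}"
abbreviation "post_tile \<equiv> F ` {l p..l (l p)}"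
abbreviation "side \<equiv> F ` {x..y}"
abbreviation "other_side \<equiv> F ` {y..x+2*pi}"

lemma tile_order: "x < l' p" "l' p < p" "p < l p" "l p < l (l p)" "l (l p) < y" "l p < y"
 using fixed_interval_invariant[OF ends_fixed p(1,2), of 1] fixed_interval_invariant[OF ends_fixed p(1,2), of 2] forward[of p] forward[of "l p"] forward[of "l' p"] p
 by (auto simp: ll' numeral_2_eq_2)

lemma ends_pole: "F x = c" "F y = c" "F (x+2*pi) = c" using ends_fixed fix_c per by auto

lemma orbit_pole: "F (l p) = c" "F (l' p) = c" "F (l (l p)) = c" using p by (simp_all add: Fl_c Fl'_c)

lemma fundamental_domains_separated:
 assumes "x < s" "s <= q" "l q <= s'" "s' < y" "x < q" "q < y" "F q = c" "F s = F s'"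
 shows "F s = c"
proof (rule ccontr)
 assume off: "F s ~= c"
 have inside: "s < y" "x < s'" using assms forward[of q] by auto
 obtain \<kappa> where \<kappa>: "s <= \<kappa>" "\<kappa> <= l s" "F \<kappa> = c" by (rule fibre_in_fundamental_domain[OF gap p assms(1) inside(1)])
 obtain \<kappa>' where \<kappa>': "s' <= \<kappa>'" "\<kappa>' <= l s'" "F \<kappa>' = c" by (rule fibre_in_fundamental_domain[OF gap p inside(2) assms(4)])
 have "l s' < y" using l_less[of s' y] assms ends_fixed by simp
 moreover have "F (l q) = c" using assms Fl_c by simp
 ultimately show False
  by (intro no_linked_orbits[of x s \<kappa> "l q" s' \<kappa>']) (use \<kappa> \<kappa>' assms ends_pole xy off in auto)
qed

lemma far_right:
 assumes "z : tile" "z : F ` {l (l p)..y}" shows "z = c"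
proof -
 obtain s s' where s: "p <= s" "s <= l p" "z = F s" "l (l p) <= s'" "s' <= y" "z = F s'" using assms by auto
 show ?thesis
 proof (cases "s' = y")
  case True then show ?thesis using s ends_pole by simp
 next
  case False
  then have "F s = c" by (intro fundamental_domains_separated[of s "l p" s']) (use s tile_order p orbit_pole in auto)
  then show ?thesis using s by simp
 qed
qed

lemma far_left:
 assumes "z : tile" "z : F ` {x..l' p}" shows "z = c"
proof -
 obtain s s' where s: "p <= s" "s <= l p" "z = F s" "x <= s'" "s' <= l' p" "z = F s'" using assms by auto
 show ?thesis
 proof (cases "s' = x")
  case True then show ?thesis using s ends_pole by simp
 next
  case False
  then have "F s' = c" by (intro fundamental_domains_separated[of s' "l' p" s]) (use s tile_order p orbit_pole in \<open>auto simp: ll'\<close>)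
  then show ?thesis using s by simp
 qed
qed

lemma pre_Int_post: assumes "z : pre_tile" "z : post_tile" shows "z = c"
proof -
 obtain s s' where s: "l' p <= s" "s <= p" "z = F s" "l p <= s'" "s' <= l (l p)" "z = F s'" using assms by auto
 then have "F s = c" by (intro fundamental_domains_separated[of s p s']) (use s tile_order p orbit_pole in auto)
 then show ?thesis using s by simp
qed

lemma pole_mem: "c : pre_tile" "c : tile" "c : post_tile" "c : other_side" "c : side"
 using image_eqI[of c F p "{l' p..p}"] image_eqI[of c F p "{p..l p}"] image_eqI[of c F "l p" "{l p..l (l p)}"]
  image_eqI[of c F y "{y..x+2*pi}"] image_eqI[of c F y "{x..y}"] tile_order p orbit_pole ends_pole xy by auto

lemma H_tiles: "H ` pre_tile = tile" "H ` tile = post_tile" "H ` other_side = other_side" "H ` side = side"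
proof -
 have interval: "H ` (F ` {s..t}) = F ` {l s..l t}" for s t
 proof -
  have "l ` {s..t} = {l s..l t}"
  proof
   show "{l s..l t} <= l ` {s..t}"
   proof
    fix w assume w: "w : {l s..l t}"
    then have "l' w : {s..t}" using l_le[of s "l' w"] l_le[of "l' w" t] by (simp add: ll')
    then show "w : l ` {s..t}" by (metis imageI ll')
   qed
  qed auto
  then have "F ` {l s..l t} = F ` (l ` {s..t})" by simp
  then show ?thesis by (simp add: image_image FH)
 qed
 show "H ` pre_tile = tile" "H ` tile = post_tile" "H ` other_side = other_side" "H ` side = side" unfolding interval using ends_fixed l_per by (simp_all add: ll')
qed

lemma H_Int: "A <= S2 ==> B <= S2 ==> H ` (A Int B) = H ` A Int H ` B"
 using H_inj by (intro inj_on_image_Int[of H S2]) (auto simp: inj_on_def)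

lemma tile_disk: "closed_disk tile" "c : bdry tile"
 using disk[of p "l p"] ends[of p "l p"] tile_order p xy by auto

lemma tile_boundary: "bdry tile = (pre_tile Int tile) Un (tile Int post_tile) Un (tile Int other_side)"
proof -
 have "bdry tile = tile Int F ` {l p..p+2*pi}" using bdry_eq[of p "l p"] tile_order p xy by simp
 also have "F ` {l p..p+2*pi} = post_tile Un F ` {l (l p)..y} Un other_side Un F ` {x+2*pi..l' p+2*pi} Un F ` {l' p+2*pi..p+2*pi}"
  using image_split[of "l p" "l (l p)" "p+2*pi"] image_split[of "l (l p)" y "p+2*pi"]
   image_split[of y "x+2*pi" "p+2*pi"] image_split[of "x+2*pi" "l' p+2*pi" "p+2*pi"] tile_order p xy by auto
 also have "\<dots> = post_tile Un F ` {l (l p)..y} Un other_side Un F ` {x..l' p} Un pre_tile" by (simp only: shift_image)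
 finally have pieces: "bdry tile = tile Int (post_tile Un F ` {l (l p)..y} Un other_side Un F ` {x..l' p} Un pre_tile)" .
 have "tile Int F ` {l (l p)..y} <= {c}" "tile Int F ` {x..l' p} <= {c}" using far_right far_left by blast+
 then show ?thesis unfolding pieces using pole_mem by blast
qed

lemma pre_corner_unique:
 assumes "w ~= c" "w : pre_tile" "w : tile" "w : other_side" "v ~= c" "v : pre_tile" "v : tile" "v : other_side" shows "v = w"
proof -
 have sub: "other_side <= F ` {l p..l' p+2*pi}" using tile_order xy by (intro image_mono) auto
 show ?thesis
  by (rule triple_at_most_two[of "l' p" p "l p" c v w]) (use assms sub pole_mem tile_order p xy in auto)
qed

lemma post_corner_unique:
 assumes "w ~= c" "w : tile" "w : post_tile" "w : other_side" "v ~= c" "v : tile" "v : post_tile" "v : other_side" shows "v = w"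
proof -
 have sub: "other_side <= F ` {l (l p)..p+2*pi}" using tile_order xy p by (intro image_mono) auto
 show ?thesis
  by (rule triple_at_most_two[of p "l p" "l (l p)" c v w]) (use assms sub pole_mem tile_order p xy in auto)
qed

lemma tile_loop:
 obtains gm a b where "simple_path gm" "pathstart gm = c" "pathfinish gm = c" "path_image gm = bdry tile"
  "0 < a" "a < b" "b < 1" "pre_tile Int tile = gm ` {0..a}" "tile Int post_tile = gm ` {b..1}"
proof -
 obtain gm where g: "simple_path gm" "pathstart gm = c" "pathfinish gm = c" "path_image gm = bdry tile"
  by (rule closed_disk_boundary_loop[OF tile_disk])
 have con: "connected (pre_tile Int tile)" "connected (tile Int post_tile)"
  using connected_Int_consecutive[of "l' p" p "l p"] connected_Int_consecutive[of p "l p" "l (l p)"] tile_order p xy by simp_all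
 have nontrivial: "pre_tile Int tile ~= {c}" "tile Int post_tile ~= {c}"
  using consecutive_Int_nontrivial[of "l' p" p "l p"] ends[of "l' p" "l p"]
   consecutive_Int_nontrivial[of p "l p" "l (l p)"] ends[of p "l (l p)"] tile_order p xy orbit_pole by auto
 have closed: "closed (pre_tile Int tile)" "closed (tile Int post_tile)" by (intro closed_Int closed_im)+
 have sub: "pre_tile Int tile <= path_image gm" "tile Int post_tile <= path_image gm" using g(4) tile_boundary by auto
 have meet: "(pre_tile Int tile) Int (tile Int post_tile) <= {c}" using pre_Int_post by blast
 show thesis
  by (rule loop_two_subcontinua[OF g(1-3) closed(1) con(1) sub(1) _ nontrivial(1) closed(2) con(2) sub(2) _ nontrivial(2) meet])
   (use pole_mem g(4) that in auto)
qed

lemma lpow_fixed: "l t = t ==> lpow j t = t"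
proof -
 assume t: "l t = t"
 then have "l' t = t" by (simp add: l'_fix)
 then have "(l ^^ n) t = t" "(l' ^^ n) t = t" for n by (induction n) (simp_all add: t)
 then show ?thesis by (simp add: lpow_def)
qed

lemma Hpow_image: "Hpow j ` (F ` {s..t}) = F ` {lpow j s..lpow j t}"
proof -
 have "lpow j ` {s..t} = {lpow j s..lpow j t}"
 proof
  show "lpow j ` {s..t} <= {lpow j s..lpow j t}" using lpow_mono[of j] by (auto simp: strict_mono_less_eq)
  show "{lpow j s..lpow j t} <= lpow j ` {s..t}"
  proof
   fix w assume w: "w : {lpow j s..lpow j t}"
   have inverse: "lpow j (lpow (- j) w) = w" "lpow (- j) (lpow j v) = v" for v using lpow_add[of j "- j" w] lpow_add[of "- j" j v] by auto
   have "lpow (- j) w : {s..t}" using w lpow_mono[of "- j"] inverse(2)[of s] inverse(2)[of t] strict_mono_less_eq[of "lpow (- j)"] by (metis atLeastAtMost_iff)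
   then show "w : lpow j ` {s..t}" using inverse(1) by (metis imageI)
  qed
 qed
 then have "F ` {lpow j s..lpow j t} = F ` (lpow j ` {s..t})" by simp
 then show ?thesis by (simp add: image_image Hpow_F)
qed

lemma Hpow_c: "Hpow j c = c" using Hpow_F[of j x] lpow_fixed[of x j] ends_fixed ends_pole by simp

lemma lpow_range: "x < t ==> t < y ==> x < lpow j t & lpow j t < y"
 using fixed_interval_invariant[OF ends_fixed] by (auto simp: lpow_def)

lemma lpow_p_mono: "i <= j ==> lpow i p <= lpow j p"
proof (induction j rule: int_ge_induct)
 case (step j)
 have "lpow j p < l (lpow j p)" using forward[of "lpow j p"] lpow_range[OF p(1,2), of j] by blast
 then show ?case using step by (simp add: lpow_Suc)
qed simp

lemma lpow_tile: "lpow j (l p) = lpow (j+1) p" using lpow_add[of j 1 p] lpow_Suc[of 0 p] by simp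

lemma tile_index:
 assumes t: "x < t" "t < y" shows "EX j. lpow j p <= t & t <= lpow (j+1) p"
proof -
 consider (right) "p < t" | (same) "t = p" | (left) "t < p" by linarith
 then show ?thesis
 proof cases
  case right
  obtain k where k: "(l ^^ k) p < t" "t <= (l ^^ Suc k) p" by (rule fundamental_iterate[OF gap p(1) right t(2)])
  have "lpow (int k) p = (l ^^ k) p" "lpow (int k+1) p = (l ^^ Suc k) p" by (simp_all add: lpow_def nat_add_distrib)
  then show ?thesis using k by (intro exI[of _ "int k"]) auto
 next
  case same
  then show ?thesis using tile_order by (intro exI[of _ 0]) (simp add: lpow_Suc[of 0, simplified])
 next
  case left
  obtain k where k: "(l ^^ k) t < p" "p <= (l ^^ Suc k) t" by (rule fundamental_iterate[OF gap t(1) left p(2)])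
  have "lpow (int k) t = (l ^^ k) t" "lpow (int k+1) t = (l ^^ Suc k) t" by (simp_all add: lpow_def nat_add_distrib)
  then have "lpow (- int k) (lpow (int k) t) < lpow (- int k) p" "lpow (- (int k+1)) p <= lpow (- (int k+1)) (lpow (int k+1) t)"
   using k by (simp_all add: strict_mono_less[OF lpow_mono] strict_mono_less_eq[OF lpow_mono])
  then have "t < lpow (- int k) p" "lpow (- (int k+1)) p <= t"
   using lpow_add[of "- int k" "int k" t] lpow_add[of "- (int k+1)" "int k+1" t] by simp_all
  then show ?thesis by (intro exI[of _ "- (int k+1)"]) auto
 qed
qed

lemma Hpow_other_side: "Hpow j ` other_side = other_side"
 using Hpow_image lpow_fixed[of y j] lpow_fixed[of "x+2*pi" j] ends_fixed l_per[of x] by simp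

lemma tile_S2: "tile <= S2" "other_side <= S2" using F_in by auto

lemma tiles_cover: "(\<Union>j. Hpow j ` (tile - {c})) = side - {c}"
proof
 show "(\<Union>j. Hpow j ` (tile - {c})) <= side - {c}"
 proof
  fix z assume "z : (\<Union>j. Hpow j ` (tile - {c}))"
  then obtain j w where w: "w : tile" "w ~= c" "z = Hpow j w" by blast
  have "w : S2" using w tile_S2 by blast
  then have "z ~= c" using Hpow_inj[OF _ pole_in_S2, of w j] Hpow_c w by metis
  moreover obtain t where t: "p <= t" "t <= l p" "w = F t" using w by auto
  have "x < lpow j t" "lpow j t < y" using lpow_range[of t j] t p tile_order by auto
  then have "z : side" using w t Hpow_F by auto
  ultimately show "z : side - {c}" by blast
 qed
 show "side - {c} <= (\<Union>j. Hpow j ` (tile - {c}))"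
 proof
  fix z assume z: "z : side - {c}"
  then obtain t where t: "x <= t" "t <= y" "z = F t" by auto
  then have "x < t" "t < y" using z ends_pole by (auto simp: less_le)
  then obtain j where j: "lpow j p <= t" "t <= lpow (j+1) p" using tile_index by blast
  then have "z : Hpow j ` tile" unfolding Hpow_image lpow_tile using t by auto
  then obtain w where w: "w : tile" "z = Hpow j w" by blast
  then have "w ~= c" using Hpow_c z by auto
  then show "z : (\<Union>j. Hpow j ` (tile - {c}))" using w by blast
 qed
qed

lemma tiles_far:
 assumes "\<bar>j\<bar> >= 2" shows "(tile - {c}) Int Hpow j ` (tile - {c}) = {}"
proof (rule ccontr)
 assume "~ ?thesis"
 then obtain z w where z: "z : tile" "z ~= c" "w : tile" "z = Hpow j w" by blast
 then have zj: "z : F ` {lpow j p..lpow (j+1) p}" unfolding lpow_tile[symmetric] Hpow_image[symmetric] by blast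
 consider (right) "j >= 2" | (left) "j+1 <= -1" using assms by linarith
 then show False
 proof cases
  case right
  have "lpow 2 p <= lpow j p" by (rule lpow_p_mono[OF right])
  moreover have "lpow 2 p = l (l p)" using lpow_Suc[of 1 p] lpow_Suc[of 0 p] by simp
  moreover have "lpow (j+1) p < y" using lpow_range p by blast
  ultimately have "{lpow j p..lpow (j+1) p} <= {l (l p)..y}" by auto
  then have "z : F ` {l (l p)..y}" using zj by blast
  then show False using far_right z by blast
 next
  case left
  have "lpow (j+1) p <= lpow (-1) p" by (rule lpow_p_mono[OF left])
  moreover have "lpow (-1) p = l' p" using lpow_pred[of 0 p] by simp
  moreover have "x < lpow j p" using lpow_range p by blast
  ultimately have "{lpow j p..lpow (j+1) p} <= {x..l' p}" by auto
  then have "z : F ` {x..l' p}" using zj by blast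
  then show False using far_left z by blast
 qed
qed

lemma other_side_tiles: "(\<Union>j. Hpow j ` (tile Int other_side - {c})) = side Int other_side - {c}"
proof
 show "(\<Union>j. Hpow j ` (tile Int other_side - {c})) <= side Int other_side - {c}" using tiles_cover Hpow_other_side by blast
 show "side Int other_side - {c} <= (\<Union>j. Hpow j ` (tile Int other_side - {c}))"
 proof
  fix z assume z: "z : side Int other_side - {c}"
  then obtain j w where w: "w : tile - {c}" "z = Hpow j w" using tiles_cover by blast
  have "w : S2" using w tile_S2 by blast
  then have "w = Hpow (- j) z" using Hpow_inv w by simp
  then have "w : other_side" using Hpow_other_side[of "- j"] z by blast
  then show "z : (\<Union>j. Hpow j ` (tile Int other_side - {c}))" using w by blast
 qed
qed

lemma tiles_shrink:
 assumes "e > 0" obtains N :: nat where "!!j z. \<bar>j\<bar> >= int N ==> z : Hpow j ` tile ==> dist z c < e"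
proof -
 obtain d where d: "d > 0" "!!s t. \<bar>s - t\<bar> < d ==> dist (F s) (F t) < e" using periodic_uniformly_continuous[OF cont per assms] by metis
 obtain N1 where N1: "!!n. n >= N1 ==> dist ((l ^^ n) p) y < d"
  using forward_gap_limits(1)[OF gap p(1,2)] d(1) metric_LIMSEQ_D by blast
 obtain N2 where N2: "!!n. n >= N2 ==> dist ((l' ^^ n) p) x < d"
  using forward_gap_limits(2)[OF gap p(1,2)] d(1) metric_LIMSEQ_D by blast
 define N where "N = N1 + N2+1"
 have "dist z c < e" if j: "\<bar>j\<bar> >= int N" and z: "z : Hpow j ` tile" for j z
 proof -
  obtain t where t: "lpow j p <= t" "t <= lpow (j+1) p" "z = F t" using z unfolding Hpow_image lpow_tile by auto
  have range: "x < lpow j p" "lpow (j+1) p < y" using lpow_range p by blast+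
  show ?thesis
  proof (cases "0 <= j")
   case True
   then have "nat j >= N1" using j by (simp add: N_def)
   then have "dist (lpow j p) y < d" using N1 True by (simp add: lpow_def)
   then have "dist (F t) (F y) < e" using t range by (intro d(2)) (auto simp: dist_real_def)
   then show ?thesis using t ends_pole by simp
  next
   case False
   then have late: "nat (- (j+1)) >= N2" "j+1 <= 0" using j by (auto simp: N_def)
   have "lpow (j+1) p = (l' ^^ nat (- (j+1))) p" using late(2) by (cases "j+1 = 0") (auto simp: lpow_def)
   then have "dist (lpow (j+1) p) x < d" using N2 late by simp
   then have "dist (F t) (F x) < e" using t range by (intro d(2)) (auto simp: dist_real_def)
   then show ?thesis using t ends_pole by simp
  qed
 qed
 then show thesis using that[of N] by blast
qed

definition equivariant_line :: "(real => real^3) => bool" where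
 "equivariant_line lam \<longleftrightarrow> continuous_on UNIV lam & inj lam & range lam = side Int other_side - {c} & (ALL u. lam (u+1) = H (lam u)) &
   (ALL e>0. EX n. ALL u. \<bar>u\<bar> >= n --> dist (lam u) c < e)"

end

lemma compact_connected_preimage_interval:
 fixes lam :: "real => 'a::metric_space"
 assumes lam: "continuous_on UNIV lam" "inj lam" and \<beta>: "compact \<beta>" "connected \<beta>" "\<beta> <= range lam"
  and bounded: "!!u. lam u : \<beta> ==> \<bar>u\<bar> <= n"
 obtains m M where "{u. lam u : \<beta>} = {m..M}"
proof -
 define V where "V = {u. lam u : \<beta>}"
 have V: "V <= {- n..n}" using bounded by (force simp: V_def)
 have lV: "lam ` V = \<beta>" using \<beta>(3) by (auto simp: V_def)
 have "EX g. homeomorphism {- n..n} (lam ` {- n..n}) lam g"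
  by (rule homeomorphism_compact) (use lam in \<open>auto intro: continuous_on_subset inj_on_subset\<close>)
 then obtain g where g: "homeomorphism {- n..n} (lam ` {- n..n}) lam g" ..
 have "g (lam v) = v" if "v : V" for v using homeomorphism_apply1[OF g] V that by blast
 then have "g ` \<beta> = V" unfolding lV[symmetric] by (simp add: image_image)
 moreover have "continuous_on \<beta> g"
  by (rule continuous_on_subset[OF homeomorphism_cont2[OF g]]) (use lV V in blast)
 ultimately have "connected V" "compact V"
  using connected_continuous_image[of \<beta> g] compact_continuous_image[of \<beta> g] \<beta> by auto
 then show thesis using connected_compact_interval_1[of V] that unfolding V_def by auto
qed

subsection \<open>The boundary loop of a tile\<close>

locale wheel_tile_loop = wheel_tile +
 fixes gm :: "real => real^3" and a b :: real
 assumes g: "simple_path gm" "pathstart gm = c" "pathfinish gm = c" "path_image gm = bdry tile"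
  and ab: "0 < a" "a < b" "b < 1" and k0: "pre_tile Int tile = gm ` {0..a}" and k1: "tile Int post_tile = gm ` {b..1}"
begin

lemma gm_cont: "continuous_on {0..1} gm" using g(1) by (simp add: simple_path_def path_def)

lemma gm_ends: "gm 0 = c" "gm 1 = c" using g by (auto simp: pathstart_def pathfinish_def)

lemma gm_off_pole: "0 < t ==> t < 1 ==> gm t ~= c"
 using simple_loop_inj[OF g(1), of 0 t] gm_ends by auto

lemma middle_arc_in_D': "gm ` {a..b} <= tile Int other_side"
proof -
 have "gm t : tile Int other_side" if t: "a < t" "t < b" for t
 proof -
  have "gm t : bdry tile" unfolding g(4)[symmetric] path_image_def using t ab by auto
  moreover have "gm t ~: gm ` {0..a}" "gm t ~: gm ` {b..1}"
   using simple_loop_arc_mem[OF g(1), of t 0 a] simple_loop_arc_mem[OF g(1), of t b 1] t ab by fastforce+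
  ultimately show ?thesis using tile_boundary k0 k1 by blast
 qed
 moreover have "closed (tile Int other_side)" by (intro closed_Int closed_im)
 ultimately have "gm ` closure {a<..<b} <= tile Int other_side"
  by (intro image_closure_subset) (use ab in \<open>auto intro: continuous_on_subset[OF gm_cont]\<close>)
 then show ?thesis using ab by simp
qed

lemma corners: "gm a : pre_tile Int tile" "gm a : tile Int other_side - {c}" "gm b : tile Int post_tile" "gm b : tile Int other_side - {c}"
 using k0 k1 middle_arc_in_D' gm_off_pole[of a] gm_off_pole[of b] ab by auto

lemma middle_arc: "tile Int other_side - {c} = gm ` {a..b}"
proof
 have "gm t ~= c" if "t : {a..b}" for t using gm_off_pole[of t] that ab by auto
 then show "gm ` {a..b} <= tile Int other_side - {c}" using middle_arc_in_D' by blast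
 show "tile Int other_side - {c} <= gm ` {a..b}"
 proof
  fix w assume w: "w : tile Int other_side - {c}"
  then have "w : path_image gm" using tile_boundary g(4) by blast
  then obtain t where t: "0 <= t" "t <= 1" "w = gm t" by (auto simp: path_image_def)
  consider (pre) "t : {0..a}" | (post) "t : {b..1}" | (middle) "t : {a..b}" using t by fastforce
  then show "w : gm ` {a..b}"
  proof cases
   case pre
   then have "w : pre_tile" using k0 t by blast
   then have "w = gm a" using pre_corner_unique[of "gm a" w] w corners by blast
   then show ?thesis using ab by auto
  next
   case post
   then have "w : post_tile" using k1 t by blast
   then have "w = gm b" using post_corner_unique[of "gm b" w] w corners by blast
   then show ?thesis using ab by auto
  qed (use t in blast)
 qed
qed

lemma H_corner: "H (gm a) = gm b"
proof (rule post_corner_unique[of "gm b" "H (gm a)"])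
 show "H (gm a) : tile" "H (gm a) : post_tile" "H (gm a) : other_side" using corners H_tiles by blast+
 have "gm a : S2" using corners tile_S2 by blast
 then show "H (gm a) ~= c" using H_inj[of "gm a" c] pole_in_S2 H_pole corners by auto
qed (use corners in auto)

lemma post_edge: "tile Int post_tile = H ` gm ` {0..a}"
proof -
 have "pre_tile <= S2" using F_in by auto
 then show ?thesis unfolding k0[symmetric] using H_Int[of pre_tile tile] tile_S2 H_tiles by simp
qed

definition edge :: "complex => real^3" where "edge z = gm (a+(b - a) * Re z)"

definition "unit_segment = {z::complex. Im z = 0 & 0 <= Re z & Re z <= 1}"

lemma edge_arg:
 assumes "z : unit_segment" shows "a <= a+(b - a) * Re z" "a+(b - a) * Re z <= b"
proof -
 have "0 <= (b - a) * Re z" "(b - a) * Re z <= b - a"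
  using assms ab mult_left_le[of "Re z" "b - a"] by (simp_all add: unit_segment_def)
 then show "a <= a+(b - a) * Re z" "a+(b - a) * Re z <= b" by simp_all
qed

lemma edge_image: "edge ` unit_segment = tile Int other_side - {c}"
proof
 show "edge ` unit_segment <= tile Int other_side - {c}" unfolding middle_arc edge_def using edge_arg by auto
 show "tile Int other_side - {c} <= edge ` unit_segment"
 proof
  fix z assume "z : tile Int other_side - {c}"
  then obtain t where t: "a <= t" "t <= b" "z = gm t" unfolding middle_arc by auto
  define u where "u = (t - a) / (b - a)"
  have "0 <= u" "u <= 1" "a+(b - a) * u = t" using t ab by (auto simp: u_def field_simps)
  then have "z = edge (of_real u)" "of_real u : unit_segment" using t by (auto simp: edge_def unit_segment_def)
  then show "z : edge ` unit_segment" by blast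
 qed
qed

lemma edge_inj: "inj_on edge unit_segment"
proof (rule inj_onI)
 fix z w assume zw: "z : unit_segment" "w : unit_segment" "edge z = edge w"
 have "a+(b - a) * Re z = a+(b - a) * Re w"
  by (rule simple_loop_inj[OF g(1)]) (use zw edge_arg[of z] edge_arg[of w] ab in \<open>auto simp: edge_def\<close>)
 then show "z = w" using zw ab by (auto simp: complex_eq_iff unit_segment_def)
qed

lemma edge_post_tile: assumes z: "z : unit_segment" "edge z : post_tile" shows "Re z = 1"
proof -
 have "edge z : tile Int other_side - {c}" using edge_image z(1) by blast
 then have "edge z = gm b" using post_corner_unique[of "gm b" "edge z"] corners z(2) by blast
 moreover have "edge 1 = gm b" by (simp add: edge_def)
 ultimately have "z = 1" using inj_onD[OF edge_inj, of z 1] z(1) by (simp add: unit_segment_def)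
 then show ?thesis by simp
qed

lemma edge_strip: "fundamental_strip F l l' H H' {z. Im z = 0} unit_segment 0 edge"
proof
 show "unit_segment = {z : {z. Im z = 0}. 0 <= Re z & Re z <= 0+1}" by (auto simp: unit_segment_def)
 show "closed {z. Im z = 0}" by (intro closed_Collect_eq continuous_intros)
 show "continuous_on unit_segment edge" unfolding edge_def
 proof (rule continuous_on_compose2[OF gm_cont])
  show "continuous_on unit_segment (%z. a+(b - a) * Re z)" by (intro continuous_intros)
  show "(%z. a+(b - a) * Re z) ` unit_segment <= {0..1}" using edge_arg ab by fastforce
 qed
 show "edge ` unit_segment <= S2" unfolding edge_image using tile_S2 by blast
 show "edge (z+1) = H (edge z)" if "z : {z. Im z = 0}" "Re z = 0" for z using that H_corner by (simp add: edge_def)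
 show "edge ` unit_segment Int Hpow j ` (edge ` unit_segment) = {}" if "\<bar>j\<bar> >= 2" for j
  unfolding edge_image using tiles_far[OF that] by blast
 show "Re z = 0+1" if "z : unit_segment" "edge z : H ` (edge ` unit_segment)" for z
 proof -
  have "edge z : post_tile" using that(2) edge_image H_tiles(2) by blast
  then show ?thesis using edge_post_tile[OF that(1)] by simp
 qed
qed (auto simp: edge_inj)

lemma equivariant_line_exists: "EX lam. equivariant_line lam"
proof -
 interpret E: fundamental_strip F l l' H H' "{z. Im z = 0}" unit_segment 0 edge by (rule edge_strip)
 define lam where "lam u = E.glued (of_real u)" for u
 have axis: "{z. Im z = 0} = range complex_of_real" by (auto simp: complex_eq_iff intro: range_eqI[of _ _ "Re _"])
 have "continuous_on UNIV lam" unfolding lam_def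
  by (rule continuous_on_compose2[OF E.continuous_on_glued]) (auto intro: continuous_intros)
 moreover have "inj lam"
 proof (rule injI)
  fix u v assume "lam u = lam v"
  then have "complex_of_real u = of_real v" using inj_onD[OF E.inj_on_glued, of "of_real u" "of_real v"] by (simp add: lam_def)
  then show "u = v" by simp
 qed
 moreover have "range lam = side Int other_side - {c}"
 proof -
  have "range lam = E.glued ` {z. Im z = 0}" unfolding axis by (simp add: lam_def image_image)
  then show ?thesis unfolding E.glued_image edge_image other_side_tiles .
 qed
 moreover have "lam (u+1) = H (lam u)" for u using E.glued_equivariant[of "of_real u"] by (simp add: lam_def)
 moreover have "EX n. ALL u. \<bar>u\<bar> >= n --> dist (lam u) c < e" if "e > 0" for e
 proof -
  obtain N :: nat where N: "!!j z. \<bar>j\<bar> >= int N ==> z : Hpow j ` tile ==> dist z c < e" by (rule tiles_shrink[OF \<open>e > 0\<close>], rule that)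
  have "dist (lam u) c < e" if u: "\<bar>u\<bar> >= real N+1" for u
  proof -
   obtain w and j :: int where w: "w : unit_segment" "of_real u = w + of_int j" "lam u = Hpow j (edge w)"
    using E.glued_representative[of "of_real u"] by (auto simp: lam_def)
   have "u = Re w + of_int j" using arg_cong[OF w(2), of Re] by simp
   then have "\<bar>of_int j\<bar> >= real N" using u w(1) by (auto simp: unit_segment_def)
   then have "\<bar>j\<bar> >= int N" by linarith
   moreover have "lam u : Hpow j ` tile" using w edge_image by blast
   ultimately show ?thesis by (rule N)
  qed
  then show ?thesis by blast
 qed
 ultimately have "equivariant_line lam" by (simp add: equivariant_line_def)
 then show ?thesis by blast
qed

end

definition "triangle_left = {z : triangle. Re z = 0}"
definition "triangle_bottom = {z : triangle. Im z = 0}"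
definition "triangle_slant = {z : triangle. Re z + Im z = 1}"

lemma triangle_boundary_split: "triangle_boundary = triangle_left Un triangle_bottom Un triangle_slant"
 by (auto simp: triangle_boundary_def triangle_left_def triangle_bottom_def triangle_slant_def)

lemma closed_triangle_boundarys: "closed triangle_left" "closed triangle_bottom" "closed triangle_slant"
 unfolding triangle_left_def triangle_bottom_def triangle_slant_def Collect_conj_eq Collect_mem_eq
 by (intro closed_Int compact_imp_closed[OF triangle_facts(1)] closed_Collect_eq continuous_intros)+

subsection \<open>Filling a tile along an invariant line\<close>

locale wheel_tile_line = wheel_tile_loop +
 fixes lam :: "real => real^3" and u0 :: real
 assumes line: "equivariant_line lam" and u0: "lam u0 = gm a"
begin

lemma lam_cont: "continuous_on UNIV lam" and lam_inj: "inj lam" and lam_range: "range lam = side Int other_side - {c}"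
 and lam_H: "lam (u+1) = H (lam u)"
 using line by (auto simp: equivariant_line_def)

lemma lam_corner: "lam (u0+1) = gm b" using lam_H u0 H_corner by simp

lemma lam_translate: "lam (u + of_int j) = Hpow j (lam u)"
proof -
 have S2: "lam v : S2" for v using lam_range tile_S2 by blast
 have H1: "lam (v+1) = Hpow 1 (lam v)" for v using lam_H Hpow_1[OF S2] by simp
 show ?thesis
 proof (induction j rule: int_induct[where k = 0])
  case base then show ?case by simp
 next
  case (step1 i)
  have "lam (u + of_int (i+1)) = lam ((u + of_int i)+1)" by (simp add: algebra_simps)
  also have "\<dots> = Hpow 1 (Hpow i (lam u))" using H1 step1 by simp
  finally show ?case using Hpow_add[OF S2, of 1 i u] by (simp add: add.commute)
 next
  case (step2 i)
  have "Hpow 1 (lam (u + of_int (i - 1))) = lam ((u + of_int (i - 1))+1)" by (rule H1[symmetric])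
  also have "\<dots> = Hpow i (lam u)" using step2 by simp
  finally have "Hpow (-1) (Hpow 1 (lam (u + of_int (i - 1)))) = Hpow (-1) (Hpow i (lam u))" by simp
  then show ?case using Hpow_inv[OF S2, of 1] Hpow_add[OF S2, of "-1" i u] by simp
 qed
qed

lemma lam_unit_interval: "lam ` {u0..u0+1} = gm ` {a..b}"
proof -
 let ?\<beta> = "gm ` {a..b}"
 have "continuous_on {a..b} gm" using gm_cont ab by (auto intro: continuous_on_subset)
 then have compact: "compact ?\<beta>" and connected: "connected ?\<beta>"
  by (auto intro!: compact_continuous_image connected_continuous_image)
 have "tile <= side" using p tile_order by (intro image_mono) auto
 then have sub: "?\<beta> <= range lam" unfolding lam_range middle_arc[symmetric] by blast
 have "c : - ?\<beta>" "open (- ?\<beta>)" using middle_arc compact compact_imp_closed by blast+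
 then obtain e where e: "e > 0" "ball c e <= - ?\<beta>" using openE by metis
 obtain n where n: "ALL u. \<bar>u\<bar> >= n --> dist (lam u) c < e" using line e(1) unfolding equivariant_line_def by blast
 have bounded: "\<bar>u\<bar> <= n" if "lam u : ?\<beta>" for u
 proof (rule ccontr)
  assume "~ \<bar>u\<bar> <= n"
  then have "lam u : ball c e" using n by (simp add: dist_commute)
  then show False using e(2) that by blast
 qed
 obtain m M where mM: "{u. lam u : ?\<beta>} = {m..M}"
  by (rule compact_connected_preimage_interval[OF lam_cont lam_inj compact connected sub, of n], erule bounded, rule that)
 have "u0 : {m..M}" "u0+1 : {m..M}" unfolding mM[symmetric] using u0 lam_corner ab by auto
 then have order: "m <= u0" "u0+1 <= M" by auto
 have unique: "v = u0" if "v : {m..M}" "v+1 : {m..M}" for v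
 proof -
  have v: "lam v : tile Int other_side - {c}" "lam (v+1) : tile Int other_side - {c}" using that unfolding mM[symmetric] middle_arc by auto
  then have "H (lam v) : H ` tile" by blast
  then have "lam (v+1) : post_tile" by (simp only: lam_H H_tiles(2))
  then have "lam (v+1) = lam (u0+1)" using post_corner_unique[of "lam (u0+1)" "lam (v+1)"] v corners lam_corner by auto
  then show ?thesis using lam_inj by (simp add: inj_eq)
 qed
 have "m = u0" "M - 1 = u0" using unique[of m] unique[of "M - 1"] order by auto
 then have "{u0..u0+1} = {u. lam u : ?\<beta>}" unfolding mM by auto
 moreover have "lam ` (lam -` ?\<beta>) = ?\<beta>" unfolding image_vimage_eq using sub by (rule Int_absorb2)
 ultimately show ?thesis by (simp only: vimage_def)
qed

definition boundary_map :: "complex => real^3" where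
 "boundary_map z = (if Re z = 0 then gm (a * (1 - Im z)) else if Im z = 0 then lam (u0 + Re z) else H (gm (a * (1 - Im z))))"

lemma boundary_map_left: "z : triangle_left ==> boundary_map z = gm (a * (1 - Im z))"
 by (simp add: boundary_map_def triangle_left_def)

lemma boundary_map_bottom: "z : triangle_bottom ==> boundary_map z = lam (u0 + Re z)"
 using u0 by (auto simp: boundary_map_def triangle_bottom_def)

lemma boundary_map_slant: "z : triangle_slant ==> boundary_map z = H (gm (a * (1 - Im z)))"
 using u0 lam_corner H_corner gm_ends H_pole by (auto simp: boundary_map_def triangle_slant_def)

lemma left_arg:
 assumes "z : triangle" shows "0 <= a * (1 - Im z)" "a * (1 - Im z) <= a" "a * (1 - Im z) < 1"
proof -
 show "0 <= a * (1 - Im z)" using assms ab by (simp add: triangle_def)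
 show "a * (1 - Im z) <= a" using assms ab mult_left_le[of "1 - Im z" a] by (simp add: triangle_def)
 then show "a * (1 - Im z) < 1" by (rule le_less_trans) (use ab in simp)
qed

lemma left_S2: "z : triangle ==> gm (a * (1 - Im z)) : S2"
proof -
 assume "z : triangle"
 then have "gm (a * (1 - Im z)) : pre_tile Int tile" unfolding k0 using left_arg by auto
 then show ?thesis using tile_S2 by blast
qed

lemma boundary_map_cont: "continuous_on triangle_boundary boundary_map"
proof -
 have arc: "continuous_on triangle (%z. gm (a * (1 - Im z)))"
  by (rule continuous_on_compose2[OF gm_cont]) (use left_arg in \<open>auto intro!: continuous_intros simp: less_imp_le\<close>)
 have sub: "triangle_left <= triangle" "triangle_slant <= triangle" by (auto simp: triangle_left_def triangle_slant_def)
 have "continuous_on triangle_left boundary_map"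
  using continuous_on_subset[OF arc sub(1)] by (rule continuous_on_eq) (simp add: boundary_map_left)
 moreover have "continuous_on triangle_bottom (%z. lam (u0 + Re z))"
  by (rule continuous_on_compose2[OF lam_cont]) (auto intro!: continuous_intros)
 then have "continuous_on triangle_bottom boundary_map" by (rule continuous_on_eq) (simp add: boundary_map_bottom)
 moreover have "continuous_on triangle_slant (%z. H (gm (a * (1 - Im z))))"
  by (rule continuous_on_compose2[OF homeomorphism_cont1[OF hom] continuous_on_subset[OF arc sub(2)]]) (use left_S2 sub in blast)
 then have "continuous_on triangle_slant boundary_map" by (rule continuous_on_eq) (simp add: boundary_map_slant)
 ultimately show ?thesis unfolding triangle_boundary_split by (intro continuous_on_closed_Un closed_Un closed_triangle_boundarys)
qed

lemma left_image: "boundary_map ` triangle_left = gm ` {0..a}"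
proof
 show "boundary_map ` triangle_left <= gm ` {0..a}" using boundary_map_left left_arg by (auto simp: triangle_left_def)
 show "gm ` {0..a} <= boundary_map ` triangle_left"
 proof
  fix w assume "w : gm ` {0..a}"
  then obtain t where t: "0 <= t" "t <= a" "w = gm t" by auto
  define z where "z = Complex 0 (1 - t / a)"
  have z: "z : triangle_left" using t ab by (auto simp: z_def triangle_left_def triangle_def field_simps)
  then have "boundary_map z = w" unfolding boundary_map_left[OF z] using t ab by (simp add: z_def)
  then show "w : boundary_map ` triangle_left" using z by blast
 qed
qed

lemma bottom_image: "boundary_map ` triangle_bottom = gm ` {a..b}"
proof -
 have "{u0..u0+1} <= (%z. u0 + Re z) ` triangle_bottom"
 proof
  fix u assume "u : {u0..u0+1}"
  then show "u : (%z. u0 + Re z) ` triangle_bottom" by (intro image_eqI[of _ _ "of_real (u - u0)"]) (auto simp: triangle_bottom_def triangle_def)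
 qed
 moreover have "(%z. u0 + Re z) ` triangle_bottom <= {u0..u0+1}" by (auto simp: triangle_bottom_def triangle_def)
 ultimately have "(%z. u0 + Re z) ` triangle_bottom = {u0..u0+1}" by (rule equalityI[rotated])
 moreover have "boundary_map ` triangle_bottom = lam ` (%z. u0 + Re z) ` triangle_bottom" using boundary_map_bottom by (simp add: image_image)
 ultimately show ?thesis using lam_unit_interval by simp
qed

lemma slant_image: "boundary_map ` triangle_slant = tile Int post_tile"
proof
 show "boundary_map ` triangle_slant <= tile Int post_tile" unfolding post_edge using boundary_map_slant left_arg by (auto simp: triangle_slant_def)
 show "tile Int post_tile <= boundary_map ` triangle_slant"
 proof
  fix w assume "w : tile Int post_tile"
  then obtain t where t: "0 <= t" "t <= a" "w = H (gm t)" unfolding post_edge by auto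
  define z where "z = Complex (t / a) (1 - t / a)"
  have z: "z : triangle_slant" using t ab by (auto simp: z_def triangle_slant_def triangle_def field_simps)
  then have "boundary_map z = w" unfolding boundary_map_slant[OF z] using t ab by (simp add: z_def)
  then show "w : boundary_map ` triangle_slant" using z by blast
 qed
qed

lemma boundary_map_image: "boundary_map ` triangle_boundary = bdry tile"
 unfolding triangle_boundary_split image_Un left_image bottom_image slant_image k0[symmetric] middle_arc[symmetric] tile_boundary
 using pole_mem by blast

lemma left_arg_inj:
 assumes "z : triangle" "w : triangle" "gm (a * (1 - Im z)) = gm (a * (1 - Im w))" shows "Im z = Im w"
proof -
 have "a * (1 - Im z) = a * (1 - Im w)"
  using g(1) assms(3) left_arg[OF assms(1)] left_arg[OF assms(2)] unfolding simple_path_def loop_free_def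
  by (metis atLeastAtMost_iff less_eq_real_def order_less_irrefl)
 then show ?thesis using ab by simp
qed

lemma boundary_map_inj_edges: "inj_on boundary_map triangle_left" "inj_on boundary_map triangle_bottom" "inj_on boundary_map triangle_slant"
proof -
 show "inj_on boundary_map triangle_left"
  using left_arg_inj boundary_map_left by (auto simp: inj_on_def triangle_left_def complex_eq_iff)
 show "inj_on boundary_map triangle_bottom"
 proof (rule inj_onI)
  fix z w assume zw: "z : triangle_bottom" "w : triangle_bottom" "boundary_map z = boundary_map w"
  then have "Re z = Re w" using boundary_map_bottom lam_inj by (simp add: inj_eq)
  then show "z = w" using zw by (simp add: triangle_bottom_def complex_eq_iff)
 qed
 show "inj_on boundary_map triangle_slant"
 proof (rule inj_onI)
  fix z w assume zw: "z : triangle_slant" "w : triangle_slant" "boundary_map z = boundary_map w"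
  then have triangle: "z : triangle" "w : triangle" by (auto simp: triangle_slant_def)
  have "gm (a * (1 - Im z)) = gm (a * (1 - Im w))"
   using zw boundary_map_slant H_inj[OF left_S2[OF triangle(1)] left_S2[OF triangle(2)]] by simp
  then have "Im z = Im w" by (rule left_arg_inj[OF triangle])
  then show "z = w" using zw by (auto simp: triangle_slant_def complex_eq_iff)
 qed
qed

lemma vertices:
 "0 : triangle_left" "0 : triangle_bottom" "boundary_map 0 = gm a"
 "1 : triangle_bottom" "1 : triangle_slant" "boundary_map 1 = gm b"
 "\<i> : triangle_left" "\<i> : triangle_slant" "boundary_map \<i> = c"
 using boundary_map_left[of 0] boundary_map_bottom[of 1] boundary_map_left[of \<i>] lam_corner gm_ends
 by (auto simp: triangle_left_def triangle_bottom_def triangle_slant_def triangle_def)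

lemma edges_meet_in_vertices:
 assumes eq: "boundary_map z = boundary_map w"
 shows "z : triangle_left ==> w : triangle_bottom ==> z = w" "z : triangle_bottom ==> w : triangle_slant ==> z = w" "z : triangle_left ==> w : triangle_slant ==> z = w"
proof -
 note inj = boundary_map_inj_edges[THEN inj_onD]
 show "z = w" if zw: "z : triangle_left" "w : triangle_bottom"
 proof -
  have "boundary_map z : pre_tile Int tile" "boundary_map w : tile Int other_side - {c}"
   using left_image bottom_image zw unfolding k0 middle_arc by blast+
  then have "boundary_map z = gm a" using pre_corner_unique[of "gm a" "boundary_map z"] corners eq by auto
  then show ?thesis using inj(1)[OF _ zw(1) vertices(1)] inj(2)[OF _ zw(2) vertices(2)] vertices(3) eq by simp
 qed
 show "z = w" if zw: "z : triangle_bottom" "w : triangle_slant"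
 proof -
  have "boundary_map w : tile Int post_tile" "boundary_map z : tile Int other_side - {c}"
   using slant_image bottom_image zw unfolding middle_arc by blast+
  then have "boundary_map w = gm b" using post_corner_unique[of "gm b" "boundary_map w"] corners eq by auto
  then show ?thesis using inj(2)[OF _ zw(1) vertices(4)] inj(3)[OF _ zw(2) vertices(5)] vertices(6) eq by simp
 qed
 show "z = w" if zw: "z : triangle_left" "w : triangle_slant"
 proof -
  have "boundary_map w : tile Int post_tile" "boundary_map z : pre_tile Int tile" using slant_image left_image zw unfolding k0 by blast+
  then have "boundary_map w = c" using pre_Int_post[of "boundary_map w"] eq by auto
  then show ?thesis using inj(1)[OF _ zw(1) vertices(7)] inj(3)[OF _ zw(2) vertices(8)] vertices(9) eq by simp
 qed
qed

lemma boundary_map_inj: "inj_on boundary_map triangle_boundary"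
proof (rule inj_onI)
 fix z w assume zw: "z : triangle_boundary" "w : triangle_boundary" "boundary_map z = boundary_map w"
 have "z : triangle_left | z : triangle_bottom | z : triangle_slant" "w : triangle_left | w : triangle_bottom | w : triangle_slant"
  using zw unfolding triangle_boundary_split by auto
 then show "z = w"
  using boundary_map_inj_edges[THEN inj_onD, OF zw(3)] edges_meet_in_vertices[OF zw(3)] edges_meet_in_vertices[OF zw(3)[symmetric]] by metis
qed

end

locale wheel_filled_tile = wheel_tile_line +
 fixes B :: "complex => real^3"
 assumes B: "continuous_on triangle B" "inj_on B triangle" "B ` triangle = tile" "z : triangle_boundary ==> B z = boundary_map z"
begin

definition "half_plane = {z::complex. 0 <= Im z}"
definition "half_strip = {z : half_plane. u0 <= Re z & Re z <= u0+1}"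

definition fill :: "complex => real^3" where "fill z = B (strip_to_triangle (z - of_real u0))"

lemma half_strip_translate: "(%z. z - of_real u0) ` half_strip = {z. 0 <= Im z & 0 <= Re z & Re z <= 1}" (is "_ = ?S")
proof
 show "?S <= (%z. z - of_real u0) ` half_strip"
 proof
  fix z assume "z : ?S"
  then show "z : (%z. z - of_real u0) ` half_strip"
   by (intro image_eqI[of _ _ "z + of_real u0"]) (auto simp: half_strip_def half_plane_def)
 qed
qed (auto simp: half_strip_def half_plane_def)

lemma strip_to_triangle_mem: "z : half_strip ==> strip_to_triangle (z - of_real u0) : triangle"
 using half_strip_translate strip_to_triangle(3) by blast

lemma fill_image: "fill ` half_strip = tile - {c}"
proof -
 have "fill ` half_strip = B ` strip_to_triangle ` (%z. z - of_real u0) ` half_strip" by (simp add: fill_def image_image)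
 also have "\<dots> = B ` (triangle - {\<i>})" unfolding half_strip_translate strip_to_triangle(3) ..
 also have "\<dots> = B ` triangle - B ` {\<i>}" by (rule inj_on_image_set_diff[OF B(2)]) (auto simp: triangle_def)
 also have "B ` {\<i>} = {c}" using B(4)[of \<i>] vertices triangle_boundary_split by auto
 finally show ?thesis using B(3) by simp
qed

lemma fill_cont: "continuous_on half_strip fill" unfolding fill_def
proof (rule continuous_on_compose2[OF B(1)])
 show "continuous_on half_strip (%z. strip_to_triangle (z - of_real u0))"
  by (rule continuous_on_compose2[OF strip_to_triangle(1)]) (use half_strip_translate in \<open>auto intro!: continuous_intros\<close>)
qed (use strip_to_triangle_mem in blast)

lemma fill_inj: "inj_on fill half_strip"
proof (rule inj_onI)
 fix z w assume zw: "z : half_strip" "w : half_strip" "fill z = fill w"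
 have "strip_to_triangle (z - of_real u0) = strip_to_triangle (w - of_real u0)"
  using B(2) strip_to_triangle_mem[OF zw(1)] strip_to_triangle_mem[OF zw(2)] zw(3) by (simp add: fill_def inj_on_eq_iff)
 moreover have "z - of_real u0 : {z. 0 <= Im z & 0 <= Re z & Re z <= 1}" "w - of_real u0 : {z. 0 <= Im z & 0 <= Re z & Re z <= 1}"
  using half_strip_translate zw by blast+
 ultimately have "z - of_real u0 = w - of_real u0" using strip_to_triangle(2) by (simp only: inj_on_eq_iff)
 then show "z = w" by simp
qed

lemma fill_H: assumes z: "z : half_plane" "Re z = u0" shows "fill (z+1) = H (fill z)"
proof -
 define s where "s = Im z / (1 + Im z)"
 have Im: "1 + Im z > 0" "0 <= Im z" using z by (auto simp: half_plane_def)
 then have sides: "1 / (1 + Im z) = 1 - s" "0 <= s" "s <= 1" by (auto simp: s_def field_simps)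
 have args: "strip_to_triangle (z - of_real u0) = Complex 0 s" "strip_to_triangle (z+1 - of_real u0) = Complex (1 - s) s"
  using z sides(1) by (simp_all add: strip_to_triangle_def s_def)
 have mem: "Complex 0 s : triangle_left" "Complex (1 - s) s : triangle_slant" using sides by (auto simp: triangle_left_def triangle_slant_def triangle_def)
 show ?thesis unfolding fill_def args
  using B(4) boundary_map_left[OF mem(1)] boundary_map_slant[OF mem(2)] mem unfolding triangle_boundary_split by simp
qed

lemma fill_post_tile: assumes z: "z : half_strip" "fill z : post_tile" shows "Re z = u0+1"
proof -
 have "fill z : tile Int post_tile" using z fill_image by blast
 then obtain w where w: "w : triangle_slant" "fill z = boundary_map w" using slant_image by blast
 then have "B (strip_to_triangle (z - of_real u0)) = B w" using B(4)[of w] unfolding triangle_boundary_split by (simp add: fill_def)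
 moreover have "w : triangle" using w by (simp add: triangle_slant_def)
 ultimately have "strip_to_triangle (z - of_real u0) = w" using B(2) strip_to_triangle_mem[OF z(1)] by (auto simp: inj_on_eq_iff)
 then have "(Re z - u0) / (1 + Im z) + Im z / (1 + Im z) = 1" using w by (auto simp: triangle_slant_def strip_to_triangle_def)
 then have "(Re z - u0 + Im z) / (1 + Im z) = 1" by (simp only: add_divide_distrib)
 moreover have "1 + Im z > 0" using z by (simp add: half_strip_def half_plane_def)
 ultimately have "Re z - u0 + Im z = 1 + Im z" by (simp only: divide_eq_1_iff)
 then show ?thesis by linarith
qed

lemma fill_real: assumes "w : half_strip" "Im w = 0" shows "fill w = lam (Re w)"
proof -
 have mem: "Complex (Re w - u0) 0 : triangle_bottom" using assms by (auto simp: half_strip_def triangle_bottom_def triangle_def)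
 have "strip_to_triangle (w - of_real u0) = Complex (Re w - u0) 0" using assms(2) by (simp add: strip_to_triangle_def)
 then show ?thesis using B(4) mem boundary_map_bottom[OF mem] unfolding triangle_boundary_split by (simp add: fill_def)
qed

lemma fill_strip: "fundamental_strip F l l' H H' half_plane half_strip u0 fill"
proof
 show "closed half_plane" unfolding half_plane_def by (intro closed_Collect_le continuous_intros)
 show "fill ` half_strip <= S2" unfolding fill_image using tile_S2 by blast
 show "fill ` half_strip Int Hpow j ` (fill ` half_strip) = {}" if "\<bar>j\<bar> >= 2" for j unfolding fill_image by (rule tiles_far[OF that])
 show "Re z = u0+1" if "z : half_strip" "fill z : H ` (fill ` half_strip)" for z
 proof (rule fill_post_tile[OF that(1)])
  show "fill z : post_tile" using that(2) H_tiles(2) unfolding fill_image by blast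
 qed
qed (simp_all add: half_strip_def[symmetric] fill_cont fill_inj fill_H, simp_all add: half_strip_def half_plane_def)

lemma half_plane_map:
 obtains \<Psi> where "continuous_on {z::complex. 0 <= Im z} \<Psi>" "inj_on \<Psi> {z. 0 <= Im z}" "\<Psi> ` {z. 0 <= Im z} = side - {c}"
  "!!z. 0 <= Im z ==> \<Psi> (z+1) = H (\<Psi> z)" "!!u. \<Psi> (of_real u) = lam u"
proof -
 interpret S: fundamental_strip F l l' H H' half_plane half_strip u0 fill by (rule fill_strip)
 have "S.glued (of_real u) = lam u" for u
 proof -
  have "complex_of_real u : half_plane" by (simp add: half_plane_def)
  then obtain w and j :: int where w: "w : half_strip" "of_real u = w + of_int j" "S.glued (of_real u) = Hpow j (fill w)"
   using S.glued_representative by blast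
  have "Im w = 0" "u = Re w + of_int j" using arg_cong[OF w(2), of Im] arg_cong[OF w(2), of Re] by simp_all
  then show ?thesis using w fill_real lam_translate by simp
 qed
 moreover have "S.glued ` half_plane = side - {c}" unfolding S.glued_image fill_image by (rule tiles_cover)
 ultimately show thesis
  using that[of S.glued] S.continuous_on_glued S.inj_on_glued S.glued_equivariant by (simp add: half_plane_def)
qed

end

subsection \<open>Conjugation to a translation\<close>

lemma (in wheel_tile) half_plane:
 assumes line: "equivariant_line lam"
 obtains \<Psi> where "continuous_on {z::complex. 0 <= Im z} \<Psi>" "inj_on \<Psi> {z. 0 <= Im z}" "\<Psi> ` {z. 0 <= Im z} = side - {c}"
  "!!z. 0 <= Im z ==> \<Psi> (z+1) = H (\<Psi> z)" "!!u. \<Psi> (of_real u) = lam u"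
proof -
 obtain gm a b where g: "simple_path gm" "pathstart gm = c" "pathfinish gm = c" "path_image gm = bdry tile"
  "0 < a" "a < b" "b < 1" "pre_tile Int tile = gm ` {0..a}" "tile Int post_tile = gm ` {b..1}"
  by (rule tile_loop)
 interpret L: wheel_tile_loop F l l' H H' c x y p gm a b by unfold_locales (use g in auto)
 have "tile <= side" using p tile_order by (intro image_mono) auto
 then have "gm a : side Int other_side - {c}" using L.corners(2) by blast
 also have "side Int other_side - {c} = range lam" using line by (simp add: equivariant_line_def)
 finally obtain u0 where "lam u0 = gm a" by (metis imageE)
 then interpret N: wheel_tile_line F l l' H H' c x y p gm a b lam u0 by unfold_locales (use line in auto)
 obtain B where "continuous_on triangle B" "inj_on B triangle" "B ` triangle = tile" "!!z. z : triangle_boundary ==> B z = N.boundary_map z"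
  using extend_boundary_map[OF tile_disk(1) N.boundary_map_cont N.boundary_map_inj N.boundary_map_image] by metis
 then interpret B: wheel_filled_tile F l l' H H' c x y p gm a b lam u0 B by unfold_locales auto
 show thesis by (rule B.half_plane_map, rule that)
qed

lemma (in wheel_tile) line_exists: "EX lam. equivariant_line lam"
proof -
 obtain gm a b where g: "simple_path gm" "pathstart gm = c" "pathfinish gm = c" "path_image gm = bdry tile"
  "0 < a" "a < b" "b < 1" "pre_tile Int tile = gm ` {0..a}" "tile Int post_tile = gm ` {b..1}"
  by (rule tile_loop)
 interpret L: wheel_tile_loop F l l' H H' c x y p gm a b by unfold_locales (use g in auto)
 show ?thesis by (rule L.equivariant_line_exists)
qed

lemma half_planes_meet:
 assumes inj: "inj_on \<Psi>1 {z. 0 <= Im z}" "inj_on \<Psi>2 {z. 0 <= Im z}"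
  and agree: "!!u. \<Psi>1 (of_real u) = \<Psi>2 (of_real u)"
  and meet: "\<Psi>1 ` {z. 0 <= Im z} Int \<Psi>2 ` {z. 0 <= Im z} <= range (%u. \<Psi>1 (of_real u))"
  and zw: "0 <= Im z" "Im w <= 0" "\<Psi>1 z = \<Psi>2 (cnj w)"
 shows "z = w"
proof -
 have "\<Psi>1 z : \<Psi>1 ` {z. 0 <= Im z}" "\<Psi>2 (cnj w) : \<Psi>2 ` {z. 0 <= Im z}" using zw by (intro imageI; simp)+
 then have "\<Psi>1 z : \<Psi>1 ` {z. 0 <= Im z} Int \<Psi>2 ` {z. 0 <= Im z}" using zw by simp
 then obtain u where "\<Psi>1 z = \<Psi>1 (of_real u)" using meet by auto
 then have "z = of_real u" "cnj w = of_real u"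
  using inj_onD[OF inj(1), of z "of_real u"] inj_onD[OF inj(2), of "cnj w" "of_real u"] agree zw by simp_all
 then show ?thesis by (metis complex_cnj_cnj complex_cnj_complex_of_real)
qed

lemma glue_half_planes:
 fixes \<Psi>1 \<Psi>2 :: "complex => 'a::metric_space"
 assumes cont: "continuous_on {z. 0 <= Im z} \<Psi>1" "continuous_on {z. 0 <= Im z} \<Psi>2"
  and inj: "inj_on \<Psi>1 {z. 0 <= Im z}" "inj_on \<Psi>2 {z. 0 <= Im z}"
  and agree: "!!u. \<Psi>1 (of_real u) = \<Psi>2 (of_real u)"
  and meet: "\<Psi>1 ` {z. 0 <= Im z} Int \<Psi>2 ` {z. 0 <= Im z} <= range (%u. \<Psi>1 (of_real u))"
 obtains \<Psi> where "continuous_on UNIV \<Psi>" "inj \<Psi>" "range \<Psi> = \<Psi>1 ` {z. 0 <= Im z} Un \<Psi>2 ` {z. 0 <= Im z}"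
  "!!z. 0 <= Im z ==> \<Psi> z = \<Psi>1 z" "!!z. Im z <= 0 ==> \<Psi> z = \<Psi>2 (cnj z)"
proof -
 define \<Psi> where "\<Psi> z = (if 0 <= Im z then \<Psi>1 z else \<Psi>2 (cnj z))" for z
 have upper: "\<Psi> z = \<Psi>1 z" if "0 <= Im z" for z using that by (simp add: \<Psi>_def)
 have lower: "\<Psi> z = \<Psi>2 (cnj z)" if "Im z <= 0" for z
 proof (cases "Im z = 0")
  case True
  then have "z = of_real (Re z)" "cnj z = of_real (Re z)" by (simp_all add: complex_eq_iff)
  then show ?thesis using agree[of "Re z"] True by (simp add: \<Psi>_def)
 qed (use that in \<open>simp add: \<Psi>_def\<close>)
 have cover: "{z. 0 <= Im z} Un {z. Im z <= 0} = UNIV" by auto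
 have "continuous_on {z. Im z <= 0} (%z. \<Psi>2 (cnj z))"
  by (rule continuous_on_compose2[OF cont(2)]) (auto intro!: continuous_intros)
 then have "continuous_on {z. 0 <= Im z} \<Psi>" "continuous_on {z. Im z <= 0} \<Psi>"
  using continuous_on_eq[OF cont(1)] continuous_on_eq[of "{z. Im z <= 0}" "%z. \<Psi>2 (cnj z)"] upper lower by simp_all
 then have "continuous_on ({z. 0 <= Im z} Un {z. Im z <= 0}) \<Psi>"
  by (intro continuous_on_closed_Un closed_Collect_le continuous_intros)
 then have continuous: "continuous_on UNIV \<Psi>" unfolding cover .
 have mixed: "z = w" if "0 <= Im z" "Im w <= 0" "\<Psi> z = \<Psi> w" for z w
  by (rule half_planes_meet[OF inj agree meet that(1,2)]) (use that upper lower in simp)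
 have "inj \<Psi>"
 proof (rule injI)
  fix z w assume eq: "\<Psi> z = \<Psi> w"
  consider (upper) "0 <= Im z" "0 <= Im w" | (lower) "Im z <= 0" "Im w <= 0"
   | (mixed) "0 <= Im z" "Im w <= 0" | (swapped) "0 <= Im w" "Im z <= 0" by linarith
  then show "z = w"
  proof cases
   case upper then show ?thesis using eq inj_onD[OF inj(1), of z w] by (simp add: \<Psi>_def)
  next
   case lower
   then have "cnj z = cnj w" using eq inj_onD[OF inj(2), of "cnj z" "cnj w"] \<open>\<And>z. Im z <= 0 ==> \<Psi> z = \<Psi>2 (cnj z)\<close> by simp
   then show ?thesis by simp
  qed (use mixed[of z w] mixed[of w z] eq in auto)
 qed
 moreover have "range \<Psi> = \<Psi>1 ` {z. 0 <= Im z} Un \<Psi>2 ` {z. 0 <= Im z}"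
 proof -
  have "z : cnj ` {z. Im z <= 0}" if "0 <= Im z" for z using that by (intro image_eqI[of _ _ "cnj z"]) auto
  then have "{z. 0 <= Im z} = cnj ` {z. Im z <= 0}" by auto
  then have "\<Psi>2 ` {z. 0 <= Im z} = \<Psi> ` {z. Im z <= 0}" using lower by (simp add: image_image)
  moreover have "\<Psi>1 ` {z. 0 <= Im z} = \<Psi> ` {z. 0 <= Im z}" using upper by simp
  ultimately show ?thesis unfolding cover[symmetric] image_Un by simp
 qed
 ultimately show thesis using that[of \<Psi>] continuous upper lower by blast
qed

lemma plane_bijection_homeomorphism:
 assumes c: "c : S2" and \<Psi>: "continuous_on UNIV \<Psi>" "inj \<Psi>" "range \<Psi> = S2 - {c}"
 obtains \<phi> where "homeomorphism (S2 - {c}) (UNIV::complex set) \<phi> \<Psi>"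
proof -
 obtain sg tu where chart: "homeomorphism (S2 - {c}) (UNIV::complex set) sg tu" using punctured_S2_homeomorphism[OF c] by blast
 have "continuous_on UNIV (sg \<circ> \<Psi>)"
  by (rule continuous_on_compose[OF \<Psi>(1)]) (use \<Psi>(3) homeomorphism_cont1[OF chart] in simp)
 moreover have "inj (sg \<circ> \<Psi>)" using comp_inj_on[OF \<Psi>(2), of sg] homeomorphism_imp_inj_on[OF chart] \<Psi>(3) by simp
 ultimately obtain g where g: "homeomorphism UNIV (range (sg \<circ> \<Psi>)) (sg \<circ> \<Psi>) g"
  using invariance_of_domain_homeomorphism[of UNIV "sg \<circ> \<Psi>"] by auto
 have onto: "range (sg \<circ> \<Psi>) = UNIV" unfolding image_comp[symmetric] \<Psi>(3) by (rule homeomorphism_image1[OF chart])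
 have inverse: "(g \<circ> sg) (\<Psi> z) = z" for z using homeomorphism_apply1[OF g, of z] by simp
 have "homeomorphism (S2 - {c}) UNIV (g \<circ> sg) \<Psi>"
 proof (rule homeomorphismI)
  show "continuous_on (S2 - {c}) (g \<circ> sg)"
   by (rule continuous_on_compose[OF homeomorphism_cont1[OF chart]])
     (use homeomorphism_cont2[OF g] onto in \<open>auto intro: continuous_on_subset\<close>)
  fix v assume "v : S2 - {c}"
  then obtain z where "v = \<Psi> z" using \<Psi>(3) by auto
  then show "\<Psi> ((g \<circ> sg) v) = v" using inverse by simp
 qed (use \<Psi> inverse in auto)
 then show thesis by (rule that)
qed

lemma (in wheel_parabolic) wheel_parabolic_reflect: "wheel_parabolic (%t. F (- t)) (%t. - l (- t)) (%t. - l' (- t)) H H' c"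
proof -
 interpret R: wheel_map "%t. F (- t)" "%t. - l (- t)" "%t. - l' (- t)" H H' by (rule wheel_map_reflect)
 obtain u v where "l u = u" "l v ~= v" using fixp nontriv by blast
 then have "- l (- (- u)) = - u" "- l (- (- v)) ~= - v" by auto
 then show ?thesis
 proof unfold_locales
  show "F (- t) = c" if "- l (- t) = t" for t using fix_c[of "- t"] that by simp
  show "F (- t) = c" if "H (F (- t)) = F (- t)" for t using Hfix_c that by blast
 qed blast+
qed

theorem (in wheel_parabolic) conjugate_translation:
 assumes gaps: "forward_gap l x y" "forward_gap l' y (x+2*pi)"
 shows "EX \<phi> \<phi>'. homeomorphism (S2 - {c}) (UNIV::complex set) \<phi> \<phi>' & (EX v. ALL z. \<phi> (H (\<phi>' z)) = z + v)"
proof -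
 have xy: "x < y" "y < x+2*pi" using gaps by (auto simp: forward_gap_def)
 obtain p where p: "x < p" "p < y" "F p = c" using fibre_meets_forward_gap[OF gaps(1)] xy by auto
 interpret A: wheel_tile F l l' H H' c x y p by unfold_locales (use gaps xy p in auto)
 interpret R: wheel_parabolic "%t. F (- t)" "%t. - l (- t)" "%t. - l' (- t)" H H' c by (rule wheel_parabolic_reflect)
 define x' y' where "x' = - (x+2*pi)" and "y' = - y"
 have gap': "forward_gap (%t. - l (- t)) x' y'"
 proof -
  have "t < - l (- t)" if "x' < t" "t < y'" for t
   using wheel_map.forward_gap_inverse[OF wheel_map_inverse gaps(2), of "- t"] that by (auto simp: x'_def y'_def)
  then show ?thesis using gaps(2) by (auto simp: forward_gap_def x'_def y'_def l'_fix add.commute[of "2*pi" x])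
 qed
 have short': "y' < x'+2*pi" using xy by (simp add: x'_def y'_def)
 obtain p' where p': "x' < p'" "p' < y'" "F (- p') = c" using R.fibre_meets_forward_gap[OF gap'] short' by auto
 interpret B: wheel_tile "%t. F (- t)" "%t. - l (- t)" "%t. - l' (- t)" H H' c x' y' p'
  by unfold_locales (use gap' short' p' in auto)
 have "(%t. F (- t)) ` {s..t} = F ` uminus ` {s..t}" for s t by (simp only: image_image)
 then have neg: "(%t. F (- t)) ` {s..t} = F ` {- t..- s}" for s t by simp
 have sides: "(%t. F (- t)) ` {x'..y'} = F ` {y..x+2*pi}" "(%t. F (- t)) ` {y'..x'+2*pi} = F ` {x..y}"
  unfolding neg by (simp_all add: x'_def y'_def add.commute)
 obtain lam where line: "A.equivariant_line lam" using A.line_exists by blast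
 then have line': "B.equivariant_line lam"
  unfolding A.equivariant_line_def B.equivariant_line_def sides by (simp add: Int_commute)
 obtain \<Psi>1 where \<Psi>1: "continuous_on {z::complex. 0 <= Im z} \<Psi>1" "inj_on \<Psi>1 {z. 0 <= Im z}" "\<Psi>1 ` {z. 0 <= Im z} = F ` {x..y} - {c}"
  "!!z. 0 <= Im z ==> \<Psi>1 (z+1) = H (\<Psi>1 z)" "!!u. \<Psi>1 (of_real u) = lam u"
  using A.half_plane[OF line] by metis
 obtain \<Psi>2 where \<Psi>2: "continuous_on {z::complex. 0 <= Im z} \<Psi>2" "inj_on \<Psi>2 {z. 0 <= Im z}" "\<Psi>2 ` {z. 0 <= Im z} = F ` {y..x+2*pi} - {c}"
  "!!z. 0 <= Im z ==> \<Psi>2 (z+1) = H (\<Psi>2 z)" "!!u. \<Psi>2 (of_real u) = lam u"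
  using B.half_plane[OF line'] unfolding sides by metis
 have "range (%u. \<Psi>1 (of_real u)) = F ` {x..y} Int F ` {y..x+2*pi} - {c}" using line by (simp add: A.equivariant_line_def \<Psi>1(5))
 then have meet: "\<Psi>1 ` {z. 0 <= Im z} Int \<Psi>2 ` {z. 0 <= Im z} <= range (%u. \<Psi>1 (of_real u))"
  unfolding \<Psi>1(3) \<Psi>2(3) by blast
 have agree: "\<Psi>1 (of_real u) = \<Psi>2 (of_real u)" for u by (simp add: \<Psi>1(5) \<Psi>2(5))
 obtain \<Psi> where \<Psi>: "continuous_on UNIV \<Psi>" "inj \<Psi>" "range \<Psi> = \<Psi>1 ` {z. 0 <= Im z} Un \<Psi>2 ` {z. 0 <= Im z}"
  "!!z. 0 <= Im z ==> \<Psi> z = \<Psi>1 z" "!!z. Im z <= 0 ==> \<Psi> z = \<Psi>2 (cnj z)"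
  by (rule glue_half_planes[OF \<Psi>1(1) \<Psi>2(1) \<Psi>1(2) \<Psi>2(2) agree meet], rule that)
 have "range \<Psi> = S2 - {c}" unfolding \<Psi>(3) \<Psi>1(3) \<Psi>2(3) Un_Diff[symmetric] using image_split[of x y "x+2*pi"] full_image xy by simp
 then obtain \<phi> where \<phi>: "homeomorphism (S2 - {c}) UNIV \<phi> \<Psi>" using plane_bijection_homeomorphism[OF pole_in_S2 \<Psi>(1,2)] by blast
 have "\<Psi> (z+1) = H (\<Psi> z)" for z
  using \<Psi>(4)[of z] \<Psi>(4)[of "z+1"] \<Psi>(5)[of z] \<Psi>(5)[of "z+1"] \<Psi>1(4)[of z] \<Psi>2(4)[of "cnj z"] by (cases "0 <= Im z") auto
 then have "\<phi> (H (\<Psi> z)) = z+1" for z using homeomorphism_apply2[OF \<phi>, of "z+1"] by simp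
 then show ?thesis using \<phi> by blast
qed

subsection \<open>Boundary orientation does not depend on the stereographic chart\<close>

lemma moebius_identity:
 fixes Q Q' q qc m k z zc V :: complex
 assumes "Q * (1 - k) = - (m * q)" "q * Q' = m * (1 - k)" "q * qc = (1 - k) * (1 + k)" "z * zc = (1 - V) * (1 + V)"
 shows "(Q * z + Q' * zc+2 * m * V) * (q * (z * (1 - k) - qc * (1 - V)))
  = m * (2 - q * z - qc * zc - 2 * k * V) * ((1 - k) * (1 - V) + q * z)"
proof -
 have "(Q * z + Q' * zc+2 * m * V) * (q * (z * (1 - k) - qc * (1 - V))) - m * (2 - q * z - qc * zc - 2 * k * V) * ((1 - k) * (1 - V) + q * z)
  = (Q * (1 - k) - - (m * q)) * (q * z * z - z * (1 - V) * (1 + k))+(q * Q' - m * (1 - k)) * (z * zc * (1 - k) - qc * zc * (1 - V))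
   + (q * qc - (1 - k) * (1 + k)) * (m * z * zc - Q * z * (1 - V) - 2 * m * V * (1 - V))
   + (z * zc - (1 - V) * (1 + V)) * (m * (1 - k) * (1 - k) + m * (1 - k) * (1 + k))"
  by (simp add: algebra_simps)
 then show ?thesis unfolding assms by simp
qed

lemma rotation_rows:
 fixes T :: "real^3 => real^3"
 assumes T: "orthogonal_transformation T" "det (matrix T) = 1" and n: "T n = north"
 obtains a b where "a ~= 0" "cross3 n a = b" "cross3 b n = a"
  "!!v. T v $ 1 = v \<bullet> a" "!!v. T v $ 2 = v \<bullet> b" "!!v. T v $ 3 = v \<bullet> n"
proof -
 have bij: "bij T" using T orthogonal_transformation_bij by blast
 have inner: "T v \<bullet> T w = v \<bullet> w" for v w using T(1) by (simp add: orthogonal_transformation_def)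
 have cross: "cross3 (T v) (T w) = T (cross3 v w)" for v w using cross_orthogonal_transformation[OF T(1), of v w] T(2) by simp
 have Tn: "T n = axis 3 1" using n by (simp add: vec3_eq_iff north_def axis_def)
 obtain a b where ab: "T a = axis 1 1" "T b = axis 2 1" using bij by (metis bij_pointE)
 have "T (cross3 n a) = T b" "T (cross3 b n) = T a" unfolding cross[symmetric] ab Tn by (rule cross_basis)+
 then have "cross3 n a = b" "cross3 b n = a" using bij by (simp_all add: bij_is_inj inj_eq)
 moreover have "T v $ 1 = v \<bullet> a" "T v $ 2 = v \<bullet> b" "T v $ 3 = v \<bullet> n" for v
  using inner[of v a] inner[of v b] inner[of v n] unfolding ab Tn inner_axis by simp_all
 moreover have "a ~= 0" using ab(1) inner[of a a] by (auto simp: axis_eq_0_iff)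
 ultimately show thesis by (intro that)
qed

lemma moebius_coefficients:
 fixes a b n :: "real^3"
 defines "q \<equiv> Complex (n$1) (n$2)" and "k \<equiv> complex_of_real (n$3)" and "m \<equiv> Complex (a$3) (- b$3)"
  and "Q \<equiv> Complex (a$1 + b$2) (a$2 - b$1)" and "Q' \<equiv> Complex (a$1 - b$2) (- a$2 - b$1)"
 assumes n: "n : S2" "n ~= north" "n ~= - north" and a: "a ~= 0" and cross: "cross3 n a = b" "cross3 b n = a"
 shows "q * cnj q = (1 - k) * (1 + k)" "q ~= 0" "1 - k ~= 0" "m ~= 0" "Q * (1 - k) = - (m * q)" "q * Q' = m * (1 - k)"
proof -
 have b_eq: "b$1 = n$2 * a$3 - n$3 * a$2" "b$2 = n$3 * a$1 - n$1 * a$3"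
  unfolding cross(1)[symmetric] by (simp_all add: cross_components)
 have a_eq: "a$1 = b$2 * n$3 - b$3 * n$2" "a$2 = b$3 * n$1 - b$1 * n$3"
  unfolding cross(2)[symmetric] by (simp_all add: cross_components)
 have unit: "(n$1)\<^sup>2+(n$2)\<^sup>2+(n$3)\<^sup>2 = 1" using n(1) by (simp add: S2_iff)
 show norm: "q * cnj q = (1 - k) * (1 + k)"
  using unit by (simp add: q_def k_def complex_eq_iff power2_eq_square algebra_simps)
 show q0: "q ~= 0"
 proof
  assume "q = 0"
  then have zero: "n$1 = 0" "n$2 = 0" by (simp_all add: q_def complex_eq_iff)
  then have "n$3 = 1 | n$3 = -1" using unit by (simp add: power2_eq_1_iff)
  then show False using n(2,3) zero by (auto simp: vec3_eq_iff north_def)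
 qed
 then show k1: "1 - k ~= 0" using norm by auto
 have k2: "1 + k ~= 0" using norm q0 by auto
 have rel: "- (b$3 * n$2) = a$1 - b$2 * n$3" "b$3 * n$1 = a$2 + b$1 * n$3" "- (n$1 * a$3) = b$2 - n$3 * a$1" "n$2 * a$3 = b$1 + n$3 * a$2"
  using a_eq b_eq by linarith+
 have "(a$1 + b$2) * (1 - n$3) = - (b$3 * n$2) + - (n$1 * a$3)" "(a$2 - b$1) * (1 - n$3) = b$3 * n$1 - n$2 * a$3"
  unfolding rel by (simp_all add: algebra_simps)
 then show mq: "Q * (1 - k) = - (m * q)" by (simp add: Q_def k_def m_def q_def complex_eq_iff mult.commute)
 have "(a$1 - b$2) * (1 + n$3) = - (b$3 * n$2) - - (n$1 * a$3)" "(- a$2 - b$1) * (1 + n$3) = - (b$3 * n$1) - n$2 * a$3"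
  unfolding rel by (simp_all add: algebra_simps)
 then have "Q' * (1 + k) = m * cnj q" by (simp add: Q'_def k_def m_def q_def complex_eq_iff mult.commute)
 then have "(q * Q') * (1 + k) = (m * (1 - k)) * (1 + k)" using norm by (metis mult.assoc mult.left_commute)
 then show mk: "q * Q' = m * (1 - k)" using k2 by simp
 show "m ~= 0"
 proof
  assume "m = 0"
  then have "Q = 0" "Q' = 0" using mq mk k1 q0 by simp_all
  then have "a = 0" using \<open>m = 0\<close> by (simp add: Q_def Q'_def m_def complex_eq_iff vec3_eq_iff)
  then show False using a by simp
 qed
qed

text \<open>Away from the poles, the change between two stereographic charts is the Moebius map
  with pole at the image of the new centre of projection and zero at its antipode.\<close>

lemma stereo_rotation:
 fixes T :: "real^3 => real^3"
 assumes T: "orthogonal_transformation T" "det (matrix T) = 1"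
  and n: "n : S2" "T n = north" "n ~= north" "n ~= - north"
 obtains \<kappa> where "\<kappa> ~= 0" "!!v. v : S2 ==> v ~= north ==> v ~= n ==>
  stereo v ~= stereo n & stereo (T v) = \<kappa> * (1 + cnj (stereo n) * stereo v) / (stereo v - stereo n)"
proof -
 obtain a b where ab: "a ~= 0" "cross3 n a = b" "cross3 b n = a"
  and rows: "!!v. T v $ 1 = v \<bullet> a" "!!v. T v $ 2 = v \<bullet> b" "!!v. T v $ 3 = v \<bullet> n"
  by (rule rotation_rows[OF T n(2)], rule that)
 define q k m where "q = Complex (n$1) (n$2)" and "k = complex_of_real (n$3)" and "m = Complex (a$3) (- b$3)"
 define Q Q' where "Q = Complex (a$1 + b$2) (a$2 - b$1)" and "Q' = Complex (a$1 - b$2) (- a$2 - b$1)"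
 note coeff = moebius_coefficients[OF n(1,3,4) ab, folded q_def k_def m_def Q_def Q'_def]
 have stereo_n: "stereo n = cnj q / (1 - k)" by (simp add: stereo_def q_def k_def complex_eq_iff)
 show thesis
 proof (rule that[of "m / q"])
  show "m / q ~= 0" using coeff by simp
  fix v :: "real^3" assume v: "v : S2" "v ~= north" "v ~= n"
  have ne: "stereo v ~= stereo n" using v n stereo_homeomorphism by (metis Diff_iff homeomorphism_apply1 singletonD)
  define z V where "z = Complex (v$1) (- v$2)" and "V = complex_of_real (v$3)"
  have V1: "1 - V ~= 0" using S2_third_lt_1[OF v(1,2)] by (simp add: V_def complex_eq_iff)
  have zz: "z * cnj z = (1 - V) * (1 + V)"
   using v(1) by (simp add: S2_iff z_def V_def complex_eq_iff power2_eq_square algebra_simps)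
  have stereo_v: "stereo v = z / (1 - V)" by (simp add: stereo_def z_def V_def)
  have "T v : S2" using v homeomorphism_image1[OF orthogonal_transformation_homeomorphism_S2[OF T(1)]] by blast
  moreover have "T v ~= north" using v n injD[OF bij_is_inj[OF orthogonal_transformation_bij[OF T(1)]]] by metis
  ultimately have "1 - T v $ 3 ~= 0" using S2_third_lt_1 by force
  moreover have den: "2 * (1 - complex_of_real (T v $ 3)) = 2 - q * z - cnj q * cnj z - 2 * k * V"
   unfolding rows by (simp add: inner_vec_def sum_3 q_def z_def k_def V_def complex_eq_iff algebra_simps)
  ultimately have den0: "2 - q * z - cnj q * cnj z - 2 * k * V ~= 0"
   unfolding den[symmetric] by (simp add: complex_eq_iff)
  have num: "2 * Complex (T v $ 1) (- (T v $ 2)) = Q * z + Q' * cnj z+2 * m * V"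
   unfolding rows by (simp add: inner_vec_def sum_3 Q_def Q'_def z_def m_def V_def complex_eq_iff algebra_simps)
  have diff: "stereo v - stereo n = (z * (1 - k) - cnj q * (1 - V)) / ((1 - k) * (1 - V))"
   unfolding stereo_v stereo_n using V1 coeff(3) by (simp add: field_simps)
  then have diff0: "q * (z * (1 - k) - cnj q * (1 - V)) ~= 0" using ne coeff(2) by auto
  have "cnj (1 - k) = 1 - k" by (simp add: k_def)
  then have antipode: "1 + cnj (stereo n) * stereo v = ((1 - k) * (1 - V) + q * z) / ((1 - k) * (1 - V))"
   unfolding stereo_v stereo_n complex_cnj_divide complex_cnj_cnj times_divide_times_eq add_divide_distrib using V1 coeff(3) by simp
  have "stereo (T v) = (2 * Complex (T v $ 1) (- (T v $ 2))) / (2 * (1 - complex_of_real (T v $ 3)))"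
   unfolding stereo_def of_real_diff of_real_1 by (rule mult_divide_mult_cancel_left[symmetric]) simp
  also have "\<dots> = m * ((1 - k) * (1 - V) + q * z) / (q * (z * (1 - k) - cnj q * (1 - V)))"
   unfolding num den frac_eq_eq[OF den0 diff0] moebius_identity[OF coeff(5,6,1) zz] by simp
  also have "\<dots> = m / q * (1 + cnj (stereo n) * stereo v) / (stereo v - stereo n)"
  proof -
   have "m * X / (q * Y) = m / q * (X / C) / (Y / C)" if "C ~= 0" for X Y C using that by simp
   then show ?thesis unfolding diff antipode using V1 coeff(3) by simp
  qed
  finally show "stereo v ~= stereo n & stereo (T v) = m / q * (1 + cnj (stereo n) * stereo v) / (stereo v - stereo n)"
   using ne by blast
 qed
qed

lemma winding_number_moebius:
 fixes g :: "real => complex"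
 assumes g: "path g" "w ~: path_image g" "p ~: path_image g" "w ~= p" and c: "\<kappa> ~= 0" "1 + e * p ~= 0"
 shows "winding_number (%t. \<kappa> * (1 + e * g t) / (g t - p)) (\<kappa> * (1 + e * w) / (w - p)) = winding_number g w - winding_number g p"
proof -
 obtain q1 where q1: "path q1" "pathfinish q1 - pathstart q1 = 2 * of_real pi * \<i> * winding_number g w" "!!t. t : {0..1} ==> g t = w + exp (q1 t)"
  by (rule winding_number_as_continuous_log[OF g(1,2)]) (rule that)
 obtain q2 where q2: "path q2" "pathfinish q2 - pathstart q2 = 2 * of_real pi * \<i> * winding_number g p" "!!t. t : {0..1} ==> g t = p + exp (q2 t)"
  by (rule winding_number_as_continuous_log[OF g(1,3)]) (rule that)
 define C where "C = - \<kappa> * (1 + e * p) / (w - p)"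
 have "C ~= 0" using c g(4) by (simp add: C_def)
 then obtain d where d: "C = exp d" by (metis exp_Ln)
 define Q where "Q = (%t. d + q1 t - q2 t)"
 have path_Q: "path Q" using q1(1) q2(1) unfolding path_def Q_def by (intro continuous_intros)
 have eq: "\<kappa> * (1 + e * g t) / (g t - p) - \<kappa> * (1 + e * w) / (w - p) = (exp \<circ> Q) t" if t: "0 <= t" "t <= 1" for t
 proof -
  have n: "g t - p ~= 0" "w - p ~= 0" using q2(3)[of t] t g(4) by auto
  have "\<kappa> * (1 + e * g t) / (g t - p) - \<kappa> * (1 + e * w) / (w - p) = C * (g t - w) / (g t - p)"
   unfolding C_def using n by (simp add: divide_simps) (simp add: algebra_simps)
  also have "\<dots> = C * exp (q1 t) / exp (q2 t)"
  proof -
   have "g t - w = exp (q1 t)" "g t - p = exp (q2 t)" using arg_cong[OF q1(3)[of t], of "%x. x - w"] arg_cong[OF q2(3)[of t], of "%x. x - p"] t by auto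
   then show ?thesis by simp
  qed
  finally show ?thesis by (simp add: Q_def d exp_add exp_diff)
 qed
 have "winding_number (%t. \<kappa> * (1 + e * g t) / (g t - p)) (\<kappa> * (1 + e * w) / (w - p)) = winding_number (exp \<circ> Q) 0"
  unfolding winding_number_offset[of "%t. \<kappa> * (1 + e * g t) / (g t - p)"] by (rule winding_number_cong) (rule eq)
 also have "\<dots> = (pathfinish Q - pathstart Q) / (2 * of_real pi * \<i>)" by (rule winding_number_compose_exp[OF path_Q])
 also have "pathfinish Q - pathstart Q = (pathfinish q1 - pathstart q1) - (pathfinish q2 - pathstart q2)"
  by (simp add: Q_def pathfinish_def pathstart_def)
 also have "\<dots> / (2 * of_real pi * \<i>) = winding_number g w - winding_number g p"
  unfolding q1(2) q2(2) by (simp add: diff_divide_distrib)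
 finally show ?thesis .
qed

definition chart :: "(real^3 => real^3) => real^3 => bool" where
 "chart R N \<longleftrightarrow> orthogonal_transformation R & det (matrix R) = 1 & R N = north"

definition chart_winding :: "(real^3 => real^3) => (real => real^3) => real^3 => complex" where
 "chart_winding R gm w = winding_number (%t. stereo (R (gm t))) (stereo (R w))"

lemma chart_exists: assumes "N : S2" obtains R where "chart R N"
 by (rule stereographic_chart[OF assms]) (use that in \<open>auto simp: chart_def\<close>)

lemma chart_homeo:
 assumes "chart R N" "N : S2"
 shows "homeomorphism (S2 - {N}) UNIV (%v. stereo (R v)) (%z. inv_into UNIV R (unstereo z))"
 using rotated_stereo_homeomorphism assms by (simp add: chart_def)

lemma chart_path:
 assumes "chart R N" "N : S2" "path gm" "path_image gm <= S2 - {N}"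
 shows "path (%t. stereo (R (gm t)))" "path_image (%t. stereo (R (gm t))) = (%v. stereo (R v)) ` path_image gm"
proof -
 have "path ((%v. stereo (R v)) \<circ> gm)"
  by (rule path_continuous_image[OF assms(3)]) (rule continuous_on_subset[OF homeomorphism_cont1[OF chart_homeo[OF assms(1,2)]] assms(4)])
 then show "path (%t. stereo (R (gm t)))" by (simp add: o_def)
qed (simp add: path_image_def image_image)

lemma chart_inj:
 assumes "chart R N" "N : S2" "v : S2 - {N}" "w : S2 - {N}" "stereo (R v) = stereo (R w)" shows "v = w"
 using homeomorphism_apply1[OF chart_homeo[OF assms(1,2)]] assms(3-5) by metis

lemma chart_notin:
 assumes "chart R N" "N : S2" "path_image gm <= S2 - {N}" "w : S2 - {N}" "w ~: path_image gm"
 shows "stereo (R w) ~: (%v. stereo (R v)) ` path_image gm"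
proof
 assume "stereo (R w) : (%v. stereo (R v)) ` path_image gm"
 then obtain v where v: "v : path_image gm" "stereo (R w) = stereo (R v)" by blast
 then have "w = v" using chart_inj[OF assms(1,2,4), of v] assms(3) by blast
 then show False using v assms(5) by blast
qed

lemma chart_transition:
 assumes "chart R N" "chart R' N'"
 shows "orthogonal_transformation (R' \<circ> inv_into UNIV R)" "det (matrix (R' \<circ> inv_into UNIV R)) = 1" "(R' \<circ> inv_into UNIV R) (R v) = R' v"
proof -
 have R: "orthogonal_transformation R" "det (matrix R) = 1" and R': "orthogonal_transformation R'" "det (matrix R') = 1"
  using assms by (auto simp: chart_def)
 have b: "bij R" using R orthogonal_transformation_bij by blast
 have oi: "orthogonal_transformation (inv_into UNIV R)" by (rule orthogonal_transformation_inv[OF R(1)])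
 show "orthogonal_transformation (R' \<circ> inv_into UNIV R)" using orthogonal_transformation_compose[OF R'(1) oi] .
 have l: "linear R" "linear R'" "linear (inv_into UNIV R)" using R R' oi by (auto simp: orthogonal_transformation_def)
 have "R \<circ> inv_into UNIV R = id" using bij_is_surj[OF b] unfolding surj_iff .
 then have "matrix R ** matrix (inv_into UNIV R) = mat 1" using matrix_compose[OF l(3) l(1)] by (simp add: matrix_id_mat_1)
 then have "det (matrix R) * det (matrix (inv_into UNIV R)) = 1" by (metis det_mul det_I)
 then show "det (matrix (R' \<circ> inv_into UNIV R)) = 1" using matrix_compose[OF l(3) l(2)] R R' by (simp add: det_mul)
 show "(R' \<circ> inv_into UNIV R) (R v) = R' v" using b by (simp add: bij_is_inj)
qed

lemma chart_change:
 assumes R: "chart R N" "chart R' N'" and N: "N : S2" "N' : S2" "N' ~= N" "N' ~= - N"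
 obtains \<kappa> where "\<kappa> ~= 0" "!!v. v : S2 - {N, N'} ==> stereo (R v) ~= stereo (R N') &
  stereo (R' v) = \<kappa> * (1 + cnj (stereo (R N')) * stereo (R v)) / (stereo (R v) - stereo (R N'))"
proof -
 let ?T = "R' \<circ> inv_into UNIV R"
 note transition = chart_transition[OF R]
 have oR: "orthogonal_transformation R" "R N = north" "R' N' = north" using R by (auto simp: chart_def)
 have iR: "R u = R v \<longleftrightarrow> u = v" for u v using orthogonal_transformation_bij[OF oR(1)] by (simp add: bij_is_inj inj_eq)
 have RS: "R v : S2" if "v : S2" for v using homeomorphism_image1[OF orthogonal_transformation_homeomorphism_S2[OF oR(1)]] that by blast
 have neg: "- north = R (- N)" using oR by (simp add: orthogonal_transformation_def linear_neg)
 obtain \<kappa> where \<kappa>: "\<kappa> ~= 0" "!!v. v : S2 ==> v ~= north ==> v ~= R N' ==>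
  stereo v ~= stereo (R N') & stereo (?T v) = \<kappa> * (1 + cnj (stereo (R N')) * stereo v) / (stereo v - stereo (R N'))"
 proof (rule stereo_rotation[OF transition(1,2), of "R N'"])
  show "R N' : S2" using RS N by blast
  show "?T (R N') = north" using transition(3) oR by simp
  show "R N' ~= north" "R N' ~= - north" unfolding neg using iR N oR by metis+
 qed (rule that)
 show thesis
 proof (rule that[OF \<kappa>(1)])
  fix v assume "v : S2 - {N, N'}"
  then have "v : S2" "v ~= N" "v ~= N'" by auto
  then show "stereo (R v) ~= stereo (R N') &
   stereo (R' v) = \<kappa> * (1 + cnj (stereo (R N')) * stereo (R v)) / (stereo (R v) - stereo (R N'))"
   using \<kappa>(2)[of "R v"] RS iR oR transition(3)[of v] by metis
 qed
qed

locale wheel_chart = wheel +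
 fixes s t :: real and R :: "real^3 => real^3" and N :: "real^3"
 assumes st: "s < t" "t < s+2*pi" and R: "chart R N" and N: "N : S2 - F ` {s..t}"
begin

abbreviation "D \<equiv> F ` {s..t}"
abbreviation "proj v \<equiv> stereo (R v)"

lemma NS: "N : S2" and D_sub: "D <= S2 - {N}" and bdry_sub: "bdry D <= D"
 using N F_in by (auto simp: bdry_def)

lemmas proj_homeo = chart_homeo[OF R NS]
lemmas proj_inj = chart_inj[OF R NS]

lemma proj_cont: "A <= S2 - {N} ==> continuous_on A proj"
 by (rule continuous_on_subset[OF homeomorphism_cont1[OF proj_homeo]])

lemma proj_disjoint:
 assumes "A <= S2 - {N}" "B <= S2 - {N}" "A Int B = {}" shows "proj ` A Int proj ` B = {}"
 using proj_inj assms by blast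

lemma exterior_outside:
 assumes A: "A <= D" shows "proj ` (S2 - D - {N}) <= outside (proj ` A)"
proof (rule connected_unbounded_subset_outside)
 have "S2 - D = F ` {t..s+2*pi} - bdry (F ` {t..s+2*pi})" using complement_eq[OF st] by simp
 then have "connected (S2 - D - {N})"
  using closed_disk_interior_connected_punctured[OF disk[of t "s+2*pi"], of N] st by simp
 then show "connected (proj ` (S2 - D - {N}))" by (intro connected_continuous_image proj_cont) blast
 have "bounded (proj ` D)" by (intro compact_imp_bounded compact_continuous_image compact_im proj_cont D_sub)
 moreover have "(S2 - D - {N}) Un D = S2 - {N}" using D_sub by blast
 then have "proj ` (S2 - D - {N}) Un proj ` D = UNIV"
  unfolding image_Un[symmetric] using homeomorphism_image1[OF proj_homeo] by simp
 ultimately show "~ bounded (proj ` (S2 - D - {N}))" using bounded_Un not_bounded_UNIV by metis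
 show "proj ` (S2 - D - {N}) Int proj ` A = {}" by (rule proj_disjoint) (use A D_sub in blast)+
qed

lemma chart_winding_zero:
 assumes w: "w : S2 - D" "w ~= N" and g: "path gm" "pathfinish gm = pathstart gm" "path_image gm <= D"
 shows "chart_winding R gm w = 0"
proof -
 have gS: "path_image gm <= S2 - {N}" using g(3) D_sub by blast
 have "proj w : outside (path_image (%t. proj (gm t)))"
  unfolding chart_path(2)[OF R NS g(1) gS] using exterior_outside[OF g(3)] w by blast
 then show ?thesis unfolding chart_winding_def
  by (intro winding_number_zero_in_outside chart_path(1)[OF R NS g(1) gS]) (use g(2) in \<open>simp_all add: pathfinish_def pathstart_def\<close>)
qed

lemma proj_interior:
 assumes "A <= bdry D" shows "connected (proj ` (D - bdry D))" "proj ` (D - bdry D) Int proj ` A = {}"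
proof -
 show "connected (proj ` (D - bdry D))"
  by (intro connected_continuous_image closed_disk_interior_connected[OF disk[OF st]] proj_cont) (use D_sub in blast)
 show "proj ` (D - bdry D) Int proj ` A = {}" by (rule proj_disjoint) (use D_sub bdry_sub assms in blast)+
qed

lemma chart_winding_interior:
 assumes w: "w : D - bdry D" "w' : D - bdry D" and g: "path gm" "pathfinish gm = pathstart gm" "path_image gm <= bdry D"
 shows "chart_winding R gm w = chart_winding R gm w'"
proof -
 have gS: "path_image gm <= S2 - {N}" using g(3) D_sub bdry_sub by blast
 have disjoint: "proj ` (D - bdry D) Int path_image (%t. proj (gm t)) = {}"
  unfolding chart_path(2)[OF R NS g(1) gS] by (rule proj_interior(2)[OF g(3)])
 show ?thesis unfolding chart_winding_def
  by (rule winding_number_eq[OF chart_path(1)[OF R NS g(1) gS] _ _ _ proj_interior(1)[OF g(3)] disjoint])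
   (use g(2) w in \<open>simp_all add: pathfinish_def pathstart_def\<close>)
qed

lemma chart_winding_boundary:
 assumes w: "w : D - bdry D" and g: "simple_path gm" "pathfinish gm = pathstart gm" "path_image gm = bdry D"
 shows "chart_winding R gm w = 1 | chart_winding R gm w = -1"
proof -
 have gS: "path_image gm <= S2 - {N}" using g(3) D_sub bdry_sub by blast
 have image: "path_image (%t. proj (gm t)) = proj ` bdry D"
  using chart_path(2)[OF R NS simple_path_imp_path[OF g(1)] gS] g(3) by simp
 have "simple_path (proj \<circ> gm)"
  by (rule simple_path_continuous_image[OF g(1) proj_cont[OF gS]]) (use proj_inj gS in \<open>auto simp: inj_on_def\<close>)
 then have simple: "simple_path (%t. proj (gm t))" by (simp add: o_def)
 have closed: "pathfinish (%t. proj (gm t)) = pathstart (%t. proj (gm t))" using g(2) by (simp add: pathfinish_def pathstart_def)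
 obtain z where z: "z : inside (proj ` bdry D)"
  using Jordan_inside_outside[OF simple closed] unfolding image by blast
 have "z : proj ` (S2 - {N})" using homeomorphism_image1[OF proj_homeo] by simp
 then obtain v where v: "v : S2 - {N}" "z = proj v" by blast
 have "z ~: proj ` bdry D" "z ~: outside (proj ` bdry D)" using z inside_no_overlap inside_Int_outside by fast+
 then have "v : D - bdry D" using exterior_outside[OF bdry_sub] v by blast
 then have "proj v : proj ` (D - bdry D)" "proj w : proj ` (D - bdry D)" using w by blast+
 moreover have "proj ` (D - bdry D) <= - (proj ` bdry D)" using proj_interior(2)[OF order_refl] by blast
 ultimately have "connected_component (- (proj ` bdry D)) z (proj w)"
  unfolding connected_component_def v(2) using proj_interior(1)[OF order_refl] by blast
 then have "proj w : inside (path_image (%t. proj (gm t)))" unfolding image using inside_same_component z by blast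
 then show ?thesis unfolding chart_winding_def using simple_closed_path_winding_number_inside[OF simple] by metis
qed

end

context wheel
begin

lemma wheel_chartI: "s < t ==> t < s+2*pi ==> chart R N ==> N : S2 - F ` {s..t} ==> wheel_chart F s t R N"
 by unfold_locales

lemmas chart_winding_zero = wheel_chart.chart_winding_zero[OF wheel_chartI]
 and chart_winding_interior = wheel_chart.chart_winding_interior[OF wheel_chartI]
 and chart_winding_boundary = wheel_chart.chart_winding_boundary[OF wheel_chartI]

lemma chart_winding_generic:
 assumes st: "s < t" "t < s+2*pi" and R: "chart R N" "chart R' N'" and N: "N : S2 - F ` {s..t}" "N' : S2 - F ` {s..t}" "N' ~= N" "N' ~= - N"
  and w: "w : F ` {s..t} - bdry (F ` {s..t})"
  and g: "path gm" "pathfinish gm = pathstart gm" "path_image gm <= bdry (F ` {s..t})"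
 shows "chart_winding R' gm w = chart_winding R gm w"
proof -
 let ?D = "F ` {s..t}" and ?p = "stereo (R N')" and ?u = "%t. stereo (R (gm t))"
 have NS: "N : S2" "N' : S2" using N by blast+
 have DS: "?D <= S2 - {N, N'}" using F_in N by blast
 have gD: "path_image gm <= ?D" using g(3) by (auto simp: bdry_def)
 have gS: "path_image gm <= S2 - {N}" using gD DS by blast
 obtain \<kappa> where \<kappa>: "\<kappa> ~= 0" and change: "!!v. v : S2 - {N, N'} ==> stereo (R v) ~= ?p &
  stereo (R' v) = \<kappa> * (1 + cnj ?p * stereo (R v)) / (stereo (R v) - ?p)"
  by (rule chart_change[OF R NS N(3,4)], rule that)
 have nonzero: "1 + cnj ?p * ?p ~= 0"
 proof -
  have "1 + cnj ?p * ?p = of_real (1+(norm ?p)\<^sup>2)" using complex_norm_square[of ?p] by (simp add: mult.commute)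
  moreover have "1+(norm ?p)\<^sup>2 > 0" by (simp add: add_pos_nonneg)
  ultimately show ?thesis by (metis of_real_eq_0_iff less_irrefl)
 qed
 have wD: "w : ?D" "w ~: path_image gm" using w g(3) by blast+
 have w_change: "?p ~= stereo (R w)" "stereo (R' w) = \<kappa> * (1 + cnj ?p * stereo (R w)) / (stereo (R w) - ?p)"
  using change[OF subsetD[OF DS wD(1)]] by auto
 have path: "path ?u" "path_image ?u = (%v. stereo (R v)) ` path_image gm" using chart_path[OF R(1) NS(1) g(1) gS] by blast+
 have w_off: "stereo (R w) ~: path_image ?u" unfolding path(2) by (rule chart_notin[OF R(1) NS(1) gS]) (use wD DS in blast)+
 have p_off: "?p ~: path_image ?u" unfolding path(2) by (rule chart_notin[OF R(1) NS(1) gS]) (use gD N in blast)+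
 have "chart_winding R' gm w = winding_number (%t. \<kappa> * (1 + cnj ?p * ?u t) / (?u t - ?p)) (\<kappa> * (1 + cnj ?p * stereo (R w)) / (stereo (R w) - ?p))"
  unfolding chart_winding_def w_change(2)
 proof (rule winding_number_cong)
  fix t :: real assume "0 <= t" "t <= 1"
  then have "gm t : path_image gm" by (simp add: path_image_def)
  then have "gm t : S2 - {N, N'}" using gD DS by blast
  then show "stereo (R' (gm t)) = \<kappa> * (1 + cnj ?p * ?u t) / (?u t - ?p)" using change by blast
 qed
 also have "\<dots> = winding_number ?u (stereo (R w)) - winding_number ?u ?p"
  by (rule winding_number_moebius[OF path(1) w_off p_off _ \<kappa> nonzero]) (use w_change in metis)
 also have "winding_number ?u ?p = 0"
  using chart_winding_zero[OF st R(1) N(1) N(2) N(3) g(1,2) gD] by (simp add: chart_winding_def)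
 finally show ?thesis by (simp add: chart_winding_def)
qed

lemma chart_winding_independent:
 assumes st: "s < t" "t < s+2*pi" and R: "chart R N" "chart R' N'" and N: "N : S2 - F ` {s..t}" "N' : S2 - F ` {s..t}"
  and w: "w : F ` {s..t} - bdry (F ` {s..t})" "w' : F ` {s..t} - bdry (F ` {s..t})"
  and g: "path gm" "pathfinish gm = pathstart gm" "path_image gm <= bdry (F ` {s..t})"
 shows "chart_winding R' gm w' = chart_winding R gm w"
proof -
 have "infinite (S2 - F ` {s..t})"
 proof -
  have d: "closed_disk (F ` {t..s+2*pi})" using disk[of t "s+2*pi"] st by simp
  obtain \<phi> \<psi> where p: "homeomorphism (cball (0::complex) 1) (F ` {t..s+2*pi}) \<phi> \<psi>"
   "\<phi> ` ball 0 1 = F ` {t..s+2*pi} - bdry (F ` {t..s+2*pi})" using closed_disk_param[OF d] by metis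
  have "inj_on \<phi> (ball 0 1)" by (rule inj_on_inverseI[of _ \<psi>]) (use homeomorphism_apply1[OF p(1)] in auto)
  moreover have "infinite (ball (0::complex) 1)" using uncountable_ball[of 1 "0::complex"] countable_finite by auto
  ultimately have "infinite (\<phi> ` ball 0 1)" using finite_imageD by blast
  then show ?thesis unfolding p(2) complement_eq[OF st] .
 qed
 then obtain M where "M : (S2 - F ` {s..t}) - {N, - N, N', - N'}"
  by (metis Diff_infinite_finite finite.emptyI finite_insert infinite_imp_nonempty all_not_in_conv)
 then have M: "M : S2 - F ` {s..t}" "M ~= N" "M ~= - N" "N' ~= M" "N' ~= - M" by auto
 obtain R'' where R'': "chart R'' M" using M(1) chart_exists by blast
 have "chart_winding R' gm w' = chart_winding R' gm w" by (rule chart_winding_interior[OF st R(2) N(2) w(2) w(1) g])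
 also have "\<dots> = chart_winding R'' gm w" by (rule chart_winding_generic[OF st R'' R(2) M(1) N(2) M(4,5) w(1) g])
 also have "\<dots> = chart_winding R gm w" by (rule chart_winding_generic[OF st R(1) R'' N(1) M(1,2,3) w(1) g])
 finally show ?thesis .
qed

end

subsection \<open>Interleaved fibres have opposite orientations\<close>

lemma reversepath_image: "reversepath gm ` {u..v} = gm ` {1 - v..1 - u}"
proof -
 have "(%x. 1 - x) ` {u..v} = {1 - v..1 - u}" by simp
 then show ?thesis unfolding reversepath_def by (metis image_image)
qed

lemma chart_winding_join:
 assumes R: "chart R N" "N : S2" and p: "path p" "path_image p <= S2 - {N}" and q: "path q" "path_image q <= S2 - {N}"
  and w: "w : S2 - {N}" "w ~: path_image p" "w ~: path_image q" and e: "pathfinish p = pathstart q"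
 shows "chart_winding R (p +++ q) w = chart_winding R p w + chart_winding R q w"
proof -
 have "(%t. stereo (R ((p +++ q) t))) = (%t. stereo (R (p t))) +++ (%t. stereo (R (q t)))"
  by (auto simp: joinpaths_def)
 then show ?thesis unfolding chart_winding_def using e
  by (simp add: winding_number_join chart_path[OF R p] chart_path[OF R q] chart_notin[OF R p(2) w(1,2)] chart_notin[OF R q(2) w(1,3)] pathfinish_def pathstart_def)
qed

lemma chart_winding_split:
 assumes R: "chart R N" "N : S2" and p: "path p" "path_image p <= S2 - {N}"
  and w: "w : S2 - {N}" "w ~: path_image p" and u: "0 <= u" "u <= 1"
 shows "chart_winding R p w = chart_winding R (subpath 0 u p) w + chart_winding R (subpath u 1 p) w"
proof -
 have s: "(%t. stereo (R (subpath x y p t))) = subpath x y (%t. stereo (R (p t)))" for x y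
  by (simp add: subpath_def)
 have n: "stereo (R w) ~: path_image (%t. stereo (R (p t)))"
  unfolding chart_path(2)[OF R p] by (rule chart_notin[OF R p(2) w])
 show ?thesis unfolding chart_winding_def s
  using winding_number_subpath_combine[OF chart_path(1)[OF R p] n, of 0 u 1] u by simp
qed

lemma chart_winding_reverse:
 assumes R: "chart R N" "N : S2" and p: "path p" "path_image p <= S2 - {N}" and w: "w : S2 - {N}" "w ~: path_image p"
 shows "chart_winding R (reversepath p) w = - chart_winding R p w"
proof -
 have s: "(%t. stereo (R (reversepath p t))) = reversepath (%t. stereo (R (p t)))" by (simp add: reversepath_def)
 have n: "stereo (R w) ~: path_image (%t. stereo (R (p t)))"
  unfolding chart_path(2)[OF R p] by (rule chart_notin[OF R p(2) w])
 show ?thesis unfolding chart_winding_def s by (rule winding_number_reversepath[OF chart_path(1)[OF R p] n])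
qed

lemma (in wheel) pos_oriented_iff:
 assumes st: "s < t" "t < s+2*pi" and R: "chart R N" and N: "N : S2 - F ` {s..t}"
  and w: "w : F ` {s..t} - bdry (F ` {s..t})"
  and h: "homeomorphism S1 (bdry (F ` {s..t})) \<delta> \<delta>'" and af: "af : {0..1}"
 shows "pos_oriented (F ` {s..t}) \<delta> \<longleftrightarrow> chart_winding R (circle_loop af \<delta>) w = 1"
proof -
 let ?D = "F ` {s..t}"
 have loop: "path (circle_loop af \<delta>)" "pathfinish (circle_loop af \<delta>) = pathstart (circle_loop af \<delta>)" "path_image (circle_loop af \<delta>) = bdry ?D" for af
  using circle_loop[OF h, of af] simple_path_imp_path by auto
 have sub: "bdry ?D <= ?D" "?D <= S2" using F_in by (auto simp: bdry_def)
 have shift: "circle_loop af \<delta> = shiftpath af (circle_loop 0 \<delta>)"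
 proof
  fix x
  have "cis (2*pi * (af + x)) = cis (2*pi * (af + x - 1))"
   using cis_periodic[of "2*pi * (af + x - 1)"] by (simp add: algebra_simps)
  then show "circle_loop af \<delta> x = shiftpath af (circle_loop 0 \<delta>) x" by (simp add: shiftpath_def circle_loop_def)
 qed
 have same: "chart_winding R' (circle_loop 0 \<delta>) w' = chart_winding R (circle_loop af \<delta>) w"
  if R': "chart R' N'" "N' : S2 - ?D" "w' : ?D - bdry ?D" for R' N' w'
 proof -
  have gS: "path_image (circle_loop 0 \<delta>) <= S2 - {N'}" unfolding loop(3) using sub R' by blast
  have NS: "N' : S2" using R' by blast
  have off: "stereo (R' w') ~: path_image (%t. stereo (R' (circle_loop 0 \<delta> t)))"
   unfolding chart_path(2)[OF R'(1) NS loop(1) gS] by (rule chart_notin[OF R'(1) NS gS]) (use R' sub loop(3) in blast)+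
  have "chart_winding R' (circle_loop af \<delta>) w' = winding_number (shiftpath af (%t. stereo (R' (circle_loop 0 \<delta> t)))) (stereo (R' w'))"
   unfolding chart_winding_def shift by (rule arg_cong2[where f = winding_number]) (auto simp: shiftpath_def)
  also have "\<dots> = chart_winding R' (circle_loop 0 \<delta>) w'" unfolding chart_winding_def
   by (rule winding_number_shiftpath[OF chart_path(1)[OF R'(1) NS loop(1) gS] off _ af]) (use loop(2)[of 0] in \<open>simp add: pathfinish_def pathstart_def\<close>)
  finally show ?thesis using chart_winding_independent[OF st R R'(1) N R'(2) w R'(3) loop(1,2), of af] loop(3) by simp
 qed
 have "pos_oriented ?D \<delta> \<longleftrightarrow> (EX N':S2 - ?D. EX R'. chart R' N' & (EX w':?D - bdry ?D. chart_winding R' (circle_loop 0 \<delta>) w' = 1))"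
  unfolding pos_oriented_def chart_def chart_winding_def circle_loop_def by simp
 also have "\<dots> \<longleftrightarrow> chart_winding R (circle_loop af \<delta>) w = 1"
  using same R N w by (metis (no_types, lifting))
 finally show ?thesis .
qed

lemma connected_punctured_loop:
 fixes gm :: "real => 'a::t2_space"
 assumes "simple_path gm" "pathstart gm = a" "pathfinish gm = a" shows "connected (path_image gm - {a})"
proof -
 have ends: "gm 0 = a" "gm 1 = a" using assms by (auto simp: pathstart_def pathfinish_def)
 have "gm x ~= a" if "x : {0<..<1}" for x using simple_loop_inj[OF assms(1), of 0 x] ends that by auto
 then have "a ~: gm ` {0<..<1}" by blast
 moreover have "{0..1} = {0<..<1} Un {0, 1::real}" by auto
 then have "path_image gm = gm ` {0<..<1} Un {a}" unfolding path_image_def by (simp only: image_Un image_insert image_empty ends) simp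
 ultimately have "path_image gm - {a} = gm ` {0<..<1}" by simp
 moreover have "continuous_on {0<..<1} gm"
  using assms(1) by (auto simp: simple_path_def path_def intro: continuous_on_subset)
 ultimately show ?thesis by (simp add: connected_continuous_image)
qed

lemma arc_cis_unit:
 assumes "0 <= u" "u < 1"
 shows "arc (cis (2*pi * af)) (cis (2*pi * (af + u))) = cis ` {2*pi * af..2*pi * (af + u)}"
proof (rule arc_cis)
 show "2*pi * af <= 2*pi * (af + u)" using assms by (intro mult_left_mono) auto
 have "2*pi * (af + u) < 2*pi * (af+1)" using assms by (intro mult_strict_left_mono) auto
 then show "2*pi * (af + u) < 2*pi * af+2*pi" by (simp add: algebra_simps)
qed

lemma cis_unit_mem_arc_iff:
 assumes u: "0 <= u" "u < 1" and v: "0 <= v" "v < 1"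
 shows "cis (2*pi * (af + v)) : arc (cis (2*pi * af)) (cis (2*pi * (af + u))) \<longleftrightarrow> v <= u"
proof
 assume "cis (2*pi * (af + v)) : arc (cis (2*pi * af)) (cis (2*pi * (af + u)))"
 then obtain y where y: "2*pi * af <= y" "y <= 2*pi * (af + u)" "cis (2*pi * (af + v)) = cis y"
  unfolding arc_cis_unit[OF u] by auto
 have "2*pi * (af + u) = 2*pi * af+2*pi * u" "2*pi * (af + v) = 2*pi * af+2*pi * v" by (simp_all only: distrib_left)
 moreover have "2*pi * u < 2*pi" "0 <= 2*pi * v" "2*pi * v < 2*pi" using u v by simp_all
 ultimately have "\<bar>2*pi * (af + v) - y\<bar> < 2*pi" using y by linarith
 then have "2*pi * (af + v) = y" by (rule cis_eq_imp_eq[OF y(3)])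
 then have "2*pi * (af + v) <= 2*pi * (af + u)" using y by simp
 then show "v <= u" by simp
next
 assume "v <= u"
 then show "cis (2*pi * (af + v)) : arc (cis (2*pi * af)) (cis (2*pi * (af + u)))"
  unfolding arc_cis_unit[OF u] using v by auto
qed

lemma homeomorphism_S1_cnj: "homeomorphism S1 S1 cnj cnj"
proof (rule homeomorphismI)
 show "continuous_on S1 cnj" "continuous_on S1 cnj" by (intro continuous_intros)+
qed (auto simp: S1_def)

lemma circle_loop_cnj: "circle_loop (1 - af) (\<delta> \<circ> cnj) = reversepath (circle_loop af \<delta>)"
proof
 fix x
 have angle: "2*pi * (af+(1 - x)) = - (2*pi * (1 - af + x))+2*pi * of_int 2" by (simp add: algebra_simps)
 have "cnj (cis (2*pi * (1 - af + x))) = cis (- (2*pi * (1 - af + x)))" by (simp add: cis_cnj)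
 also have "\<dots> = cis (2*pi * (af+(1 - x)))" unfolding angle by (rule cis_shift_int[symmetric])
 finally show "circle_loop (1 - af) (\<delta> \<circ> cnj) x = reversepath (circle_loop af \<delta>) x" by (simp add: circle_loop_def reversepath_def)
qed

locale wheel_quad = wheel F for F :: "real => real^3" +
 fixes t1 t2 t3 t4 :: real and a r :: "real^3"
 assumes ord: "t1 < t2" "t2 < t3" "t3 < t4" "t4 < t1+2*pi"
  and Fa: "F t1 = a" "F t3 = a" and Fr: "F t2 = r" "F t4 = r" and ar: "a ~= r"
begin

abbreviation "sector1 \<equiv> F ` {t1..t2}"
abbreviation "sector2 \<equiv> F ` {t2..t3}"
abbreviation "sector3 \<equiv> F ` {t3..t4}"
abbreviation "sector4 \<equiv> F ` {t4..t1+2*pi}"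
abbreviation "half1 \<equiv> F ` {t1..t3}"
abbreviation "half2 \<equiv> F ` {t3..t1+2*pi}"

lemma wheel_quad_rotate: "wheel_quad F t2 t3 t4 (t1+2*pi) r a"
 by unfold_locales (use ord Fa Fr ar per[of t1] in auto)

lemma corners: "a : sector1" "r : sector1" "a : sector2" "r : sector2" "a : sector3" "r : sector3" "a : sector4" "r : sector4"
proof -
 have F1: "F (t1+2*pi) = a" using per[of t1] Fa by simp
 show "a : sector1" by (rule image_eqI[of _ _ t1]) (use ord Fa in auto)
 show "r : sector1" by (rule image_eqI[of _ _ t2]) (use ord Fr in auto)
 show "a : sector2" by (rule image_eqI[of _ _ t3]) (use ord Fa in auto)
 show "r : sector2" by (rule image_eqI[of _ _ t2]) (use ord Fr in auto)
 show "a : sector3" by (rule image_eqI[of _ _ t3]) (use ord Fa in auto)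
 show "r : sector3" by (rule image_eqI[of _ _ t4]) (use ord Fr in auto)
 show "a : sector4" by (rule image_eqI[of _ _ "t1+2*pi"]) (use ord F1 in auto)
 show "r : sector4" by (rule image_eqI[of _ _ t4]) (use ord Fr in auto)
qed

lemma opposite_sectors: "sector1 Int sector3 <= {a, r}"
proof
 fix z assume z: "z : sector1 Int sector3"
 then obtain s where s: "t3 <= s" "s <= t4" "z = F s" by auto
 show "z : {a, r}"
 proof (rule ccontr)
  assume n: "z ~: {a, r}"
  then have s': "t3 < s" "s < t4" using s Fa Fr by (auto simp: less_le)
  have m: "b : F ` {u..v}" if "F x = b" "u <= x" "x <= v" for b x u v using that by auto
  have F1: "F (t1+2*pi) = a" using per[of t1] Fa by simp
  have "a : F ` {t2..s}" by (rule m[OF Fa(2)]) (use s' ord in auto)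
  moreover have "r : F ` {t2..s}" by (rule m[OF Fr(1)]) (use s' ord in auto)
  moreover have "z : F ` {t2..s}" by (rule m[OF s(3)[symmetric]]) (use s' ord in auto)
  moreover have "r : F ` {s..t1+2*pi}" by (rule m[OF Fr(2)]) (use s' ord in auto)
  moreover have "z : F ` {s..t1+2*pi}" by (rule m[OF s(3)[symmetric]]) (use s' ord in auto)
  moreover have "a : F ` {s..t1+2*pi}" by (rule m[OF F1]) (use s' ord in auto)
  moreover have "a : sector1" "r : sector1" "z : sector1" using corners z by blast+
  ultimately have "{a, r, z} <= sector1 Int F ` {t2..s} Int F ` {s..t1+2*pi}" by (simp only: insert_subset Int_iff empty_subsetI simp_thms)
  then have "r = z" by (rule triple_at_most_two[rotated 3]) (use ord s' ar n in auto)
  then show False using n by simp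
 qed
qed

lemma half2_split: "half2 = sector3 Un sector4" using image_split[of t3 t4 "t1+2*pi"] ord by simp

lemma sector_Int_half2: "sector1 Int half2 = sector1 Int sector4" "sector2 Int half2 = sector2 Int sector3"
proof -
 interpret Q: wheel_quad F t2 t3 t4 "t1+2*pi" r a by (rule wheel_quad_rotate)
 have *: "A Int (C Un D) = A Int D" if "A Int C <= {a, r}" "a : D" "r : D" for A C D :: "(real^3) set" using that by blast
 show "sector1 Int half2 = sector1 Int sector4" unfolding half2_split by (rule *[OF opposite_sectors corners(7,8)])
 have "sector2 Int sector4 <= {a, r}" using Q.opposite_sectors by (simp only: insert_commute)
 then show "sector2 Int half2 = sector2 Int sector3" unfolding half2_split Un_commute[of sector3] by (rule *) (rule corners)+
qed

lemma bdry_half1: "bdry half1 = half1 Int half2" by (rule bdry_eq) (use ord in auto)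

lemma boundary_arcs:
 assumes g: "simple_path gm" "pathstart gm = a" "pathfinish gm = a" "path_image gm = bdry half1"
  and s: "t1 < s" "s < t3" "F s : half2" "F s ~= a"
 obtains tu where "0 < tu" "tu < 1" "gm tu = F s"
  "F ` {t1..s} Int half2 = gm ` {0..tu} & F ` {s..t3} Int half2 = gm ` {tu..1} | F ` {t1..s} Int half2 = gm ` {tu..1} & F ` {s..t3} Int half2 = gm ` {0..tu}"
proof -
 let ?P = "F ` {t1..s} Int half2" and ?Q = "F ` {s..t3} Int half2"
 have aX: "a : half2" unfolding half2_split using corners by blast
 have m: "F s : F ` {t1..s}" "F s : F ` {s..t3}" using s by auto
 have a1: "a : F ` {t1..s}" by (rule image_eqI[of _ _ t1]) (use s Fa in auto)
 have a2: "a : F ` {s..t3}" by (rule image_eqI[of _ _ t3]) (use s Fa in auto)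
 have cP: "connected ?P" by (rule connected_Int_consecutive') (use s ord in auto)
 have cQ: "connected ?Q" by (rule connected_Int_consecutive) (use s ord in auto)
 have un: "?P Un ?Q = path_image gm" unfolding g(4) bdry_half1 using image_split[of t1 s t3] s by auto
 have tr: "?P Int ?Q <= {a, F s}"
 proof
  fix x assume x: "x : ?P Int ?Q"
  show "x : {a, F s}"
  proof (rule ccontr)
   assume n: "x ~: {a, F s}"
   have "{a, F s, x} <= F ` {t1..s} Int F ` {s..t3} Int half2" using x a1 a2 m aX s(3) by blast
   then have "F s = x" by (rule triple_at_most_two[rotated 3]) (use ord s n in auto)
   then show False using n by simp
  qed
 qed
 show thesis
 proof (rule simple_loop_two_arcs[OF g(1-3) _ cP _ _ _ cQ _ _ un tr])
  show "closed ?P" "closed ?Q" by (intro closed_Int closed_im)+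
  show "a : ?P" "a : ?Q" using a1 a2 aX by simp_all
  have "F s : ?P" "F s : ?Q" using m s(3) by simp_all
  then show "?P ~= {a}" "?Q ~= {a}" using s(4) by (metis singletonD)+
 qed (rule that)
qed

definition compatible :: "(real => real^3) => real => bool" where
 "compatible gm tu \<longleftrightarrow> simple_path gm & pathstart gm = a & pathfinish gm = a & path_image gm = bdry half1 &
  0 < tu & tu < 1 & gm tu = r & gm ` {0..tu} = sector1 Int sector4 & gm ` {tu..1} = sector2 Int sector3"

lemma compatible_orientation:
 assumes g: "simple_path gm" "pathstart gm = a" "pathfinish gm = a" "path_image gm = bdry half1"
 obtains tu where "compatible gm tu" | tu where "compatible (reversepath gm) tu"
proof -
 have rX: "F t2 : half2" "F t2 ~= a" unfolding half2_split using corners Fr ar by auto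
 obtain tu where t: "0 < tu" "tu < 1" "gm tu = F t2"
  and c: "sector1 Int half2 = gm ` {0..tu} & sector2 Int half2 = gm ` {tu..1} | sector1 Int half2 = gm ` {tu..1} & sector2 Int half2 = gm ` {0..tu}"
  by (rule boundary_arcs[OF g ord(1,2) rX]) (rule that)
 from c show thesis
 proof
  assume "sector1 Int half2 = gm ` {0..tu} & sector2 Int half2 = gm ` {tu..1}"
  then have "compatible gm tu" unfolding sector_Int_half2 compatible_def using g t Fr by simp
  then show thesis by (rule that(1))
 next
  assume "sector1 Int half2 = gm ` {tu..1} & sector2 Int half2 = gm ` {0..tu}"
  then have "reversepath gm ` {0..1 - tu} = sector1 Int sector4" "reversepath gm ` {1 - tu..1} = sector2 Int sector3"
   unfolding sector_Int_half2 reversepath_image by simp_all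
  moreover have "reversepath gm (1 - tu) = r" using t Fr by (simp add: reversepath_def)
  ultimately have "compatible (reversepath gm) (1 - tu)" unfolding compatible_def using g t by (simp add: simple_path_reversepath)
  then show thesis by (rule that(2))
 qed
qed

lemma compatible_initial_arc:
 assumes c: "compatible gm tu" and s: "t1 < s" "s < t3" "F s : half2" "F s ~= a"
 obtains u where "0 < u" "u < 1" "gm u = F s" "F ` {t1..s} Int half2 = gm ` {0..u}"
proof -
 have g: "simple_path gm" "pathstart gm = a" "pathfinish gm = a" "path_image gm = bdry half1" and t: "0 < tu" "tu < 1"
  and im: "gm ` {0..tu} = sector1 Int half2" "gm ` {tu..1} = sector2 Int half2" using c unfolding compatible_def sector_Int_half2 by auto
 obtain u where u: "0 < u" "u < 1" "gm u = F s"
  and cs: "F ` {t1..s} Int half2 = gm ` {0..u} & F ` {s..t3} Int half2 = gm ` {u..1} | F ` {t1..s} Int half2 = gm ` {u..1} & F ` {s..t3} Int half2 = gm ` {0..u}"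
  by (rule boundary_arcs[OF g s]) (rule that)
 have "False" if h: "F ` {t1..s} Int half2 = gm ` {u..1}" "F ` {s..t3} Int half2 = gm ` {0..u}"
 proof (cases "s <= t2")
  case True
  define x where "x = (max u tu+1) / 2"
  have x: "u <= x" "tu < x" "0 < x" "x < 1" unfolding x_def using u t by (auto simp: max_def)
  have "F ` {t1..s} Int half2 <= sector1 Int half2" using True by auto
  moreover have "gm x : F ` {t1..s} Int half2" unfolding h using x by auto
  ultimately have "gm x : gm ` {0..tu}" unfolding im by blast
  then obtain y where y: "0 <= y" "y <= tu" "gm y = gm x" by auto
  then have "y = x" by (intro simple_loop_inj[OF g(1)]) (use x t in auto)
  then show False using x y by simp
 next
  case False
  define x where "x = min u tu / 2"
  have x: "x <= u" "x < tu" "0 < x" "x < 1" unfolding x_def using u t by (auto simp: min_def)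
  have "F ` {s..t3} Int half2 <= sector2 Int half2" using False by auto
  moreover have "gm x : F ` {s..t3} Int half2" unfolding h using x by auto
  ultimately have "gm x : gm ` {tu..1}" unfolding im by blast
  then obtain y where y: "tu <= y" "y <= 1" "gm y = gm x" by auto
  then have "y = x" by (intro simple_loop_inj[OF g(1)]) (use x t in auto)
  then show False using x y by simp
 qed
 then have "F ` {t1..s} Int half2 = gm ` {0..u}" using cs by blast
 then show thesis by (rule that[OF u])
qed

lemma compatible_mono:
 assumes c: "compatible gm tu" and s: "t1 <= s1" "s1 <= s2" "s2 <= t3" "F s1 : half2" "F s1 ~= a" "F s2 : half2" "F s2 ~= a"
  and u: "u1 : {0..1}" "gm u1 = F s1" "u2 : {0..1}" "gm u2 = F s2"
 shows "u1 <= u2"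
proof -
 have g: "simple_path gm" "gm 0 = a" "gm 1 = a" using c unfolding compatible_def pathstart_def pathfinish_def by auto
 have s': "t1 < s2" "s2 < t3" using s Fa by (auto simp: less_le)
 obtain v where v: "0 < v" "v < 1" "gm v = F s2" "F ` {t1..s2} Int half2 = gm ` {0..v}"
  by (rule compatible_initial_arc[OF c s' s(6,7)]) (rule that)
 have "u2 = v" by (rule simple_loop_inj[OF g(1)]) (use u v in auto)
 have "F s1 : gm ` {0..v}" unfolding v(4)[symmetric] using s by auto
 then obtain y where y: "0 <= y" "y <= v" "F s1 = gm y" by auto
 have "u1 = y" by (rule simple_loop_inj[OF g(1)]) (use u y v g s in auto)
 then show ?thesis using y \<open>u2 = v\<close> by simp
qed

definition separates :: "(real^3 => real^3) => real^3 => real^3 => bool" where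
 "separates R N w \<longleftrightarrow> chart R N & N : S2 - F ` {t1..t4} & w : S2 - F ` {t3..t2+2*pi}"

lemma separatesD:
 assumes "separates R N w"
 shows "chart R N" "N : S2 - half1" "N : S2 - sector1" "N : S2 - sector2" "N : S2 - sector3"
  "w : half1 - bdry half1" "w : S2 - sector1" "w : S2 - sector3" "w : S2 - sector4" "w : S2 - {N}" "bdry half1 <= S2 - {N}" "w ~: bdry half1"
proof -
 have N: "N : S2 - F ` {t1..t4}" and w: "w : S2 - F ` {t3..t2+2*pi}" using assms by (auto simp: separates_def)
 have "half1 <= F ` {t1..t4}" "sector1 <= F ` {t1..t4}" "sector2 <= F ` {t1..t4}" "sector3 <= F ` {t1..t4}" by (intro image_mono, use ord in auto)+
 then show N': "N : S2 - half1" "N : S2 - sector1" "N : S2 - sector2" "N : S2 - sector3" using N by blast+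
 have "F ` {t1+2*pi..t2+2*pi} <= F ` {t3..t2+2*pi}" by (intro image_mono) (use ord in auto)
 then have "sector1 <= F ` {t3..t2+2*pi}" unfolding shift_image .
 moreover have "sector3 <= F ` {t3..t2+2*pi}" "sector4 <= F ` {t3..t2+2*pi}" "half2 <= F ` {t3..t2+2*pi}" by (intro image_mono, use ord in auto)+
 ultimately show w': "w : S2 - sector1" "w : S2 - sector3" "w : S2 - sector4" "w : half1 - bdry half1"
  using w interior_eq[of t1 t3] ord by auto
 then show "w : S2 - {N}" "bdry half1 <= S2 - {N}" "w ~: bdry half1" using N'(1) F_in by (auto simp: bdry_def)
 show "chart R N" using assms by (simp add: separates_def)
qed

lemma separates_exists: obtains R N w where "separates R N w"
proof -
 have "S2 - F ` {s..t} ~= {}" if "s < t" "t < s+2*pi" for s t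
  using closed_disk_interior_nonempty[OF disk[of t "s+2*pi"]] complement_eq[OF that] that by simp
 from this[of t1 t4] this[of t3 "t2+2*pi"] obtain N w where "N : S2 - F ` {t1..t4}" "w : S2 - F ` {t3..t2+2*pi}" using ord by auto
 moreover from this obtain R where "chart R N" using chart_exists by blast
 ultimately show thesis by (intro that[of R N w]) (auto simp: separates_def)
qed

lemma joined_arcs_winding_zero:
 assumes sep: "separates R N w" and E: "E = sector1 | E = sector3"
  and p: "path p" "path_image p <= E" and q: "path q" "path_image q <= E" and ends: "pathfinish p = pathstart q" "pathfinish q = pathstart p"
 shows "chart_winding R p w + chart_winding R q w = 0"
proof -
 note R = separatesD(1)[OF sep]
 have NS: "N : S2" and wN: "w : S2 - {N}" "w ~= N" and off: "N : S2 - E" "w : S2 - E" using separatesD[OF sep] E by auto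
 have image: "path_image (p +++ q) <= E" by (rule subset_path_image_join[OF p(2) q(2)])
 have "chart_winding R (p +++ q) w = 0" using E
 proof
  assume E: "E = sector1"
  show ?thesis by (rule chart_winding_zero[OF _ _ R off(1)[unfolded E] off(2)[unfolded E] wN(2)]) (use p q ends image ord E in auto)
 next
  assume E: "E = sector3"
  show ?thesis by (rule chart_winding_zero[OF _ _ R off(1)[unfolded E] off(2)[unfolded E] wN(2)]) (use p q ends image ord E in auto)
 qed
 moreover have "E <= S2" using E F_in by auto
 then have "path_image p <= S2 - {N}" "path_image q <= S2 - {N}" "w ~: path_image p" "w ~: path_image q" using p q off by blast+
 then have "chart_winding R (p +++ q) w = chart_winding R p w + chart_winding R q w"
  by (intro chart_winding_join[OF R NS p(1) _ q(1) _ wN(1) _ _ ends(1)])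
 ultimately show ?thesis by simp
qed

lemma compatible_opposite_winding:
 assumes c1: "compatible gm1 tu1" and c2: "wheel_quad.compatible F t2 t3 t4 (t1+2*pi) r a gm2 tu2" and sep: "separates R N w"
 shows "chart_winding R gm1 w = - chart_winding R gm2 w"
proof -
 interpret Q: wheel_quad F t2 t3 t4 "t1+2*pi" r a by (rule wheel_quad_rotate)
 note R = separatesD(1)[OF sep]
 have g1: "path gm1" "gm1 0 = a" "gm1 1 = a" "gm1 tu1 = r" "0 < tu1" "tu1 < 1" "path_image gm1 = bdry half1"
  and arcs1: "gm1 ` {0..tu1} = sector1 Int sector4" "gm1 ` {tu1..1} = sector2 Int sector3"
  using c1 simple_path_imp_path unfolding compatible_def pathstart_def pathfinish_def by auto
 have g2: "path gm2" "gm2 0 = r" "gm2 1 = r" "gm2 tu2 = a" "0 < tu2" "tu2 < 1"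
  and arcs2: "gm2 ` {0..tu2} = sector2 Int sector1" "gm2 ` {tu2..1} = sector3 Int sector4"
  using c2 simple_path_imp_path unfolding Q.compatible_def pathstart_def pathfinish_def shift_image by auto
 have NS: "N : S2" using separatesD(2)[OF sep] by blast
 have "path_image gm2 = gm2 ` {0..tu2} Un gm2 ` {tu2..1}"
  unfolding path_image_def image_Un[symmetric] using g2 by (simp add: ivl_disj_un_two_touch)
 moreover have "sector1 <= S2" "sector3 <= S2" using F_in by auto
 ultimately have off2: "path_image gm2 <= S2 - {N}" "w ~: path_image gm2" unfolding arcs2 using separatesD[OF sep] by blast+
 have off1: "path_image gm1 <= S2 - {N}" "w ~: path_image gm1" using separatesD[OF sep] g1(7) by auto
 have images: "path_image (subpath 0 tu1 gm1) = sector1 Int sector4" "path_image (subpath tu1 1 gm1) = sector2 Int sector3"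
  "path_image (subpath 0 tu2 gm2) = sector2 Int sector1" "path_image (subpath tu2 1 gm2) = sector3 Int sector4"
  using g1 arcs1 g2 arcs2 by (simp_all add: path_image_subpath)
 have paths: "path (subpath 0 tu1 gm1)" "path (subpath tu1 1 gm1)" "path (subpath 0 tu2 gm2)" "path (subpath tu2 1 gm2)"
  using g1 g2 by (auto intro!: path_subpath)
 have "chart_winding R (subpath 0 tu1 gm1) w + chart_winding R (subpath 0 tu2 gm2) w = 0"
  by (rule joined_arcs_winding_zero[OF sep, of sector1]) (use paths g1 g2 in \<open>simp_all add: images\<close>)
 moreover have "chart_winding R (subpath tu2 1 gm2) w + chart_winding R (subpath tu1 1 gm1) w = 0"
  by (rule joined_arcs_winding_zero[OF sep, of sector3]) (use paths g1 g2 in \<open>simp_all add: images\<close>)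
 ultimately have "chart_winding R gm1 w + chart_winding R gm2 w = 0"
  using chart_winding_split[OF R NS g1(1) off1(1) separatesD(10)[OF sep] off1(2), of tu1]
   chart_winding_split[OF R NS g2(1) off2(1) separatesD(10)[OF sep] off2(2), of tu2] g1 g2 by (simp add: algebra_simps)
 then show ?thesis by (rule eq_neg_iff_add_eq_0[THEN iffD2])
qed

lemma compatible_exists: "EX gm tu. compatible gm tu"
proof -
 have d: "closed_disk half1" by (rule disk) (use ord in auto)
 have ab: "a : bdry half1" using ends[of t1 t3] ord Fa by simp
 obtain gm where "simple_path gm" "pathstart gm = a" "pathfinish gm = a" "path_image gm = bdry half1"
  by (rule closed_disk_boundary_loop[OF d ab])
 then show ?thesis by (rule compatible_orientation) blast+
qed

lemma compatible_same_winding: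
 assumes "compatible gm tu" "compatible gm' tu'" "separates R N w" shows "chart_winding R gm w = chart_winding R gm' w"
proof -
 interpret Q: wheel_quad F t2 t3 t4 "t1+2*pi" r a by (rule wheel_quad_rotate)
 obtain gm2 tu2 where "Q.compatible gm2 tu2" using Q.compatible_exists by blast
 then show ?thesis using compatible_opposite_winding[OF assms(1) _ assms(3)] compatible_opposite_winding[OF assms(2) _ assms(3)] by simp
qed

lemma arc_half1: "arc (cis t1) (cis t3) = cis ` {t1..t3}" by (rule arc_cis) (use ord in auto)

lemma a_boundary: "a : bdry half1" using ends[of t1 t3] ord Fa by simp

lemma based_circle_loop:
 assumes h: "homeomorphism S1 (bdry half1) \<delta> \<delta>'"
 obtains af where "0 <= af" "af < 1" "\<delta>' a = cis (2*pi * af)" "simple_path (circle_loop af \<delta>)"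
  "pathstart (circle_loop af \<delta>) = a" "pathfinish (circle_loop af \<delta>) = a" "path_image (circle_loop af \<delta>) = bdry half1"
proof -
 have "\<delta>' a : S1" using homeomorphism_image2[OF h] a_boundary by blast
 then obtain af where af: "0 <= af" "af < 1" "\<delta>' a = cis (2*pi * af)" by (rule S1_eq_cis_unit_angle)
 have "\<delta> (cis (2*pi * af)) = a" using homeomorphism_apply2[OF h a_boundary] af by simp
 then show thesis using that[OF af] circle_loop[OF h, of af] by simp
qed

lemma circle_loop_inverse:
 "homeomorphism S1 B \<delta> \<delta>' ==> \<delta>' (circle_loop af \<delta> x) = cis (2*pi * (af + x))"
 using homeomorphism_apply1[of S1 B \<delta> \<delta>'] by (simp add: circle_loop_def)

lemma canonical_if_compatible:
 assumes F: "F = (%t. f (cis t))" and loops: "!!\<delta> \<delta>' af. homeomorphism S1 (bdry half1) \<delta> \<delta>' ==> pos_oriented half1 \<delta> ==>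
  0 <= af ==> af < 1 ==> \<delta>' a = cis (2*pi * af) ==> EX tu. compatible (circle_loop af \<delta>) tu"
 shows "canon_agrees f (cis t1) (cis t3) (bdry half1 - {a})"
proof -
 have im: "f ` arc (cis t1) (cis t3) = half1" unfolding arc_half1 F by (simp add: image_image)
 show ?thesis unfolding canon_agrees_def im Let_def
 proof (intro allI impI ballI)
  fix \<delta> \<delta>' z p1 p2
  assume h_pos: "homeomorphism S1 (bdry half1) \<delta> \<delta>' & pos_oriented half1 \<delta>" and z: "z : bdry half1 - (bdry half1 - {a})"
   and points: "p1 : arc (cis t1) (cis t3) & p2 : arc (cis t1) (cis t3) & f p1 : bdry half1 - {a} & f p2 : bdry half1 - {a} & p1 : arc (cis t1) p2"
  then have h: "homeomorphism S1 (bdry half1) \<delta> \<delta>'" and za: "z = a" by auto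
  obtain s1 s2 where s: "t1 <= s1" "s1 <= t3" "p1 = cis s1" "t1 <= s2" "s2 <= t3" "p2 = cis s2" using points unfolding arc_half1 by auto
  have Fs: "F s1 : bdry half1" "F s1 ~= a" "F s2 : bdry half1" "F s2 ~= a" using points s unfolding F by auto
  have "arc (cis t1) (cis s2) = cis ` {t1..s2}" by (rule arc_cis) (use s ord in auto)
  then obtain y where y: "t1 <= y" "y <= s2" "cis s1 = cis y" using points s by auto
  have "s1 = y" by (rule cis_eq_imp_eq[OF y(3)]) (use s y ord in linarith)
  then have s12: "s1 <= s2" using y by simp
  obtain af where af: "0 <= af" "af < 1" "\<delta>' a = cis (2*pi * af)"
   and g: "pathfinish (circle_loop af \<delta>) = a" "path_image (circle_loop af \<delta>) = bdry half1"
   by (rule based_circle_loop[OF h], rule that)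
  obtain tu where c: "compatible (circle_loop af \<delta>) tu" using loops[OF h _ af] h_pos by blast
  obtain u1 where u1: "u1 : {0..1}" "circle_loop af \<delta> u1 = F s1" using Fs(1) g(2) unfolding path_image_def by (metis image_iff)
  obtain u2 where u2: "u2 : {0..1}" "circle_loop af \<delta> u2 = F s2" using Fs(3) g(2) unfolding path_image_def by (metis image_iff)
  have "u1 <= u2" by (rule compatible_mono[OF c s(1) s12 s(5) _ Fs(2) _ Fs(4) u1 u2]) (use Fs bdry_half1 in blast)+
  moreover have "u2 ~= 1" using u2 g(1) Fs(4) by (auto simp: pathfinish_def)
  ultimately have "cis (2*pi * (af + u1)) : arc (cis (2*pi * af)) (cis (2*pi * (af + u2)))"
   using u1 u2 by (subst cis_unit_mem_arc_iff) auto
  then have "\<delta>' (F s1) : arc (\<delta>' a) (\<delta>' (F s2))" unfolding u1(2)[symmetric] u2(2)[symmetric] circle_loop_inverse[OF h] af(3) .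
  then show "\<delta>' (f p1) : arc (\<delta>' z) (\<delta>' (f p2))" unfolding za s F .
 qed
qed

lemma reversed_not_canonical:
 assumes F: "F = (%t. f (cis t))" and h: "homeomorphism S1 (bdry half1) \<delta> \<delta>'" and po: "pos_oriented half1 \<delta>"
  and g: "simple_path (circle_loop af \<delta>)" "pathstart (circle_loop af \<delta>) = a" "path_image (circle_loop af \<delta>) = bdry half1"
  and reversed: "compatible (reversepath (circle_loop af \<delta>)) tu"
 shows "~ canon_agrees f (cis t1) (cis t3) (bdry half1 - {a})"
proof
 assume ca: "canon_agrees f (cis t1) (cis t3) (bdry half1 - {a})"
 let ?g = "circle_loop af \<delta>"
 have im: "f ` arc (cis t1) (cis t3) = half1" unfolding arc_half1 F by (simp add: image_image)
 have g0: "?g 0 = a" using g(2) by (simp add: pathstart_def)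
 have t: "0 < tu" "tu < 1" "?g (1 - tu) = r" "reversepath ?g ` {0..tu} = sector1 Int sector4"
  using reversed unfolding compatible_def by (auto simp: reversepath_def)
 have "reversepath ?g (tu / 2) : sector1 Int sector4" unfolding t(4)[symmetric] using t by auto
 then obtain s where s: "t1 <= s" "s <= t2" "F s = ?g (1 - tu / 2)" by (auto simp: reversepath_def)
 have Fs: "F s ~= a" using simple_loop_inj[OF g(1), of 0 "1 - tu / 2"] g0 s t by auto
 have gB: "?g x : bdry half1" if "x : {0..1}" for x using g(3) that by (auto simp: path_image_def)
 have arcs: "cis s : arc (cis t1) (cis t3)" "cis t2 : arc (cis t1) (cis t3)" "cis s : arc (cis t1) (cis t2)"
  unfolding arc_half1 using arc_cis[of t1 t2] s ord by auto
 have points: "f (cis s) = ?g (1 - tu / 2)" "f (cis t2) = ?g (1 - tu)" using s(3) Fr(1) t(3) unfolding F by auto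
 have Y: "f (cis s) : bdry half1 - {a}" "f (cis t2) : bdry half1 - {a}" unfolding points
  using gB[of "1 - tu / 2"] gB[of "1 - tu"] t Fs s ar by auto
 have "\<delta>' (f (cis s)) : arc (\<delta>' a) (\<delta>' (f (cis t2)))"
  using ca h po a_boundary arcs Y unfolding canon_agrees_def im Let_def by blast
 then have "cis (2*pi * (af+(1 - tu / 2))) : arc (cis (2*pi * (af + 0))) (cis (2*pi * (af+(1 - tu))))"
  unfolding points g0[symmetric] circle_loop_inverse[OF h] .
 then show False using cis_unit_mem_arc_iff[of "1 - tu" "1 - tu / 2" af] t by simp
qed

lemma reverse_winding:
 assumes "separates R N w" "path gm" "path_image gm = bdry half1"
 shows "chart_winding R (reversepath gm) w = - chart_winding R gm w"
 by (rule chart_winding_reverse) (use separatesD[OF assms(1)] assms in auto)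

lemma canonical_iff:
 assumes F: "F = (%t. f (cis t))" and c: "compatible gm tu" and sep: "separates R N w"
 shows "canon_agrees f (cis t1) (cis t3) (bdry half1 - {a}) \<longleftrightarrow> chart_winding R gm w = 1"
proof
 have st: "t1 < t3" "t3 < t1+2*pi" using ord by auto
 note pos_iff = pos_oriented_iff[OF st separatesD(1,2,6)[OF sep]]
 show "canon_agrees f (cis t1) (cis t3) (bdry half1 - {a})" if one: "chart_winding R gm w = 1"
 proof (rule canonical_if_compatible[OF F])
  fix \<delta> \<delta>' af assume h: "homeomorphism S1 (bdry half1) \<delta> \<delta>'" "pos_oriented half1 \<delta>" and af: "0 <= af" "af < 1" "\<delta>' a = cis (2*pi * af)"
  have "\<delta> (cis (2*pi * af)) = a" using homeomorphism_apply2[OF h(1) a_boundary] af by simp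
  then have g: "simple_path (circle_loop af \<delta>)" "pathstart (circle_loop af \<delta>) = a" "pathfinish (circle_loop af \<delta>) = a" "path_image (circle_loop af \<delta>) = bdry half1"
   using circle_loop[OF h(1), of af] by auto
  have "chart_winding R (circle_loop af \<delta>) w = 1" using pos_iff[OF h(1), of af] af h(2) by simp
  then have "chart_winding R (reversepath (circle_loop af \<delta>)) w ~= 1"
   using reverse_winding[OF sep simple_path_imp_path[OF g(1)] g(4)] by simp
  then show "EX tu. compatible (circle_loop af \<delta>) tu" using compatible_orientation[OF g] compatible_same_winding[OF c _ sep] one by metis
 qed
 assume ca: "canon_agrees f (cis t1) (cis t3) (bdry half1 - {a})"
 obtain \<delta> \<delta>' where h: "homeomorphism S1 (bdry half1) \<delta> \<delta>'" by (rule closed_disk_boundary_circle[OF disk[OF st]])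
 obtain af where af: "0 <= af" "af < 1" and g: "simple_path (circle_loop af \<delta>)" "pathstart (circle_loop af \<delta>) = a"
   "pathfinish (circle_loop af \<delta>) = a" "path_image (circle_loop af \<delta>) = bdry half1"
  by (rule based_circle_loop[OF h], rule that)
 have reverse: "chart_winding R (reversepath (circle_loop af \<delta>)) w = - chart_winding R (circle_loop af \<delta>) w"
  by (rule reverse_winding[OF sep simple_path_imp_path[OF g(1)] g(4)])
 show "chart_winding R gm w = 1"
 proof (rule ccontr)
  assume "chart_winding R gm w ~= 1"
  then have minus: "chart_winding R gm w = -1"
   using chart_winding_boundary[OF st separatesD(1,2,6)[OF sep], of gm] c unfolding compatible_def by auto
  show False
  proof (rule compatible_orientation[OF g])
   fix tu' assume c': "compatible (reversepath (circle_loop af \<delta>)) tu'"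
   then have "chart_winding R (circle_loop af \<delta>) w = 1" using compatible_same_winding[OF c c' sep] minus reverse by simp
   then have "pos_oriented half1 \<delta>" using pos_iff[OF h, of af] af by simp
   then show False using reversed_not_canonical[OF F h _ g(1,2,4) c'] ca by blast
  next
   fix tu' assume c': "compatible (circle_loop af \<delta>) tu'"
   let ?g = "circle_loop (1 - af) (\<delta> \<circ> cnj)"
   have h': "homeomorphism S1 (bdry half1) (\<delta> \<circ> cnj) (cnj \<circ> \<delta>')" by (rule homeomorphism_compose[OF homeomorphism_S1_cnj h])
   have "chart_winding R (circle_loop af \<delta>) w = -1" using compatible_same_winding[OF c c' sep] minus by simp
   then have "chart_winding R ?g w = 1" unfolding circle_loop_cnj reverse by simp
   moreover have "1 - af : {0..1}" using af by simp
   ultimately have po: "pos_oriented half1 (\<delta> \<circ> cnj)" using pos_iff[OF h'] by blast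
   have "simple_path ?g" "pathstart ?g = a" "path_image ?g = bdry half1" "compatible (reversepath ?g) tu'"
    unfolding circle_loop_cnj using g c' by (simp_all add: simple_path_reversepath)
   then show False using reversed_not_canonical[OF F h' po] ca by blast
  qed
 qed
qed

lemma canonical_alternate:
 assumes F: "F = (%t. f (cis t))"
 shows "canon_agrees f (cis t1) (cis t3) (bdry half1 - {a}) \<longleftrightarrow> ~ canon_agrees f (cis t2) (cis t4) (bdry (F ` {t2..t4}) - {r})"
proof -
 interpret Q: wheel_quad F t2 t3 t4 "t1+2*pi" r a by (rule wheel_quad_rotate)
 obtain R N w where sep: "separates R N w" by (rule separates_exists)
 obtain R' N' w' where sep': "Q.separates R' N' w'" by (rule Q.separates_exists)
 obtain gm tu where c: "compatible gm tu" using compatible_exists by blast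
 obtain gm2 tu2 where c2: "Q.compatible gm2 tu2" using Q.compatible_exists by blast
 have st: "t2 < t4" "t4 < t2+2*pi" using ord by auto
 have g2: "path gm2" "simple_path gm2" "pathfinish gm2 = pathstart gm2" "path_image gm2 = bdry (F ` {t2..t4})"
  using c2 simple_path_imp_path unfolding Q.compatible_def by auto
 have "F ` {t2..t4} <= F ` {t1..t4}" "F ` {t4..t2+2*pi} <= F ` {t3..t2+2*pi}" by (intro image_mono, use ord in auto)+
 then have N: "N : S2 - F ` {t2..t4}" and w: "w : F ` {t2..t4} - bdry (F ` {t2..t4})"
  unfolding interior_eq[OF st] using sep unfolding separates_def by blast+
 have "chart_winding R' gm2 w' = chart_winding R gm2 w"
  by (rule chart_winding_independent[OF st separatesD(1)[OF sep] Q.separatesD(1)[OF sep'] N Q.separatesD(2)[OF sep'] w Q.separatesD(6)[OF sep'] g2(1,3)])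
    (use g2 in simp)
 moreover have "chart_winding R gm w = - chart_winding R gm2 w" by (rule compatible_opposite_winding[OF c c2 sep])
 moreover have "chart_winding R gm2 w = 1 | chart_winding R gm2 w = -1"
  by (rule chart_winding_boundary[OF st separatesD(1)[OF sep] N w g2(2-4)])
 ultimately show ?thesis unfolding canonical_iff[OF F c sep] Q.canonical_iff[OF F c2 sep'] by auto
qed

lemma pos_degenerate_iff:
 assumes F: "F = (%t. f (cis t))"
 shows "pos_degenerate f (cis t1) (cis t3) \<longleftrightarrow> ~ canon_agrees f (cis t1) (cis t3) (bdry half1 - {a})"
  "neg_degenerate f (cis t1) (cis t3) \<longleftrightarrow> canon_agrees f (cis t1) (cis t3) (bdry half1 - {a})"
proof -
 have im: "f ` arc (cis t1) (cis t3) = half1" unfolding arc_half1 F by (simp add: image_image)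
 have fa: "f (cis t1) = a" "f (cis t3) = a" using Fa unfolding F by auto
 have "cis t1 ~= cis t3" using cis_eq_imp_eq[of t1 t3] ord by auto
 then have degenerate: "degenerate f (cis t1) (cis t3)" using fa by (simp add: degenerate_def)
 obtain gm tu where "compatible gm tu" using compatible_exists by blast
 then have g: "simple_path gm" "pathstart gm = a" "pathfinish gm = a" "path_image gm = bdry half1" and tu: "0 < tu" "tu < 1" "gm tu = r"
  unfolding compatible_def by auto
 have "gm tu : path_image gm" unfolding path_image_def by (rule imageI) (use tu in simp)
 then have "r : bdry half1 - {a}" using g(4) tu(3) ar by simp
 moreover have "connected (bdry half1 - {a})" using connected_punctured_loop[OF g(1-3)] g(4) by simp
 ultimately have "components (bdry half1 - {a}) = {bdry half1 - {a}}" unfolding components_eq_sing_iff by auto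
 then have "Zplus_empty f (cis t1) (cis t3) \<longleftrightarrow> ~ canon_agrees f (cis t1) (cis t3) (bdry half1 - {a})"
  unfolding Zplus_empty_def im fa by simp
 then show "pos_degenerate f (cis t1) (cis t3) \<longleftrightarrow> ~ canon_agrees f (cis t1) (cis t3) (bdry half1 - {a})"
  "neg_degenerate f (cis t1) (cis t3) \<longleftrightarrow> canon_agrees f (cis t1) (cis t3) (bdry half1 - {a})"
  using degenerate by (auto simp: pos_degenerate_def neg_degenerate_def)
qed

lemma degenerate_alternate:
 assumes F: "F = (%t. f (cis t))"
 shows "pos_degenerate f (cis t1) (cis t3) \<longleftrightarrow> neg_degenerate f (cis t2) (cis t4)"
  "neg_degenerate f (cis t1) (cis t3) \<longleftrightarrow> pos_degenerate f (cis t2) (cis t4)"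
  "pos_degenerate f (cis t1) (cis t3) \<longleftrightarrow> ~ neg_degenerate f (cis t1) (cis t3)"
proof -
 interpret Q: wheel_quad F t2 t3 t4 "t1+2*pi" r a by (rule wheel_quad_rotate)
 show "pos_degenerate f (cis t1) (cis t3) \<longleftrightarrow> neg_degenerate f (cis t2) (cis t4)"
  "neg_degenerate f (cis t1) (cis t3) \<longleftrightarrow> pos_degenerate f (cis t2) (cis t4)"
  "pos_degenerate f (cis t1) (cis t3) \<longleftrightarrow> ~ neg_degenerate f (cis t1) (cis t3)"
  unfolding pos_degenerate_iff[OF F] Q.pos_degenerate_iff[OF F] using canonical_alternate[OF F] by blast+
qed

end

subsection \<open>Leaves between consecutive preimages\<close>

definition opposite_leaves :: "(complex => real^3) => complex => complex => complex => complex => bool" where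
 "opposite_leaves f p q p' q' \<longleftrightarrow>
  (pos_degenerate f p q \<longleftrightarrow> neg_degenerate f p' q') & (neg_degenerate f p q \<longleftrightarrow> pos_degenerate f p' q')"

definition (in wheel) adjacent_preimages :: "real^3 => real => real => bool" where
 "adjacent_preimages c x y \<longleftrightarrow> F x = c & F y = c & x < y & y < x+2*pi & (ALL t. x < t --> t < y --> F t ~= c)"

lemma (in wheel) adjacent_preimages_shift:
 assumes "adjacent_preimages c x y" shows "adjacent_preimages c (x+2*pi * of_int k) (y+2*pi * of_int k)"
proof -
 have "F t ~= c" if "x+2*pi * of_int k < t" "t < y+2*pi * of_int k" for t
  using assms that per_int[of "t - 2*pi * of_int k" k] by (simp add: adjacent_preimages_def)
 then show ?thesis using assms by (simp add: adjacent_preimages_def per_int)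
qed

lemma (in wheel) linked_preimages_opposite:
 assumes F: "F = (%t. f (cis t))" and order: "t1 < t2" "t2 < t3" "t3 < t4" "t4 < t1+2*pi"
  and fibres: "F t1 = a" "F t3 = a" "F t2 = r" "F t4 = r" "a ~= r"
 shows "opposite_leaves f (cis t1) (cis t3) (cis t2) (cis t4)"
proof -
 interpret Q: wheel_quad F t1 t2 t3 t4 a r by unfold_locales (use order fibres in auto)
 show ?thesis using Q.degenerate_alternate[OF F] by (auto simp: opposite_leaves_def)
qed

locale wheel_alternating = wheel F for F +
 fixes a r :: "real^3"
 assumes distinct: "a ~= r"
  and next_source: "F x = a ==> EX v>x. v <= x+2*pi & F v = r & (ALL w. x < w --> w < v --> F w ~: {a, r})"
  and next_sink: "F x = r ==> EX v>x. v <= x+2*pi & F v = a & (ALL w. x < w --> w < v --> F w ~: {a, r})"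
begin

lemma wheel_alternating_swap: "wheel_alternating F r a"
 by unfold_locales (use distinct next_source next_sink in \<open>auto simp: insert_commute\<close>)

lemma source_between:
 assumes "F x = a" "F y = a" "x < y" obtains t where "F t = r" "x < t" "t < y"
proof -
 obtain v where v: "x < v" "F v = r" "ALL w. x < w --> w < v --> F w ~: {a, r}" using next_source[OF assms(1)] by blast
 then have "~ y < v" "y ~= v" using assms distinct by auto
 then show thesis using v that by simp
qed

lemma sink_between:
 assumes "F x = r" "F y = r" "x < y" obtains t where "F t = a" "x < t" "t < y"
 using wheel_alternating.source_between[OF wheel_alternating_swap assms] that by blast

lemma adjacent_preimages_opposite_normalized:
 assumes F: "F = (%t. f (cis t))" and y: "adjacent_preimages a y1 y2" and z: "adjacent_preimages r z1 z2"
  and normalized: "y1 <= z1" "z1 < y1+2*pi"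
 shows "opposite_leaves f (cis y1) (cis y2) (cis z1) (cis z2)"
proof -
 note linked = linked_preimages_opposite[OF F _ _ _ _ _ _ _ _ distinct] linked_preimages_opposite[OF F _ _ _ _ _ _ _ _ distinct[symmetric]]
 have Fy: "F y1 = a" "F y2 = a" "y1 < y2" "y2 < y1+2*pi" and Fz: "F z1 = r" "F z2 = r" "z1 < z2" "z2 < z1+2*pi"
  and free: "!!t. y1 < t ==> t < y2 ==> F t ~= a" "!!t. z1 < t ==> t < z2 ==> F t ~= r"
  using y z unfolding adjacent_preimages_def by blast+
 have per2: "F (y1+2*pi) = a" "F (y2+2*pi) = a" using Fy per by simp_all
 have "y1 ~= z1" "y2 ~= z1" "y1+2*pi ~= z2" using Fy Fz per2 distinct by auto
 then have "y1 < z1" using normalized by simp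
 obtain s where s: "F s = a" "z1 < s" "s < z2" by (rule sink_between[OF Fz(1-3)])
 obtain t where t: "F t = r" "y1 < t" "t < y2" by (rule source_between[OF Fy(1-3)])
 consider (interleaved) "z1 < y2" | (disjoint) "y2 < z1" "z2 < y1+2*pi" | (wrapped) "y2 < z1" "y1+2*pi < z2"
  using \<open>y2 ~= z1\<close> \<open>y1+2*pi ~= z2\<close> by linarith
 then show ?thesis
 proof cases
  case interleaved
  obtain u where u: "F u = r" "y2 < u" "u < y1+2*pi" by (rule source_between[OF Fy(2) per2(1) Fy(4)])
  have "~ s < y2" using free(1)[of s] s \<open>y1 < z1\<close> by auto
  moreover have "~ u < z2" using free(2)[of u] u interleaved by auto
  ultimately show ?thesis using Fy Fz s u \<open>y1 < z1\<close> interleaved by (intro linked(1)) auto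
 next
  case disjoint
  have "opposite_leaves f (cis y1) (cis y2) (cis t) (cis z1)" using t disjoint Fy Fz by (intro linked(1)) auto
  moreover have "opposite_leaves f (cis t) (cis z1) (cis y2) (cis s)" using t s disjoint Fy Fz by (intro linked(2)) auto
  moreover have "opposite_leaves f (cis y2) (cis s) (cis z1) (cis z2)" using s disjoint Fy Fz by (intro linked(1)) auto
  ultimately show ?thesis unfolding opposite_leaves_def by blast
 next
  case wrapped
  have "F (t+2*pi) = r" using t per by simp
  then have "~ t+2*pi < z2" using free(2)[of "t+2*pi"] t \<open>z1 < y1+2*pi\<close> by auto
  then have "opposite_leaves f (cis z1) (cis z2) (cis (y1+2*pi)) (cis (y2+2*pi))"
   using t wrapped Fy Fz per2 normalized by (intro linked(2)) auto
  then show ?thesis unfolding opposite_leaves_def cis_periodic by blast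
 qed
qed

lemma adjacent_preimages_opposite:
 assumes F: "F = (%t. f (cis t))" and y: "adjacent_preimages a y1 y2" and x: "adjacent_preimages r x1 x2"
 shows "opposite_leaves f (cis y1) (cis y2) (cis x1) (cis x2)"
proof -
 obtain k where "y1 <= x1+2*pi * of_int k" "x1+2*pi * of_int k < y1+2*pi" using real_period_representative by blast
 then have "opposite_leaves f (cis y1) (cis y2) (cis (x1+2*pi * of_int k)) (cis (x2+2*pi * of_int k))"
  by (rule adjacent_preimages_opposite_normalized[OF F y adjacent_preimages_shift[OF x]])
 then show ?thesis by (simp add: cis_shift_int)
qed

lemma adjacent_sources_exist:
 assumes "adjacent_preimages a y1 y2" obtains x1 x2 where "adjacent_preimages r x1 x2"
proof -
 have y: "F y1 = a" "F y2 = a" "y1 < y2" "y2 < y1+2*pi" using assms by (auto simp: adjacent_preimages_def)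
 obtain x where x: "F x = r" "y1 < x" "x < y2" by (rule source_between[OF y(1-3)])
 obtain v where v: "x < v" "F v = a" "ALL w. x < w --> w < v --> F w ~: {a, r}" using next_sink[OF x(1)] by blast
 obtain u where u: "v < u" "F u = r" "ALL w. v < w --> w < u --> F w ~: {a, r}" using next_source[OF v(2)] by blast
 have "F (y1+2*pi) = a" using y per by simp
 obtain z where z: "F z = r" "y2 < z" "z < y1+2*pi" by (rule source_between[OF y(2) \<open>F (y1+2*pi) = a\<close> y(4)])
 have "v <= y2" using v(3) y(2) x(3) by force
 then have "u <= z" using u(3) z by force
 have "F t ~= r" if "x < t" "t < u" for t
  using v(2,3) u(3) that distinct by (cases t v rule: linorder_cases) auto
 then have "adjacent_preimages r x u" using x v(1) u(1,2) z(3) \<open>u <= z\<close> by (auto simp: adjacent_preimages_def)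
 then show thesis by (rule that)
qed

lemma adjacent_preimages_leaves:
 assumes F: "F = (%t. f (cis t))"
 shows "(ALL x y. adjacent_preimages a x y --> pos_degenerate f (cis x) (cis y)) &
   (ALL x y. adjacent_preimages r x y --> neg_degenerate f (cis x) (cis y)) |
  (ALL x y. adjacent_preimages a x y --> neg_degenerate f (cis x) (cis y)) &
   (ALL x y. adjacent_preimages r x y --> pos_degenerate f (cis x) (cis y))"
proof -
 note opposite = adjacent_preimages_opposite[OF F, unfolded opposite_leaves_def]
 have signed: "pos_degenerate f (cis x) (cis y) | neg_degenerate f (cis x) (cis y)" if "adjacent_preimages a x y" for x y
  using that cis_eq_imp_eq[of x y] unfolding F by (auto simp: wheel.adjacent_preimages_def[OF wheel_axioms, unfolded F] pos_degenerate_def neg_degenerate_def degenerate_def)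
 have "EX x y. adjacent_preimages r x y" if "adjacent_preimages a x y" for x y using adjacent_sources_exist[OF that] by blast
 moreover have "EX x y. adjacent_preimages a x y" if "adjacent_preimages r x y" for x y
  using wheel_alternating.adjacent_sources_exist[OF wheel_alternating_swap that] by blast
 ultimately show ?thesis using opposite signed by meson
qed

lemma card_sinks_le:
 assumes F: "F = (%t. f (cis t))" and fin: "finite {z : S1. f z = r}"
 shows "card {z : S1. f z = a} <= card {z : S1. f z = r}"
proof (rule card_le_if_inj_on_rel[OF fin, where r = "%z w. EX x v. z = cis x & w = cis v & F x = a & x < v & (ALL t. x < t --> t < v --> F t ~= a)"])
 fix z assume "z : {z : S1. f z = a}"
 then obtain x where x: "z = cis x" "F x = a" using S1_iff_cis F by auto
 obtain v where "x < v" "F v = r" "ALL w. x < w --> w < v --> F w ~: {a, r}" using next_source[OF x(2)] by blast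
 then show "EX w. w : {z : S1. f z = r} & (EX x v. z = cis x & w = cis v & F x = a & x < v & (ALL t. x < t --> t < v --> F t ~= a))"
  using x F by (intro exI[of _ "cis v"]) auto
next
 fix z1 z2 w
 assume "EX x v. z1 = cis x & w = cis v & F x = a & x < v & (ALL t. x < t --> t < v --> F t ~= a)"
  and "EX x v. z2 = cis x & w = cis v & F x = a & x < v & (ALL t. x < t --> t < v --> F t ~= a)"
 then obtain x1 v1 x2 v2 where 
  x1: "z1 = cis x1" "w = cis v1" "F x1 = a" "x1 < v1" "ALL t. x1 < t --> t < v1 --> F t ~= a" and
  x2: "z2 = cis x2" "w = cis v2" "F x2 = a" "x2 < v2" "ALL t. x2 < t --> t < v2 --> F t ~= a" by blast
 obtain j :: int where j: "v1 = v2+2*pi * of_int j" using x1(2) x2(2) cis_eq_iff_int by metis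
 have "~ x1 < x2+2*pi * of_int j" using x1(5) x2(3,4) per_int[of x2 j] j by auto
 moreover have "~ x2 < x1+2*pi * of_int (- j)" using x2(5) x1(3,4) per_int[of x1 "- j"] j by auto
 ultimately have "x1 = x2+2*pi * of_int j" by simp
 then show "z1 = z2" using x1(1) x2(1) by (simp add: cis_shift_int)
qed

end

lemma consecutive_lift:
 assumes consecutive: "consecutive S p q" and S: "S <= S1"
 obtains x y where "p = cis x" "q = cis y" "x < y" "y < x+2*pi" "cis x : S" "cis y : S" "!!w. x < w ==> w < y ==> cis w ~: S"
proof -
 have pq: "p : S" "q : S" "p ~= q" using consecutive by (auto simp: consecutive_def)
 have between: "w = p | w = q" if "w : S" "w : arc p q" for w
  using consecutive that by (auto simp: consecutive_def)
 obtain x where x: "p = cis x" using S1_iff_cis[of p] pq(1) S by auto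
 obtain y0 where y0: "q = cis y0" using S1_iff_cis[of q] pq(2) S by auto
 obtain k where "x <= y0+2*pi * of_int k" and y_less: "y0+2*pi * of_int k < x+2*pi" using real_period_representative by blast
 define y where "y = y0+2*pi * of_int k"
 have y: "q = cis y" unfolding y0 y_def by (simp add: cis_shift_int)
 then have "x < y" using \<open>x <= y0+2*pi * of_int k\<close> pq x unfolding y_def[symmetric] by (cases "x = y") auto
 have "cis w ~: S" if w: "x < w" "w < y" for w
 proof
  assume "cis w : S"
  moreover have "cis w : arc p q" unfolding x y using arc_cis[of x y] y_less w by (simp add: y_def)
  ultimately have "cis w = cis x | cis w = cis y" using between x y by blast
  then have "w = x | w = y" using cis_eq_imp_eq[of w x] cis_eq_imp_eq[of w y] w y_less by (auto simp: y_def)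
  then show False using w by simp
 qed
 then show thesis using that[OF x y \<open>x < y\<close>] y_less pq x y by (simp add: y_def)
qed

lemma (in wheel) consecutive_adjacent:
 assumes F: "F = (%t. f (cis t))" and "consecutive {z : S1. f z = c} p q"
 obtains x y where "p = cis x" "q = cis y" "adjacent_preimages c x y"
proof -
 obtain x y where xy: "p = cis x" "q = cis y" "x < y" "y < x+2*pi" "cis x : {z : S1. f z = c}" "cis y : {z : S1. f z = c}"
  "!!w. x < w ==> w < y ==> cis w ~: {z : S1. f z = c}" by (rule consecutive_lift[OF assms(2)], blast, rule that)
 have "adjacent_preimages c x y" unfolding adjacent_preimages_def using xy F by auto
 then show thesis using that xy by blast
qed

definition joined_by :: "complex set => complex set set => bool" where
 "joined_by S \<Lambda> \<longleftrightarrow> (ALL x y. consecutive S x y --> {x, y} : \<Lambda>)"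

lemma (in wheel) fibre_joined_by:
 assumes F: "F = (%t. f (cis t))" and leaf: "!!x y. adjacent_preimages c x y ==> {cis x, cis y} : \<Lambda>"
 shows "joined_by {z : S1. f z = c} \<Lambda>"
 unfolding joined_by_def
proof (intro allI impI)
 fix p q assume "consecutive {z : S1. f z = c} p q"
 then obtain x y where "p = cis x" "q = cis y" "adjacent_preimages c x y" by (rule consecutive_adjacent[OF F])
 then show "{p, q} : \<Lambda>" using leaf by simp
qed

lemma (in wheel_alternating) fibres_joined_by_leaves:
 assumes F: "F = (%t. f (cis t))"
 shows "joined_by {z : S1. f z = a} (Lplus f) & joined_by {z : S1. f z = r} (Lminus f) |
  joined_by {z : S1. f z = r} (Lplus f) & joined_by {z : S1. f z = a} (Lminus f)"
proof -
 have leaf: "pos_degenerate f p q ==> {p, q} : Lplus f" "neg_degenerate f p q ==> {p, q} : Lminus f" for p q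
  unfolding Lplus_def Lminus_def by blast+
 show ?thesis using adjacent_preimages_leaves[OF F]
 proof (elim disjE conjE)
  assume "ALL x y. adjacent_preimages a x y --> pos_degenerate f (cis x) (cis y)"
   "ALL x y. adjacent_preimages r x y --> neg_degenerate f (cis x) (cis y)"
  then show ?thesis using leaf by (intro disjI1 conjI fibre_joined_by[OF F]) simp_all
 next
  assume "ALL x y. adjacent_preimages a x y --> neg_degenerate f (cis x) (cis y)"
   "ALL x y. adjacent_preimages r x y --> pos_degenerate f (cis x) (cis y)"
  then show ?thesis using leaf by (intro disjI2 conjI fibre_joined_by[OF F]) simp_all
 qed
qed

subsection \<open>Dynamics of the induced circle map\<close>

definition circle_fixed :: "(complex => complex) => complex set" where
 "circle_fixed g = {x : S1. g x = x}"

definition circle_sinks :: "(complex => complex) => complex set" where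
 "circle_sinks g = {x : circle_fixed g. attracting S1 g x}"

definition circle_sources :: "(complex => complex) => complex set" where
 "circle_sources g = {x : circle_fixed g. repelling S1 g x}"

definition sphere_fixed :: "(real^3 => real^3) => (real^3) set" where
 "sphere_fixed H = {y : S2. H y = y}"

definition alternating_dynamics :: "(complex => complex) => bool" where
 "alternating_dynamics g \<longleftrightarrow> finite (circle_fixed g) & even (card (circle_fixed g)) & card (circle_fixed g) > 0 &
  (ALL x:circle_fixed g. (attracting S1 g x | repelling S1 g x) & ~ (attracting S1 g x & repelling S1 g x)) &
  (ALL x y. consecutive (circle_fixed g) x y -->
   (x : circle_sinks g & y : circle_sources g) | (x : circle_sources g & y : circle_sinks g))"

definition poles_joined_by_leaves :: "(complex => real^3) => (complex => complex) => bool" where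
 "poles_joined_by_leaves f g \<longleftrightarrow> joined_by (circle_sinks g) (Lplus f) & joined_by (circle_sources g) (Lminus f) |
  joined_by (circle_sources g) (Lplus f) & joined_by (circle_sinks g) (Lminus f)"

definition source_sink_images :: "(complex => real^3) => (complex => complex) => (real^3 => real^3) => bool" where
 "source_sink_images f g H \<longleftrightarrow> (EX a r. a ~= r & f ` circle_sinks g = {a} & f ` circle_sources g = {r} &
  sphere_fixed H = {a, r} & attracting S2 H a & repelling S2 H r)"

definition conjugate_to_translation :: "(real^3 => real^3) => real^3 => bool" where
 "conjugate_to_translation H c \<longleftrightarrow> (EX \<phi> \<phi>'. homeomorphism (S2 - {c}) (UNIV :: complex set) \<phi> \<phi>' &
  (EX v. ALL z. \<phi> (H (\<phi>' z)) = z + v))"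

definition two_point_dynamics :: "(complex => real^3) => (complex => complex) => (real^3 => real^3) => bool" where
 "two_point_dynamics f g H \<longleftrightarrow> sphere_fixed H = f ` circle_fixed g &
  (card (f ` circle_fixed g) = 2 & (ALL x:circle_sinks g. attracting S2 H (f x)) & (ALL x:circle_sources g. repelling S2 H (f x)) |
   (EX c. f ` circle_fixed g = {c} & conjugate_to_translation H c))"

definition wheel_dynamics :: "(complex => real^3) => (complex => complex) => (real^3 => real^3) => bool" where
 "wheel_dynamics f g H \<longleftrightarrow> alternating_dynamics g & poles_joined_by_leaves f g &
  (card (circle_fixed g) >= 4 --> source_sink_images f g H) & (card (circle_fixed g) = 2 --> two_point_dynamics f g H)"

lemma (in wheel_map) contracts_at_shift:
 assumes "contracts_at l x \<epsilon>" shows "contracts_at l (x+2*pi * of_int k) \<epsilon>"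
proof -
 have "\<bar>l y - (x+2*pi * of_int k)\<bar> < \<bar>y - (x+2*pi * of_int k)\<bar>"
  if "0 < \<bar>y - (x+2*pi * of_int k)\<bar>" "\<bar>y - (x+2*pi * of_int k)\<bar> < \<epsilon>" for y
 proof -
  define s where "s = y - 2*pi * of_int k"
  have y: "y = s+2*pi * of_int k" by (simp add: s_def)
  show ?thesis using assms that unfolding y l_per_int contracts_at_def by simp
 qed
 then show ?thesis using assms by (simp add: contracts_at_def l_per_int)
qed

locale wheel_root = wheel_fix F l l' "H ^^ n" "H' ^^ n" + B: wheel_map F L L' H H'
 for F l l' L L' and H H' :: "real^3 => real^3" and n :: nat +
 fixes k :: int and f :: "complex => real^3" and g :: "complex => complex"
 assumes n: "n >= 1" and root: "l t = (L ^^ n) t+2*pi * of_int k"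
  and F_cis: "F = (%t. f (cis t))" and g_lift: "g (cis t) = cis (l t)"
begin

lemma l_commute: "l (L t) = L (l t)" unfolding root B.l_per_int B.pow_commute ..

lemma fix_L: "l (L t) = L t \<longleftrightarrow> l t = t" unfolding l_commute by simp

lemma fix_lift:
 assumes "g (cis t) = cis t" shows "l t = t"
proof -
 obtain j :: int where j: "l t = t+2*pi * of_int j" using assms unfolding g_lift using cis_eq_iff_int by blast
 obtain x where x: "l x = x" using fixp by blast
 obtain m where m: "x <= t+2*pi * of_int m" "t+2*pi * of_int m < x+2*pi" using real_period_representative by blast
 then have "l x <= l (t+2*pi * of_int m)" "l (t+2*pi * of_int m) < l (x+2*pi)" by auto
 then have "x <= l t+2*pi * of_int m" "l t+2*pi * of_int m < x+2*pi" unfolding l_per_int l_per x by auto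
 then have "\<bar>l t - t\<bar> < 2*pi" using m by linarith
 then show ?thesis by (intro cis_eq_imp_eq) (simp_all add: j cis_shift_int)
qed

lemma circle_fixed_iff: "cis t : circle_fixed g \<longleftrightarrow> l t = t"
 using fix_lift[of t] g_lift[of t] by (auto simp: circle_fixed_def)

lemma g_inj: "inj_on g S1"
proof (rule inj_onI)
 fix x y assume xy: "x : S1" "y : S1" "g x = g y"
 obtain s t where st: "x = cis s" "y = cis t" using xy S1_iff_cis by metis
 obtain j :: int where "l s = l t+2*pi * of_int j" using xy unfolding st g_lift using cis_eq_iff_int by blast
 then have "l s = l (t+2*pi * of_int j)" by (simp add: l_per_int)
 then show "x = y" unfolding st using cis_shift_int by simp
qed

lemma g_S1: "g ` S1 <= S1"
 using S1_iff_cis g_lift by (metis cis_in_S1 image_subsetI)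

lemma g_inverse: "inv_into S1 g (cis t) = cis (l' t)"
 by (rule inv_into_f_eq[OF g_inj]) (simp_all add: g_lift ll')

lemma wheel_root_inverse: "wheel_root F l' l L' L H' H n (- k) f (inv_into S1 g)"
proof -
 interpret I: wheel_fix F l' l "H' ^^ n" "H ^^ n" by (rule wheel_fix_inverse)
 interpret BI: wheel_map F L' L H' H by (rule B.wheel_map_inverse)
 interpret P: wheel_map F "L ^^ n" "L' ^^ n" "H ^^ n" "H' ^^ n" by (rule B.wheel_map_pow)
 have "l ((L' ^^ n) t+2*pi * of_int (- k)) = t" for t
  using P.l_per_int[of "(L' ^^ n) t" "- k"] P.ll'[of t] by (simp add: root)
 then have "l' t = (L' ^^ n) t+2*pi * of_int (- k)" for t by (metis l'l)
 then show ?thesis by unfold_locales (use n F_cis g_inverse in auto)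
qed

lemma not_attracting_repelling: "attracting S1 g (cis x) ==> ~ repelling S1 g (cis x)"
proof
 assume "attracting S1 g (cis x)" "repelling S1 g (cis x)"
 then show False
 proof (rule attracting_not_repelling[OF _ _ g_inj g_S1])
  fix d :: real assume "d > 0"
  define e where "e = min (d / 2) 1"
  have e: "0 < e" "e < d" "e <= 1" using \<open>d > 0\<close> by (auto simp: e_def min_def)
  have "cis (x + e) ~= cis x" using cis_eq_imp_eq[of "x + e" x] e pi_gt3 by auto
  moreover have "dist (cis (x + e)) (cis x) < d" using dist_cis_le[of "x + e" x] e by simp
  ultimately show "EX y:S1. y ~= cis x & dist y (cis x) < d" by (intro bexI[of _ "cis (x + e)"]) auto
 qed
qed

lemma contraction_attracting:
 assumes contracts: "contracts_at l x \<epsilon>" "\<epsilon> > 0" shows "attracting S1 g (cis x)"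
proof (rule attracting_semiconjugate[of cis _ g l _ \<epsilon>])
 show "range cis = S1" using S1_iff_cis by auto
 show "contracts_at l y \<epsilon>" if "cis y = cis x" for y
  using that contracts_at_shift[OF contracts(1)] cis_eq_iff_int[of y x] by auto
qed (use contracts l_cont l_mono in \<open>auto simp: cis_periodic g_lift intro!: continuous_intros\<close>)

lemma contraction_repelling:
 assumes "contracts_at l' x \<epsilon>" "\<epsilon> > 0" shows "repelling S1 g (cis x)"
 unfolding repelling_def by (rule wheel_root.contraction_attracting[OF wheel_root_inverse assms])

lemma H_fix_pow: "H y = y ==> (H ^^ n) y = y" by (induction n) auto

lemma inv_into_H: "y : S2 ==> inv_into S2 H y = H' y"
 by (rule inv_into_f_eq) (auto simp: inj_on_def B.H_inj B.H'_in B.HH')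

end

locale wheel_root_poles = wheel_root F l l' L L' H H' n k f g + wheel_source_sink F l l' "H ^^ n" "H' ^^ n" a r
 for F l l' L L' H H' n k f g a r
begin

lemma wheel_root_poles_inverse: "wheel_root_poles F l' l L' L H' H n (- k) f (inv_into S1 g) r a"
 by (intro wheel_root_poles.intro wheel_root_inverse wheel_source_sink_inverse)

lemma sink_fixed: "H a = a"
proof -
 obtain t where t: "l t ~= t" using nontriv by blast
 then have Lt: "l (L t) ~= L t" by (simp add: fix_L)
 have "H (F (iterate_limit l t)) = F (iterate_limit l (L t))"
  using iterate_limit_commute[OF l_commute B.l_cont iterate_limit(1)[OF t]] B.FH by simp
 then show ?thesis using limits[OF t] limits[OF Lt] by simp
qed

lemma source_fixed: "H r = r"
 using wheel_root_poles.sink_fixed[OF wheel_root_poles_inverse] B.HH'[OF poles(2)] by simp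

lemma sphere_fixed_poles: "sphere_fixed H = {a, r}"
 using poles sink_fixed source_fixed H_fix_pow H_fixed_pole by (auto simp: sphere_fixed_def)

end

lemma (in wheel_hyperbolic) wheel_alternating: "wheel_alternating F a r"
proof
 fix x assume x: "F x = a"
 obtain u v where gap: "forward_gap l' x v" "v <= x+2*pi" by (rule sink_gaps[OF x], rule that)
 have "F w ~: {a, r}" if "x < w" "w < v" for w
  using gap(1) that pole_fixed[of w] l'_fix[of w] unfolding forward_gap_def by (metis less_irrefl)
 then show "EX v>x. v <= x+2*pi & F v = r & (ALL w. x < w --> w < v --> F w ~: {a, r})"
  using gap backward_gap_poles(2)[OF gap(1)] by (intro exI[of _ v]) (auto simp: forward_gap_def)
next
 interpret I: wheel_hyperbolic F l' l H' H r a by (rule wheel_hyperbolic_inverse)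
 fix x assume x: "F x = r"
 obtain u v where gap: "forward_gap l x v" "v <= x+2*pi" by (rule I.sink_gaps[OF x], rule that)
 have "F w ~: {a, r}" if "x < w" "w < v" for w
  using gap(1) that pole_fixed[of w] unfolding forward_gap_def by (metis less_irrefl)
 then show "EX v>x. v <= x+2*pi & F v = a & (ALL w. x < w --> w < v --> F w ~: {a, r})"
  using gap forward_gap_poles(2)[OF gap(1)] by (intro exI[of _ v]) (auto simp: forward_gap_def)
qed (rule distinct)

lemma (in wheel_hyperbolic) finite_fixed_points: "finite (cis ` {t. l t = t})"
proof -
 obtain \<epsilon> where \<epsilon>: "\<epsilon> > 0" "!!x y. l x = x ==> l y = y ==> \<bar>x - y\<bar> < \<epsilon> ==> x = y" by (rule fixed_points_separated, rule that)
 have "finite ({0..2*pi} Int {t. l t = t})"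
 proof (rule finite_not_islimpt_in_compact)
  fix z :: real
  show "~ z islimpt {t. l t = t}"
  proof
   assume limit: "z islimpt {t. l t = t}"
   then have "l z = z" using closed_fix closed_limpt by blast
   moreover obtain y where "l y = y" "y ~= z" "dist y z < \<epsilon>" using limit \<epsilon>(1) unfolding islimpt_approachable by blast
   ultimately show False using \<epsilon>(2)[of y z] by (simp add: dist_real_def)
  qed
 qed simp
 moreover have "cis ` {t. l t = t} <= cis ` ({0..2*pi} Int {t. l t = t})"
 proof (rule image_subsetI)
  fix t assume "t : {t. l t = t}"
  obtain m where "0 <= t+2*pi * of_int m" "t+2*pi * of_int m < 0+2*pi" using real_period_representative by blast
  then show "cis t : cis ` ({0..2*pi} Int {t. l t = t})"
   using \<open>t : {t. l t = t}\<close> by (intro image_eqI[of _ _ "t+2*pi * of_int m"]) (auto simp: cis_shift_int fix_per)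
 qed
 ultimately show ?thesis using finite_surj by blast
qed

locale wheel_root_hyperbolic = wheel_root_poles F l l' L L' H H' n k f g a r + wheel_hyperbolic F l l' "H ^^ n" "H' ^^ n" a r
 for F l l' L L' H H' n k f g a r
begin

lemma wheel_root_hyperbolic_inverse: "wheel_root_hyperbolic F l' l L' L H' H n (- k) f (inv_into S1 g) r a"
 by (intro wheel_root_hyperbolic.intro wheel_root_poles_inverse wheel_hyperbolic_inverse)

sublocale wheel_alternating F a r by (rule wheel_alternating)

lemma sink_attracting: "F t = a ==> attracting S1 g (cis t)"
 using sink_contracts contraction_attracting by metis

lemma source_repelling: "F t = r ==> repelling S1 g (cis t)"
 unfolding repelling_def by (rule wheel_root_hyperbolic.sink_attracting[OF wheel_root_hyperbolic_inverse])

lemma f_cis: "f (cis t) = F t" unfolding F_cis ..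

lemma circle_fixed_fibres: "circle_fixed g = {z : S1. f z = a} Un {z : S1. f z = r}"
proof -
 have "z : circle_fixed g \<longleftrightarrow> f z : {a, r}" if z: "z : S1" for z
 proof -
  obtain t where "z = cis t" using z S1_iff_cis by blast
  then show ?thesis using circle_fixed_iff[of t] pole_fixed[of t] by (simp add: f_cis)
 qed
 moreover have "circle_fixed g <= S1" by (auto simp: circle_fixed_def)
 ultimately show ?thesis by blast
qed

lemma circle_sinks_fibre: "circle_sinks g = {z : S1. f z = a}"
 and circle_sources_fibre: "circle_sources g = {z : S1. f z = r}"
proof -
 have poles: "(attracting S1 g z \<longleftrightarrow> f z = a) & (repelling S1 g z \<longleftrightarrow> f z = r)" if z: "z : circle_fixed g" for z
 proof -
  obtain t where t: "z = cis t" using z S1_iff_cis circle_fixed_fibres by blast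
  then have "F t = a | F t = r" using z circle_fixed_fibres f_cis by auto
  then show ?thesis
   using sink_attracting[of t] source_repelling[of t] not_attracting_repelling[of t] distinct t f_cis by auto
 qed
 then show "circle_sinks g = {z : S1. f z = a}" "circle_sources g = {z : S1. f z = r}"
  unfolding circle_sinks_def circle_sources_def using circle_fixed_fibres by blast+
qed

lemma finite_circle_fixed: "finite (circle_fixed g)"
proof (rule finite_subset[OF _ finite_fixed_points])
 show "circle_fixed g <= cis ` {t. l t = t}"
 proof
  fix z assume z: "z : circle_fixed g"
  then obtain t where "z = cis t" using S1_iff_cis circle_fixed_fibres by blast
  then show "z : cis ` {t. l t = t}" using z circle_fixed_iff by blast
 qed
qed

lemma card_circle_fixed: "card (circle_fixed g) = 2 * card (circle_sinks g)"
proof -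
 have fin: "finite {z : S1. f z = a}" "finite {z : S1. f z = r}" using finite_circle_fixed unfolding circle_fixed_fibres by auto
 have "card {z : S1. f z = r} = card {z : S1. f z = a}"
  using card_sinks_le[OF F_cis fin(2)] wheel_alternating.card_sinks_le[OF wheel_alternating_swap F_cis fin(1)] by simp
 moreover have "{z : S1. f z = a} Int {z : S1. f z = r} = {}" using distinct by auto
 ultimately show ?thesis unfolding circle_fixed_fibres circle_sinks_fibre by (simp add: card_Un_disjoint[OF fin])
qed

lemma consecutive_fixed_alternate:
 assumes "consecutive (circle_fixed g) p q" shows "{f p, f q} = {a, r}"
proof -
 obtain x y where xy: "p = cis x" "q = cis y" "x < y" "y < x+2*pi" "cis x : circle_fixed g" "cis y : circle_fixed g"
  "!!w. x < w ==> w < y ==> cis w ~: circle_fixed g"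
  by (rule consecutive_lift[OF assms], use circle_fixed_fibres in blast, rule that)
 have ends: "F x : {a, r}" "F y : {a, r}" and free: "!!w. x < w ==> w < y ==> F w ~: {a, r}"
  using xy(5-7) circle_fixed_iff pole_fixed by blast+
 have "EX v>x. {F x, F v} = {a, r} & (ALL w. x < w --> w < v --> F w ~: {a, r})"
  using ends(1) next_source[of x] next_sink[of x] by auto
 then obtain v where v: "x < v" "{F x, F v} = {a, r}" "ALL w. x < w --> w < v --> F w ~: {a, r}" by blast
 have "F v : {a, r}" using v(2) by blast
 then have "v = y" using v(1,3) ends(2) free[of v] xy(3) by (cases v y rule: linorder_cases) auto
 then show ?thesis using v(2) f_cis xy(1,2) by simp
qed

lemma alternating_dynamics: "alternating_dynamics g"
 unfolding alternating_dynamics_def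
proof (intro conjI ballI allI impI)
 obtain x where "l x = x" using fixp by blast
 then have "circle_fixed g ~= {}" using circle_fixed_iff by blast
 then show "card (circle_fixed g) > 0" using finite_circle_fixed by (simp add: card_gt_0_iff)
 show "even (card (circle_fixed g))" by (simp add: card_circle_fixed)
 have union: "circle_fixed g = circle_sinks g Un circle_sources g"
  unfolding circle_fixed_fibres circle_sinks_fibre circle_sources_fibre ..
 show "attracting S1 g z | repelling S1 g z" if "z : circle_fixed g" for z
  using that union unfolding circle_sinks_def circle_sources_def by blast
 show "~ (attracting S1 g z & repelling S1 g z)" if z: "z : circle_fixed g" for z
 proof -
  obtain t where "z = cis t" using z S1_iff_cis[of z] by (auto simp: circle_fixed_def)
  then show ?thesis using not_attracting_repelling[of t] by simp
 qed
 fix p q assume pq: "consecutive (circle_fixed g) p q"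
 then have "p : S1" "q : S1" by (auto simp: consecutive_def circle_fixed_def)
 then show "p : circle_sinks g & q : circle_sources g | p : circle_sources g & q : circle_sinks g"
  using consecutive_fixed_alternate[OF pq] distinct unfolding circle_sinks_fibre circle_sources_fibre doubleton_eq_iff by blast
qed (rule finite_circle_fixed)

lemma attracting_sink_image: "attracting S2 H a"
proof (rule attracting_power[where H = H and x = a, OF _ n _ _ sink_fixed])
 obtain \<epsilon> where "\<epsilon> > 0" "!!x. F x = a ==> contracts_at l x \<epsilon>" by (rule sink_contracts, rule that)
 then show "attracting S2 (H ^^ n) a"
  using cont per surj FH poles(1) by (intro attracting_semiconjugate[of F S2 _ l a \<epsilon>] l_cont l_mono) simp_all
 show "continuous_on S2 H" using B.hom by (simp add: homeomorphism_def)
 show "H ` S2 <= S2" using B.H_in by blast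
qed

lemma repelling_source_image: "repelling S2 H r"
 unfolding repelling_def
 by (rule attracting_cong[OF B.H'_in inv_into_H wheel_root_hyperbolic.attracting_sink_image[OF wheel_root_hyperbolic_inverse]])

lemma pole_fibre_images: "f ` {z : S1. f z = a} = {a}" "f ` {z : S1. f z = r} = {r}"
proof -
 have "f ` {z : S1. f z = y} = {y}" if y: "y : S2" for y
 proof -
  obtain t where "y = F t" using y surj by (metis imageE)
  then have "cis t : {z : S1. f z = y}" using f_cis by simp
  then show ?thesis by blast
 qed
 then show "f ` {z : S1. f z = a} = {a}" "f ` {z : S1. f z = r} = {r}" using poles(1,2) by blast+
qed

lemma wheel_dynamics: "wheel_dynamics f g H"
proof -
 note images = pole_fibre_images[folded circle_sinks_fibre circle_sources_fibre]
 have "f ` circle_fixed g = {a, r}" unfolding circle_fixed_fibres image_Un pole_fibre_images by auto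
 then have "two_point_dynamics f g H"
  unfolding two_point_dynamics_def sphere_fixed_poles
  using attracting_sink_image repelling_source_image distinct by (simp add: circle_sinks_fibre circle_sources_fibre)
 moreover have "source_sink_images f g H"
  unfolding source_sink_images_def using distinct images sphere_fixed_poles attracting_sink_image repelling_source_image by blast
 moreover have "poles_joined_by_leaves f g"
  unfolding poles_joined_by_leaves_def circle_sinks_fibre circle_sources_fibre by (rule fibres_joined_by_leaves[OF F_cis])
 ultimately show ?thesis unfolding wheel_dynamics_def using alternating_dynamics by blast
qed

end

lemma iterate_le: "mono m ==> m t <= t ==> (m ^^ i) t <= (t :: real)"
 by (induction i) (auto intro: order_trans dest: monoD)

lemma iterate_fixed: "m t = t ==> (m ^^ i) t = t"
 by (induction i) simp_all

lemma forward_gap_root: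
 assumes "strict_mono m" "m u = u" "m v = v" and gap: "forward_gap (m ^^ i) u v" shows "forward_gap m u v"
proof -
 have "t < m t" if t: "u < t" "t < v" for t
 proof (rule ccontr)
  assume "~ t < m t"
  then have "(m ^^ i) t <= t" using assms(1) by (intro iterate_le strict_mono_mono) auto
  then show False using gap t by (auto simp: forward_gap_def dest: spec[of _ t])
 qed
 then show ?thesis using assms by (simp add: forward_gap_def)
qed

locale wheel_root_parabolic = wheel_root_poles F l l' L L' H H' n k f g c c
 for F l l' L L' H H' n k f g c +
 fixes x y :: real
 assumes gap: "forward_gap l x y" and return_gap: "forward_gap l' y (x+2*pi)"
begin

lemma ends: "x < y" "y < x+2*pi" "l x = x" "l y = y"
 using gap return_gap by (auto simp: forward_gap_def)

lemma fixed_between: "l t = t ==> x < t ==> t < x+2*pi ==> t = y"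
 using gap return_gap l'_fix[of t] unfolding forward_gap_def by (metis less_irrefl linorder_neqE)

lemma fixed_angles: "l t = t ==> EX j::int. t = x+2*pi * of_int j | t = y+2*pi * of_int j"
proof -
 assume t: "l t = t"
 obtain m where m: "x <= t+2*pi * of_int m" "t+2*pi * of_int m < x+2*pi" using real_period_representative by blast
 then have "t+2*pi * of_int m = x | t+2*pi * of_int m = y" using fixed_between[of "t+2*pi * of_int m"] fix_per[OF t] by force
 then show ?thesis by (intro exI[of _ "- m"]) auto
qed

lemma circle_fixed_pair: "circle_fixed g = {cis x, cis y}"
proof
 show "{cis x, cis y} <= circle_fixed g" using ends circle_fixed_iff by simp
 show "circle_fixed g <= {cis x, cis y}"
 proof
  fix z assume z: "z : circle_fixed g"
  then obtain t where t: "z = cis t" using S1_iff_cis[of z] by (auto simp: circle_fixed_def)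
  then obtain j :: int where "t = x+2*pi * of_int j | t = y+2*pi * of_int j" using z circle_fixed_iff fixed_angles by blast
  then show "z : {cis x, cis y}" unfolding t by (auto simp: cis_shift_int)
 qed
qed

lemma attracting_end: "attracting S1 g (cis y)"
 by (rule contraction_attracting[OF forward_gaps_contract[OF gap return_gap, of "min (y - x) (x+2*pi - y)"]]) (use ends in auto)

lemma repelling_end: "repelling S1 g (cis x)"
proof -
 have "contracts_at l' (x+2*pi) (min (y - x) (x+2*pi - y))"
  by (rule wheel_map.forward_gaps_contract[OF wheel_map_inverse return_gap forward_gap_shift[OF gap]]) auto
 then have "repelling S1 g (cis (x+2*pi))" by (rule contraction_repelling) (use ends in auto)
 then show ?thesis by (simp add: cis_periodic)
qed

lemma circle_poles: "circle_sinks g = {cis y}" "circle_sources g = {cis x}"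
 unfolding circle_sinks_def circle_sources_def circle_fixed_pair
 using attracting_end repelling_end not_attracting_repelling by blast+

lemma forward_gap_lift:
 assumes "forward_gap l u v" shows "forward_gap l (L u) (L v)"
proof -
 have "t < l t" if "L u < t" "t < L v" for t
 proof -
  have "L u < L (L' t)" "L (L' t) < L v" using that by (simp_all add: B.ll')
  then have "L' t < l (L' t)" using assms by (simp add: forward_gap_def)
  then have "L (L' t) < L (l (L' t))" by simp
  then show ?thesis unfolding l_commute[symmetric] B.ll' .
 qed
 then show ?thesis using assms by (simp add: forward_gap_def l_commute)
qed

lemma forward_gap_not_backward: "forward_gap l u v ==> ~ forward_gap l' u v'"
proof
 assume gaps: "forward_gap l u v" "forward_gap l' u v'"
 obtain t where t: "u < t" "t < min v v'" using gaps dense[of u "min v v'"] by (auto simp: forward_gap_def)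
 then have "l' t < t" "t < l' t" using forward_gap_inverse[OF gaps(1)] gaps(2) by (auto simp: forward_gap_def)
 then show False by simp
qed

lemma lift_shifts_ends: obtains j :: int where "L x = x+2*pi * of_int j" "L y = y+2*pi * of_int j"
proof -
 interpret I: wheel_map F l' l "H' ^^ n" "H ^^ n" by (rule wheel_map_inverse)
 have "L x ~= y+2*pi * of_int j" for j
  using forward_gap_not_backward[OF forward_gap_lift[OF gap]] I.forward_gap_shift_int[OF return_gap, of j] by metis
 then obtain j :: int where j: "L x = x+2*pi * of_int j" using fixed_angles[of "L x"] ends fix_L by blast
 have "l (L y+2*pi * of_int (- j)) = L y+2*pi * of_int (- j)" using ends fix_L fix_per by blast
 moreover have "L x < L y" "L y < L x+2*pi" using ends B.l_per[of x] B.l_less[of y "x+2*pi"] by simp_all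
 ultimately have "L y+2*pi * of_int (- j) = y" using j by (intro fixed_between) auto
 then show thesis using that j by simp
qed

lemma conjugate_to_translation: "conjugate_to_translation H c"
proof -
 obtain j where j: "L x = x+2*pi * of_int j" "L y = y+2*pi * of_int j" by (rule lift_shifts_ends)
 define E where "E = (%t. L t+2*pi * of_int (- j))"
 define E' where "E' = (%t. L' (t - 2*pi * of_int (- j)))"
 interpret E: wheel_map F E E' H H' unfolding E_def E'_def by (rule B.wheel_map_shift)
 interpret EP: wheel_map F "E ^^ n" "E' ^^ n" "H ^^ n" "H' ^^ n" by (rule E.wheel_map_pow)
 have Efix: "E x = x" "E y = y" using j by (simp_all add: E_def)
 have shift: "(E ^^ i) t = (L ^^ i) t+2*pi * of_int (- j * int i)" for i t
 proof (induction i)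
  case (Suc i)
  then have "(E ^^ Suc i) t = L ((L ^^ i) t+2*pi * of_int (- j * int i))+2*pi * of_int (- j)" by (simp add: E_def)
  then show ?case unfolding B.l_per_int by (simp add: algebra_simps)
 qed simp
 then have "l x = (E ^^ n) x+2*pi * of_int (k + j * int n)" by (simp add: root algebra_simps)
 then have "2*pi * of_int (k + j * int n) = 0" using iterate_fixed[of E x n, OF Efix(1)] ends by simp
 then have k: "k = - j * int n" unfolding mult_eq_0_iff of_int_eq_0_iff by simp
 have power: "E ^^ n = l" by (rule ext) (simp only: shift root k)
 then have power': "E' ^^ n = l'" using EP.ll' l'l by (metis ext)
 have E_gap: "forward_gap E x y" using E.l_mono Efix gap unfolding power[symmetric] by (rule forward_gap_root)
 have E'fix: "E' y = y" "E' (x+2*pi) = x+2*pi" using Efix E.l'_fix E.l_per[of x] by simp_all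
 have E'_gap: "forward_gap E' y (x+2*pi)" using E.l'_mono E'fix return_gap unfolding power'[symmetric] by (rule forward_gap_root)
 have "wheel_parabolic F E E' H H' c"
 proof
  show "EX x. E x = x" using Efix by blast
  show "EX x. E x ~= x" using E_gap ends dense[of x y] unfolding forward_gap_def by (metis less_irrefl)
  show "F t = c" if "E t = t" for t using iterate_fixed[of E t n] that fixed[of t] power by simp
  show "F t = c" if "H (F t) = F t" for t using that F_in[of t] sphere_fixed_poles unfolding sphere_fixed_def by blast
 qed
 then show ?thesis unfolding conjugate_to_translation_def by (rule wheel_parabolic.conjugate_translation[OF _ E_gap E'_gap])
qed

lemma wheel_dynamics: "wheel_dynamics f g H"
proof -
 have distinct: "cis x ~= cis y" using cis_eq_imp_eq[of x y] ends by auto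
 have consecutive: "(p = cis y & q = cis x) | (p = cis x & q = cis y)" if "consecutive {cis x, cis y} p q" for p q
  using that by (auto simp: consecutive_def)
 have "alternating_dynamics g"
  unfolding alternating_dynamics_def circle_poles circle_fixed_pair
  using distinct consecutive attracting_end repelling_end not_attracting_repelling by auto
 moreover have "poles_joined_by_leaves f g"
  unfolding poles_joined_by_leaves_def joined_by_def circle_poles by (auto simp: consecutive_def)
 moreover have "f ` circle_fixed g = {c}" using fixed[OF ends(3)] fixed[OF ends(4)] unfolding circle_fixed_pair F_cis by simp
 then have "two_point_dynamics f g H"
  unfolding two_point_dynamics_def sphere_fixed_poles using conjugate_to_translation by auto
 ultimately show ?thesis unfolding wheel_dynamics_def using distinct by (simp add: circle_fixed_pair)
qed

end

lemma (in wheel_root) wheel_dynamics: "wheel_dynamics f g H"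
proof -
 obtain a r where "wheel_source_sink F l l' (H ^^ n) (H' ^^ n) a r" by (rule source_sink)
 then interpret P: wheel_root_poles F l l' L L' H H' n k f g a r by (intro wheel_root_poles.intro wheel_root_axioms)
 show ?thesis
 proof (cases "a = r")
  case True
  interpret Q: wheel_parabolic F l l' "H ^^ n" "H' ^^ n" a
  proof
   show "F t = a" if "l t = t" for t using P.fixed[OF that] True by simp
   show "F t = a" if "(H ^^ n) (F t) = F t" for t using P.H_fixed_pole[of "F t"] F_in that True by simp
  qed
  obtain x y where "forward_gap l x y" "forward_gap l' y (x+2*pi)" by (rule Q.two_fixed_points)
  then interpret wheel_root_parabolic F l l' L L' H H' n k f g a x y
   using P.wheel_root_poles_axioms True by (intro wheel_root_parabolic.intro wheel_root_parabolic_axioms.intro) simp_all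
  show ?thesis by (rule wheel_dynamics)
 next
  case False
  then interpret wheel_root_hyperbolic F l l' L L' H H' n k f g a r
   by (intro wheel_root_hyperbolic.intro P.wheel_root_poles_axioms wheel_hyperbolic.intro P.wheel_source_sink_axioms wheel_hyperbolic_axioms.intro)
  show ?thesis by (rule wheel_dynamics)
 qed
qed

subsection \<open>The induced dynamics on circle and sphere\<close>

lemma equivariant_lift:
 assumes "catherine_wheel f" "op_homeo_S1 h" "op_homeo_S2 H" and equivariant: "ALL z:S1. f (h z) = H (f z)"
 obtains L L' H' where "wheel_map (%t. f (cis t)) L L' H H'" "!!t. h (cis t) = cis (L t)"
proof -
 interpret wheel "%t. f (cis t)" by (rule catherine_wheel_lift[OF assms(1)])
 obtain h' where "homeomorphism S1 S1 h h'" "deg1 h = 1" using assms(2) by (auto simp: op_homeo_S1_def deg1_def)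
 then obtain L where L: "continuous_on UNIV L" "strict_mono L" "!!t. L (t+2*pi) = L t+2*pi" "!!t. h (cis t) = cis (L t)"
  using homeomorphism_S1_lift by metis
 obtain H' where H': "homeomorphism S2 S2 H H'" using assms(3) by (auto simp: op_homeo_S2_def)
 have "surj L" "inj L" using increasing_lift_surj[OF L(1,3)] strict_mono_imp_inj_on[OF L(2)] by simp_all
 moreover have "f (cis (L t)) = H (f (cis t))" for t using equivariant L(4)[of t] by (metis cis_in_S1)
 ultimately have "wheel_map (%t. f (cis t)) L (inv_into UNIV L) H H'" by unfold_locales (use L H' in \<open>auto simp: surj_f_inv_f\<close>)
 then show thesis using L(4) by (rule that)
qed

lemma (in wheel_map) periodic_root:
 assumes "c : S2" "H c = c"
 obtains n k m m' where "n >= 1" "!!t. m t = (l ^^ n) t+2*pi * of_int k" "wheel_map F m m' (H ^^ n) (H' ^^ n)" "EX x. m x = x"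
proof -
 obtain n x and k :: int where "n >= 1" "(l ^^ n) x = x+2*pi * of_int k" using periodic_point_exists[OF assms] by blast
 moreover have "wheel_map F (%t. (l ^^ n) t+2*pi * of_int (- k)) (%t. (l' ^^ n) (t - 2*pi * of_int (- k))) (H ^^ n) (H' ^^ n)"
  by (rule wheel_map.wheel_map_shift[OF wheel_map_pow])
 ultimately show thesis by (intro that[of n _ "- k"]) (auto intro: exI[of _ x])
qed

theorem equivariant_power_dynamics:
 assumes "catherine_wheel f" "op_homeo_S1 h" "op_homeo_S2 H" "ALL z:S1. f (h z) = H (f z)"
 shows "EX n>=1. (ALL z:S1. (h ^^ n) z = z) | wheel_dynamics f (h ^^ n) H"
proof -
 obtain L L' H' where L: "wheel_map (%t. f (cis t)) L L' H H'" "!!t. h (cis t) = cis (L t)" by (rule equivariant_lift[OF assms], rule that)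
 obtain c where c: "c : S2" "H c = c" by (rule op_homeo_S2_fixed_point[OF assms(3)])
 obtain n k l l' where n: "n >= 1" and root: "!!t. l t = (L ^^ n) t+2*pi * of_int k"
  and l: "wheel_map (%t. f (cis t)) l l' (H ^^ n) (H' ^^ n)" "EX x. l x = x"
  by (rule wheel_map.periodic_root[OF L(1) c], rule that)
 have "(h ^^ i) (cis t) = cis ((L ^^ i) t)" for i t by (induction i) (simp_all add: L(2))
 then have lift: "(h ^^ n) (cis t) = cis (l t)" for t by (simp add: root cis_shift_int)
 have "wheel_dynamics f (h ^^ n) H" if "EX t. l t ~= t"
  by (rule wheel_root.wheel_dynamics[of _ l l' L L' H H' n k], intro wheel_root.intro wheel_fix.intro wheel_fix_axioms.intro wheel_root_axioms.intro)
   (use L l n root lift that in auto)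
 moreover have "ALL z:S1. (h ^^ n) z = z" if "ALL t. l t = t"
 proof
  fix z assume "z : S1"
  then obtain t where "z = cis t" using S1_iff_cis by blast
  then show "(h ^^ n) z = z" using lift that by simp
 qed
 ultimately show ?thesis using n by blast
qed

theorem theorem6p3:
  fixes f :: "complex \<Rightarrow> real^3" and h :: "complex \<Rightarrow> complex" and H :: "real^3 \<Rightarrow> real^3"
  assumes "catherine_wheel f"
    and "op_homeo_S1 h" and "op_homeo_S2 H"
    and "\<forall>z \<in> S1. f (h z) = H (f z)"
  shows "\<exists>n::nat. n \<ge> 1 \<and>
    (let g = h ^^ n;
         F = {x \<in> S1. g x = x};
         A = {x \<in> F. attracting S1 g x};
         R = {x \<in> F. repelling S1 g x};
         FH = {y \<in> S2. H y = y}
     in (\<forall>x \<in> S1. g x = x) \<or>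
        (finite F \<and> even (card F) \<and> card F > 0 \<and>
         (\<forall>x \<in> F. (attracting S1 g x \<or> repelling S1 g x) \<and>
                   \<not> (attracting S1 g x \<and> repelling S1 g x)) \<and>
         (\<forall>x y. consecutive F x y \<longrightarrow> (x \<in> A \<and> y \<in> R) \<or> (x \<in> R \<and> y \<in> A)) \<and>
         ((  (\<forall>x y. consecutive A x y \<longrightarrow> {x, y} \<in> Lplus f)
           \<and> (\<forall>x y. consecutive R x y \<longrightarrow> {x, y} \<in> Lminus f))
          \<or>
          (  (\<forall>x y. consecutive R x y \<longrightarrow> {x, y} \<in> Lplus f)
           \<and> (\<forall>x y. consecutive A x y \<longrightarrow> {x, y} \<in> Lminus f))) \<and>
         (card F \<ge> 4 \<longrightarrow>
            (\<exists>a r. a \<noteq> r \<and> f ` A = {a} \<and> f ` R = {r} \<and> FH = {a, r} \<and>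
                   attracting S2 H a \<and> repelling S2 H r)) \<and>
         (card F = 2 \<longrightarrow>
            FH = f ` F \<and>
            ((card (f ` F) = 2 \<and> (\<forall>x \<in> A. attracting S2 H (f x)) \<and>
                                 (\<forall>x \<in> R. repelling S2 H (f x)))
             \<or>
             (\<exists>c. f ` F = {c} \<and>
                  (\<exists>\<phi> \<phi>'. homeomorphism (S2 - {c}) (UNIV :: complex set) \<phi> \<phi>' \<and>
                     (\<exists>v. \<forall>z. \<phi> (H (\<phi>' z)) = z + v)))))))"
proof -
 obtain n where n: "n >= 1" and "(ALL z:S1. (h ^^ n) z = z) | wheel_dynamics f (h ^^ n) H"
  using equivariant_power_dynamics[OF assms] by blast
 then show ?thesis
  unfolding wheel_dynamics_def alternating_dynamics_def poles_joined_by_leaves_def joined_by_def source_sink_images_def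
   two_point_dynamics_def conjugate_to_translation_def circle_sinks_def circle_sources_def circle_fixed_def sphere_fixed_def
   Let_def conj_assoc by (intro exI[of _ n] conjI)
qed

end
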